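(* Let $k\ge 1$ and let $S\subset\mathbb{H}^k$ be a Semmes surface. Then $S$ is lower Ahlfors-regular (with dimension $2k+1$) and $S$ has big pieces of intrinsic Lipschitz graphs.
   Context: Fix an integer $k\ge 1$. The Heisenberg group $\mathbb{H}^k$ is $\mathbb{R}^{2k}\times\mathbb{R}$ with group law $(v,t)\cdot(v',t')=(v+v',t+t'+\omega(v,v')/2)$, $\omega(v,v')=\sum_{j=1}^k (v_jv'_{j+k}-v_{j+k}v'_j)$, equipped with the Korányi norm $\|(v,t)\|=\sqrt[4]{|v|^4+16t^2}$ and metric $d(p,q)=\|q^{-1}\cdot p\|$. All metric notions are with respect to $d$; $B(p,r)$ is the closed ball, $\mathcal{H}^s$ is the $s$-dimensional Hausdorff measure of $d$, and $A^c=\mathbb{H}^k\setminus A$. A closed set $E\subset\mathbb{H}^k$ is upper Ahlfors-regular (with dimension $2k+1$) if there is $C>0$ with $\mathcal{H}^{2k+1}(B(p,r)\cap E)\le Cr^{2k+1}$ for all $p\in\mathbb{H}^k$, $r>0$; it is lower Ahlfors-regular (with dimension $2k+1$) if there is $c>0$ with $\mathcal{H}^{2k+1}(B(p,r)\cap E)\ge cr^{2k+1}$ for all $p\in E$, $0<r<\operatorname{diam}E$. A closed set $S$ satisfies Condition B if there is $c>0$ such that for all $p\in S$ and $0<r<\operatorname{diam}S$ there exist $q_1,q_2$ in different connected components of $S^c$ with $q_1,q_2\in B(p,r)$ and $\min\{\operatorname{dist}(q_1,S),\operatorname{dist}(q_2,S)\}>cr$. A Semmes surface is a closed set that is upper Ahlfors-regular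 (with dimension $2k+1$) and satisfies Condition B. For $\nu$ in the Euclidean unit sphere $\mathbb{S}^{2k-1}\subset\mathbb{R}^{2k}$ let $\mathbb{L}_\nu=\mathbb{R}\nu\times\{0\}$ and $\mathbb{W}_\nu=\nu^\perp\times\mathbb{R}$. Every $p\in\mathbb{H}^k$ is uniquely $p=\pi_{\mathbb{W}_\nu}(p)\cdot\pi_{\mathbb{L}_\nu}(p)$ with $\pi_{\mathbb{W}_\nu}(p)\in\mathbb{W}_\nu$, $\pi_{\mathbb{L}_\nu}(p)\in\mathbb{L}_\nu$. For $\gamma>0$ let $C_\gamma(\nu)=\{p:\|\pi_{\mathbb{W}_\nu}(p)\|\le\gamma\|\pi_{\mathbb{L}_\nu}(p)\|\}$. A set $\Gamma\subset\mathbb{H}^k$ is an intrinsic $L$-Lipschitz graph ($L>0$) if for some $\nu\in\mathbb{S}^{2k-1}$ one has $\pi_{\mathbb{W}_\nu}(\Gamma)=\mathbb{W}_\nu$ and $(p\cdot C_{1/L}(\nu))\cap\Gamma=\{p\}$ for all $p\in\Gamma$. A closed set $S$ has big pieces of intrinsic Lipschitz graphs if there are $L>0$, $c>0$ such that for all $p\in S$ and $0<r<\operatorname{diam}S$ there is an intrinsic $L$-Lipschitz graph $\Gamma$ with $\mathcal{H}^{2k+1}(B(p,r)\cap S\cap\Gamma)\ge cr^{2k+1}$. *)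

theory Defs
  imports "HOL-Analysis.Analysis"
begin

section \<open>The Heisenberg group\<close>

text \<open>
  The Heisenberg group \<open>\<real>\<^sup>2\<^sup>k \<times> \<real>\<close>, with \<open>k = CARD('k) \<ge> 1\<close>. Coordinates of \<open>\<real>\<^sup>2\<^sup>k\<close> are indexed by the
  disjoint sum \<open>'k + 'k\<close>: \<open>Inl j\<close> stands for the index \<open>j\<close> and \<open>Inr j\<close> for the index \<open>j + k\<close>.
  This is a type of its own because the product type already carries the Euclidean metric and
  the commutative group structure.
\<close>

datatype ('k::finite) heis = Heis (hor: "real ^ ('k + 'k)") (ver: real)

definition heis_omega :: "real ^ ('k::finite + 'k) \<Rightarrow> real ^ ('k + 'k) \<Rightarrow> real" where
  "heis_omega v w = (\<Sum>j\<in>(UNIV :: 'k set). v $ Inl j * w $ Inr j - v $ Inr j * w $ Inl j)"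

text \<open>
  The group law is written additively: \<open>group_add\<close> is the class of arbitrary, not necessarily
  commutative, groups. So \<open>p + q\<close> is the Heisenberg product and \<open>- p\<close> the Heisenberg inverse.
\<close>

instantiation heis :: (finite) group_add
begin

definition "0 = Heis 0 0"
definition "p + q = Heis (hor p + hor q) (ver p + ver q + heis_omega (hor p) (hor q) / 2)"
definition "- p = Heis (- hor p) (- ver p)"
definition "p - q = p + - (q :: 'a heis)"

instance
proof
  fix p q r :: "'a heis"
  show "p + q + r = p + (q + r)"
    by (simp add: plus_heis_def heis_omega_def algebra_simps sum.distrib sum_subtractf
        add_divide_distrib diff_divide_distrib)
  show "0 + p = p" "p + 0 = p" "- p + p = 0" "p + - q = p - q"
    by (simp_all add: plus_heis_def zero_heis_def uminus_heis_def minus_heis_def heis_omega_def algebra_simps)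
qed

end

lemma hor_ver_simps [simp]:
  "hor (p + q) = hor p + hor q" "ver (p + q) = ver p + ver q + heis_omega (hor p) (hor q) / 2"
  "hor (- p) = - hor p" "ver (- p) = - ver p"
  "hor (p - q) = hor p - hor q" "ver (p - q) = ver p - ver q + heis_omega (hor p) (- hor q) / 2"
  "hor 0 = 0" "ver 0 = 0"
  by (simp_all add: plus_heis_def uminus_heis_def zero_heis_def minus_heis_def
      del: add_uminus_conv_diff)

definition koranyi :: "('k::finite) heis \<Rightarrow> real" where
  "koranyi p = root 4 (norm (hor p) ^ 4 + 16 * (ver p)\<^sup>2)"

lemma koranyi_pow4: "koranyi p ^ 4 = norm (hor p) ^ 4 + 16 * (ver p)\<^sup>2"
  unfolding koranyi_def by (rule real_root_pow_pos2) simp_all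

lemma koranyi_nonneg [simp]: "koranyi p \<ge> 0"
  by (simp add: koranyi_def)

lemma koranyi_eq_0_iff [simp]: "koranyi p = 0 \<longleftrightarrow> p = 0"
proof -
  have "koranyi p = 0 \<longleftrightarrow> norm (hor p) ^ 4 + 16 * (ver p)\<^sup>2 = 0"
    by (simp add: koranyi_def)
  also have "\<dots> \<longleftrightarrow> hor p = 0 \<and> ver p = 0"
    by (subst add_nonneg_eq_0_iff) auto
  finally show ?thesis
    by (cases p) (simp add: zero_heis_def)
qed

lemma koranyi_uminus [simp]: "koranyi (- p) = koranyi p"
  by (simp add: koranyi_def)

lemma koranyi_eq_norm_Complex:
  "(koranyi p)\<^sup>2 = norm (Complex ((norm (hor p))\<^sup>2) (4 * ver p))"
proof (rule power2_eq_imp_eq)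
  show "((koranyi p)\<^sup>2)\<^sup>2 = (norm (Complex ((norm (hor p))\<^sup>2) (4 * ver p)))\<^sup>2"
    unfolding cmod_power2 by (simp add: koranyi_pow4 power_mult_distrib flip: power_mult)
qed auto

lemma inner_omega_le:
  fixes v w :: "real ^ ('k::finite + 'k)"
  shows "norm (Complex (v \<bullet> w) (heis_omega v w)) \<le> norm v * norm w"
proof (cases "v = 0")
  case True
  then show ?thesis by (simp add: heis_omega_def complex_norm)
next
  case False
  define J :: "real ^ ('k + 'k)"
    where "J = (\<chi> i. case i of Inl j \<Rightarrow> - v $ Inr j | Inr j \<Rightarrow> v $ Inl j)"
  have inner_sum: "x \<bullet> y = (\<Sum>j\<in>UNIV. x $ Inl j * y $ Inl j) + (\<Sum>j\<in>UNIV. x $ Inr j * y $ Inr j)"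
    for x y :: "real ^ ('k + 'k)"
    unfolding inner_vec_def UNIV_sum
    by (subst sum.union_disjoint) (auto simp: sum.reindex)
  have JJ: "J \<bullet> J = v \<bullet> v" and Jv: "J \<bullet> v = 0" and Jw: "J \<bullet> w = heis_omega v w"
    by (simp_all add: inner_sum J_def heis_omega_def sum_negf sum_subtractf mult.commute)
  define a b n where "a = v \<bullet> w" and "b = heis_omega v w" and "n = v \<bullet> v"
  have n: "n > 0" using False by (simp add: n_def)
  have "0 \<le> (n *\<^sub>R w - a *\<^sub>R v - b *\<^sub>R J) \<bullet> (n *\<^sub>R w - a *\<^sub>R v - b *\<^sub>R J)" by simp
  also have "\<dots> = n * (n * (w \<bullet> w) - (a\<^sup>2 + b\<^sup>2))"
    using JJ Jv Jw
    by (simp add: inner_diff_left inner_diff_right a_def b_def n_def inner_commute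
        algebra_simps power2_eq_square)
  finally have "a\<^sup>2 + b\<^sup>2 \<le> n * (w \<bullet> w)"
    using n by (simp add: zero_le_mult_iff)
  then have "(norm (Complex a b))\<^sup>2 \<le> (norm v * norm w)\<^sup>2"
    by (simp add: cmod_power2 n_def power_mult_distrib power2_norm_eq_inner)
  then show ?thesis
    unfolding a_def b_def by (rule power2_le_imp_le) simp
qed

lemma koranyi_ge_norm_hor: "norm (hor p) \<le> koranyi p"
proof -
  have "norm (hor p) ^ 4 \<le> koranyi p ^ 4" by (simp add: koranyi_pow4)
  then show ?thesis by (rule power_le_imp_le_base[where n = 3, simplified]) simp
qed

lemma koranyi_triangle: "koranyi (p + q) \<le> koranyi p + koranyi q"
proof (rule power2_le_imp_le)
  let ?c = "\<lambda>p. Complex ((norm (hor p))\<^sup>2) (4 * ver p)"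
  let ?i = "Complex (hor p \<bullet> hor q) (heis_omega (hor p) (hor q))"
  have "?c (p + q) = ?c p + ?c q + 2 * ?i"
    by (simp add: complex_eq_iff power2_norm_eq_inner inner_add_left inner_add_right inner_commute)
  then have "norm (?c (p + q)) \<le> norm (?c p) + norm (?c q) + norm (2 * ?i)"
    by (metis norm_triangle_mono norm_triangle_ineq order_refl)
  also have "norm (2 * ?i) \<le> 2 * (koranyi p * koranyi q)"
    using inner_omega_le[of "hor p" "hor q"]
      mult_mono[OF koranyi_ge_norm_hor[of p] koranyi_ge_norm_hor[of q]]
    by (simp add: norm_mult)
  finally show "(koranyi (p + q))\<^sup>2 \<le> (koranyi p + koranyi q)\<^sup>2"
    unfolding koranyi_eq_norm_Complex[symmetric] by (simp add: power2_sum mult.assoc)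
qed simp

instantiation heis :: (finite) metric_space
begin

definition dist_heis :: "'a heis \<Rightarrow> 'a heis \<Rightarrow> real" where
  "dist_heis p q = koranyi (- q + p)"

definition uniformity_heis :: "('a heis \<times> 'a heis) filter" where
  "uniformity_heis = (INF e\<in>{0<..}. principal {(x, y). dist x y < e})"

definition open_heis :: "'a heis set \<Rightarrow> bool" where
  "open_heis U \<longleftrightarrow> (\<forall>x\<in>U. eventually (\<lambda>(x', y). x' = x \<longrightarrow> y \<in> U) uniformity)"

instance
proof
  fix x y z :: "'a heis"
  show "dist x y = 0 \<longleftrightarrow> x = y"
    by (metis dist_heis_def koranyi_eq_0_iff add.right_inverse minus_unique left_minus minus_minus)
  have "- y + x = (- y + z) + (- z + x)"
    by (simp add: add.assoc flip: add.assoc[of z])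
  then have "dist x y \<le> koranyi (- y + z) + koranyi (- z + x)"
    by (simp only: dist_heis_def koranyi_triangle)
  also have "koranyi (- y + z) = koranyi (- z + y)"
    by (metis koranyi_uminus minus_add minus_minus)
  finally show "dist x y \<le> dist x z + dist y z"
    by (simp add: dist_heis_def)
qed (simp_all add: uniformity_heis_def open_heis_def)

end


section \<open>Hausdorff measure, Ahlfors regularity, Condition B\<close>

text \<open>
  The \<open>s\<close>-dimensional Hausdorff (outer) measure for \<open>s > 0\<close>, without normalising constant. (For
  \<open>s = 0\<close> it would be wrong, since \<open>0 powr 0 = 0\<close>.) The library's \<open>diameter\<close> is only meaningful on
  bounded sets, hence the boundedness requirement on the covering sets.
\<close>

definition hausdorff_pre :: "real \<Rightarrow> real \<Rightarrow> 'a::metric_space set \<Rightarrow> ennreal" where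
  "hausdorff_pre \<delta> s A =
     (INF U \<in> {U :: nat \<Rightarrow> 'a set. A \<subseteq> (\<Union>i. U i) \<and> (\<forall>i. bounded (U i) \<and> diameter (U i) \<le> \<delta>)}.
        \<Sum>i. ennreal (diameter (U i) powr s))"

definition hausdorff :: "real \<Rightarrow> 'a::metric_space set \<Rightarrow> ennreal" where
  "hausdorff s A = (SUP \<delta>\<in>{0<..}. hausdorff_pre \<delta> s A)"

definition ediam :: "'a::metric_space set \<Rightarrow> ennreal" where
  "ediam A = (if bounded A then ennreal (diameter A) else \<infinity>)"

definition upper_ahlfors_regular :: "real \<Rightarrow> 'a::metric_space set \<Rightarrow> bool" where
  "upper_ahlfors_regular s E \<longleftrightarrow> closed E \<and>
     (\<exists>C>0. \<forall>p. \<forall>r>0. hausdorff s (cball p r \<inter> E) \<le> ennreal (C * r powr s))"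

definition lower_ahlfors_regular :: "real \<Rightarrow> 'a::metric_space set \<Rightarrow> bool" where
  "lower_ahlfors_regular s E \<longleftrightarrow> closed E \<and>
     (\<exists>c>0. \<forall>p\<in>E. \<forall>r>0. ennreal r < ediam E \<longrightarrow>
        hausdorff s (cball p r \<inter> E) \<ge> ennreal (c * r powr s))"

definition condition_B :: "'a::metric_space set \<Rightarrow> bool" where
  "condition_B S \<longleftrightarrow> closed S \<and>
     (\<exists>c>0. \<forall>p\<in>S. \<forall>r>0. ennreal r < ediam S \<longrightarrow>
        (\<exists>q1 q2. \<exists>K1\<in>components (- S). \<exists>K2\<in>components (- S).
           K1 \<noteq> K2 \<and> q1 \<in> K1 \<and> q2 \<in> K2 \<and> q1 \<in> cball p r \<and> q2 \<in> cball p r \<and>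
           min (infdist q1 S) (infdist q2 S) > c * r))"

definition semmes_surface :: "('k::finite) heis set \<Rightarrow> bool" where
  "semmes_surface S \<longleftrightarrow> closed S \<and>
     upper_ahlfors_regular (2 * real CARD('k) + 1) S \<and> condition_B S"


section \<open>Intrinsic Lipschitz graphs\<close>

definition heis_L :: "real ^ ('k::finite + 'k) \<Rightarrow> 'k heis set" where
  "heis_L \<nu> = {Heis (s *\<^sub>R \<nu>) 0 | s. True}"

definition heis_W :: "real ^ ('k::finite + 'k) \<Rightarrow> 'k heis set" where
  "heis_W \<nu> = {Heis v t | v t. v \<bullet> \<nu> = 0}"

lemma heis_decomp_iff:
  fixes p :: "('k::finite) heis"
  assumes "norm \<nu> = 1"
  shows "w \<in> heis_W \<nu> \<and> l \<in> heis_L \<nu> \<and> p = w + l \<longleftrightarrow>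
    l = Heis ((hor p \<bullet> \<nu>) *\<^sub>R \<nu>) 0 \<and> w = p - Heis ((hor p \<bullet> \<nu>) *\<^sub>R \<nu>) 0"
proof -
  have \<nu>: "\<nu> \<bullet> \<nu> = 1" using assms by (simp add: norm_eq_1)
  show ?thesis
  proof
    assume asm: "w \<in> heis_W \<nu> \<and> l \<in> heis_L \<nu> \<and> p = w + l"
    then obtain v t s where "w = Heis v t" "v \<bullet> \<nu> = 0" "l = Heis (s *\<^sub>R \<nu>) 0"
      by (auto simp: heis_W_def heis_L_def)
    with asm \<nu> show "l = Heis ((hor p \<bullet> \<nu>) *\<^sub>R \<nu>) 0 \<and> w = p - Heis ((hor p \<bullet> \<nu>) *\<^sub>R \<nu>) 0"
      by (auto simp: inner_add_left algebra_simps)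
  next
    assume asm: "l = Heis ((hor p \<bullet> \<nu>) *\<^sub>R \<nu>) 0 \<and> w = p - Heis ((hor p \<bullet> \<nu>) *\<^sub>R \<nu>) 0"
    then have "hor w = hor p - (hor p \<bullet> \<nu>) *\<^sub>R \<nu>" by simp
    then have "hor w \<bullet> \<nu> = 0" using \<nu> by (simp add: inner_diff_left)
    then have "w \<in> heis_W \<nu>" unfolding heis_W_def by (cases w) auto
    with asm show "w \<in> heis_W \<nu> \<and> l \<in> heis_L \<nu> \<and> p = w + l"
      by (auto simp: heis_L_def)
  qed
qed

definition proj_W :: "real ^ ('k::finite + 'k) \<Rightarrow> 'k heis \<Rightarrow> 'k heis" where
  "proj_W \<nu> p = (THE w. w \<in> heis_W \<nu> \<and> (\<exists>l\<in>heis_L \<nu>. p = w + l))"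

definition proj_L :: "real ^ ('k::finite + 'k) \<Rightarrow> 'k heis \<Rightarrow> 'k heis" where
  "proj_L \<nu> p = (THE l. l \<in> heis_L \<nu> \<and> (\<exists>w\<in>heis_W \<nu>. p = w + l))"

lemma proj_W_eq: "norm \<nu> = 1 \<Longrightarrow> proj_W \<nu> p = p - Heis ((hor p \<bullet> \<nu>) *\<^sub>R \<nu>) 0"
  unfolding proj_W_def by (rule the_equality; use heis_decomp_iff in blast)

lemma proj_L_eq: "norm \<nu> = 1 \<Longrightarrow> proj_L \<nu> p = Heis ((hor p \<bullet> \<nu>) *\<^sub>R \<nu>) 0"
  unfolding proj_L_def by (rule the_equality; use heis_decomp_iff in blast)

lemma proj_W_plus_proj_L: "norm \<nu> = 1 \<Longrightarrow> proj_W \<nu> p + proj_L \<nu> p = p"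
  by (simp add: proj_W_eq proj_L_eq)

definition heis_cone :: "real \<Rightarrow> real ^ ('k::finite + 'k) \<Rightarrow> 'k heis set" where
  "heis_cone \<gamma> \<nu> = {p. koranyi (proj_W \<nu> p) \<le> \<gamma> * koranyi (proj_L \<nu> p)}"

definition intrinsic_lipschitz_graph :: "real \<Rightarrow> ('k::finite) heis set \<Rightarrow> bool" where
  "intrinsic_lipschitz_graph L \<Gamma> \<longleftrightarrow>
     (\<exists>\<nu>. norm \<nu> = 1 \<and> proj_W \<nu> ` \<Gamma> = heis_W \<nu> \<and>
        (\<forall>p\<in>\<Gamma>. (+) p ` heis_cone (1 / L) \<nu> \<inter> \<Gamma> = {p}))"

definition big_pieces_intrinsic_lipschitz_graphs :: "('k::finite) heis set \<Rightarrow> bool" where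
  "big_pieces_intrinsic_lipschitz_graphs S \<longleftrightarrow> closed S \<and>
     (\<exists>L>0. \<exists>c>0. \<forall>p\<in>S. \<forall>r>0. ennreal r < ediam S \<longrightarrow>
        (\<exists>\<Gamma>. intrinsic_lipschitz_graph L \<Gamma> \<and>
           hausdorff (2 * real CARD('k) + 1) (cball p r \<inter> S \<inter> \<Gamma>)
             \<ge> ennreal (c * r powr (2 * real CARD('k) + 1))))"

end

theory Submission
  imports Defs
begin

text \<open>
  Write \<open>n = 2k + 1\<close> and \<open>Q = 2k + 2\<close>. Lebesgue measure in coordinates is invariant under left and
  right translations and gives balls of radius \<open>r\<close> a measure proportional to \<open>r\<^sup>Q\<close>. It controls
  \<open>n\<close>-dimensional Hausdorff measure in one direction: the starting points of the horizontal segments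
  of direction \<open>a\<close> that meet a set \<open>G\<close> have volume at most a constant times the length of \<open>a\<close> times
  the Hausdorff measure of \<open>G\<close> (\<open>vol_Hit_le\<close>). To bound the Hausdorff measure of a piece of \<open>S\<close> from
  below it is therefore enough to hit it with many parallel segments.

  Condition B provides such segments. Two points in different components can be joined by a path of
  five horizontal segments, and translating this path shows that near every point of \<open>S\<close> there are a
  component \<open>\<Omega>\<close> of the complement and a horizontal vector \<open>a\<close> such that \<open>q \<in> \<Omega>\<close> and \<open>q + a \<notin> \<Omega>\<close> for
  a set of points \<open>q\<close> of volume at least \<open>c r\<^sup>Q\<close> (\<open>condition_B_crossing\<close>). Lower regularity follows.

  For big pieces let \<open>\<nu>\<close> be the direction of \<open>a\<close>. Order the group by \<open>x < y\<close> if \<open>- x + y\<close> lies in a narrow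
  cone around \<open>\<nu>\<close>. This is a partial order, because the cone is a semigroup, and an antichain is what
  the cone condition asks for: every antichain extends to an intrinsic Lipschitz graph, namely the
  lower boundary of its upper closure (\<open>antichain_extends_to_graph\<close>). Bisection selects on the segment
  from \<open>q\<close> to \<open>q + a\<close> a point of \<open>S\<close>, and it remains to find an antichain among the selected points
  that is hit by a fixed proportion of the segments. A set whose chains have at most \<open>N\<close> elements is
  a union of at most \<open>N\<close> antichains, so what is needed is a bound on the length of chains of good
  points. It comes from three facts.

  First, most selected points are good in this sense: at every dyadic scale \<open>\<rho>\<close> the
  set of points near it at which a step \<open>\<rho> \<nu>\<close> leads out of \<open>\<Omega>\<close> has volume at least \<open>\<epsilon> \<rho>\<^sup>Q\<close>. The points
  where this fails are removed with a Vitali covering (\<open>low_density_small\<close>).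

  Second, two good points \<open>x < y\<close> whose height difference is comparable to \<open>2\<^sup>i \<rho>\<close> force non-monotone
  patterns at scale \<open>\<rho>\<close>: sequences \<open>q, q + v, \<dots>, q + M v\<close> along which membership in \<open>\<Omega>\<close> changes at
  least twice. Join a point \<open>p\<close> near \<open>x\<close> to a point \<open>p'\<close> near \<open>y\<close> by two horizontal segments of
  nearly the direction \<open>\<nu>\<close>, where both \<open>p\<close> and \<open>p'\<close> are about to leave \<open>\<Omega>\<close>. If the corner lies in
  \<open>\<Omega>\<close>, the first segment leaves \<open>\<Omega>\<close> and returns; if it does not, the second segment enters \<open>\<Omega>\<close>
  and leaves again when it is prolonged beyond \<open>p'\<close>. Counting all such paths in two ways turns this
  into a lower bound for the volume of the patterns (\<open>two_point_counting\<close>,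
  \<open>aligned_crossings_nonmono\<close>).

  Third, non-monotone patterns are rare. Steps \<open>v\<close> change sides at least as often as long
  steps \<open>2\<^sup>i v\<close> require, with an excess of two at every non-monotone pattern; summed over dyadic scales
  the excess telescopes (\<open>nonmono_packing\<close>). On average a selected point thus sees a bounded number of
  scales with many patterns (\<open>many_bad_scales_small\<close>), and the points that see \<open>J\<close> or more of them are
  discarded. In a chain of the remaining points the height differences seen from any one point take
  at most \<open>J\<close> dyadic sizes, so the chain has at most \<open>4\<^sup>J\<close> elements (\<open>card_le_of_few_scales\<close>).
\<close>

section \<open>Coordinates, horizontal elements and the symplectic form\<close>

lemma omega_add_left: "heis_omega (u + v) w = heis_omega u w + heis_omega v w"
  by (simp add: heis_omega_def sum.distrib sum_subtractf algebra_simps)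

lemma omega_add_right: "heis_omega u (v + w) = heis_omega u v + heis_omega u w"
  by (simp add: heis_omega_def sum.distrib sum_subtractf algebra_simps)

lemma omega_scaleR_left: "heis_omega (c *\<^sub>R u) w = c * heis_omega u w"
  by (simp add: heis_omega_def sum_distrib_left algebra_simps)

lemma omega_scaleR_right: "heis_omega u (c *\<^sub>R w) = c * heis_omega u w"
  by (simp add: heis_omega_def sum_distrib_left algebra_simps)

lemma omega_self [simp]: "heis_omega u u = 0"
  by (simp add: heis_omega_def)

lemma omega_zero [simp]: "heis_omega 0 u = 0" "heis_omega u 0 = 0"
  by (simp_all add: heis_omega_def)

lemma omega_minus_left [simp]: "heis_omega (- u) w = - heis_omega u w"
  using omega_scaleR_left[of "-1" u w] by simp

lemma omega_minus_right [simp]: "heis_omega u (- w) = - heis_omega u w"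
  using omega_scaleR_right[of u "-1" w] by simp

lemma omega_diff_left: "heis_omega (u - v) w = heis_omega u w - heis_omega v w"
  using omega_add_left[of u "-v" w] by simp

lemma omega_diff_right: "heis_omega u (v - w) = heis_omega u v - heis_omega u w"
  using omega_add_right[of u v "-w"] by simp

lemma omega_commute: "heis_omega u w = - heis_omega w u"
  by (simp add: heis_omega_def algebra_simps sum_subtractf)

lemma abs_omega_le: "\<bar>heis_omega u w\<bar> \<le> norm u * norm w"
proof -
  have "\<bar>heis_omega u w\<bar> = \<bar>Im (Complex (u \<bullet> w) (heis_omega u w))\<bar>" by simp
  also have "\<dots> \<le> norm (Complex (u \<bullet> w) (heis_omega u w))" by (rule abs_Im_le_cmod)
  finally show ?thesis using inner_omega_le[of u w] by linarith
qed

lemmas omega_simps = omega_add_left omega_add_right omega_scaleR_left omega_scaleR_right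
  omega_diff_left omega_diff_right

lemma bounded_bilinear_omega: "bounded_bilinear heis_omega"
proof
  show "\<exists>K. \<forall>a b. norm (heis_omega a b) \<le> norm a * norm b * K"
    by (rule exI[of _ 1]) (simp add: abs_omega_le)
qed (simp_all add: omega_simps)

lemmas continuous_on_omega [continuous_intros] =
  bounded_bilinear.continuous_on[OF bounded_bilinear_omega]

text \<open>
  The standard complex structure. Since \<open>omega_symp\<close> turns the symplectic form into the inner product, a
  displacement along \<open>symp \<nu>\<close> changes vertical coordinates at a rate given by the component along \<open>\<nu>\<close>.
\<close>

definition symp :: "real ^ ('k::finite + 'k) \<Rightarrow> real ^ ('k + 'k)" where
  "symp v = (\<chi> i. case i of Inl j \<Rightarrow> - v $ Inr j | Inr j \<Rightarrow> v $ Inl j)"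

lemma inner_sum_index:
  "x \<bullet> y = (\<Sum>j\<in>UNIV. x $ Inl j * y $ Inl j) + (\<Sum>j\<in>UNIV. x $ Inr j * y $ Inr j)"
  for x y :: "real ^ ('k::finite + 'k)"
  unfolding inner_vec_def UNIV_sum
  by (subst sum.union_disjoint) (auto simp: sum.reindex)

lemma symp_inner: "symp v \<bullet> w = heis_omega v w"
  by (simp add: inner_sum_index symp_def heis_omega_def sum_negf sum_subtractf mult.commute)

lemma omega_symp: "heis_omega v (symp w) = v \<bullet> w"
  by (simp add: inner_sum_index symp_def heis_omega_def sum_negf sum_subtractf sum.distrib mult.commute)

lemma norm_symp [simp]: "norm (symp v) = norm v"
  unfolding norm_eq_sqrt_inner symp_inner omega_commute[of v "symp v"]
  by (metis omega_symp omega_commute symp_inner)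

text \<open>
  The curve \<open>s \<mapsto> p + hz (s *\<^sub>R a)\<close> is the horizontal line through \<open>p\<close> with direction \<open>a\<close>; on it the
  Koranyi distance is the Euclidean one.
\<close>

definition hz :: "real ^ ('k::finite + 'k) \<Rightarrow> 'k heis" where "hz a = Heis a 0"

text \<open>
  Coordinates, used to transport Lebesgue measure and Borel sets to the group.
\<close>

definition hc :: "(real ^ ('k::finite + 'k)) \<times> real \<Rightarrow> 'k heis" where "hc z = Heis (fst z) (snd z)"

lemma hz_simps [simp]: "hor (hz a) = a" "ver (hz a) = 0" "hz 0 = 0"
  by (simp_all add: hz_def zero_heis_def)

lemma hc_simps [simp]: "hor (hc z) = fst z" "ver (hc z) = snd z"
  by (simp_all add: hc_def)

lemma hc_hor_ver [simp]: "hc (hor p, ver p) = p"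
  by (simp add: hc_def)

lemma heis_eqI: "hor p = hor q \<Longrightarrow> ver p = ver q \<Longrightarrow> p = q"
  by (cases p; cases q) simp

lemma bij_hc: "bij hc"
  by (rule bijI') (auto simp: hc_def prod_eq_iff intro: heis.exhaust_sel exI[of _ "(hor _, ver _)"])

lemma hz_add_scaleR: "hz (s *\<^sub>R a) + hz (t *\<^sub>R a) = hz ((s + t) *\<^sub>R a)"
  by (rule heis_eqI) (simp_all add: algebra_simps omega_simps)

lemma uminus_hz: "- hz a = hz (- a)"
  by (rule heis_eqI) simp_all

lemma koranyi_hz [simp]: "koranyi (hz a) = norm a"
  by (simp add: koranyi_def real_root_power_cancel)

lemma koranyi_le_length: "koranyi p \<le> norm (hor p) + 2 * sqrt \<bar>ver p\<bar>"
proof -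
  have "koranyi p ^ 4 \<le> (norm (hor p) + 2 * sqrt \<bar>ver p\<bar>) ^ 4"
  proof -
    let ?x = "norm (hor p)" and ?y = "2 * sqrt \<bar>ver p\<bar>"
    have "?y ^ 4 = 16 * (sqrt \<bar>ver p\<bar> ^ 2) ^ 2" by (simp only: power2_eq_square power4_eq_xxxx)
    then have y: "?y ^ 4 = 16 * (ver p)\<^sup>2" by simp
    have xy: "?x \<ge> 0" "?y \<ge> 0" by simp_all
    have "x ^ 4 + y ^ 4 \<le> (x + y) ^ 4" if "x \<ge> 0" "y \<ge> 0" for x y :: real
    proof -
      have "(x + y) ^ 4 = x ^ 4 + y ^ 4 + (4 * x ^ 3 * y + 6 * x\<^sup>2 * y\<^sup>2 + 4 * x * y ^ 3)"
        by algebra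
      moreover have "4 * x ^ 3 * y + 6 * x\<^sup>2 * y\<^sup>2 + 4 * x * y ^ 3 \<ge> 0" using that by simp
      ultimately show ?thesis by linarith
    qed
    from this[OF xy] y show ?thesis by (simp add: koranyi_pow4)
  qed
  then show ?thesis by (rule power_le_imp_le_base[where n = 3, simplified]) simp
qed

text \<open>
  The vertical part of \<open>- hz u + hz v\<close> is linear in \<open>v - u\<close>, and the Koranyi norm takes its square root.
  This is the source of the factor \<open>sqrt \<delta>\<close> wherever one direction is replaced by a nearby one.
\<close>

lemma koranyi_hz_diff_le:
  assumes \<delta>: "0 \<le> \<delta>" "\<delta> \<le> 1" and u: "norm u \<le> 2 * b" and uv: "norm (v - u) \<le> \<delta> * b"
  shows "koranyi (- hz u + hz v) \<le> 3 * sqrt \<delta> * b"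
proof -
  let ?g = "- hz u + hz v"
  have b: "b \<ge> 0" using order_trans[OF norm_ge_zero u] by simp
  have "\<bar>heis_omega u (v - u)\<bar> \<le> (2 * b) * (\<delta> * b)"
    using u uv b by (intro order_trans[OF abs_omega_le] mult_mono) auto
  moreover have "ver ?g = - heis_omega u (v - u) / 2" by (simp add: omega_diff_right)
  ultimately have "\<bar>ver ?g\<bar> \<le> \<delta> * b\<^sup>2" by (simp add: power2_eq_square mult_ac)
  then have "sqrt \<bar>ver ?g\<bar> \<le> sqrt (\<delta> * b\<^sup>2)" by (rule real_sqrt_le_mono)
  also have "\<dots> = sqrt \<delta> * b" using b by (simp add: real_sqrt_mult)
  finally have 1: "sqrt \<bar>ver ?g\<bar> \<le> sqrt \<delta> * b" .
  have "\<delta> \<le> sqrt \<delta>" using \<delta> by (intro real_le_rsqrt) (simp add: power2_eq_square mult_left_le)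
  then have "\<delta> * b \<le> sqrt \<delta> * b" using b by (intro mult_right_mono) auto
  moreover have "norm (hor ?g) \<le> \<delta> * b" using uv by simp
  ultimately show ?thesis using 1 koranyi_le_length[of ?g] by simp
qed

lemma abs_ver_le_koranyi: "\<bar>ver p\<bar> \<le> (koranyi p)\<^sup>2 / 4"
proof -
  have "(4 * \<bar>ver p\<bar>)\<^sup>2 \<le> ((koranyi p)\<^sup>2)\<^sup>2"
    using koranyi_pow4[of p] by (simp add: power_mult_distrib flip: power_mult)
  then have "4 * \<bar>ver p\<bar> \<le> (koranyi p)\<^sup>2" by (rule power2_le_imp_le) simp
  then show ?thesis by simp
qed

lemma dist_heis_le_iff: "q \<in> cball p r \<longleftrightarrow> koranyi (- p + q) \<le> r"
  using dist_heis_def[of q p] by (simp add: dist_commute)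

lemma dist_add_self [simp]: "dist p (p + g) = koranyi g" "dist (p + g) p = koranyi g"
proof -
  show "dist (p + g) p = koranyi g" by (simp add: dist_heis_def flip: add.assoc)
  then show "dist p (p + g) = koranyi g" by (simp add: dist_commute)
qed

lemma dist_0_heis: "dist 0 p = koranyi (p :: 'k::finite heis)"
  using dist_add_self(1)[of 0 p] by simp

lemma koranyi_add_le: "koranyi p \<le> a \<Longrightarrow> koranyi q \<le> b \<Longrightarrow> koranyi (p + q) \<le> a + b"
  using koranyi_triangle[of p q] by linarith

lemma continuous_on_heis:
  fixes f :: "'a::topological_space \<Rightarrow> 'k::finite heis"
  assumes "continuous_on A (\<lambda>x. hor (f x))" "continuous_on A (\<lambda>x. ver (f x))"
  shows "continuous_on A f"
  unfolding continuous_on_def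
proof
  fix a assume a: "a \<in> A"
  let ?F = "at a within A"
  have h: "((\<lambda>x. hor (f x)) \<longlongrightarrow> hor (f a)) ?F" and v: "((\<lambda>x. ver (f x)) \<longlongrightarrow> ver (f a)) ?F"
    using assms a by (auto simp: continuous_on_def)
  have "((\<lambda>x. norm (hor (f x) - hor (f a)) + 2 * sqrt \<bar>ver (f x) - ver (f a) - heis_omega (hor (f a)) (hor (f x)) / 2\<bar>)
      \<longlongrightarrow> norm (hor (f a) - hor (f a)) + 2 * sqrt \<bar>ver (f a) - ver (f a) - heis_omega (hor (f a)) (hor (f a)) / 2\<bar>) ?F"
    by (intro tendsto_intros h v bounded_bilinear.tendsto[OF bounded_bilinear_omega]) simp_all
  then have lim: "((\<lambda>x. norm (hor (f x) - hor (f a)) + 2 * sqrt \<bar>ver (f x) - ver (f a) - heis_omega (hor (f a)) (hor (f x)) / 2\<bar>)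
      \<longlongrightarrow> 0) ?F" by simp
  have "((\<lambda>x. dist (f x) (f a)) \<longlongrightarrow> 0) ?F"
  proof (rule tendsto_sandwich[OF _ _ tendsto_const lim])
    show "\<forall>\<^sub>F x in ?F. dist (f x) (f a) \<le> norm (hor (f x) - hor (f a)) +
        2 * sqrt \<bar>ver (f x) - ver (f a) - heis_omega (hor (f a)) (hor (f x)) / 2\<bar>"
    proof (rule always_eventually, rule allI)
      fix x
      show "dist (f x) (f a) \<le> norm (hor (f x) - hor (f a)) +
        2 * sqrt \<bar>ver (f x) - ver (f a) - heis_omega (hor (f a)) (hor (f x)) / 2\<bar>"
        using koranyi_le_length[of "- f a + f x"] by (simp add: dist_heis_def algebra_simps)
    qed
  qed simp
  then show "(f \<longlongrightarrow> f a) ?F" by (rule tendsto_dist_iff[THEN iffD2])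
qed

lemma continuous_on_hc [continuous_intros]: "continuous_on A hc"
  by (rule continuous_on_heis) (auto intro!: continuous_intros)

lemma continuous_on_hz [continuous_intros]: "continuous_on A f \<Longrightarrow> continuous_on A (\<lambda>x. hz (f x))"
  by (rule continuous_on_heis) (auto intro!: continuous_intros)


section \<open>The Haar measure of the Heisenberg group\<close>

lemma nn_integral_translate:
  fixes f :: "'a::euclidean_space \<Rightarrow> ennreal"
  assumes [measurable]: "f \<in> borel_measurable borel"
  shows "(\<integral>\<^sup>+ x. f (a + x) \<partial>lborel) = (\<integral>\<^sup>+ x. f x \<partial>lborel)"
  by (subst (2) lborel_distr_plus[of a, symmetric]) (simp add: nn_integral_distr)

lemma emeasure_prod_fst:
  assumes "X \<in> sets borel"
  shows "emeasure lborel (X :: ('a::euclidean_space \<times> 'b::euclidean_space) set) =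
    (\<integral>\<^sup>+ v. \<integral>\<^sup>+ t. indicator X (v, t) \<partial>lborel \<partial>lborel)"
proof -
  have X [measurable]: "X \<in> sets (lborel \<Otimes>\<^sub>M lborel)" using assms by (simp only: lborel_prod sets_lborel)
  have "emeasure lborel X = (\<integral>\<^sup>+ z. indicator X z \<partial>(lborel \<Otimes>\<^sub>M lborel))"
    using assms by (simp add: lborel_prod)
  also have "\<dots> = (\<integral>\<^sup>+ v. \<integral>\<^sup>+ t. indicator X (v, t) \<partial>lborel \<partial>lborel)"
    by (rule lborel.nn_integral_fst[symmetric]) measurable
  finally show ?thesis .
qed

text \<open>
  In coordinates both left and right translations have the form of this shear, because the symplectic
  form is bilinear; hence Lebesgue measure is invariant under both.
\<close>

lemma lborel_shear:
  fixes g :: "'a::euclidean_space \<Rightarrow> real"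
  assumes [measurable]: "g \<in> borel_measurable borel"
  shows "distr lborel borel (\<lambda>z::'a \<times> real. (a + fst z, g (fst z) + snd z)) = lborel"
proof (rule measure_eqI)
  fix X assume "X \<in> sets (distr lborel borel (\<lambda>z::'a \<times> real. (a + fst z, g (fst z) + snd z)))"
  then have [measurable]: "X \<in> sets borel" by simp
  have Xp [measurable]: "X \<in> sets (lborel \<Otimes>\<^sub>M lborel)" using \<open>X \<in> sets borel\<close> by (simp only: lborel_prod sets_lborel)
  let ?T = "\<lambda>z::'a \<times> real. (a + fst z, g (fst z) + snd z)"
  have [measurable]: "?T \<in> borel \<rightarrow>\<^sub>M borel"
    unfolding borel_prod[symmetric] by measurable
  have "emeasure (distr lborel borel ?T) X = (\<integral>\<^sup>+ z. indicator X (?T z) \<partial>(lborel \<Otimes>\<^sub>M lborel))"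
    by (simp add: lborel_prod nn_integral_distr flip: nn_integral_indicator)
  also have "\<dots> = (\<integral>\<^sup>+ v. \<integral>\<^sup>+ t. indicator X (a + v, g v + t) \<partial>lborel \<partial>lborel)"
    by (subst lborel.nn_integral_fst[symmetric]) (simp_all add: lborel_prod)
  also have "\<dots> = (\<integral>\<^sup>+ v. \<integral>\<^sup>+ t. indicator X (a + v, t) \<partial>lborel \<partial>lborel)"
  proof (rule nn_integral_cong)
    fix v
    show "(\<integral>\<^sup>+ t. indicator X (a + v, g v + t) \<partial>lborel) = (\<integral>\<^sup>+ t. indicator X (a + v, t) \<partial>lborel)"
      by (rule nn_integral_translate) measurable
  qed
  also have "\<dots> = (\<integral>\<^sup>+ v. \<integral>\<^sup>+ t. indicator X (v, t) \<partial>lborel \<partial>lborel)"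
    by (rule nn_integral_translate) measurable
  also have "\<dots> = emeasure lborel X"
    by (subst lborel.nn_integral_fst) (simp_all add: lborel_prod)
  finally show "emeasure (distr lborel borel ?T) X = emeasure lborel X" .
qed simp

text \<open>
  An outer measure, because it is applied to sets such as the starting points of segments that meet an
  arbitrary set. The sets in \<open>hsets\<close> are the Borel sets; every set lies in one of the same volume.
\<close>

definition vol :: "('k::finite) heis set \<Rightarrow> ennreal" where
  "vol A = outer_measure_of lborel (hc -` A)"

definition hsets :: "('k::finite) heis set set" where
  "hsets = {A. hc -` A \<in> sets borel}"

lemma vol_mono: "A \<subseteq> B \<Longrightarrow> vol A \<le> vol B"
  unfolding vol_def by (rule outer_measure_of_mono) auto

lemma vol_attain: "\<exists>B\<in>hsets. A \<subseteq> B \<and> vol B = vol A"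
proof -
  obtain E where E: "E \<in> sets lborel" "hc -` A \<subseteq> E" "outer_measure_of lborel (hc -` A) = emeasure lborel E"
    using outer_measure_of_attain[of "hc -` A" lborel] by auto
  have v: "hc -` (hc ` E) = E" by (rule inj_vimage_image_eq[OF bij_is_inj[OF bij_hc]])
  have "A = hc ` (hc -` A)" by (rule surj_image_vimage_eq[OF bij_is_surj[OF bij_hc], symmetric])
  then have "A \<subseteq> hc ` E" using E(2) by blast
  with E v show ?thesis by (intro bexI[of _ "hc ` E"]) (auto simp: vol_def hsets_def)
qed

lemma vol_hsets: "A \<in> hsets \<Longrightarrow> vol A = emeasure lborel (hc -` A)"
  by (simp add: vol_def hsets_def)

lemma hsets_closed: "closed A \<Longrightarrow> A \<in> hsets"
  using closed_vimage[OF _ continuous_on_hc] by (auto simp: hsets_def intro: borel_closed)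

lemma hsets_open: "open A \<Longrightarrow> A \<in> hsets"
  unfolding hsets_def using open_vimage[OF _ continuous_on_hc, of A] by (auto intro: borel_open)

lemma hsets_vimage:
  assumes "A \<in> hsets" "continuous_on UNIV (\<lambda>z. (hor (f (hc z)), ver (f (hc z))))"
  shows "f -` A \<in> hsets"
proof -
  let ?g = "\<lambda>z. (hor (f (hc z)), ver (f (hc z)))"
  have "hc -` (f -` A) = ?g -` (hc -` A)" by auto
  moreover have "?g \<in> borel \<rightarrow>\<^sub>M borel" using assms(2) by (rule borel_measurable_continuous_onI)
  ultimately show ?thesis using assms(1) by (simp add: hsets_def measurable_sets_borel)
qed

lemma hsets_vimage_left: "A \<in> hsets \<Longrightarrow> {q. p + q \<in> A} \<in> hsets"
  using hsets_vimage[of A "\<lambda>q. p + q"] by (simp add: vimage_def continuous_intros)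

lemma hsets_vimage_right: "A \<in> hsets \<Longrightarrow> {q. q + p \<in> A} \<in> hsets"
  using hsets_vimage[of A "\<lambda>q. q + p"] by (simp add: vimage_def continuous_intros)

lemma hsets_Int: "A \<in> hsets \<Longrightarrow> B \<in> hsets \<Longrightarrow> A \<inter> B \<in> hsets"
  and hsets_Un: "A \<in> hsets \<Longrightarrow> B \<in> hsets \<Longrightarrow> A \<union> B \<in> hsets"
  and hsets_Diff: "A \<in> hsets \<Longrightarrow> B \<in> hsets \<Longrightarrow> A - B \<in> hsets"
  by (auto simp: hsets_def vimage_Diff intro: sets.Diff)

lemma vol_empty [simp]: "vol {} = 0"
  by (simp add: vol_def)

lemma vol_UN_le:
  fixes A :: "nat \<Rightarrow> 'k::finite heis set"
  shows "vol (\<Union>i. A i) \<le> (\<Sum>i. vol (A i))"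
proof -
  have "\<forall>i. \<exists>B\<in>hsets. A i \<subseteq> B \<and> vol B = vol (A i)" using vol_attain by blast
  then obtain B where B: "\<And>i. B i \<in> hsets" "\<And>i. A i \<subseteq> B i" "\<And>i. vol (B i) = vol (A i)" by metis
  have U: "(\<Union>i. B i) \<in> hsets" using B(1) by (auto simp: hsets_def vimage_UN)
  have "vol (\<Union>i. A i) \<le> vol (\<Union>i. B i)" by (rule vol_mono) (use B(2) in blast)
  also have "\<dots> \<le> (\<Sum>i. emeasure lborel (hc -` B i))"
    using B(1) by (subst vol_hsets[OF U], unfold vimage_UN) (rule emeasure_subadditive_countably, auto simp: hsets_def)
  also have "\<dots> = (\<Sum>i. vol (A i))" using B by (simp add: vol_hsets[symmetric])
  finally show ?thesis .
qed

lemma vol_UN_finite_le: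
  assumes "finite I" shows "vol (\<Union>i\<in>I. A i) \<le> (\<Sum>i\<in>I. vol (A i))"
  using assms
proof induction
  case (insert i I)
  have "vol (A i \<union> (\<Union>i\<in>I. A i)) \<le> vol (A i) + vol (\<Union>i\<in>I. A i)"
  proof -
    obtain B C where B: "B \<in> hsets" "A i \<subseteq> B" "vol B = vol (A i)"
      and C: "C \<in> hsets" "(\<Union>i\<in>I. A i) \<subseteq> C" "vol C = vol (\<Union>i\<in>I. A i)" using vol_attain by metis
    have "vol (A i \<union> (\<Union>i\<in>I. A i)) \<le> vol (B \<union> C)" by (rule vol_mono) (use B C in blast)
    also have "\<dots> \<le> emeasure lborel (hc -` B) + emeasure lborel (hc -` C)"
        using B(1) C(1) by (subst vol_hsets[OF hsets_Un]) (auto simp: hsets_def vimage_Un intro!: emeasure_subadditive)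
    finally show ?thesis using B C by (simp add: vol_hsets)
  qed
  with insert show ?case by (simp add: add_left_mono order_trans)
qed simp

lemma vol_Un_le: "vol (A \<union> B) \<le> vol A + vol B"
  using vol_UN_finite_le[of "{True, False}" "\<lambda>b. if b then A else B"] by (simp add: Un_commute)

text \<open>
  For a translation \<open>f\<close> the inequality also holds for its inverse, which gives equality below.
\<close>

lemma vol_preserved_le:
  assumes f: "\<And>z. f (hc z) = hc (a + fst z, g (fst z) + snd z)" and g: "continuous_on UNIV g"
  shows "vol (f -` A) \<le> vol A"
proof -
  obtain B where B: "B \<in> hsets" "A \<subseteq> B" "vol B = vol A" using vol_attain by blast
  have gm [measurable]: "g \<in> borel_measurable borel" using g by (rule borel_measurable_continuous_onI)
  let ?T = "\<lambda>z. (a + fst z, g (fst z) + snd z)"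
  have "continuous_on UNIV ?T"
    by (intro continuous_intros continuous_on_compose2[OF g]) auto
  then have Tm: "?T \<in> lborel \<rightarrow>\<^sub>M borel" by (simp add: borel_measurable_continuous_onI)
  have *: "hc -` f -` B = ?T -` (hc -` B) \<inter> space lborel" by (auto simp: f)
  then have fB: "f -` B \<in> hsets" using measurable_sets[OF Tm, of "hc -` B"] B(1) by (simp add: hsets_def)
  have "vol (f -` A) \<le> vol (f -` B)" using B by (intro vol_mono) auto
  also have "\<dots> = emeasure (distr lborel borel ?T) (hc -` B)"
    using B(1) by (simp only: vol_hsets[OF fB] *) (simp add: emeasure_distr[OF Tm] hsets_def)
  also have "\<dots> = vol B" by (simp only: lborel_shear[OF gm] vol_hsets[OF B(1)])
  finally show ?thesis using B by simp
qed

lemma vol_left [simp]: "vol {q. p + q \<in> A} = vol A"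
proof (rule antisym)
  have le: "vol {q. p + q \<in> A} \<le> vol A" for p and A :: "'a heis set"
    using vol_preserved_le[of "\<lambda>q. p + q" "hor p" "\<lambda>v. ver p + heis_omega (hor p) v / 2" A]
    by (simp add: vimage_def heis_eqI continuous_intros)
  show "vol {q. p + q \<in> A} \<le> vol A" by (rule le)
  have "{q. - p + q \<in> {q. p + q \<in> A}} = A" by (simp flip: add.assoc)
  with le[of "- p" "{q. p + q \<in> A}"] show "vol A \<le> vol {q. p + q \<in> A}" by simp
qed

lemma vol_right [simp]: "vol {q. q + p \<in> A} = vol A"
proof (rule antisym)
  have le: "vol {q. q + p \<in> A} \<le> vol A" for p and A :: "'a heis set"
    using vol_preserved_le[of "\<lambda>q. q + p" "hor p" "\<lambda>v. ver p + heis_omega v (hor p) / 2" A]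
    by (simp add: vimage_def heis_eqI continuous_intros)
  show "vol {q. q + p \<in> A} \<le> vol A" by (rule le)
  have "{q. q + - p \<in> {q. q + p \<in> A}} = A" by (simp add: add.assoc)
  with le[of "- p" "{q. q + p \<in> A}"] show "vol A \<le> vol {q. q + p \<in> A}" by simp
qed

definition unit_vol :: "'k::finite itself \<Rightarrow> real" where
  "unit_vol _ = enn2real (vol (cball (0 :: 'k heis) 1))"

lemma DIM_hor: "DIM(real ^ ('k::finite + 'k)) = 2 * CARD('k)"
  by (simp add: card_UNIV_sum)

text \<open>
  The Heisenberg dilation scales \<open>2k\<close> coordinates by \<open>r\<close> and the vertical one by \<open>r\<^sup>2\<close>; therefore
  the homogeneous dimension is \<open>2k + 2\<close>.
\<close>

lemma vol_dilate:
  fixes A :: "'k::finite heis set"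
  assumes A: "A \<in> hsets" and r: "r > 0"
  shows "vol {q. Heis (r *\<^sub>R hor q) (r\<^sup>2 * ver q) \<in> A} * ennreal (r ^ (2 * CARD('k) + 2)) = vol A"
    (is "vol ?D * _ = _")
proof -
  let ?X = "hc -` A"
  have X [measurable]: "?X \<in> sets borel" using A by (simp add: hsets_def)
  have X2 [measurable]: "?X \<in> sets (lborel \<Otimes>\<^sub>M lborel)" using X by (simp only: lborel_prod sets_lborel)
  have D: "?D \<in> hsets"
    using hsets_vimage[OF A, of "\<lambda>q. Heis (r *\<^sub>R hor q) (r\<^sup>2 * ver q)"]
    by (simp add: vimage_def continuous_intros)
  then have [measurable]: "hc -` ?D \<in> sets (lborel \<Otimes>\<^sub>M lborel)" by (simp only: hsets_def lborel_prod sets_lborel mem_Collect_eq)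
  have ind: "indicator (hc -` ?D) (v, t) = (indicator ?X (r *\<^sub>R v, r\<^sup>2 * t) :: ennreal)" for v t
    by (simp add: indicator_def hc_def)
  have "vol A = (\<integral>\<^sup>+ v. \<integral>\<^sup>+ t. indicator ?X (v, t) \<partial>lborel \<partial>lborel)"
    by (subst lborel.nn_integral_fst) (simp_all add: lborel_prod vol_hsets A)
  also have "\<dots> = (\<integral>\<^sup>+ v. \<integral>\<^sup>+ t. indicator ?X (v, t) \<partial>lborel \<partial>density (distr lborel borel (\<lambda>x. 0 + r *\<^sub>R x)) (\<lambda>_. \<bar>r\<bar>^DIM(real^('k+'k))))"
    using r by (subst lborel_affine[of r "0::real^('k+'k)"]) auto
  also have "\<dots> = (\<integral>\<^sup>+ v. ennreal (\<bar>r\<bar>^DIM(real^('k+'k))) * \<integral>\<^sup>+ t. indicator ?X (r *\<^sub>R v, t) \<partial>lborel \<partial>lborel)"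
    by (subst nn_integral_density) (simp_all add: nn_integral_distr)
  also have "\<dots> = (\<integral>\<^sup>+ v. ennreal (r^(2 * CARD('k))) * (ennreal (r\<^sup>2) * \<integral>\<^sup>+ t. indicator (hc -` ?D) (v, t) \<partial>lborel) \<partial>lborel)"
  proof (rule nn_integral_cong)
    fix v :: "real^('k+'k)"
    have "(\<integral>\<^sup>+ t. indicator ?X (r *\<^sub>R v, t) \<partial>lborel) = ennreal \<bar>r\<^sup>2\<bar> * (\<integral>\<^sup>+ t. indicator ?X (r *\<^sub>R v, 0 + r\<^sup>2 * t) \<partial>lborel)"
      using r by (intro nn_integral_real_affine) (auto simp: lborel_prod[symmetric])
    with r show "ennreal (\<bar>r\<bar>^DIM(real^('k+'k))) * (\<integral>\<^sup>+ t. indicator ?X (r *\<^sub>R v, t) \<partial>lborel) =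
       ennreal (r^(2 * CARD('k))) * (ennreal (r\<^sup>2) * \<integral>\<^sup>+ t. indicator (hc -` ?D) (v, t) \<partial>lborel)"
      by (simp only: ind DIM_hor) simp
  qed
  also have "\<dots> = ennreal (r^(2 * CARD('k))) * (ennreal (r\<^sup>2) * vol ?D)"
  proof -
    define Y where "Y = hc -` ?D"
    have [measurable]: "Y \<in> sets (lborel \<Otimes>\<^sub>M lborel)"
      using D by (simp only: hsets_def lborel_prod sets_lborel mem_Collect_eq Y_def)
    show ?thesis
      unfolding vol_hsets[OF D] Y_def[symmetric]
      using D by (subst emeasure_prod_fst) (simp_all add: nn_integral_cmult Y_def hsets_def)
  qed
  also have "\<dots> = vol ?D * ennreal (r ^ (2 * CARD('k) + 2))"
    using r by (simp add: power_add power2_eq_square ennreal_mult mult_ac)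
  finally show ?thesis by simp
qed

lemma vol_cball_center: "vol (cball (p :: 'k heis) r) = vol (cball (0 :: 'k::finite heis) r)"
proof -
  have "{q. p + q \<in> cball p r} = cball 0 r" by (auto simp: dist_0_heis)
  with vol_left[of p "cball p r"] show ?thesis by (simp only:)
qed

lemma koranyi_dilate: "r \<ge> 0 \<Longrightarrow> koranyi (Heis (r *\<^sub>R v) (r\<^sup>2 * t)) = r * koranyi (Heis v t)"
proof -
  assume r: "r \<ge> 0"
  have "koranyi (Heis (r *\<^sub>R v) (r\<^sup>2 * t)) ^ 4 = (r * koranyi (Heis v t)) ^ 4"
    using r by (simp add: koranyi_pow4 power_mult_distrib algebra_simps flip: power_mult)
  then show ?thesis using r by (simp add: power_eq_iff_eq_base)
qed

lemma vol_cball_finite: "vol (cball (0 :: 'k::finite heis) r) < \<infinity>"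
proof -
  have "hc -` cball (0 :: 'k heis) r \<subseteq> cball 0 r \<times> cball 0 (r\<^sup>2 / 4)"
  proof
    fix z :: "(real^('k+'k)) \<times> real" assume "z \<in> hc -` cball (0 :: 'k heis) r"
    then have k: "koranyi (hc z) \<le> r" by (simp add: dist_0_heis)
    then have "(koranyi (hc z))\<^sup>2 \<le> r\<^sup>2" by (intro power_mono) auto
    with k koranyi_ge_norm_hor[of "hc z"] abs_ver_le_koranyi[of "hc z"]
    show "z \<in> cball 0 r \<times> cball 0 (r\<^sup>2 / 4)" by (cases z) auto
  qed
  then have "vol (cball (0 :: 'k heis) r) \<le> outer_measure_of lborel (cball (0::real^('k+'k)) r \<times> cball (0::real) (r\<^sup>2 / 4))"
    unfolding vol_def by (rule outer_measure_of_mono)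
  also have "\<dots> = emeasure lborel (cball (0::real^('k+'k)) r \<times> cball (0::real) (r\<^sup>2 / 4))"
    by (rule outer_measure_of_eq) (simp add: borel_closed closed_Times)
  also have "\<dots> < \<infinity>"
    by (rule emeasure_bounded_finite) (simp add: bounded_Times)
  finally show ?thesis .
qed

lemma vol_cball_pos: "vol (cball (0 :: 'k::finite heis) 1) > 0"
proof (rule ccontr)
  assume "\<not> ?thesis"
  then have z: "vol (cball (0 :: 'k heis) 1) = 0" by simp
  have o: "open (hc -` ball (0 :: 'k heis) 1)"
    by (rule open_vimage[OF open_ball continuous_on_hc])
  have ne: "hc -` ball (0 :: 'k heis) 1 \<noteq> {}"
  proof -
    have "hc (0, 0) = (0 :: 'k heis)" by (simp add: hc_def zero_heis_def)
    then have "(0, 0) \<in> hc -` ball (0 :: 'k heis) 1" by simp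
    then show ?thesis by blast
  qed
  have "vol (ball (0 :: 'k heis) 1) = 0" using vol_mono[of "ball 0 1" "cball (0 :: 'k heis) 1"] z by auto
  then have "emeasure lborel (hc -` ball (0 :: 'k heis) 1) = 0"
    by (simp only: vol_hsets[OF hsets_open[OF open_ball]])
  then have "hc -` ball (0 :: 'k heis) 1 \<in> null_sets lebesgue"
    using o by (auto simp: null_sets_def)
  with o ne show False using open_not_negligible by (auto simp: negligible_iff_null_sets)
qed

lemma unit_vol_pos: "unit_vol TYPE('k::finite) > 0"
  using vol_cball_pos[where 'k = 'k] vol_cball_finite[where 'k = 'k]
  by (simp add: unit_vol_def enn2real_positive_iff)

lemma vol_cball:
  fixes p :: "'k::finite heis"
  assumes "r \<ge> 0"
  shows "vol (cball p r) = ennreal (unit_vol TYPE('k) * r ^ (2 * CARD('k) + 2))"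
proof -
  have u: "vol (cball (0 :: 'k heis) 1) = ennreal (unit_vol TYPE('k))"
    using vol_cball_finite[where 'k = 'k] by (simp add: unit_vol_def)
  show ?thesis
  proof (cases "r = 0")
    case True
    have "hc -` {p} = {(hor p, ver p)}" by (auto simp: hc_def intro: heis_eqI prod_eqI)
    then have "vol {p} = 0" by (simp add: vol_def)
    with True show ?thesis by simp
  next
    case False
    with assms have r: "r > 0" by simp
    have "{q. Heis (r *\<^sub>R hor q) (r\<^sup>2 * ver q) \<in> cball (0 :: 'k heis) r} = cball 0 1"
      using r by (auto simp: dist_0_heis koranyi_dilate)
    with vol_dilate[OF hsets_closed[OF closed_cball, of "0 :: 'k heis" r] r] u unit_vol_pos[where 'k = 'k]
    show ?thesis using r by (simp add: vol_cball_center[of p] ennreal_mult)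
  qed
qed

section \<open>Hausdorff measure, volume and coverings\<close>

definition Hit :: "real ^ ('k::finite + 'k) \<Rightarrow> 'k heis set \<Rightarrow> 'k heis set" where
  "Hit a G = {p. \<exists>s\<in>{0..1}. p + hz (s *\<^sub>R a) \<in> G}"

definition hit_const :: "'k::finite itself \<Rightarrow> real" where
  "hit_const _ = unit_vol TYPE('k) * 2 ^ (2 * CARD('k) + 4)"

lemma hit_const_pos: "hit_const TYPE('k::finite) > 0"
  using unit_vol_pos[where 'k = 'k] by (simp add: hit_const_def)

text \<open>
  Subdivide the segments into about \<open>norm a / d\<close> pieces of length at most \<open>d\<close>. If a segment meets \<open>U\<close>, one
  of its subdivision points lies in the ball of twice the radius, and each of these conditions cuts out a
  right translate of that ball.
\<close>

lemma vol_Hit_cball: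
  fixes U :: "'k::finite heis set"
  assumes U: "U \<subseteq> cball z d" and d: "0 < d" "d \<le> norm a"
  shows "vol (Hit a U) \<le> ennreal (hit_const TYPE('k) * norm a * d ^ (2 * CARD('k) + 1))"
proof -
  define m where "m = nat \<lceil>norm a / d\<rceil>"
  have a: "norm a > 0" using d by linarith
  have m1: "real m \<ge> norm a / d" unfolding m_def by linarith
  have m2: "real m \<le> 2 * (norm a / d)"
  proof -
    have "real m \<le> norm a / d + 1" unfolding m_def using a d by (simp add: ceiling_correct)
    moreover have "1 \<le> norm a / d" using d by simp
    ultimately show ?thesis by simp
  qed
  have m0: "m > 0" using m1 a d by (metis divide_pos_pos less_le_trans of_nat_0_less_iff)
  have md: "norm a / real m \<le> d" using m1 m0 d a by (simp add: field_simps)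
  let ?A = "\<lambda>j. {p. p + hz ((real j / real m) *\<^sub>R a) \<in> cball z (2 * d)}"
  have "Hit a U \<subseteq> (\<Union>j\<in>{..m}. ?A j)"
  proof
    fix p assume "p \<in> Hit a U"
    then obtain s where s: "0 \<le> s" "s \<le> 1" and sU: "p + hz (s *\<^sub>R a) \<in> U" by (auto simp: Hit_def)
    define j where "j = nat \<lfloor>s * real m\<rfloor>"
    have j1: "real j \<le> s * real m" and j2: "s * real m < real j + 1"
      using s unfolding j_def by (auto simp: of_nat_floor)
    have jm: "j \<le> m"
    proof -
      have "real j \<le> 1 * real m" using j1 s mult_right_mono[of s 1 "real m"] by linarith
      then show ?thesis by simp
    qed
    let ?q = "p + hz ((real j / real m) *\<^sub>R a)"
    have "p + hz (s *\<^sub>R a) = ?q + hz ((s - real j / real m) *\<^sub>R a)"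
      by (simp add: add.assoc hz_add_scaleR)
    then have "dist ?q (p + hz (s *\<^sub>R a)) = \<bar>s - real j / real m\<bar> * norm a" by simp
    also have "\<bar>s - real j / real m\<bar> \<le> 1 / real m"
    proof -
      have "s - real j / real m = (s * real m - real j) / real m" using m0 by (simp add: field_simps)
      moreover have "\<bar>s * real m - real j\<bar> \<le> 1" using j1 j2 by simp
      ultimately show ?thesis by (simp add: divide_right_mono)
    qed
    then have "\<bar>s - real j / real m\<bar> * norm a \<le> norm a / real m"
      using mult_right_mono[of _ _ "norm a"] by fastforce
    also have "\<dots> \<le> d" by (rule md)
    finally have "dist ?q (p + hz (s *\<^sub>R a)) \<le> d" .
    moreover have "dist z (p + hz (s *\<^sub>R a)) \<le> d" using sU U by auto
    ultimately have "dist z ?q \<le> 2 * d" by metric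
    with jm show "p \<in> (\<Union>j\<in>{..m}. ?A j)" by auto
  qed
  then have "vol (Hit a U) \<le> vol (\<Union>j\<in>{..m}. ?A j)" by (rule vol_mono)
  also have "\<dots> \<le> (\<Sum>j\<in>{..m}. vol (?A j))" by (rule vol_UN_finite_le) simp
  also have "\<dots> = ennreal (real (m + 1) * (unit_vol TYPE('k) * (2 * d) ^ (2 * CARD('k) + 2)))"
    using d unit_vol_pos[where 'k = 'k]
    by (simp add: vol_cball ennreal_mult' del: mem_cball power_Suc add_2_eq_Suc' mult_Suc_right)
      (simp add: ennreal_of_nat_eq_real_of_nat flip: ennreal_mult')
  also have "\<dots> \<le> ennreal (hit_const TYPE('k) * norm a * d ^ (2 * CARD('k) + 1))"
  proof (rule ennreal_leI)
    have "real (m + 1) \<le> 2 * real m" using m0 by simp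
    also have "\<dots> \<le> 4 * (norm a / d)" using m2 by linarith
    finally have "real (m + 1) * (unit_vol TYPE('k) * (2 * d) ^ (2 * CARD('k) + 2))
      \<le> 4 * (norm a / d) * (unit_vol TYPE('k) * (2 * d) ^ (2 * CARD('k) + 2))"
      using d unit_vol_pos[where 'k = 'k] by (intro mult_right_mono) auto
    also have "\<dots> = unit_vol TYPE('k) * 2 ^ (2 * CARD('k) + 4) * norm a * d ^ (2 * CARD('k) + 1)"
      using d by (simp add: power_add power_mult_distrib power2_eq_square field_simps eval_nat_numeral)
    finally show "real (m + 1) * (unit_vol TYPE('k) * (2 * d) ^ (2 * CARD('k) + 2)) \<le>
      hit_const TYPE('k) * norm a * d ^ (2 * CARD('k) + 1)"
      by (simp add: hit_const_def)
  qed
  finally show ?thesis .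
qed

lemma hausdorff_mono: "A \<subseteq> B \<Longrightarrow> hausdorff s A \<le> hausdorff s B"
proof -
  assume "A \<subseteq> B"
  then have "hausdorff_pre \<delta> s A \<le> hausdorff_pre \<delta> s B" for \<delta>
    unfolding hausdorff_pre_def by (intro INF_superset_mono) auto
  then show ?thesis unfolding hausdorff_def by (intro SUP_mono) auto
qed

text \<open>
  Sum \<open>vol_Hit_cball\<close> over a cover by sets of diameter at most \<open>norm a\<close>. Sets of diameter \<open>0\<close> lie in balls
  of every small radius, so their contribution vanishes, in accordance with \<open>0 powr s = 0\<close>.
\<close>

lemma vol_Hit_le:
  fixes G :: "'k::finite heis set"
  assumes a: "a \<noteq> 0"
  shows "vol (Hit a G) \<le> ennreal (hit_const TYPE('k) * norm a) * hausdorff (2 * real CARD('k) + 1) G"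
proof -
  let ?c = "ennreal (hit_const TYPE('k) * norm a)" and ?s = "2 * real CARD('k) + 1"
  have c0: "?c \<noteq> 0" "?c \<noteq> \<infinity>" using a hit_const_pos[where 'k = 'k] by (auto simp: ennreal_eq_0_iff mult_le_0_iff)
  have c1: "0 < ?c" using a hit_const_pos[where 'k = 'k] by simp
  have na: "norm a > 0" using a by simp
  have one: "vol (Hit a U) \<le> ?c * ennreal (diameter U powr ?s)"
    if U: "bounded U" "diameter U \<le> norm a" for U :: "'k heis set"
  proof (cases "U = {}")
    case True then show ?thesis by (simp add: Hit_def)
  next
    case False
    then obtain z where z: "z \<in> U" by blast
    have Uz: "U \<subseteq> cball z (diameter U)" using diameter_bounded_bound[OF U(1) z] by auto
    have pw: "x ^ (2 * CARD('k) + 1) = x powr ?s" if "x > 0" for x :: real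
      using powr_realpow[OF that, of "2 * CARD('k) + 1"] by (simp add: algebra_simps)
    show ?thesis
    proof (cases "diameter U > 0")
      case True
      from vol_Hit_cball[OF Uz True U(2)] show ?thesis
        by (simp only: pw[OF True]) (simp add: ennreal_mult' hit_const_pos less_imp_le)
    next
      case False
      with diameter_ge_0[OF U(1)] have d0: "diameter U = 0" by simp
      have "((\<lambda>d. ennreal (hit_const TYPE('k) * norm a * d ^ (2 * CARD('k) + 1))) \<longlongrightarrow>
          ennreal (hit_const TYPE('k) * norm a * 0 ^ (2 * CARD('k) + 1))) (at_right 0)"
        by (intro tendsto_intros)
      then have "((\<lambda>d. ennreal (hit_const TYPE('k) * norm a * d ^ (2 * CARD('k) + 1))) \<longlongrightarrow> 0) (at_right 0)"
        by simp
      moreover have "\<forall>\<^sub>F d in at_right 0. vol (Hit a U) \<le> ennreal (hit_const TYPE('k) * norm a * d ^ (2 * CARD('k) + 1))"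
        unfolding eventually_at_right_field
      proof (intro exI[of _ "norm a"] conjI allI impI)
        fix d assume "0 < d" "d < norm a"
        with Uz d0 show "vol (Hit a U) \<le> ennreal (hit_const TYPE('k) * norm a * d ^ (2 * CARD('k) + 1))"
          by (intro vol_Hit_cball[of U z]) auto
      qed (use na in simp)
      ultimately have "vol (Hit a U) \<le> 0"
        by (rule tendsto_lowerbound) simp
      then show ?thesis by simp
    qed
  qed
  have "vol (Hit a G) / ?c \<le> hausdorff_pre (norm a) ?s G"
    unfolding hausdorff_pre_def
  proof (rule INF_greatest, clarsimp)
    fix U :: "nat \<Rightarrow> 'k heis set"
    assume G: "G \<subseteq> (\<Union>i. U i)" and U: "\<forall>i. bounded (U i) \<and> diameter (U i) \<le> norm a"
    have "vol (Hit a G) \<le> vol (\<Union>i. Hit a (U i))" using G unfolding Hit_def by (intro vol_mono) blast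
    also have "\<dots> \<le> (\<Sum>i. vol (Hit a (U i)))" by (rule vol_UN_le)
    also have "\<dots> \<le> (\<Sum>i. ?c * ennreal (diameter (U i) powr ?s))"
      using one U by (intro suminf_le summableI) auto
    also have "\<dots> = ?c * (\<Sum>i. ennreal (diameter (U i) powr ?s))" by (simp add: ennreal_suminf_cmult)
    finally have "vol (Hit a G) \<le> ?c * (\<Sum>i. ennreal (diameter (U i) powr ?s))" .
    with c1 show "vol (Hit a G) / ?c \<le> (\<Sum>i. ennreal (diameter (U i) powr ?s))"
      by (rule divide_le_posI_ennreal)
  qed
  also have "\<dots> \<le> hausdorff ?s G" unfolding hausdorff_def using na by (intro SUP_upper) auto
  finally have "?c * (vol (Hit a G) / ?c) \<le> ?c * hausdorff ?s G" by (rule mult_left_mono) simp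
  then show ?thesis using c0 by (simp add: ennreal_times_divide mult_divide_eq_ennreal mult.commute)
qed

lemma hausdorff_pre_antimono: "\<delta> \<le> \<delta>' \<Longrightarrow> hausdorff_pre \<delta>' s A \<le> hausdorff_pre \<delta> s A"
  unfolding hausdorff_pre_def by (intro INF_superset_mono) (auto intro: order_trans)

text \<open>
  In a cover by sets of diameter less than \<open>e\<close>, no set meets both \<open>A\<close> and \<open>B\<close>, so the cover splits into
  one of \<open>A\<close> and one of \<open>B\<close>. The outer measure is thus superadditive on separated sets.
\<close>

lemma hausdorff_separated_Un:
  fixes A B :: "'a::metric_space set"
  assumes e: "e > 0" and sep: "\<And>x y. x \<in> A \<Longrightarrow> y \<in> B \<Longrightarrow> e \<le> dist x y"
  shows "hausdorff s A + hausdorff s B \<le> hausdorff s (A \<union> B)"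
proof -
  have pre: "hausdorff_pre \<delta> s A + hausdorff_pre \<delta> s B \<le> hausdorff_pre \<delta> s (A \<union> B)"
    if d: "0 < \<delta>" "\<delta> < e" for \<delta>
    unfolding hausdorff_pre_def[of _ _ "A \<union> B"]
  proof (rule INF_greatest, clarify)
    fix U :: "nat \<Rightarrow> 'a set"
    assume G: "A \<union> B \<subseteq> (\<Union>i. U i)" and U: "\<forall>i. bounded (U i) \<and> diameter (U i) \<le> \<delta>"
    define V where "V C i = (if U i \<inter> C \<noteq> {} then U i else {})" for C i
    have V: "hausdorff_pre \<delta> s C \<le> (\<Sum>i. ennreal (diameter (V C i) powr s))" if "C \<subseteq> A \<union> B" for C
      unfolding hausdorff_pre_def
    proof (rule INF_lower, intro CollectI conjI allI)
      show "C \<subseteq> (\<Union>i. V C i)"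
      proof
        fix x assume "x \<in> C"
        with that G obtain i where "x \<in> U i" by blast
        with \<open>x \<in> C\<close> show "x \<in> (\<Union>i. V C i)" by (auto simp: V_def intro!: exI[of _ i])
      qed
    qed (use U d in \<open>auto simp: V_def\<close>)
    have "hausdorff_pre \<delta> s A + hausdorff_pre \<delta> s B
      \<le> (\<Sum>i. ennreal (diameter (V A i) powr s)) + (\<Sum>i. ennreal (diameter (V B i) powr s))"
      by (intro add_mono V) auto
    also have "\<dots> = (\<Sum>i. ennreal (diameter (V A i) powr s) + ennreal (diameter (V B i) powr s))"
      by (rule suminf_add) (auto intro: summableI)
    also have "\<dots> \<le> (\<Sum>i. ennreal (diameter (U i) powr s))"
    proof (intro suminf_le summableI)
      fix i
      have "\<not> (U i \<inter> A \<noteq> {} \<and> U i \<inter> B \<noteq> {})"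
      proof
        assume "U i \<inter> A \<noteq> {} \<and> U i \<inter> B \<noteq> {}"
        then obtain x y where x: "x \<in> U i" "x \<in> A" and y: "y \<in> U i" "y \<in> B" by blast
        have "dist x y \<le> diameter (U i)" using U x y by (intro diameter_bounded_bound) auto
        with U sep[OF x(2) y(2)] d show False by (meson linorder_not_le order_trans)
      qed
      then show "ennreal (diameter (V A i) powr s) + ennreal (diameter (V B i) powr s) \<le> ennreal (diameter (U i) powr s)"
        by (auto simp: V_def)
    qed
    finally show "hausdorff_pre \<delta> s A + hausdorff_pre \<delta> s B \<le> (\<Sum>i. ennreal (diameter (U i) powr s))" .
  qed
  have "hausdorff s A + hausdorff s B = (SUP \<delta>\<in>{0<..}. hausdorff_pre \<delta> s A + hausdorff_pre \<delta> s B)"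
    unfolding hausdorff_def
  proof (rule SUP_add_directed_ennreal[symmetric])
    fix i j :: real assume "i \<in> {0<..}" "j \<in> {0<..}"
    then show "\<exists>k\<in>{0<..}. hausdorff_pre i s A + hausdorff_pre j s B \<le> hausdorff_pre k s A + hausdorff_pre k s B"
      by (intro bexI[of _ "min i j"] add_mono hausdorff_pre_antimono) auto
  qed
  also have "\<dots> \<le> hausdorff s (A \<union> B)"
  proof (rule SUP_least)
    fix \<delta> :: real assume "\<delta> \<in> {0<..}"
    let ?d = "min \<delta> (e / 2)"
    have "hausdorff_pre \<delta> s A + hausdorff_pre \<delta> s B \<le> hausdorff_pre ?d s A + hausdorff_pre ?d s B"
      by (intro add_mono hausdorff_pre_antimono) auto
    also have "\<dots> \<le> hausdorff_pre ?d s (A \<union> B)" using \<open>\<delta> \<in> _\<close> e by (intro pre) (auto simp: min_def)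
    also have "\<dots> \<le> hausdorff s (A \<union> B)"
      unfolding hausdorff_def using \<open>\<delta> \<in> _\<close> e by (intro SUP_upper) auto
    finally show "hausdorff_pre \<delta> s A + hausdorff_pre \<delta> s B \<le> hausdorff s (A \<union> B)" .
  qed
  finally show ?thesis .
qed

text \<open>
  Halving the radii of finitely many disjoint balls separates them by a positive distance.
\<close>

lemma hausdorff_disjoint_balls:
  fixes S :: "'a::metric_space set"
  assumes "finite D" and rad: "\<And>x. x \<in> D \<Longrightarrow> rad x > 0"
    and disj: "\<And>x y. x \<in> D \<Longrightarrow> y \<in> D \<Longrightarrow> x \<noteq> y \<Longrightarrow> cball x (rad x) \<inter> cball y (rad y) = {}"
  shows "(\<Sum>x\<in>D. hausdorff s (S \<inter> cball x (rad x / 2))) \<le> hausdorff s (S \<inter> (\<Union>x\<in>D. cball x (rad x)))"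
proof -
  have "(\<Sum>x\<in>D. hausdorff s (S \<inter> cball x (rad x / 2))) \<le> hausdorff s (\<Union>x\<in>D. S \<inter> cball x (rad x / 2))"
    using assms
  proof (induction D)
    case (insert x D)
    show ?case
    proof (cases "D = {}")
      case False
      define e where "e = Min (rad ` D)"
      have e0: "e > 0" using insert False by (auto simp: e_def)
      have ey: "e \<le> rad y" if "y \<in> D" for y using insert that by (auto simp: e_def)
      have "(\<Sum>x\<in>insert x D. hausdorff s (S \<inter> cball x (rad x / 2)))
        \<le> hausdorff s (S \<inter> cball x (rad x / 2)) + hausdorff s (\<Union>x\<in>D. S \<inter> cball x (rad x / 2))"
        using insert by (simp add: add_left_mono)
      also have "\<dots> \<le> hausdorff s (S \<inter> cball x (rad x / 2) \<union> (\<Union>x\<in>D. S \<inter> cball x (rad x / 2)))"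
      proof (rule hausdorff_separated_Un[of "e / 2"])
        fix u v assume u: "u \<in> S \<inter> cball x (rad x / 2)" and "v \<in> (\<Union>x\<in>D. S \<inter> cball x (rad x / 2))"
        then obtain y where y: "y \<in> D" "dist y v \<le> rad y / 2" by auto
        have "cball x (rad x) \<inter> cball y (rad y) = {}" using insert.prems(2)[of x y] y insert.hyps by auto
        then have "u \<notin> cball y (rad y)" using u insert.prems(1)[of x] by (auto simp: disjoint_iff)
        then have "rad y < dist y u" by simp
        with y ey[OF y(1)] dist_triangle[of y u v] show "e / 2 \<le> dist u v" by (simp add: dist_commute)
      qed (use e0 in simp)
      finally show ?thesis by simp
    qed simp
  qed simp
  also have "\<dots> \<le> hausdorff s (S \<inter> (\<Union>x\<in>D. cball x (rad x)))"
  proof (rule hausdorff_mono)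
    have "cball x (rad x / 2) \<subseteq> cball x (rad x)" if "x \<in> D" for x
      using rad[OF that] by (intro subset_cball) simp
    then show "(\<Union>x\<in>D. S \<inter> cball x (rad x / 2)) \<subseteq> S \<inter> (\<Union>x\<in>D. cball x (rad x))" by blast
  qed
  finally show ?thesis .
qed

text \<open>
  Zorn's lemma is applied to the disjoint subfamilies with the following property: a ball that meets the
  subfamily meets some member of at least half its radius. A maximal one meets every ball, since otherwise
  a ball whose radius is nearly the largest among the balls missed could be added. If the balls around \<open>x\<close>
  and \<open>y\<close> meet and the first radius is at most twice the second, the centres are within three times the
  second radius.
\<close>

lemma Vitali_metric:
  fixes C :: "'a::metric_space set"
  assumes rad: "\<And>x. x \<in> C \<Longrightarrow> 0 < rad x \<and> rad x \<le> R"
  obtains D where "D \<subseteq> C"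
    and "\<And>x y. x \<in> D \<Longrightarrow> y \<in> D \<Longrightarrow> x \<noteq> y \<Longrightarrow> cball x (rad x) \<inter> cball y (rad y) = {}"
    and "\<And>x. x \<in> C \<Longrightarrow> \<exists>y\<in>D. dist x y \<le> 3 * rad y"
proof -
  let ?M = "\<lambda>x y. cball x (rad x) \<inter> cball y (rad y) \<noteq> {}"
  define \<Omega> where "\<Omega> = {D. D \<subseteq> C \<and> (\<forall>x\<in>D. \<forall>y\<in>D. x \<noteq> y \<longrightarrow> \<not> ?M x y) \<and>
    (\<forall>x\<in>C. (\<exists>y\<in>D. ?M x y) \<longrightarrow> (\<exists>y\<in>D. ?M x y \<and> rad x \<le> 2 * rad y))}"
  have "\<exists>M\<in>\<Omega>. \<forall>X\<in>\<Omega>. M \<subseteq> X \<longrightarrow> X = M"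
  proof (rule subset_Zorn)
    fix \<C> assume ch: "subset.chain \<Omega> \<C>"
    then have sub: "\<C> \<subseteq> \<Omega>" and lin: "\<And>X Y. X \<in> \<C> \<Longrightarrow> Y \<in> \<C> \<Longrightarrow> X \<subseteq> Y \<or> Y \<subseteq> X"
      by (auto simp: subset.chain_def)
    have "\<Union>\<C> \<in> \<Omega>"
      unfolding \<Omega>_def
    proof (intro CollectI conjI ballI impI)
      show "\<Union>\<C> \<subseteq> C" using sub by (auto simp: \<Omega>_def)
    next
      fix x y assume "x \<in> \<Union>\<C>" "y \<in> \<Union>\<C>" "x \<noteq> y"
      then obtain X where "X \<in> \<C>" "x \<in> X" "y \<in> X" using lin by blast
      with sub \<open>x \<noteq> y\<close> show "\<not> ?M x y" unfolding \<Omega>_def by blast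
    next
      fix x assume x: "x \<in> C" and "\<exists>y\<in>\<Union>\<C>. ?M x y"
      then obtain X y where X: "X \<in> \<C>" "y \<in> X" "?M x y" by blast
      then have "X \<in> \<Omega>" using sub by blast
      then have "\<exists>y\<in>X. ?M x y \<and> rad x \<le> 2 * rad y" using X x unfolding \<Omega>_def by blast
      with X show "\<exists>y\<in>\<Union>\<C>. ?M x y \<and> rad x \<le> 2 * rad y" by blast
    qed
    then show "\<exists>U\<in>\<Omega>. \<forall>X\<in>\<C>. X \<subseteq> U" by blast
  qed
  then obtain D where D: "D \<in> \<Omega>" and max: "\<And>X. X \<in> \<Omega> \<Longrightarrow> D \<subseteq> X \<Longrightarrow> X = D" by blast
  have DC: "D \<subseteq> C" and Dd: "\<And>x y. x \<in> D \<Longrightarrow> y \<in> D \<Longrightarrow> x \<noteq> y \<Longrightarrow> \<not> ?M x y"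
    and Dm: "\<And>x. x \<in> C \<Longrightarrow> \<exists>y\<in>D. ?M x y \<Longrightarrow> \<exists>y\<in>D. ?M x y \<and> rad x \<le> 2 * rad y"
    using D unfolding \<Omega>_def by blast+
  have meet: "\<exists>y\<in>D. ?M x y" if x: "x \<in> C" for x
  proof (rule ccontr)
    assume no: "\<not> (\<exists>y\<in>D. ?M x y)"
    define N where "N = {x\<in>C. \<not> (\<exists>y\<in>D. ?M x y)}"
    have xN: "x \<in> N" using x no by (auto simp: N_def)
    have bdd: "bdd_above (rad ` N)" using rad by (auto simp: N_def intro!: bdd_aboveI[of _ R])
    have "rad x \<le> Sup (rad ` N)" using xN bdd by (intro cSUP_upper)
    then have "Sup (rad ` N) / 2 < Sup (rad ` N)" using rad[OF x] by linarith
    then obtain z where z: "z \<in> N" "Sup (rad ` N) / 2 < rad z"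
      using less_cSup_iff[OF _ bdd, of "Sup (rad ` N) / 2"] xN by auto
    have zmax: "rad w \<le> 2 * rad z" if "w \<in> N" for w
      using cSUP_upper[OF that bdd] z by linarith
    have "insert z D \<in> \<Omega>"
      unfolding \<Omega>_def
    proof (intro CollectI conjI ballI impI)
      show "insert z D \<subseteq> C" using z DC by (auto simp: N_def)
    next
      fix u v assume "u \<in> insert z D" "v \<in> insert z D" "u \<noteq> v"
      moreover have "\<not> ?M z y" "\<not> ?M y z" if "y \<in> D" for y
        using z that unfolding N_def by (auto simp: Int_commute)
      ultimately show "\<not> ?M u v" using Dd[of u v] by (elim insertE) simp_all
    next
      fix w assume w: "w \<in> C" and "\<exists>y\<in>insert z D. ?M w y"
      show "\<exists>y\<in>insert z D. ?M w y \<and> rad w \<le> 2 * rad y"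
      proof (cases "w \<in> N")
        case True
        with \<open>\<exists>y\<in>insert z D. ?M w y\<close> have "?M w z" unfolding N_def by blast
        with zmax[OF True] show ?thesis by blast
      next
        case False
        with w have "\<exists>y\<in>D. ?M w y" unfolding N_def by blast
        from Dm[OF w this] show ?thesis by blast
      qed
    qed
    then have "z \<in> D" using max by blast
    moreover have "?M z z" using z rad[of z] by (auto simp: N_def)
    ultimately show False using z unfolding N_def by blast
  qed
  show thesis
  proof (rule that[OF DC])
    fix x assume x: "x \<in> C"
    from Dm[OF x meet[OF x]] obtain y w where y: "y \<in> D" "dist x w \<le> rad x" "dist y w \<le> rad y" "rad x \<le> 2 * rad y"
      by auto
    then have "dist x y \<le> 3 * rad y" by metric
    with y show "\<exists>y\<in>D. dist x y \<le> 3 * rad y" by blast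
  qed (use Dd in blast)
qed


section \<open>Horizontal paths\<close>

lemma koranyi_zero [simp]: "koranyi 0 = 0"
  by (simp only: koranyi_eq_0_iff)

text \<open>
  One segment produces the horizontal part of \<open>g\<close>; the commutator of \<open>\<sigma> e\<close> and \<open>\<sigma>' symp e\<close> is
  vertical of height \<open>\<sigma> \<sigma>'\<close>, which produces the vertical part with segments of length
  \<open>sqrt \<bar>ver g\<bar>\<close>.
\<close>

lemma horizontal_path:
  fixes g :: "'k::finite heis"
  obtains s :: "nat \<Rightarrow> 'k heis" and a :: "nat \<Rightarrow> real ^ ('k + 'k)" where "s 0 = 0" "s 5 = g"
    "\<And>i. i < 5 \<Longrightarrow> s (Suc i) = s i + hz (a i)" "\<And>i. i < 5 \<Longrightarrow> norm (a i) \<le> koranyi g"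
    "\<And>i. i \<le> 5 \<Longrightarrow> koranyi (s i) \<le> real i * koranyi g"
proof -
  obtain j :: 'k where True by blast
  define e :: "real ^ ('k + 'k)" where "e = axis (Inl j) 1"
  have e: "norm e = 1" by (simp add: e_def)
  define \<sigma> where "\<sigma> = sqrt \<bar>ver g\<bar>"
  define \<sigma>' where "\<sigma>' = sgn (ver g) * \<sigma>"
  have ss: "\<sigma> * \<sigma>' = ver g" by (auto simp: \<sigma>_def \<sigma>'_def sgn_if)
  have \<sigma>: "0 \<le> \<sigma>" "\<sigma> \<le> koranyi g" "\<bar>\<sigma>'\<bar> \<le> \<sigma>"
  proof -
    have "\<bar>ver g\<bar> \<le> (koranyi g)\<^sup>2" using abs_ver_le_koranyi[of g] zero_le_power2[of "koranyi g"] by linarith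
    then show "\<sigma> \<le> koranyi g" unfolding \<sigma>_def by (rule real_le_lsqrt[rotated]) simp
  qed (auto simp: \<sigma>'_def \<sigma>_def sgn_if)
  let ?as = "[hor g, \<sigma> *\<^sub>R e, \<sigma>' *\<^sub>R symp e, (- \<sigma>) *\<^sub>R e, (- \<sigma>') *\<^sub>R symp e]"
  define a where "a i = ?as ! i" for i
  define s where "s i = sum_list (map hz (take i ?as))" for i
  have ee: "heis_omega e (symp e) = 1" using e by (simp add: omega_symp norm_eq_1)
  have ee': "heis_omega (symp e) e = - 1" using ee omega_commute[of "symp e" e] by simp
  have as: "norm v \<le> koranyi g" if "v \<in> set ?as" for v
    using that e \<sigma> koranyi_ge_norm_hor[of g] by auto
  have a: "norm (a i) \<le> koranyi g" if "i < 5" for i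
    unfolding a_def by (rule as, rule nth_mem) (use that in simp)
  have s: "s (Suc i) = s i + hz (a i)" if "i < 5" for i
    using that take_Suc_conv_app_nth[of i ?as] by (simp add: s_def a_def)
  have s0: "s 0 = 0" by (simp add: s_def)
  have s5: "s 5 = g"
    by (rule heis_eqI) (simp_all add: s_def omega_simps ee ee' algebra_simps flip: ss)
  have "koranyi (s i) \<le> real i * koranyi g" if "i \<le> 5" for i
    using that
  proof (induction i)
    case (Suc i)
    then have "koranyi (s i + hz (a i)) \<le> real i * koranyi g + koranyi g"
      using a[of i] by (intro koranyi_add_le) auto
    then show ?case using s[of i] Suc by (simp add: algebra_simps)
  qed (simp add: s0)
  with s0 s5 s a show thesis by (rule that)
qed

lemma first_change:
  fixes f :: "nat \<Rightarrow> bool"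
  assumes "f 0 \<noteq> f m"
  obtains i where "i < m" "f i \<noteq> f (Suc i)"
  using assms
proof (induction m arbitrary: thesis)
  case (Suc m)
  then show ?case by (metis lessI less_Suc_eq)
qed simp

section \<open>Components of the complement and Condition B\<close>

abbreviation hmeas :: "'k::finite heis set \<Rightarrow> ennreal" where
  "hmeas A \<equiv> hausdorff (2 * real CARD('k) + 1) A"

text \<open>
  The set \<open>\<Omega>\<close> stands for a component of the complement of \<open>S\<close>, which \<open>S\<close> separates from its complement
  along horizontal segments.
\<close>

locale side =
  fixes S \<Omega> :: "'k::finite heis set"
  assumes cross: "(q \<in> \<Omega>) \<noteq> (q + hz a \<in> \<Omega>) \<Longrightarrow> \<exists>s\<in>{0..1}. q + hz (s *\<^sub>R a) \<in> S"
begin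

text \<open>
  One of the five segments of a horizontal path from \<open>q\<close> to \<open>q + g\<close> changes sides, hence meets \<open>S\<close>.
\<close>

lemma change_near_boundary:
  assumes ch: "(q \<in> \<Omega>) \<noteq> (q + g \<in> \<Omega>)"
  obtains z where "z \<in> S" "dist q z \<le> 5 * koranyi g"
proof -
  obtain s a where sa: "s 0 = 0" "s 5 = g" "\<And>i. i < 5 \<Longrightarrow> s (Suc i) = s i + hz (a i)"
      "\<And>i. i < 5 \<Longrightarrow> norm (a i) \<le> koranyi g" "\<And>i. i \<le> 5 \<Longrightarrow> koranyi (s i) \<le> real i * koranyi g"
    by (rule horizontal_path) (rule that)
  have "(q + s 0 \<in> \<Omega>) \<noteq> (q + s 5 \<in> \<Omega>)" using ch sa by simp
  then obtain i where i: "i < 5" "(q + s i \<in> \<Omega>) \<noteq> (q + s (Suc i) \<in> \<Omega>)"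
    by (rule first_change[of "\<lambda>i. q + s i \<in> \<Omega>"])
  have "q + s (Suc i) = (q + s i) + hz (a i)" using sa(3)[OF i(1)] by (simp add: add.assoc)
  with i cross[of "q + s i" "a i"] obtain t where t: "0 \<le> t" "t \<le> 1" "q + s i + hz (t *\<^sub>R a i) \<in> S" by auto
  have k4: "koranyi (s i) \<le> 4 * koranyi g"
    using i(1) sa(5)[of i] mult_right_mono[of "real i" 4 "koranyi g"] by simp
  have "norm (t *\<^sub>R a i) \<le> 1 * koranyi g"
    using t sa(4)[OF i(1)] by (simp only: norm_scaleR, intro mult_mono) auto
  then have "koranyi (s i + hz (t *\<^sub>R a i)) \<le> 5 * koranyi g"
    using koranyi_add_le[OF k4, of "hz (t *\<^sub>R a i)" "koranyi g"] by simp
  then have "dist q (q + s i + hz (t *\<^sub>R a i)) \<le> 5 * koranyi g" by (simp add: add.assoc)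
  with t that show thesis by blast
qed

end

lemma connected_hz_segment: "connected ((\<lambda>s. q + hz (s *\<^sub>R a)) ` {0..1})"
proof (rule connected_continuous_image)
  show "continuous_on {0..1} (\<lambda>s. q + hz (s *\<^sub>R a))"
    by (rule continuous_on_heis) (auto intro!: continuous_intros)
qed simp

lemma side_component:
  assumes "K \<in> components (- S)"
  shows "side S (K :: 'k::finite heis set)"
proof
  fix q :: "'k heis" and a assume ch: "(q \<in> K) \<noteq> (q + hz a \<in> K)"
  let ?T = "(\<lambda>s. q + hz (s *\<^sub>R a)) ` {0..1}"
  have q: "q \<in> ?T" by (rule image_eqI[of _ _ 0]) simp_all
  have qa: "q + hz a \<in> ?T" by (rule image_eqI[of _ _ 1]) simp_all
  show "\<exists>s\<in>{0..1}. q + hz (s *\<^sub>R a) \<in> S"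
  proof (rule ccontr)
    assume "\<not> ?thesis"
    then have "?T \<subseteq> - S" by blast
    moreover have "K \<inter> ?T \<noteq> {}" using ch q qa by blast
    ultimately have "?T \<subseteq> K" using components_maximal[OF assms connected_hz_segment] by blast
    with ch q qa show False by blast
  qed
qed

text \<open>
  Points close to \<open>q\<close> are joined to it by short horizontal paths, which avoid \<open>S\<close>.
\<close>

lemma open_component_heis:
  assumes S: "closed S" and K: "K \<in> components (- S)"
  shows "open (K :: 'k::finite heis set)"
  unfolding open_contains_ball
proof
  fix q assume q: "q \<in> K"
  interpret side S K by (rule side_component[OF K])
  have "q \<in> - S" using q in_components_subset[OF K] by blast
  with S obtain e where e: "e > 0" "ball q e \<subseteq> - S" by (meson open_Compl open_contains_ball)
  have "ball q (e / 5) \<subseteq> K"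
  proof
    fix z assume z: "z \<in> ball q (e / 5)"
    show "z \<in> K"
    proof (rule ccontr)
      assume "z \<notin> K"
      moreover have "z = q + (- q + z)" by (simp flip: add.assoc)
      ultimately have "(q \<in> K) \<noteq> (q + (- q + z) \<in> K)" using q by simp
      then obtain w where w: "w \<in> S" "dist q w \<le> 5 * koranyi (- q + z)" by (rule change_near_boundary)
      have "koranyi (- q + z) = dist q z" using dist_heis_def[of z q] by (simp add: dist_commute)
      with w z have "w \<in> ball q e" by simp
      with e w show False by blast
    qed
  qed
  with e show "\<exists>e>0. ball q e \<subseteq> K" by (intro exI[of _ "e / 5"]) auto
qed

lemma last_true:
  fixes f :: "nat \<Rightarrow> bool"
  assumes "f 0" "\<not> f m"
  obtains i where "i < m" "f i" "\<not> f (Suc i)"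
  using assms
proof (induction m arbitrary: thesis)
  case (Suc m)
  then show ?case by (metis lessI less_Suc_eq)
qed simp

text \<open>
  Left-invariant balls are not invariant under right translations. Conjugating a small element by one of
  size \<open>2 r\<close> turns the size \<open>\<sigma> r\<close> into a multiple of \<open>sqrt \<sigma> r\<close>.
\<close>

lemma koranyi_conj_le:
  assumes b: "koranyi b \<le> \<sigma> * r" and g: "koranyi g \<le> 2 * r" and r: "r > 0" and \<sigma>: "0 \<le> \<sigma>" "\<sigma> \<le> 1"
  shows "koranyi (- g + b + g) \<le> (\<sigma> + 4 * sqrt \<sigma>) * r"
proof -
  have h: "hor (- g + b + g) = hor b" by simp
  have v: "ver (- g + b + g) = ver b + heis_omega (hor b) (hor g)"
    using omega_commute[of "hor g" "hor b"] by (simp add: omega_simps field_simps)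
  have "\<bar>ver (- g + b + g)\<bar> \<le> (\<sigma> * r)\<^sup>2 / 4 + (\<sigma> * r) * (2 * r)"
  proof -
    have "\<bar>ver b\<bar> \<le> (koranyi b)\<^sup>2 / 4" by (rule abs_ver_le_koranyi)
    also have "\<dots> \<le> (\<sigma> * r)\<^sup>2 / 4" using b by (intro divide_right_mono power_mono) auto
    finally have "\<bar>ver b\<bar> \<le> (\<sigma> * r)\<^sup>2 / 4" .
    moreover have "\<bar>heis_omega (hor b) (hor g)\<bar> \<le> (\<sigma> * r) * (2 * r)"
      using abs_omega_le[of "hor b" "hor g"] koranyi_ge_norm_hor[of b] koranyi_ge_norm_hor[of g] b g r \<sigma>
      by (intro order_trans[OF abs_omega_le] mult_mono) auto
    ultimately show ?thesis unfolding v by linarith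
  qed
  also have "\<dots> \<le> 4 * \<sigma> * r\<^sup>2"
  proof -
    have "\<sigma>\<^sup>2 * r\<^sup>2 \<le> \<sigma> * r\<^sup>2"
    proof (rule mult_right_mono)
      show "\<sigma>\<^sup>2 \<le> \<sigma>" using \<sigma> by (simp add: power2_eq_square mult_left_le)
    qed simp
    moreover have "0 \<le> \<sigma> * r\<^sup>2" using \<sigma> by simp
    moreover have "(\<sigma> * r)\<^sup>2 = \<sigma>\<^sup>2 * r\<^sup>2" "(\<sigma> * r) * (2 * r) = 2 * (\<sigma> * r\<^sup>2)"
      by (simp_all add: power_mult_distrib power2_eq_square)
    ultimately show ?thesis by linarith
  qed
  finally have "sqrt \<bar>ver (- g + b + g)\<bar> \<le> sqrt (4 * \<sigma> * r\<^sup>2)" by (rule real_sqrt_le_mono)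
  also have "\<dots> = 2 * sqrt \<sigma> * r" using r by (simp add: real_sqrt_mult)
  finally have "2 * sqrt \<bar>ver (- g + b + g)\<bar> \<le> 4 * sqrt \<sigma> * r" by linarith
  moreover have "norm (hor (- g + b + g)) \<le> \<sigma> * r" using koranyi_ge_norm_hor[of b] b unfolding h by linarith
  ultimately show ?thesis using koranyi_le_length[of "- g + b + g"] by (simp add: algebra_simps)
qed

text \<open>
  Let \<open>g\<close> lead from \<open>q1 \<in> K1\<close> to \<open>q2 \<in> K2\<close>. The set \<open>S\<close> stays away from both points, so every \<open>b\<close> in a
  small ball around \<open>q1\<close> lies in \<open>K1\<close>, while \<open>b + g\<close> lies in \<open>K2\<close>. A horizontal path from \<open>b\<close> to \<open>b + g\<close>
  leaves \<open>K1\<close> on one of its five segments; one segment \<open>a\<close> serves a fifth of all \<open>b\<close>, and right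
  translation carries these \<open>b\<close> to the starting points of \<open>a\<close>.
\<close>

lemma condition_B_crossing:
  fixes S :: "'k::finite heis set"
  assumes B: "condition_B S"
  obtains cA where "cA > 0"
    and "\<And>p r. p \<in> S \<Longrightarrow> r > 0 \<Longrightarrow> ennreal r < ediam S \<Longrightarrow>
      \<exists>K\<in>components (- S). \<exists>a. a \<noteq> 0 \<and> norm a \<le> 12 * r \<and>
        ennreal (cA * r ^ (2 * CARD('k) + 2)) \<le> vol {q \<in> cball p (12 * r). q \<in> K \<and> q + hz a \<notin> K}"
proof -
  obtain c where c: "c > 0" and cB: "\<forall>p\<in>S. \<forall>r>0. ennreal r < ediam S \<longrightarrow>
      (\<exists>q1 q2. \<exists>K1\<in>components (- S). \<exists>K2\<in>components (- S).
           K1 \<noteq> K2 \<and> q1 \<in> K1 \<and> q2 \<in> K2 \<and> q1 \<in> cball p r \<and> q2 \<in> cball p r \<and>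
           min (infdist q1 S) (infdist q2 S) > c * r)"
    using conjunct2[OF B[unfolded condition_B_def]] by (elim exE conjE)
  define c' where "c' = min c 1"
  \<comment> \<open>The radius \<open>\<sigma> r\<close> has to survive conjugation by \<open>g\<close>: \<open>\<sigma> + 4 sqrt \<sigma> < c' / 5\<close>, where the
    factor \<open>5\<close> is that of \<open>change_near_boundary\<close>.\<close>
  define \<sigma> where "\<sigma> = (c' / 50)\<^sup>2"
  have c': "0 < c'" "c' \<le> 1" "c' \<le> c" using c by (auto simp: c'_def)
  have sq: "sqrt \<sigma> = c' / 50" using c' by (simp add: \<sigma>_def)
  have \<sigma>0: "\<sigma> > 0" using c' by (simp add: \<sigma>_def)
  have \<sigma>c: "\<sigma> \<le> c' / 50"
  proof -
    have "(c' / 50) * (c' / 50) \<le> 1 * (c' / 50)" using c' by (intro mult_right_mono) auto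
    then show ?thesis by (simp add: \<sigma>_def power2_eq_square)
  qed
  have \<sigma>1: "\<sigma> \<le> 1" using \<sigma>c c' by simp
  let ?u = "unit_vol TYPE('k)" and ?Q = "2 * CARD('k) + 2"
  have u: "?u > 0" by (rule unit_vol_pos)
  define cA where "cA = ?u * \<sigma> ^ ?Q / 10"
  have cA: "cA > 0" using u \<sigma>0 by (simp add: cA_def)
  show thesis
  proof (rule that[OF cA])
    fix p r assume p: "p \<in> S" and r: "r > 0" and rd: "ennreal r < ediam S"
    obtain q1 q2 K1 K2 where K: "K1 \<in> components (- S)" "K2 \<in> components (- S)" "K1 \<noteq> K2"
      and q: "q1 \<in> K1" "q2 \<in> K2" "q1 \<in> cball p r" "q2 \<in> cball p r"
      and far: "infdist q1 S > c * r" "infdist q2 S > c * r"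
      using cB[rule_format, OF p r rd] by auto
    interpret K1: side S K1 by (rule side_component[OF K(1)])
    interpret K2: side S K2 by (rule side_component[OF K(2)])
    define g where "g = - q1 + q2"
    have q2g: "q2 = q1 + g" by (simp add: g_def flip: add.assoc)
    have g2: "koranyi g \<le> 2 * r"
    proof -
      have "dist q1 q2 \<le> 2 * r" using q by (auto intro: order_trans[OF dist_triangle3[of q1 q2 p]])
      then show ?thesis unfolding q2g by simp
    qed
    have stay: "q \<in> K" if sd: "side S K" and q': "q' \<in> K" and fr: "infdist q' S > c * r" and nr: "koranyi (- q' + q) < c' / 5 * r" for q q' K
    proof (rule ccontr)
      assume "q \<notin> K"
      moreover have "q = q' + (- q' + q)" by (simp flip: add.assoc)
      ultimately have "(q' \<in> K) \<noteq> (q' + (- q' + q) \<in> K)" using q' by simp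
      then obtain z where "z \<in> S" "dist q' z \<le> 5 * koranyi (- q' + q)"
        using side.change_near_boundary[OF sd] by blast
      with infdist_le[of z S q'] fr nr mult_right_mono[OF c'(3) less_imp_le[OF r]] show False by linarith
    qed
    obtain s a where sa: "s 0 = 0" "s 5 = g" "\<And>i. i < 5 \<Longrightarrow> s (Suc i) = s i + hz (a i)"
        "\<And>i. i < 5 \<Longrightarrow> norm (a i) \<le> koranyi g" "\<And>i. i \<le> 5 \<Longrightarrow> koranyi (s i) \<le> real i * koranyi g"
      by (rule horizontal_path) (rule that)
    let ?A = "\<lambda>i. {q \<in> cball p (12 * r). q \<in> K1 \<and> q + hz (a i) \<notin> K1}"
    have "cball q1 (\<sigma> * r) \<subseteq> (\<Union>i\<in>{..<5}. {b. b + s i \<in> ?A i})"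
    proof
      fix b assume "b \<in> cball q1 (\<sigma> * r)"
      then have b: "koranyi (- q1 + b) \<le> \<sigma> * r" by (simp only: dist_heis_le_iff)
      have lt: "\<sigma> * r < c' / 5 * r" "(\<sigma> + 4 * sqrt \<sigma>) * r < c' / 5 * r"
        using \<sigma>c sq c' r by (auto intro!: mult_strict_right_mono)
      have b1: "b \<in> K1" using b lt by (intro stay[OF K1.side_axioms q(1) far(1)]) linarith
      have "- q2 + (b + g) = - g + (- q1 + b) + g" by (simp add: q2g minus_add add.assoc del: add_uminus_conv_diff)
      then have "b + g \<in> K2"
        using koranyi_conj_le[OF b g2 r] \<sigma>0 \<sigma>1 lt by (intro stay[OF K2.side_axioms q(2) far(2)]) simp
      then have bg: "b + g \<notin> K1" using components_nonoverlap[OF K(1,2)] K(3) by blast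
      have "b + s 0 \<in> K1" "\<not> b + s 5 \<in> K1" using b1 bg sa by simp_all
      then obtain i where i: "i < 5" "b + s i \<in> K1" "\<not> b + s (Suc i) \<in> K1"
        by (rule last_true[of "\<lambda>i. b + s i \<in> K1"])
      have sS: "b + s (Suc i) = (b + s i) + hz (a i)" using sa(3)[OF i(1)] by (simp add: add.assoc)
      have "koranyi (s i) \<le> real i * koranyi g" using i(1) by (intro sa) simp
      also have "\<dots> \<le> 4 * (2 * r)" using i g2 by (intro mult_mono) auto
      \<comment> \<open>Four segments of length at most \<open>2 r\<close> precede the point where the crossing segment starts.\<close>
      finally have "dist b (b + s i) \<le> 8 * r" by simp
      moreover have "dist q1 b \<le> r"
        using \<open>b \<in> cball q1 _\<close> \<sigma>1 r mult_right_mono[of \<sigma> 1 r] by (auto intro: order_trans)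
      moreover have "dist p q1 \<le> r" using q by simp
      ultimately have "dist p (b + s i) \<le> 12 * r"
        using dist_triangle[of p "b + s i" q1] dist_triangle[of q1 "b + s i" b] r by linarith
      with i sS show "b \<in> (\<Union>i\<in>{..<5}. {b. b + s i \<in> ?A i})" by auto
    qed
    then have "vol (cball q1 (\<sigma> * r)) \<le> (\<Sum>i\<in>{..<5}. vol {b. b + s i \<in> ?A i})"
      by (intro order_trans[OF vol_mono vol_UN_finite_le]) auto
    then have le: "ennreal (10 * cA * r ^ ?Q) \<le> (\<Sum>i\<in>{..<5::nat}. vol (?A i))"
      using r \<sigma>0 by (simp only: vol_right) (simp add: vol_cball cA_def power_mult_distrib algebra_simps)
    have "\<exists>i<5. ennreal (cA * r ^ ?Q) \<le> vol (?A i)"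
    proof (rule ccontr)
      assume "\<not> ?thesis"
      then have "(\<Sum>i\<in>{..<5::nat}. vol (?A i)) \<le> (\<Sum>i\<in>{..<5::nat}. ennreal (cA * r ^ ?Q))"
        by (intro sum_mono) (auto simp: not_le less_imp_le)
      also have "\<dots> = ennreal (5 * (cA * r ^ ?Q))"
        using cA r by (simp add: ennreal_mult)
      finally have "ennreal (10 * cA * r ^ ?Q) \<le> ennreal (5 * (cA * r ^ ?Q))" using le by (rule order_trans[rotated])
      moreover have "cA * r ^ ?Q > 0" using cA r by simp
      ultimately show False by (simp add: ennreal_le_iff del: power_Suc)
    qed
    then obtain i where i: "i < 5" "ennreal (cA * r ^ ?Q) \<le> vol (?A i)" by blast
    have "a i \<noteq> 0"
    proof
      assume "a i = 0"
      then have "?A i = {}" by auto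
      with i(2) have "ennreal (cA * r ^ ?Q) \<le> 0" by (simp only: vol_empty)
      then have "cA * r ^ ?Q \<le> 0" by (simp only: le_zero_eq ennreal_eq_0_iff)
      moreover have "cA * r ^ ?Q > 0" using cA r by (intro mult_pos_pos zero_less_power)
      ultimately show False by linarith
    qed
    moreover have "norm (a i) \<le> 12 * r" using sa(4)[OF i(1)] g2 r by simp
    ultimately show "\<exists>K\<in>components (- S). \<exists>a. a \<noteq> 0 \<and> norm a \<le> 12 * r \<and>
        ennreal (cA * r ^ ?Q) \<le> vol {q \<in> cball p (12 * r). q \<in> K \<and> q + hz a \<notin> K}"
      using K(1) i by blast
  qed
qed

text \<open>
  The segments of \<open>condition_B_crossing\<close> all meet \<open>S\<close> close to \<open>p\<close>; compare their volume with \<open>vol_Hit_le\<close>.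
\<close>

lemma condition_B_lower_regular:
  fixes S :: "'k::finite heis set"
  assumes B: "condition_B S"
  obtains cl where "cl > 0"
    and "\<And>p r. p \<in> S \<Longrightarrow> r > 0 \<Longrightarrow> ennreal r < ediam S \<Longrightarrow>
      ennreal (cl * r ^ (2 * CARD('k) + 1)) \<le> hmeas (S \<inter> cball p r)"
proof -
  obtain cA where cA: "cA > 0" and A: "\<And>p r. p \<in> S \<Longrightarrow> r > 0 \<Longrightarrow> ennreal r < ediam S \<Longrightarrow>
      \<exists>K\<in>components (- S). \<exists>a. a \<noteq> 0 \<and> norm a \<le> 12 * r \<and>
        ennreal (cA * r ^ (2 * CARD('k) + 2)) \<le> vol {q \<in> cball p (12 * r). q \<in> K \<and> q + hz a \<notin> K}"
    using condition_B_crossing[OF B] by blast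
  let ?h = "hit_const TYPE('k)" and ?n = "2 * CARD('k) + 1"
  have h: "?h > 0" by (rule hit_const_pos)
  define cl where "cl = cA / (24 ^ ?n * (12 * ?h))"
  have cl: "cl > 0" using cA h by (simp add: cl_def)
  show thesis
  proof (rule that[OF cl])
    fix p r assume p: "p \<in> S" and r: "r > 0" and rd: "ennreal r < ediam S"
    define t where "t = r / 24"
    have t: "t > 0" using r by (simp add: t_def)
    have "ennreal t < ediam S" using r by (intro le_less_trans[OF ennreal_leI rd]) (simp add: t_def)
    from A[OF p t this] obtain K a where K: "K \<in> components (- S)" and a: "a \<noteq> 0" "norm a \<le> 12 * t"
      and v: "ennreal (cA * t ^ (?n + 1)) \<le> vol {q \<in> cball p (12 * t). q \<in> K \<and> q + hz a \<notin> K}" by auto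
    interpret side S K by (rule side_component[OF K])
    have "{q \<in> cball p (12 * t). q \<in> K \<and> q + hz a \<notin> K} \<subseteq> Hit a (S \<inter> cball p r)"
    proof clarify
      fix q assume q: "q \<in> cball p (12 * t)" "q \<in> K" "q + hz a \<notin> K"
      with cross obtain s where s: "0 \<le> s" "s \<le> 1" "q + hz (s *\<^sub>R a) \<in> S" by (metis atLeastAtMost_iff)
      have "norm (s *\<^sub>R a) \<le> 1 * (12 * t)" using s a by (simp only: norm_scaleR, intro mult_mono) auto
      then have "dist q (q + hz (s *\<^sub>R a)) \<le> 12 * t" by simp
      with q dist_triangle[of p "q + hz (s *\<^sub>R a)" q] have "dist p (q + hz (s *\<^sub>R a)) \<le> r" by (simp add: t_def)
      with s show "q \<in> Hit a (S \<inter> cball p r)" by (auto simp: Hit_def)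
    qed
    with v have "ennreal (cA * t ^ (?n + 1)) \<le> vol (Hit a (S \<inter> cball p r))" by (meson order_trans vol_mono)
    also have "\<dots> \<le> ennreal (?h * norm a) * hmeas (S \<inter> cball p r)" by (rule vol_Hit_le[OF a(1)])
    also have "\<dots> \<le> ennreal (?h * (12 * t)) * hmeas (S \<inter> cball p r)"
      using a h by (intro mult_right_mono ennreal_leI mult_left_mono) auto
    finally have "ennreal (cA * t ^ (?n + 1)) / ennreal (?h * (12 * t)) \<le> hmeas (S \<inter> cball p r)"
      using h t by (intro divide_le_posI_ennreal) auto
    moreover have "ennreal (cA * t ^ (?n + 1)) / ennreal (?h * (12 * t)) = ennreal (cl * r ^ ?n)"
    proof -
      have "cA * t ^ (?n + 1) / (?h * (12 * t)) = cl * r ^ ?n"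
        using h t r by (simp add: cl_def t_def power_divide field_simps)
      then show ?thesis using h t cA by (subst divide_ennreal) auto
    qed
    ultimately show "ennreal (cl * r ^ ?n) \<le> hmeas (S \<inter> cball p r)" by simp
  qed
qed

section \<open>Changes of side and packing of non-monotone patterns\<close>

locale separation = side S \<Omega> for S \<Omega> :: "'k::finite heis set" +
  fixes Cu :: real
  assumes \<Omega>_sets: "\<Omega> \<in> hsets"
    and Cu_pos: "Cu > 0"
    and upper: "\<And>p r. r > 0 \<Longrightarrow> hmeas (S \<inter> cball p r) \<le> ennreal (Cu * r ^ (2 * CARD('k) + 1))"
begin

lemma vol_Hit_S_le:
  assumes "a \<noteq> 0" "r > 0"
  shows "vol (Hit a (S \<inter> cball p r)) \<le> ennreal (hit_const TYPE('k) * norm a * (Cu * r ^ (2 * CARD('k) + 1)))"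
proof -
  have "vol (Hit a (S \<inter> cball p r)) \<le> ennreal (hit_const TYPE('k) * norm a) * hmeas (S \<inter> cball p r)"
    by (rule vol_Hit_le[OF assms(1)])
  also have "\<dots> \<le> ennreal (hit_const TYPE('k) * norm a) * ennreal (Cu * r ^ (2 * CARD('k) + 1))"
    by (intro mult_left_mono upper assms) simp
  also have "\<dots> = ennreal (hit_const TYPE('k) * norm a * (Cu * r ^ (2 * CARD('k) + 1)))"
    by (rule ennreal_mult'[symmetric]) (use hit_const_pos[where 'k = 'k] in simp)
  finally show ?thesis .
qed

lemma vol_change_hz:
  assumes R: "R \<ge> 0"
  shows "vol {q \<in> cball x R. (q \<in> \<Omega>) \<noteq> (q + hz a \<in> \<Omega>)}
    \<le> ennreal (hit_const TYPE('k) * norm a * (Cu * (R + norm a) ^ (2 * CARD('k) + 1)))"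
proof (cases "a = 0")
  case False
  have "{q \<in> cball x R. (q \<in> \<Omega>) \<noteq> (q + hz a \<in> \<Omega>)} \<subseteq> Hit a (S \<inter> cball x (R + norm a))"
  proof
    fix q assume "q \<in> {q \<in> cball x R. (q \<in> \<Omega>) \<noteq> (q + hz a \<in> \<Omega>)}"
    then have q: "dist x q \<le> R" "(q \<in> \<Omega>) \<noteq> (q + hz a \<in> \<Omega>)" by auto
    from cross[OF q(2)] obtain s where s: "0 \<le> s" "s \<le> 1" "q + hz (s *\<^sub>R a) \<in> S" by auto
    have "norm (s *\<^sub>R a) \<le> 1 * norm a" using s by (simp only: norm_scaleR, intro mult_right_mono) auto
    then have "dist q (q + hz (s *\<^sub>R a)) \<le> norm a" by simp
    with q dist_triangle[of x "q + hz (s *\<^sub>R a)" q] have "dist x (q + hz (s *\<^sub>R a)) \<le> R + norm a" by linarith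
    with s show "q \<in> Hit a (S \<inter> cball x (R + norm a))" by (auto simp: Hit_def)
  qed
  then have "vol {q \<in> cball x R. (q \<in> \<Omega>) \<noteq> (q + hz a \<in> \<Omega>)} \<le> vol (Hit a (S \<inter> cball x (R + norm a)))"
    by (rule vol_mono)
  also have "\<dots> \<le> ennreal (hit_const TYPE('k) * norm a * (Cu * (R + norm a) ^ (2 * CARD('k) + 1)))"
    using False R by (intro vol_Hit_S_le) (auto simp: add_nonneg_pos)
  finally show ?thesis .
qed simp

text \<open>
  Along a horizontal path from \<open>q\<close> to \<open>q + g\<close> some segment changes sides, so the bound for horizontal
  displacements extends to arbitrary ones.
\<close>

lemma vol_change:
  assumes R: "R \<ge> 0"
  shows "vol {q \<in> cball x R. (q \<in> \<Omega>) \<noteq> (q + g \<in> \<Omega>)}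
    \<le> ennreal (5 * hit_const TYPE('k) * Cu * koranyi g * (R + 6 * koranyi g) ^ (2 * CARD('k) + 1))"
proof -
  let ?h = "hit_const TYPE('k)" and ?n = "2 * CARD('k) + 1" and ?k = "koranyi g"
  have h: "?h > 0" by (rule hit_const_pos)
  obtain s a where sa: "s 0 = 0" "s 5 = g" "\<And>i. i < 5 \<Longrightarrow> s (Suc i) = s i + hz (a i)"
      "\<And>i. i < 5 \<Longrightarrow> norm (a i) \<le> koranyi g" "\<And>i. i \<le> 5 \<Longrightarrow> koranyi (s i) \<le> real i * koranyi g"
    by (rule horizontal_path) (rule that)
  let ?A = "\<lambda>i. {q \<in> cball x (R + 5 * ?k). (q \<in> \<Omega>) \<noteq> (q + hz (a i) \<in> \<Omega>)}"
  have "{q \<in> cball x R. (q \<in> \<Omega>) \<noteq> (q + g \<in> \<Omega>)} \<subseteq> (\<Union>i\<in>{..<5}. {q. q + s i \<in> ?A i})"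
  proof
    fix q assume "q \<in> {q \<in> cball x R. (q \<in> \<Omega>) \<noteq> (q + g \<in> \<Omega>)}"
    then have q: "dist x q \<le> R" "(q + s 0 \<in> \<Omega>) \<noteq> (q + s 5 \<in> \<Omega>)" using sa by auto
    from q(2) obtain i where i: "i < 5" "(q + s i \<in> \<Omega>) \<noteq> (q + s (Suc i) \<in> \<Omega>)"
      by (rule first_change[of "\<lambda>i. q + s i \<in> \<Omega>"])
    have sS: "q + s (Suc i) = (q + s i) + hz (a i)" using sa(3)[OF i(1)] by (simp add: add.assoc)
    have "koranyi (s i) \<le> real i * ?k" using i(1) by (intro sa) simp
    also have "\<dots> \<le> 5 * ?k" using i(1) by (intro mult_right_mono) auto
    finally have "dist q (q + s i) \<le> 5 * ?k" by simp
    with q(1) dist_triangle[of x "q + s i" q] have "dist x (q + s i) \<le> R + 5 * ?k" by linarith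
    with i sS show "q \<in> (\<Union>i\<in>{..<5}. {q. q + s i \<in> ?A i})" by auto
  qed
  then have "vol {q \<in> cball x R. (q \<in> \<Omega>) \<noteq> (q + g \<in> \<Omega>)} \<le> (\<Sum>i\<in>{..<5}. vol {q. q + s i \<in> ?A i})"
    by (intro order_trans[OF vol_mono vol_UN_finite_le]) auto
  also have "\<dots> \<le> (\<Sum>i\<in>{..<5::nat}. ennreal (?h * ?k * (Cu * (R + 6 * ?k) ^ ?n)))"
  proof (rule sum_mono)
    fix i :: nat assume i: "i \<in> {..<5}"
    then have ai: "norm (a i) \<le> ?k" by (intro sa) simp
    have "vol {q. q + s i \<in> ?A i} \<le> ennreal (?h * norm (a i) * (Cu * ((R + 5 * ?k) + norm (a i)) ^ ?n))"
      unfolding vol_right using R by (intro vol_change_hz) simp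
    also have "\<dots> \<le> ennreal (?h * ?k * (Cu * (R + 6 * ?k) ^ ?n))"
      using ai h Cu_pos R by (intro ennreal_leI mult_mono power_mono mult_left_mono) auto
    finally show "vol {q. q + s i \<in> ?A i} \<le> ennreal (?h * ?k * (Cu * (R + 6 * ?k) ^ ?n))" .
  qed
  also have "\<dots> = ennreal (5 * (?h * ?k * (Cu * (R + 6 * ?k) ^ ?n)))"
    using h Cu_pos R by (simp add: ennreal_mult del: power_Suc)
  also have "5 * (?h * ?k * (Cu * (R + 6 * ?k) ^ ?n)) = 5 * ?h * Cu * ?k * (R + 6 * ?k) ^ ?n"
    by (simp only: mult_ac)
  finally show ?thesis .
qed

end

lemma card_changes_parity:
  fixes f :: "nat \<Rightarrow> bool"
  shows "even (card {m. m < N \<and> f m \<noteq> f (Suc m)}) \<longleftrightarrow> f 0 = f N"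
proof (induction N)
  case (Suc N)
  have "{m. m < Suc N \<and> f m \<noteq> f (Suc m)} =
    (if f N \<noteq> f (Suc N) then insert N {m. m < N \<and> f m \<noteq> f (Suc m)} else {m. m < N \<and> f m \<noteq> f (Suc m)})"
    by (auto simp: less_Suc_eq)
  with Suc show ?case by auto
qed simp

lemma change_between:
  fixes f :: "nat \<Rightarrow> bool"
  assumes "a < b" "f a \<noteq> f b"
  obtains m where "a \<le> m" "m < b" "f m \<noteq> f (Suc m)"
proof -
  have "f (a + 0) \<noteq> f (a + (b - a))" using assms by simp
  then obtain i where "i < b - a" "f (a + i) \<noteq> f (a + Suc i)" by (rule first_change[of "\<lambda>i. f (a + i)"])
  then show thesis using that[of "a + i"] by simp
qed

text \<open>
  The points \<open>q\<close> for which membership of \<open>q + m v\<close> in \<open>A\<close>, as a function of \<open>m \<le> N\<close>, changes back and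
  forth. A line of small steps that crosses a Lipschitz graph transversally does so once, so these points
  measure the deviation from a graph.
\<close>

definition nonmono :: "'k::finite heis set \<Rightarrow> nat \<Rightarrow> real ^ ('k + 'k) \<Rightarrow> 'k heis set" where
  "nonmono A N v = {q. \<exists>m1 m2 m3. m1 < m2 \<and> m2 < m3 \<and> m3 \<le> N \<and>
     (q + hz (real m1 *\<^sub>R v) \<in> A) \<noteq> (q + hz (real m2 *\<^sub>R v) \<in> A) \<and>
     (q + hz (real m2 *\<^sub>R v) \<in> A) \<noteq> (q + hz (real m3 *\<^sub>R v) \<in> A)}"

text \<open>
  Two changes are there by definition; if the end points lie on different sides, the number of changes is
  odd, hence at least three.
\<close>

lemma nonmono_card:
  assumes "q \<in> nonmono A N v"
  shows "2 + of_bool ((q \<in> A) \<noteq> (q + hz (real N *\<^sub>R v) \<in> A))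
    \<le> card {m. m < N \<and> (q + hz (real m *\<^sub>R v) \<in> A) \<noteq> (q + hz (real (Suc m) *\<^sub>R v) \<in> A)}"
proof -
  define f where "f m = (q + hz (real m *\<^sub>R v) \<in> A)" for m
  let ?C = "{m. m < N \<and> f m \<noteq> f (Suc m)}"
  obtain m1 m2 m3 where m: "m1 < m2" "m2 < m3" "m3 \<le> N" "f m1 \<noteq> f m2" "f m2 \<noteq> f m3"
    using assms by (auto simp: nonmono_def f_def)
  obtain a where a: "m1 \<le> a" "a < m2" "f a \<noteq> f (Suc a)" using m by (metis change_between)
  obtain b where b: "m2 \<le> b" "b < m3" "f b \<noteq> f (Suc b)" using m by (metis change_between)
  have "{a, b} \<subseteq> ?C" "a \<noteq> b" using a b m by auto
  then have c2: "2 \<le> card ?C" using card_mono[of ?C "{a, b}"] by simp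
  have "2 + of_bool (f 0 \<noteq> f N) \<le> card ?C"
  proof (cases "f 0 = f N")
    case False
    with card_changes_parity[of N f] have "odd (card ?C)" by simp
    with c2 have "3 \<le> card ?C" by (cases "card ?C = 2") auto
    with False show ?thesis by simp
  qed (use c2 in simp)
  then show ?thesis by (simp add: f_def)
qed

definition change_set :: "'k::finite heis set \<Rightarrow> real ^ ('k + 'k) \<Rightarrow> 'k heis set" where
  "change_set A v = {q. (q \<in> A) \<noteq> (q + hz v \<in> A)}"

lemma hsets_change_set:
  assumes "A \<in> hsets" shows "change_set A v \<in> hsets"
proof -
  let ?B = "{q. q + hz v \<in> A}"
  have "change_set A v = (A - ?B) \<union> (?B - A)" by (auto simp: change_set_def)
  then show ?thesis using assms hsets_vimage_right[OF assms, of "hz v"] by (simp add: hsets_Un hsets_Diff)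
qed

lemma hsets_UN_finite: "finite I \<Longrightarrow> (\<And>i. i \<in> I \<Longrightarrow> A i \<in> hsets) \<Longrightarrow> (\<Union>i\<in>I. A i) \<in> hsets"
  by (auto simp: hsets_def vimage_UN)

lemma hsets_nonmono:
  assumes A: "A \<in> hsets" shows "nonmono A N v \<in> hsets"
proof -
  define T where "T m = {q. q + hz (real m *\<^sub>R v) \<in> A}" for m
  define D where "D m m' = (T m - T m') \<union> (T m' - T m)" for m m'
  define I where "I = {x \<in> {..N} \<times> {..N} \<times> {..N}. fst x < fst (snd x) \<and> fst (snd x) < snd (snd x)}"
  have memD: "q \<in> D m m' \<longleftrightarrow> (q + hz (real m *\<^sub>R v) \<in> A) \<noteq> (q + hz (real m' *\<^sub>R v) \<in> A)" for q m m'
    by (auto simp: D_def T_def)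
  have "nonmono A N v = (\<Union>x\<in>I. D (fst x) (fst (snd x)) \<inter> D (fst (snd x)) (snd (snd x)))"
  proof (intro set_eqI iffI)
    fix q assume "q \<in> nonmono A N v"
    then obtain m1 m2 m3 where m: "m1 < m2" "m2 < m3" "m3 \<le> N" "q \<in> D m1 m2" "q \<in> D m2 m3"
      unfolding nonmono_def memD by blast
    then show "q \<in> (\<Union>x\<in>I. D (fst x) (fst (snd x)) \<inter> D (fst (snd x)) (snd (snd x)))"
      by (intro UN_I[of "(m1, m2, m3)"]) (auto simp: I_def)
  next
    fix q assume "q \<in> (\<Union>x\<in>I. D (fst x) (fst (snd x)) \<inter> D (fst (snd x)) (snd (snd x)))"
    then obtain m1 m2 m3 where "m1 < m2" "m2 < m3" "m3 \<le> N" "q \<in> D m1 m2" "q \<in> D m2 m3"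
      by (auto simp: I_def)
    then show "q \<in> nonmono A N v" unfolding nonmono_def memD by blast
  qed
  also have "\<dots> \<in> hsets"
    unfolding D_def T_def
    by (intro hsets_UN_finite hsets_Int hsets_Un hsets_Diff hsets_vimage_right A finite_subset[of I "{..N} \<times> {..N} \<times> {..N}"])
      (auto simp: I_def)
  finally show ?thesis .
qed

text \<open>
  Count the changes of side along \<open>q, q + v, \<dots>, q + N v\<close> and integrate over \<open>q\<close>: by invariance every step
  contributes the same volume. A change between the end points forces at least one change, and a
  non-monotone sequence has two more than that.
\<close>

lemma nonmono_defect:
  fixes A :: "'k::finite heis set"
  assumes A: "A \<in> hsets"
  shows "2 * vol (nonmono A N v) + vol (change_set A (real N *\<^sub>R v)) \<le> of_nat N * vol (change_set A v)"
proof -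
  let ?M = "lborel :: ((real ^ ('k + 'k)) \<times> real) measure"
  have m: "hc -` B \<in> sets ?M" if "B \<in> hsets" for B :: "'k heis set" using that by (simp add: hsets_def)
  let ?C = "\<lambda>m. {q. q + hz (real m *\<^sub>R v) \<in> change_set A v}"
  have C: "?C m \<in> hsets" for m by (intro hsets_vimage_right hsets_change_set A)
  have iv: "(\<integral>\<^sup>+ z. indicator B (hc z) \<partial>?M) = vol B" if "B \<in> hsets" for B :: "'k heis set"
  proof -
    have "(\<lambda>z. indicator B (hc z) :: ennreal) = indicator (hc -` B)" by (auto simp: indicator_def)
    then show ?thesis using m[OF that] that by (simp add: vol_hsets)
  qed
  have bm: "(\<lambda>z. indicator B (hc z) :: ennreal) \<in> borel_measurable ?M" if "B \<in> hsets" for B :: "'k heis set"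
  proof -
    have "(\<lambda>z. indicator B (hc z) :: ennreal) = indicator (hc -` B)" by (auto simp: indicator_def)
    then show ?thesis using m[OF that] by simp
  qed
  have "2 * vol (nonmono A N v) + vol (change_set A (real N *\<^sub>R v)) =
    (\<integral>\<^sup>+ z. 2 * indicator (nonmono A N v) (hc z) + indicator (change_set A (real N *\<^sub>R v)) (hc z) \<partial>?M)"
    using bm[OF hsets_nonmono[OF A]] bm[OF hsets_change_set[OF A]]
    by (simp add: nn_integral_add nn_integral_cmult iv hsets_nonmono hsets_change_set A)
  also have "\<dots> \<le> (\<integral>\<^sup>+ z. (\<Sum>m<N. indicator (?C m) (hc z)) \<partial>?M)"
  proof (rule nn_integral_mono)
    fix z :: "(real ^ ('k + 'k)) \<times> real"
    let ?q = "hc z :: 'k heis"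
    let ?K = "{m. m < N \<and> (?q + hz (real m *\<^sub>R v) \<in> A) \<noteq> (?q + hz (real (Suc m) *\<^sub>R v) \<in> A)}"
    have step: "?q + hz (real m *\<^sub>R v) + hz v = ?q + hz (real (Suc m) *\<^sub>R v)" for m
      using hz_add_scaleR[of "real m" v 1] by (simp add: add.assoc algebra_simps)
    have "(\<Sum>m<N. indicator (?C m) ?q) = (\<Sum>m<N. if m \<in> ?K then 1 else 0 :: ennreal)"
      by (intro sum.cong) (auto simp: change_set_def step indicator_def simp del: of_nat_Suc)
    also have "\<dots> = (\<Sum>m\<in>{..<N} \<inter> ?K. 1)" by (subst sum.inter_restrict) auto
    also have "\<dots> = of_nat (card ?K)"
    proof -
      have "{..<N} \<inter> ?K = ?K" by auto
      then show ?thesis by (simp only:) simp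
    qed
    finally have S: "(\<Sum>m<N. indicator (?C m) ?q :: ennreal) = of_nat (card ?K)" .
    have par: "even (card ?K) \<longleftrightarrow> (?q \<in> A) = (?q + hz (real N *\<^sub>R v) \<in> A)"
      using card_changes_parity[of N "\<lambda>m. ?q + hz (real m *\<^sub>R v) \<in> A"] by simp
    have "2 * of_bool (?q \<in> nonmono A N v) + of_bool (?q \<in> change_set A (real N *\<^sub>R v)) \<le> card ?K"
    proof (cases "?q \<in> nonmono A N v")
      case True
      with nonmono_card[OF True] show ?thesis by (simp add: change_set_def)
    next
      case False
      define c where "c = card ?K"
      have "even c \<longleftrightarrow> ?q \<notin> change_set A (real N *\<^sub>R v)"
        using par unfolding c_def[symmetric] change_set_def by simp
      then have "of_bool (?q \<in> change_set A (real N *\<^sub>R v)) \<le> c" by (cases "c = 0") auto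
      with False show ?thesis unfolding c_def[symmetric] by simp
    qed
    then have "of_nat (2 * of_bool (?q \<in> nonmono A N v) + of_bool (?q \<in> change_set A (real N *\<^sub>R v))) \<le> (of_nat (card ?K) :: ennreal)"
      by (simp only: of_nat_le_iff)
    then show "2 * indicator (nonmono A N v) ?q + indicator (change_set A (real N *\<^sub>R v)) ?q
      \<le> (\<Sum>m<N. indicator (?C m) ?q :: ennreal)"
      unfolding S by (auto simp: indicator_def)
  qed
  also have "\<dots> = (\<Sum>m<N. vol (?C m))"
    using bm[OF C] by (subst nn_integral_sum) (simp_all add: iv C)
  also have "\<dots> = of_nat N * vol (change_set A v)" by simp
  finally show ?thesis .
qed

lemma telescope_le:
  fixes a \<phi> :: "nat \<Rightarrow> real"
  assumes "\<And>j. a j \<le> \<phi> j - (if i \<le> j then \<phi> (j - i) else 0)"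
  shows "(\<Sum>j<J. a j) \<le> (\<Sum>j\<in>{J - i..<J}. \<phi> j)"
proof (induction J)
  case (Suc J)
  show ?case
  proof (cases "i \<le> J")
    case True
    have "(\<Sum>j\<in>{J - i..<J}. \<phi> j) + \<phi> J = \<phi> (J - i) + (\<Sum>j\<in>{Suc J - i..<Suc J}. \<phi> j)"
    proof -
      have "(\<Sum>j\<in>{J - i..<J}. \<phi> j) + \<phi> J = (\<Sum>j\<in>{J - i..<Suc J}. \<phi> j)" by simp
      also have "\<dots> = \<phi> (J - i) + (\<Sum>j\<in>{Suc (J - i)..<Suc J}. \<phi> j)"
        by (rule sum.atLeast_Suc_lessThan) simp
      finally show ?thesis using True by (simp add: Suc_diff_le)
    qed
    with Suc assms[of J] True show ?thesis by simp
  next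
    case False
    then have "J - i = 0" "Suc J - i = 0" by auto
    with Suc assms[of J] False show ?thesis by simp
  qed
qed simp

lemma vol_cball_annulus:
  fixes p :: "'k::finite heis"
  assumes "0 \<le> s" "s \<le> R"
  shows "vol (cball p R - cball p (R - s)) \<le> ennreal (unit_vol TYPE('k) * real (2 * CARD('k) + 2) * s * R ^ (2 * CARD('k) + 1))"
proof -
  let ?u = "unit_vol TYPE('k)" and ?n = "2 * CARD('k) + 1"
  have u: "?u > 0" by (rule unit_vol_pos)
  have d: "cball p R - cball p (R - s) \<in> hsets" by (intro hsets_Diff hsets_closed closed_cball)
  have sub: "cball p (R - s) \<subseteq> cball p R" using assms by (intro subset_cball) simp
  have "vol (cball p R - cball p (R - s)) = vol (cball p R) - vol (cball p (R - s))"
  proof -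
    have s: "hc -` cball p r \<in> sets lborel" for r
      using hsets_closed[OF closed_cball, of p r] by (simp only: hsets_def mem_Collect_eq sets_lborel)
    have "vol (cball p (R - s)) \<noteq> \<infinity>" using vol_cball[of "R - s" p] assms by simp
    then have "emeasure lborel (hc -` cball p (R - s)) \<noteq> \<infinity>" by (simp only: vol_hsets[OF hsets_closed[OF closed_cball]] not_False_eq_True)
    moreover have "hc -` cball p (R - s) \<subseteq> hc -` cball p R" using sub by blast
    ultimately have "emeasure lborel (hc -` cball p R - hc -` cball p (R - s)) =
        emeasure lborel (hc -` cball p R) - emeasure lborel (hc -` cball p (R - s))"
      by (intro emeasure_Diff s) auto
    then show ?thesis
      by (simp only: vol_hsets[OF d] vol_hsets[OF hsets_closed[OF closed_cball]] vimage_Diff)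
  qed
  also have "\<dots> = ennreal (?u * R ^ (?n + 1) - ?u * (R - s) ^ (?n + 1))"
    using assms u by (simp add: vol_cball ennreal_minus del: power_Suc)
  also have "\<dots> \<le> ennreal (?u * real (?n + 1) * s * R ^ ?n)"
  proof (rule ennreal_leI)
    have "R ^ (?n + 1) - (R - s) ^ (?n + 1) \<le> real (?n + 1) * s * R ^ ?n"
    proof -
      have "R ^ Suc ?n - (R - s) ^ Suc ?n = (R - (R - s)) * (\<Sum>i<Suc ?n. (R - s) ^ (Suc ?n - Suc i) * R ^ i)"
        by (rule power_diff_sumr2)
      also have "(\<Sum>i<Suc ?n. (R - s) ^ (Suc ?n - Suc i) * R ^ i) \<le> (\<Sum>i<Suc ?n. R ^ (Suc ?n - Suc i) * R ^ i)"
        using assms by (intro sum_mono mult_right_mono power_mono) auto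
      also have "\<dots> = real (Suc ?n) * R ^ ?n" by (simp flip: power_add)
      finally have "R ^ Suc ?n - (R - s) ^ Suc ?n \<le> s * (real (Suc ?n) * R ^ ?n)"
        using assms by (simp add: mult_left_mono del: power_Suc)
      then show ?thesis by (simp only: mult_ac Suc_eq_plus1)
    qed
    then have "?u * (R ^ (?n + 1) - (R - s) ^ (?n + 1)) \<le> ?u * (real (?n + 1) * s * R ^ ?n)"
      using u by (intro mult_left_mono) auto
    then show "?u * R ^ (?n + 1) - ?u * (R - s) ^ (?n + 1) \<le> ?u * real (?n + 1) * s * R ^ ?n"
      by (simp only: right_diff_distrib mult.assoc)
  qed
  finally show ?thesis by simp
qed

context separation
begin

definition pack_const :: real where
  "pack_const = hit_const TYPE('k) * Cu * 2 ^ (2 * CARD('k) + 1) + 2 * unit_vol TYPE('k) * real (2 * CARD('k) + 2)"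

lemma pack_const_pos: "pack_const > 0"
  using hit_const_pos[where 'k = 'k] unit_vol_pos[where 'k = 'k] Cu_pos by (simp add: pack_const_def add_pos_pos)

text \<open>
  Intersecting \<open>\<Omega>\<close> with a ball makes volumes finite. The changes of side that this creates lie in an annulus
  of width \<open>norm v\<close>, whose volume obeys the same bound.
\<close>

lemma vol_change_localized:
  assumes R: "R > 0"
  shows "vol (change_set (\<Omega> \<inter> cball p R) v) \<le> ennreal (pack_const * norm v * R ^ (2 * CARD('k) + 1))"
proof (cases "norm v \<le> R")
  case True
  let ?n = "2 * CARD('k) + 1" and ?u = "unit_vol TYPE('k)" and ?h = "hit_const TYPE('k)"
  let ?B = "cball p R" and ?I = "cball p R - cball p (R - norm v)"
  let ?X = "{q \<in> ?B. (q \<in> \<Omega>) \<noteq> (q + hz v \<in> \<Omega>)}"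
  have u: "?u > 0" "?h > 0" by (rule unit_vol_pos, rule hit_const_pos)
  have "change_set (\<Omega> \<inter> ?B) v \<subseteq> ?X \<union> (?I \<union> {q. q + hz v \<in> ?I})"
  proof
    fix q assume q: "q \<in> change_set (\<Omega> \<inter> ?B) v"
    have d: "dist q (q + hz v) = norm v" by simp
    have 1: "q \<in> ?I" if "q \<in> ?B" "q + hz v \<notin> ?B"
      using that d dist_triangle[of p "q + hz v" q] by auto
    have 2: "q + hz v \<in> ?I" if "q \<notin> ?B" "q + hz v \<in> ?B"
      using that d dist_triangle[of p q "q + hz v"] by (auto simp: dist_commute)
    show "q \<in> ?X \<union> (?I \<union> {q. q + hz v \<in> ?I})"
      using q 1 2 by (auto simp: change_set_def simp del: mem_cball)
  qed
  then have "vol (change_set (\<Omega> \<inter> ?B) v) \<le> vol (?X \<union> (?I \<union> {q. q + hz v \<in> ?I}))" by (rule vol_mono)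
  also have "\<dots> \<le> vol ?X + (vol ?I + vol {q. q + hz v \<in> ?I})"
    by (intro order_trans[OF vol_Un_le] add_left_mono vol_Un_le)
  also have "\<dots> \<le> ennreal (?h * norm v * (Cu * (R + R) ^ ?n)) +
     (ennreal (?u * real (2 * CARD('k) + 2) * norm v * R ^ ?n) + ennreal (?u * real (2 * CARD('k) + 2) * norm v * R ^ ?n))"
  proof (intro add_mono)
    have "vol ?X \<le> ennreal (?h * norm v * (Cu * (R + norm v) ^ ?n))" using R by (intro vol_change_hz) simp
    also have "\<dots> \<le> ennreal (?h * norm v * (Cu * (R + R) ^ ?n))"
      using u Cu_pos R True by (intro ennreal_leI mult_left_mono power_mono) auto
    finally show "vol ?X \<le> ennreal (?h * norm v * (Cu * (R + R) ^ ?n))" .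
    have ann: "vol ?I \<le> ennreal (?u * real (2 * CARD('k) + 2) * norm v * R ^ ?n)"
      by (rule vol_cball_annulus) (use True in auto)
    then show "vol ?I \<le> ennreal (?u * real (2 * CARD('k) + 2) * norm v * R ^ ?n)" .
    show "vol {q. q + hz v \<in> ?I} \<le> ennreal (?u * real (2 * CARD('k) + 2) * norm v * R ^ ?n)"
      unfolding vol_right by (rule ann)
  qed
  also have "\<dots> = ennreal (?h * norm v * (Cu * (R + R) ^ ?n) +
     (?u * real (2 * CARD('k) + 2) * norm v * R ^ ?n + ?u * real (2 * CARD('k) + 2) * norm v * R ^ ?n))"
  proof -
    have Y: "0 \<le> ?u * real (2 * CARD('k) + 2) * norm v * R ^ ?n" using u R by simp
    have X: "0 \<le> ?h * norm v * (Cu * (R + R) ^ ?n)" using u R Cu_pos by simp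
    show ?thesis by (simp only: ennreal_plus[OF X add_nonneg_nonneg[OF Y Y]] ennreal_plus[OF Y Y])
  qed
  also have "?h * norm v * (Cu * (R + R) ^ ?n) +
     (?u * real (2 * CARD('k) + 2) * norm v * R ^ ?n + ?u * real (2 * CARD('k) + 2) * norm v * R ^ ?n) =
     pack_const * norm v * R ^ ?n"
  proof -
    have "(R + R) ^ ?n = 2 ^ ?n * R ^ ?n" by (simp only: mult_2[symmetric] power_mult_distrib)
    then show ?thesis unfolding pack_const_def by (simp only:) (simp only: algebra_simps)
  qed
  finally show ?thesis .
next
  case False
  let ?n = "2 * CARD('k) + 1" and ?u = "unit_vol TYPE('k)" and ?B = "cball p R"
  have u: "?u > 0" by (rule unit_vol_pos)
  have "change_set (\<Omega> \<inter> ?B) v \<subseteq> ?B \<union> {q. q + hz v \<in> ?B}" by (auto simp: change_set_def)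
  then have "vol (change_set (\<Omega> \<inter> ?B) v) \<le> vol ?B + vol {q. q + hz v \<in> ?B}"
    by (intro order_trans[OF vol_mono vol_Un_le])
  also have "\<dots> = ennreal (?u * R ^ (?n + 1)) + ennreal (?u * R ^ (?n + 1))"
    using R by (simp add: vol_cball del: power_Suc mem_cball)
  also have "\<dots> = ennreal (2 * ?u * R * R ^ ?n)"
    using R u by (simp add: ennreal_plus[symmetric] del: ennreal_plus)
  also have "\<dots> \<le> ennreal (pack_const * norm v * R ^ ?n)"
  proof (intro ennreal_leI mult_right_mono mult_mono)
    have "2 * ?u \<le> 2 * ?u * real (2 * CARD('k) + 2)" using u by simp
    then show "2 * ?u \<le> pack_const" unfolding pack_const_def using hit_const_pos[where 'k = 'k] Cu_pos
      by (smt (verit) mult_pos_pos zero_less_power)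
  qed (use False R pack_const_pos in auto)
  finally show ?thesis .
qed

text \<open>
  Let \<open>\<phi> j\<close> be \<open>2\<^sup>j\<close> times the volume of the points where a step \<open>v0 / 2\<^sup>j\<close> changes sides. It is bounded,
  since that volume is at most proportional to the length of the step. By \<open>nonmono_defect\<close> the volume of
  non-monotone points of scale \<open>j\<close>, weighted by \<open>2\<^sup>j\<close>, is bounded by \<open>\<phi> j - \<phi> (j - i)\<close> up to a factor
  depending on \<open>i\<close>, and these differences telescope.
\<close>

lemma nonmono_packing:
  fixes v0 :: "real ^ ('k + 'k)"
  assumes R: "R > 0"
  shows "(\<Sum>j. ennreal (2 ^ j) * vol (nonmono (\<Omega> \<inter> cball p R) (2 ^ i) (v0 /\<^sub>R 2 ^ j)))
    \<le> ennreal (2 ^ i * real i * pack_const * norm v0 * R ^ (2 * CARD('k) + 1))"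
proof -
  let ?n = "2 * CARD('k) + 1" and ?A = "\<Omega> \<inter> cball p R"
  have A: "?A \<in> hsets" by (intro hsets_Int \<Omega>_sets hsets_closed closed_cball)
  define F where "F v = vol (change_set ?A v)" for v
  define G where "G j = vol (nonmono ?A (2 ^ i) (v0 /\<^sub>R 2 ^ j))" for j
  define B where "B = pack_const * norm v0 * R ^ ?n"
  have B: "B \<ge> 0" using pack_const_pos R by (simp add: B_def)
  have Fb: "F v \<le> ennreal (pack_const * norm v * R ^ ?n)" for v
    unfolding F_def by (rule vol_change_localized[OF R])
  have Ff: "F v < \<infinity>" for v using Fb[of v] by (rule le_less_trans) simp
  define \<phi> where "\<phi> j = 2 ^ j * enn2real (F (v0 /\<^sub>R 2 ^ j))" for j
  have \<phi>B: "\<phi> j \<le> B" for j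
  proof -
    have "enn2real (F (v0 /\<^sub>R 2 ^ j)) \<le> pack_const * norm (v0 /\<^sub>R 2 ^ j) * R ^ ?n"
      using Fb[of "v0 /\<^sub>R 2 ^ j"] pack_const_pos R by (intro enn2real_leI) auto
    then have "\<phi> j \<le> 2 ^ j * (pack_const * norm (v0 /\<^sub>R 2 ^ j) * R ^ ?n)"
      unfolding \<phi>_def by (intro mult_left_mono) auto
    also have "\<dots> = B" by (simp add: B_def field_simps del: power_Suc)
    finally show ?thesis .
  qed
  have defect: "2 * G j + F ((2 ^ i) *\<^sub>R (v0 /\<^sub>R 2 ^ j)) \<le> of_nat (2 ^ i) * F (v0 /\<^sub>R 2 ^ j)" for j
    using nonmono_defect[OF A, of "2 ^ i" "v0 /\<^sub>R 2 ^ j"] unfolding F_def G_def by simp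
  have Gf: "G j < \<infinity>" for j
  proof -
    have "G j \<le> 2 * G j + F ((2 ^ i) *\<^sub>R (v0 /\<^sub>R 2 ^ j))"
      by (simp add: add_increasing2 mult_2 add_increasing)
    also have "\<dots> \<le> of_nat (2 ^ i) * F (v0 /\<^sub>R 2 ^ j)" by (rule defect)
    also have "\<dots> < \<infinity>" using Ff[of "v0 /\<^sub>R 2 ^ j"] by (simp add: ennreal_mult_less_top power_less_top_ennreal)
    finally show ?thesis .
  qed
  define a where "a j = 2 ^ j * enn2real (G j) / 2 ^ i" for j
  have a: "a j \<le> \<phi> j - (if i \<le> j then \<phi> (j - i) else 0)" for j
  proof -
    let ?g = "enn2real (G j)" and ?f = "enn2real (F (v0 /\<^sub>R 2 ^ j))" and ?f' = "enn2real (F ((2 ^ i) *\<^sub>R (v0 /\<^sub>R 2 ^ j)))"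
    have e: "G j = ennreal ?g" "F ((2 ^ i) *\<^sub>R (v0 /\<^sub>R 2 ^ j)) = ennreal ?f'" "F (v0 /\<^sub>R 2 ^ j) = ennreal ?f"
      using Gf[of j] Ff by (simp_all only: ennreal_enn2real infinity_ennreal_def)
    have "ennreal (2 * ?g + ?f') = 2 * ennreal ?g + ennreal ?f'"
      by (simp add: ennreal_mult del: ennreal_enn2real)
    also have "\<dots> \<le> of_nat (2 ^ i) * ennreal ?f" using defect[of j] by (simp only: e[symmetric])
    also have "\<dots> = ennreal (2 ^ i * ?f)"
      by (simp add: ennreal_mult flip: ennreal_power ennreal_of_nat_eq_real_of_nat)
    finally have "ennreal (2 * ?g + ?f') \<le> ennreal (2 ^ i * ?f)" .
    then have d: "2 * ?g + ?f' \<le> 2 ^ i * ?f" by (subst (asm) ennreal_le_iff) auto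
    have g0: "?g \<ge> 0" "?f' \<ge> 0" by auto
    show ?thesis
    proof (cases "i \<le> j")
      case True
      then have p: "(2::real) ^ j = 2 ^ i * 2 ^ (j - i)" by (simp flip: power_add)
      then have rw: "(2 ^ i) *\<^sub>R (v0 /\<^sub>R 2 ^ j) = v0 /\<^sub>R 2 ^ (j - i)" by simp
      have "\<phi> (j - i) = 2 ^ (j - i) * ?f'" by (simp only: \<phi>_def rw)
      moreover have "\<phi> j = 2 ^ (j - i) * (2 ^ i * ?f)" by (simp add: \<phi>_def p)
      moreover have "a j = 2 ^ (j - i) * ?g" by (simp add: a_def p)
      moreover have "2 ^ (j - i) * ?g \<le> 2 ^ (j - i) * (2 ^ i * ?f - ?f')"
      proof (rule mult_left_mono)
        show "?g \<le> 2 ^ i * ?f - ?f'" using d g0 by linarith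
      qed simp
      ultimately show ?thesis using True by (simp add: algebra_simps)
    next
      case False
      have "?g \<le> 2 ^ i * ?f" using d g0 by linarith
      then have "a j * 2 ^ i \<le> \<phi> j * 2 ^ i"
        by (simp add: a_def \<phi>_def mult.assoc mult.commute[of _ "2 ^ i"])
      then show ?thesis using False by simp
    qed
  qed
  have part: "(\<Sum>j<J. ennreal (2 ^ j) * G j) \<le> ennreal (2 ^ i * real i * B)" for J
  proof -
    have "(\<Sum>j<J. a j) \<le> (\<Sum>j\<in>{J - i..<J}. \<phi> j)" by (rule telescope_le[OF a])
    also have "\<dots> \<le> (\<Sum>j\<in>{J - i..<J}. B)" by (intro sum_mono \<phi>B)
    also have "\<dots> \<le> real i * B" using B by (simp add: mult_right_mono)
    finally have le: "(\<Sum>j<J. a j) \<le> real i * B" .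
    have "(\<Sum>j<J. ennreal (2 ^ j) * G j) = (\<Sum>j<J. ennreal (2 ^ i * a j))"
    proof (rule sum.cong)
      fix j
      have "ennreal (2 ^ i * a j) = ennreal (2 ^ j * enn2real (G j))" by (simp add: a_def)
      also have "\<dots> = ennreal (2 ^ j) * G j" using Gf[of j] by (simp add: ennreal_mult less_top)
      finally show "ennreal (2 ^ j) * G j = ennreal (2 ^ i * a j)" by simp
    qed simp
    also have "\<dots> = ennreal (2 ^ i * (\<Sum>j<J. a j))"
      by (simp add: sum_distrib_left a_def sum_ennreal)
    also have "\<dots> \<le> ennreal (2 ^ i * (real i * B))" using le by (intro ennreal_leI mult_left_mono) auto
    finally show ?thesis by (simp add: mult.assoc)
  qed
  have "(\<Sum>j. ennreal (2 ^ j) * G j) \<le> ennreal (2 ^ i * real i * B)"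
    unfolding suminf_eq_SUP by (rule SUP_least) (rule part)
  then show ?thesis by (simp add: G_def B_def mult.assoc)
qed

end

section \<open>Double counting of two-segment paths\<close>

lemma borel_measurable_fst' [measurable (raw)]:
  fixes f :: "'a \<Rightarrow> 'b::topological_space \<times> 'c::topological_space"
  shows "f \<in> borel_measurable M \<Longrightarrow> (\<lambda>x. fst (f x)) \<in> borel_measurable M"
  by (rule borel_measurable_continuous_on[OF continuous_on_fst[OF continuous_on_id]])

lemma borel_measurable_snd' [measurable (raw)]:
  fixes f :: "'a \<Rightarrow> 'b::topological_space \<times> 'c::topological_space"
  shows "f \<in> borel_measurable M \<Longrightarrow> (\<lambda>x. snd (f x)) \<in> borel_measurable M"
  by (rule borel_measurable_continuous_on[OF continuous_on_snd[OF continuous_on_id]])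

lemma borel_measurable_omega [measurable (raw)]:
  "f \<in> borel_measurable M \<Longrightarrow> g \<in> borel_measurable M \<Longrightarrow> (\<lambda>x. heis_omega (f x) (g x)) \<in> borel_measurable M"
  using borel_measurable_continuous_Pair[of f M g heis_omega]
    continuous_on_omega[of UNIV fst snd] by (simp add: continuous_on_fst continuous_on_snd)

text \<open>
  Right multiplication in coordinates, see \<open>hc_mulc\<close>.
\<close>

definition mulc :: "(real ^ ('k::finite + 'k)) \<times> real \<Rightarrow> real ^ ('k + 'k) \<Rightarrow> real \<Rightarrow> (real ^ ('k + 'k)) \<times> real" where
  "mulc z a \<tau> = (fst z + a, snd z + \<tau> + heis_omega (fst z) a / 2)"

lemma hc_mulc: "hc (mulc z a \<tau>) = hc z + Heis a \<tau>"
  by (rule heis_eqI) (simp_all add: mulc_def)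

lemma measurable_mulc [measurable (raw)]:
  assumes [measurable]: "f \<in> borel_measurable M" "g \<in> borel_measurable M" "h \<in> borel_measurable M"
  shows "(\<lambda>x. mulc (f x) (g x) (h x)) \<in> borel_measurable M"
  unfolding mulc_def
  by (intro borel_measurable_Pair borel_measurable_add borel_measurable_divide borel_measurable_omega
      borel_measurable_fst' borel_measurable_snd' assms borel_measurable_const)

lemma nn_integral_right_translate:
  fixes f :: "(real ^ ('k::finite + 'k)) \<times> real \<Rightarrow> ennreal"
  assumes [measurable]: "f \<in> borel_measurable borel"
  shows "(\<integral>\<^sup>+ z. f (mulc z a \<tau>) \<partial>lborel) = (\<integral>\<^sup>+ z. f z \<partial>lborel)"
proof -
  have gm: "(\<lambda>v. \<tau> + heis_omega v a / 2) \<in> borel_measurable borel" by measurable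
  have Tm: "(\<lambda>z::(real ^ ('k + 'k)) \<times> real. (a + fst z, \<tau> + heis_omega (fst z) a / 2 + snd z)) \<in> borel \<rightarrow>\<^sub>M borel"
    by (intro borel_measurable_Pair borel_measurable_add borel_measurable_divide borel_measurable_omega
      borel_measurable_fst' borel_measurable_snd' borel_measurable_const) simp_all
  have eq: "mulc z a \<tau> = (a + fst z, \<tau> + heis_omega (fst z) a / 2 + snd z)" for z
    by (simp add: mulc_def algebra_simps)
  show ?thesis
    unfolding eq
    by (subst (2) lborel_shear[OF gm, of a, symmetric]) (simp add: nn_integral_distr Tm)
qed

text \<open>
  The point \<open>y\<close> lies above \<open>x\<close> in direction \<open>\<nu>\<close>, at height \<open>s\<close> between \<open>t\<close> and \<open>2 t\<close> where \<open>t = 2\<^sup>i \<rho>\<close>;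
  sideways the two points are as close as the scale \<open>\<rho>\<close>. Points \<open>p\<close> near \<open>x\<close> and \<open>p'\<close> near \<open>y\<close> are joined
  by two horizontal segments, the first of which is \<open>c l\<close>. If \<open>a\<close> is the horizontal part of \<open>- p + p'\<close>,
  the second is \<open>a - c l\<close>, and the condition on \<open>l\<close> is that the vertical part of \<open>- p + p'\<close>
  equals \<open>heis_omega (c l) a / 2\<close>.
\<close>

locale aligned_pair =
  fixes x y :: "'k::finite heis" and \<nu> w :: "real ^ ('k + 'k)" and \<rho> s :: real and i :: nat
  assumes \<nu>: "norm \<nu> = 1" and w\<nu>: "w \<bullet> \<nu> = 0" and hor_d: "hor (- x + y) = s *\<^sub>R \<nu> + w"
    and \<rho>: "\<rho> > 0" and i: "i \<ge> 7" and w: "norm w \<le> 2 * \<rho>"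
    and ver_d: "\<bar>ver (- x + y)\<bar> \<le> 4 * \<rho> * (2 ^ i * \<rho>)"
    and s: "2 ^ i * \<rho> \<le> s" "s \<le> 2 * (2 ^ i * \<rho>)"
begin

definition t :: real where "t = 2 ^ i * \<rho>"

abbreviation "\<mu> \<equiv> symp \<nu>"

definition c :: "real \<Rightarrow> real ^ ('k + 'k)" where "c l = (t / 2) *\<^sub>R \<nu> + l *\<^sub>R \<mu>"

lemma t_ge: "128 * \<rho> \<le> t" and t_pos: "t > 0"
proof -
  have "(2::real) ^ 7 \<le> 2 ^ i" using i by (intro power_increasing) auto
  then show "128 * \<rho> \<le> t" unfolding t_def using \<rho> by (intro mult_right_mono) auto
  with \<rho> show "t > 0" by linarith
qed

lemma inner_\<nu>: "\<nu> \<bullet> \<nu> = 1" using \<nu> by (simp add: norm_eq_1)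

lemma \<mu>_inner: "\<mu> \<bullet> \<nu> = 0" "\<nu> \<bullet> \<mu> = 0" by (simp_all add: symp_inner inner_commute[of \<nu>])

lemma c_inner: "c l \<bullet> \<nu> = t / 2"
  by (simp add: c_def inner_add_left inner_\<nu> \<mu>_inner)

lemma omega_c: "heis_omega (c l) a = (t / 2) * (\<mu> \<bullet> a) - l * (\<nu> \<bullet> a)"
proof -
  have "heis_omega \<mu> a = - (\<nu> \<bullet> a)"
    using omega_commute[of \<mu> a] omega_symp[of a \<nu>] by (simp add: inner_commute)
  then show ?thesis by (simp add: c_def omega_simps symp_inner)
qed

lemma step_eq: "hz (c l) + hz (a - c l) = Heis a (heis_omega (c l) a / 2)"
  by (rule heis_eqI) (simp_all add: omega_simps)

lemma abs_inner_\<nu>_le: "\<bar>u \<bullet> \<nu>\<bar> \<le> norm u" "\<bar>\<mu> \<bullet> u\<bar> \<le> norm u"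
  using Cauchy_Schwarz_ineq2[of u \<nu>] Cauchy_Schwarz_ineq2[of \<mu> u] \<nu> by simp_all

lemma ball_hor_ver: "p \<in> cball q (2 * \<rho>) \<Longrightarrow> norm (hor p - hor q) \<le> 2 * \<rho>"
  "p \<in> cball q (2 * \<rho>) \<Longrightarrow> \<bar>ver (- q + p)\<bar> \<le> \<rho>\<^sup>2"
proof -
  assume "p \<in> cball q (2 * \<rho>)"
  then have k: "koranyi (- q + p) \<le> 2 * \<rho>" by (simp only: dist_heis_le_iff)
  then show "norm (hor p - hor q) \<le> 2 * \<rho>" using koranyi_ge_norm_hor[of "- q + p"] by simp
  have "(koranyi (- q + p))\<^sup>2 \<le> (2 * \<rho>)\<^sup>2" using k by (intro power_mono) auto
  then show "\<bar>ver (- q + p)\<bar> \<le> \<rho>\<^sup>2"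
    using abs_ver_le_koranyi[of "- q + p"] by (simp only: power_mult_distrib) simp
qed

text \<open>
  The vertical part of \<open>- p + p'\<close> is of order \<open>\<rho> t\<close>, while it depends on \<open>l\<close> linearly with slope of order
  \<open>t\<close>. So \<open>l\<close> is of order \<open>\<rho>\<close>, and both segments have almost the direction \<open>\<nu>\<close>.
\<close>

lemma two_point_range:
  assumes p: "p \<in> cball x (2 * \<rho>)" and p': "p + Heis a (heis_omega (c l) a / 2) \<in> cball y (2 * \<rho>)"
  shows "t / 2 \<le> a \<bullet> \<nu>" "a \<bullet> \<nu> \<le> 3 * t" "\<bar>l\<bar> \<le> 50 * \<rho>" "norm (a - c l - (s - t / 2) *\<^sub>R \<nu>) \<le> 56 * \<rho>"
proof -
  define p' where "p' = p + Heis a (heis_omega (c l) a / 2)"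
  define b1 where "b1 = - x + p"
  define b2 where "b2 = - y + p'"
  define d where "d = - x + y"
  have b1: "norm (hor b1) \<le> 2 * \<rho>" "\<bar>ver b1\<bar> \<le> \<rho>\<^sup>2" using ball_hor_ver[OF assms(1)] by (simp_all add: b1_def)
  have b2: "norm (hor b2) \<le> 2 * \<rho>" "\<bar>ver b2\<bar> \<le> \<rho>\<^sup>2"
    using ball_hor_ver[OF assms(2)] by (simp_all add: b2_def p'_def)
  have e: "Heis a (heis_omega (c l) a / 2) = - b1 + d + b2"
  proof -
    have "- b1 + d + b2 = - p + p'" by (simp add: b1_def b2_def d_def minus_add add.assoc)
    also have "\<dots> = Heis a (heis_omega (c l) a / 2)" by (simp add: p'_def)
    finally show ?thesis by simp
  qed
  have hd: "hor d = s *\<^sub>R \<nu> + w" using hor_d by (simp add: d_def)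
  have a: "a = s *\<^sub>R \<nu> + w + (hor b2 - hor b1)"
    using arg_cong[OF e, of hor] hd by (simp add: algebra_simps)
  have \<tau>: "heis_omega (c l) a / 2 = - ver b1 + ver d - heis_omega (hor b1) (hor d) / 2 + ver b2
     + heis_omega (hor d - hor b1) (hor b2) / 2"
    using arg_cong[OF e, of ver]
    by (simp add: omega_simps algebra_simps add_divide_distrib diff_divide_distrib)
  have hb: "norm (hor b2 - hor b1) \<le> 4 * \<rho>" using norm_triangle_ineq4[of "hor b2" "hor b1"] b1 b2 by linarith
  have "\<bar>(hor b2 - hor b1) \<bullet> \<nu>\<bar> \<le> 4 * \<rho>" using abs_inner_\<nu>_le(1)[of "hor b2 - hor b1"] hb by linarith
  moreover have "a \<bullet> \<nu> = s + (hor b2 - hor b1) \<bullet> \<nu>" unfolding a by (simp add: inner_add_left inner_\<nu> w\<nu>)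
  ultimately show a1: "t / 2 \<le> a \<bullet> \<nu>" and "a \<bullet> \<nu> \<le> 3 * t"
    using s t_ge \<rho> unfolding t_def[symmetric] by linarith+
  have ma: "\<bar>\<mu> \<bullet> a\<bar> \<le> 6 * \<rho>"
  proof -
    have "\<mu> \<bullet> a = \<mu> \<bullet> (w + (hor b2 - hor b1))" unfolding a by (simp add: inner_add_right \<mu>_inner)
    moreover have "norm (w + (hor b2 - hor b1)) \<le> 6 * \<rho>" using norm_triangle_ineq[of w "hor b2 - hor b1"] w hb by linarith
    ultimately show ?thesis using abs_inner_\<nu>_le(2)[of "w + (hor b2 - hor b1)"] by linarith
  qed
  have nd: "norm (hor d) \<le> 3 * t"
  proof -
    have "norm (hor d) \<le> \<bar>s\<bar> + norm w" unfolding hd using norm_triangle_ineq[of "s *\<^sub>R \<nu>" w] \<nu> by simp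
    then show ?thesis using s w t_ge \<rho> t_pos unfolding t_def[symmetric] by linarith
  qed
  have o1: "\<bar>heis_omega (hor b1) (hor d)\<bar> \<le> (2 * \<rho>) * (3 * t)"
    using b1 nd \<rho> by (intro order_trans[OF abs_omega_le] mult_mono) auto
  have "norm (hor d - hor b1) \<le> 3 * t + 2 * \<rho>" using norm_triangle_ineq4[of "hor d" "hor b1"] nd b1 by linarith
  then have o2: "\<bar>heis_omega (hor d - hor b1) (hor b2)\<bar> \<le> (3 * t + 2 * \<rho>) * (2 * \<rho>)"
    using b2 \<rho> t_pos by (intro order_trans[OF abs_omega_le] mult_mono) auto
  have \<rho>2: "128 * \<rho>\<^sup>2 \<le> \<rho> * t" using mult_left_mono[OF t_ge, of \<rho>] \<rho> by (simp add: power2_eq_square)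
  have vd: "\<bar>ver d\<bar> \<le> 4 * (\<rho> * t)" using ver_d by (simp add: d_def t_def mult.assoc)
  have "\<bar>heis_omega (c l) a / 2\<bar> \<le> \<rho>\<^sup>2 + 4 * (\<rho> * t) + 3 * (\<rho> * t) + \<rho>\<^sup>2 + (3 * (\<rho> * t) + 2 * \<rho>\<^sup>2)"
  proof -
    have "\<bar>heis_omega (hor b1) (hor d) / 2\<bar> \<le> 3 * (\<rho> * t)" using o1 by (simp add: mult_ac)
    moreover have "\<bar>heis_omega (hor d - hor b1) (hor b2) / 2\<bar> \<le> 3 * (\<rho> * t) + 2 * \<rho>\<^sup>2"
      using o2 by (simp add: algebra_simps power2_eq_square)
    ultimately show ?thesis unfolding \<tau> using b1(2) b2(2) vd by linarith
  qed
  then have "\<bar>heis_omega (c l) a\<bar> \<le> 22 * (\<rho> * t)" using \<rho>2 zero_le_power2[of \<rho>] by linarith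
  then have "\<bar>l * (\<nu> \<bullet> a)\<bar> \<le> 22 * (\<rho> * t) + \<bar>t / 2 * (\<mu> \<bullet> a)\<bar>" unfolding omega_c by linarith
  also have "\<bar>t / 2 * (\<mu> \<bullet> a)\<bar> \<le> (t / 2) * (6 * \<rho>)" using ma t_pos by (simp add: abs_mult)
  finally have "\<bar>l\<bar> * \<bar>\<nu> \<bullet> a\<bar> \<le> 25 * (\<rho> * t)" by (simp add: abs_mult algebra_simps)
  moreover have "\<bar>l\<bar> * (t / 2) \<le> \<bar>l\<bar> * \<bar>\<nu> \<bullet> a\<bar>" using a1 by (intro mult_left_mono) (simp_all add: inner_commute)
  ultimately have "\<bar>l\<bar> * t \<le> (50 * \<rho>) * t" by (simp add: algebra_simps)
  then show l: "\<bar>l\<bar> \<le> 50 * \<rho>" using t_pos by simp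
  have eq: "a - c l - (s - t / 2) *\<^sub>R \<nu> = w + ((hor b2 - hor b1) - l *\<^sub>R \<mu>)"
    unfolding a c_def by (simp add: algebra_simps)
  have "norm (w + ((hor b2 - hor b1) - l *\<^sub>R \<mu>)) \<le> norm w + (norm (hor b2 - hor b1) + norm (l *\<^sub>R \<mu>))"
    by (intro order_trans[OF norm_triangle_ineq] add_left_mono norm_triangle_ineq4)
  moreover have "norm (l *\<^sub>R \<mu>) \<le> 50 * \<rho>" using l \<nu> by simp
  ultimately show "norm (a - c l - (s - t / 2) *\<^sub>R \<nu>) \<le> 56 * \<rho>" unfolding eq using w hb by linarith
qed

text \<open>
  The set in \<open>slab_le\<close> has extent \<open>\<rho>\<close> in all directions but one, and extent comparable to
  \<open>\<rho> / 2\<^sup>i = \<rho>\<^sup>2 / t\<close> in the remaining one.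
\<close>

definition slab :: real where
  "slab = unit_ball_vol (2 * real CARD('k)) * (3 * \<rho>) ^ (2 * CARD('k)) / 2 ^ (i - 5)"

text \<open>
  Moving \<open>a\<close> by \<open>\<theta> \<mu>\<close> moves the end point vertically, relative to \<open>y\<close>, by \<open>\<theta>\<close> times a length of order
  \<open>t\<close>, because the corner is at distance of order \<open>t\<close> from \<open>y\<close>. The ball around \<open>y\<close> has height of order
  \<open>\<rho>\<^sup>2\<close>. So the translates of the set by multiples of \<open>\<kappa> \<mu>\<close> with \<open>\<kappa>\<close> of order \<open>\<rho>\<^sup>2 / t\<close> are disjoint, and
  a fixed fraction of \<open>2\<^sup>i\<close> of them fit into one Euclidean ball of radius \<open>3 \<rho>\<close>.
\<close>

lemma slab_le:
  assumes p: "p \<in> cball x (2 * \<rho>)"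
  shows "emeasure lborel {a. p + Heis a (heis_omega (c l) a / 2) \<in> cball y (2 * \<rho>)} \<le> ennreal slab"
proof -
  let ?By = "cball y (2 * \<rho>)"
  define Z where "Z = {a. p + Heis a (heis_omega (c l) a / 2) \<in> ?By}"
  define m where "m = (2::nat) ^ (i - 5)"
  define \<kappa> where "\<kappa> = 32 * \<rho> / 2 ^ i"
  have \<kappa>: "\<kappa> > 0" using \<rho> by (simp add: \<kappa>_def)
  have "(2::real) ^ i = 2 ^ (5 + (i - 5))" using i by simp
  then have "(2::real) ^ i = 32 * 2 ^ (i - 5)" by (simp only: power_add) simp
  then have m\<kappa>: "real m * \<kappa> = \<rho>" by (simp add: m_def \<kappa>_def)
  have m0: "m > 0" by (simp add: m_def)
  have "closed Z"
  proof -
    have "continuous_on UNIV (\<lambda>a. p + Heis a (heis_omega (c l) a / 2))"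
      by (rule continuous_on_heis) (auto intro!: continuous_intros)
    then have "closed ((\<lambda>a. p + Heis a (heis_omega (c l) a / 2)) -` ?By)" by (intro closed_vimage closed_cball)
    then show ?thesis by (simp only: Z_def vimage_def)
  qed
  then have Zm [measurable]: "Z \<in> sets borel" by simp
  define T where "T j = {a. a - (real j * \<kappa>) *\<^sub>R \<mu> \<in> Z}" for j :: nat
  have Tm: "T j \<in> sets lborel" for j
  proof -
    have "T j = (\<lambda>a. a - (real j * \<kappa>) *\<^sub>R \<mu>) -` Z \<inter> space borel" by (auto simp: T_def)
    also have "\<dots> \<in> sets borel" by (rule measurable_sets[OF _ Zm]) simp
    finally show ?thesis by simp
  qed
  have TZ: "emeasure lborel (T j) = emeasure lborel Z" for j
  proof -
    have "emeasure lborel (T j) = (\<integral>\<^sup>+ a. indicator (T j) a \<partial>lborel)"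
      by (rule nn_integral_indicator[symmetric, OF Tm])
    also have "\<dots> = (\<integral>\<^sup>+ a. indicator Z (- ((real j * \<kappa>) *\<^sub>R \<mu>) + a) \<partial>lborel)"
      by (intro nn_integral_cong) (simp add: T_def indicator_def)
    also have "\<dots> = emeasure lborel Z"
      by (subst nn_integral_translate) auto
    finally show ?thesis .
  qed
  have ver_shift: "\<not> (a \<in> Z \<and> a + \<theta> *\<^sub>R \<mu> \<in> Z)" if th: "\<theta> \<ge> \<kappa>" for a \<theta>
  proof
    assume az: "a \<in> Z \<and> a + \<theta> *\<^sub>R \<mu> \<in> Z"
    define P where "P = p + hz (c l)"
    have eq: "p + Heis a' (heis_omega (c l) a' / 2) = P + hz (a' - c l)" for a'
      unfolding P_def add.assoc step_eq[symmetric] ..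
    have v: "\<bar>ver (- y + (P + hz (a - c l)))\<bar> \<le> \<rho>\<^sup>2" "\<bar>ver (- y + (P + hz (a + \<theta> *\<^sub>R \<mu> - c l)))\<bar> \<le> \<rho>\<^sup>2"
      using az ball_hor_ver(2) unfolding Z_def mem_Collect_eq eq by blast+
    have hpy: "hor p - hor y = - (s *\<^sub>R \<nu> + w) + (hor p - hor x)" using hor_d by (simp add: algebra_simps)
    have "(hor p - hor y) \<bullet> \<nu> = - s + (hor p - hor x) \<bullet> \<nu>"
      unfolding hpy by (simp add: inner_add_left inner_diff_left inner_\<nu> w\<nu>)
    moreover have "\<bar>(hor p - hor x) \<bullet> \<nu>\<bar> \<le> 2 * \<rho>"
      using abs_inner_\<nu>_le(1)[of "hor p - hor x"] ball_hor_ver(1)[OF p] by linarith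
    moreover have "(hor P - hor y) \<bullet> \<nu> = (hor p - hor y) \<bullet> \<nu> + t / 2"
      using c_inner[of l] by (simp add: P_def inner_diff_left inner_add_left)
    ultimately have far: "(hor P - hor y) \<bullet> \<nu> \<le> - (t / 4)" using s t_ge \<rho> unfolding t_def[symmetric] by linarith
    have "ver (- y + (P + hz (a + \<theta> *\<^sub>R \<mu> - c l))) - ver (- y + (P + hz (a - c l))) = \<theta> * ((hor P - hor y) \<bullet> \<nu>) / 2"
      by (simp add: omega_simps omega_symp inner_diff_left algebra_simps add_divide_distrib diff_divide_distrib)
    then have d1: "\<bar>\<theta> * ((hor P - hor y) \<bullet> \<nu>) / 2\<bar> \<le> 2 * \<rho>\<^sup>2" using v by linarith
    have "\<kappa> * (t / 4) \<le> \<theta> * - ((hor P - hor y) \<bullet> \<nu>)" using far th \<kappa> t_pos by (intro mult_mono) auto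
    moreover have "\<kappa> * (t / 4) = 8 * \<rho>\<^sup>2" by (simp add: \<kappa>_def t_def power2_eq_square)
    moreover have "\<rho>\<^sup>2 > 0" using \<rho> by simp
    ultimately show False using d1 by linarith
  qed
  have disj: "disjoint_family_on T {..<m}"
    unfolding disjoint_family_on_def
  proof (intro ballI impI)
    have *: "T j \<inter> T j' = {}" if "j < j'" for j j' :: nat
    proof (rule equals0I)
      fix a assume "a \<in> T j \<inter> T j'"
      then have 1: "a - (real j * \<kappa>) *\<^sub>R \<mu> \<in> Z" "a - (real j' * \<kappa>) *\<^sub>R \<mu> \<in> Z" by (auto simp: T_def)
      have eq: "a - (real j' * \<kappa>) *\<^sub>R \<mu> + ((real j' - real j) * \<kappa>) *\<^sub>R \<mu> = a - (real j * \<kappa>) *\<^sub>R \<mu>"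
        by (simp add: algebra_simps)
      have "1 * \<kappa> \<le> (real j' - real j) * \<kappa>" using that \<kappa> by (intro mult_right_mono) auto
      then have ge: "\<kappa> \<le> (real j' - real j) * \<kappa>" by simp
      from ver_shift[OF ge, of "a - (real j' * \<kappa>) *\<^sub>R \<mu>"] 1 show False unfolding eq by blast
    qed
    fix j j' :: nat assume "j \<noteq> j'"
    then show "T j \<inter> T j' = {}" using *[of j j'] *[of j' j] by (metis Int_commute nat_neq_iff)
  qed
  have sub: "(\<Union>j<m. T j) \<subseteq> cball (hor y - hor p) (3 * \<rho>)"
  proof clarsimp
    fix a j assume j: "j < m" and "a \<in> T j"
    then have "p + Heis (a - (real j * \<kappa>) *\<^sub>R \<mu>) (heis_omega (c l) (a - (real j * \<kappa>) *\<^sub>R \<mu>) / 2) \<in> ?By"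
      by (simp add: T_def Z_def)
    from ball_hor_ver(1)[OF this] have h: "norm (hor p + (a - (real j * \<kappa>) *\<^sub>R \<mu>) - hor y) \<le> 2 * \<rho>" by simp
    have "norm ((real j * \<kappa>) *\<^sub>R \<mu>) = real j * \<kappa>" using \<kappa> \<nu> by simp
    also have "\<dots> \<le> real m * \<kappa>" using j \<kappa> by (intro mult_right_mono) auto
    finally have "norm ((real j * \<kappa>) *\<^sub>R \<mu>) \<le> \<rho>" by (simp only: m\<kappa>)
    then have "norm ((hor p + (a - (real j * \<kappa>) *\<^sub>R \<mu>) - hor y) + (real j * \<kappa>) *\<^sub>R \<mu>) \<le> 3 * \<rho>"
      using h norm_triangle_ineq[of "hor p + (a - (real j * \<kappa>) *\<^sub>R \<mu>) - hor y" "(real j * \<kappa>) *\<^sub>R \<mu>"] by linarith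
    also have "(hor p + (a - (real j * \<kappa>) *\<^sub>R \<mu>) - hor y) + (real j * \<kappa>) *\<^sub>R \<mu> = - (hor y - hor p - a)" by simp
    finally show "dist (hor y - hor p) a \<le> 3 * \<rho>" by (simp only: dist_norm norm_minus_cancel)
  qed
  have "of_nat m * emeasure lborel Z = (\<Sum>j<m. emeasure lborel (T j))" by (simp add: TZ)
  also have "\<dots> = emeasure lborel (\<Union>j<m. T j)"
    by (rule sum_emeasure) (use Tm disj in auto)
  also have "\<dots> \<le> emeasure lborel (cball (hor y - hor p) (3 * \<rho>))" by (rule emeasure_mono[OF sub]) simp
  also have "\<dots> = ennreal (unit_ball_vol (2 * real CARD('k)) * (3 * \<rho>) ^ (2 * CARD('k)))"
    using \<rho> by (subst emeasure_cball) (simp_all only: DIM_hor, simp_all)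
  finally have "ennreal (real m) * emeasure lborel Z \<le> ennreal (unit_ball_vol (2 * real CARD('k)) * (3 * \<rho>) ^ (2 * CARD('k)))"
    by (simp add: ennreal_of_nat_eq_real_of_nat)
  then have "emeasure lborel Z * ennreal (real m) / ennreal (real m) \<le>
      ennreal (unit_ball_vol (2 * real CARD('k)) * (3 * \<rho>) ^ (2 * CARD('k))) / ennreal (real m)"
    by (intro divide_right_mono_ennreal) (simp add: mult.commute)
  moreover have "emeasure lborel Z * ennreal (real m) / ennreal (real m) = emeasure lborel Z"
    using m0 by (intro mult_divide_eq_ennreal) auto
  ultimately have "emeasure lborel Z \<le> ennreal (unit_ball_vol (2 * real CARD('k)) * (3 * \<rho>) ^ (2 * CARD('k))) / ennreal (real m)"
    by simp
  also have "\<dots> = ennreal slab"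
    using m0 \<rho> by (subst divide_ennreal) (auto simp: slab_def m_def)
  finally show ?thesis by (simp add: Z_def)
qed

text \<open>
  The same mechanism as in \<open>slab_le\<close>, seen from the end point: \<open>l\<close> moves the starting point vertically
  relative to \<open>x\<close>, with a rate of order \<open>t\<close>.
\<close>

lemma lam_le:
  shows "emeasure lborel {l. p' + hz (- c') + hz (- c l) \<in> cball x (2 * \<rho>)} \<le> ennreal (32 * \<rho> / 2 ^ i)"
proof (cases "{l. p' + hz (- c') + hz (- c l) \<in> cball x (2 * \<rho>)} = {}")
  case False
  let ?L = "{l. p' + hz (- c') + hz (- c l) \<in> cball x (2 * \<rho>)}"
  define P where "P = p' + hz (- c')"
  obtain l0 where l0: "P + hz (- c l0) \<in> cball x (2 * \<rho>)" using False by (auto simp: P_def)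
  have "(hor P - c l0 - hor x) \<bullet> \<nu> = (hor P - hor x) \<bullet> \<nu> - t / 2" by (simp add: inner_diff_left c_inner)
  moreover have "norm (hor P - c l0 - hor x) \<le> 2 * \<rho>" using ball_hor_ver(1)[OF l0] by simp
  ultimately have far: "t / 4 \<le> (hor P - hor x) \<bullet> \<nu>"
    using abs_inner_\<nu>_le(1)[of "hor P - c l0 - hor x"] t_ge \<rho> by linarith
  have "?L \<subseteq> {l0 - 16 * \<rho> / 2 ^ i .. l0 + 16 * \<rho> / 2 ^ i}"
  proof
    fix l assume "l \<in> ?L"
    then have l: "P + hz (- c l) \<in> cball x (2 * \<rho>)" by (simp add: P_def)
    have "ver (- x + (P + hz (- c l0))) - ver (- x + (P + hz (- c l))) = (l - l0) * ((hor P - hor x) \<bullet> \<nu>) / 2"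
      unfolding c_def
      by (simp add: omega_simps omega_symp inner_diff_left algebra_simps add_divide_distrib diff_divide_distrib)
    then have "\<bar>(l - l0) * ((hor P - hor x) \<bullet> \<nu>) / 2\<bar> \<le> 2 * \<rho>\<^sup>2"
      using ball_hor_ver(2)[OF l] ball_hor_ver(2)[OF l0] by linarith
    then have "\<bar>l - l0\<bar> * \<bar>(hor P - hor x) \<bullet> \<nu>\<bar> \<le> 4 * \<rho>\<^sup>2" by (simp add: abs_mult)
    moreover have "\<bar>l - l0\<bar> * (t / 4) \<le> \<bar>l - l0\<bar> * \<bar>(hor P - hor x) \<bullet> \<nu>\<bar>"
      using far by (intro mult_left_mono) auto
    ultimately have "\<bar>l - l0\<bar> * (2 ^ i * \<rho>) \<le> 16 * \<rho>\<^sup>2" by (simp add: t_def)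
    then have "(\<bar>l - l0\<bar> * 2 ^ i) * \<rho> \<le> (16 * \<rho>) * \<rho>" by (simp add: power2_eq_square algebra_simps)
    then have "\<bar>l - l0\<bar> * 2 ^ i \<le> 16 * \<rho>" using \<rho> by simp
    then have "\<bar>l - l0\<bar> \<le> 16 * \<rho> / 2 ^ i" by (simp add: field_simps)
    then show "l \<in> {l0 - 16 * \<rho> / 2 ^ i .. l0 + 16 * \<rho> / 2 ^ i}" by (auto simp: abs_le_iff)
  qed
  then have "emeasure lborel ?L \<le> emeasure lborel {l0 - 16 * \<rho> / 2 ^ i .. l0 + 16 * \<rho> / 2 ^ i}"
    by (rule emeasure_mono) simp
  also have "\<dots> = ennreal (32 * \<rho> / 2 ^ i)" using \<rho> by simp
  finally show ?thesis .
qed simp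

end

lemma nn_integral_lborel_swap:
  fixes f :: "'a::euclidean_space \<times> 'b::euclidean_space \<Rightarrow> ennreal"
  assumes f: "f \<in> borel_measurable borel"
  shows "(\<integral>\<^sup>+ u. \<integral>\<^sup>+ v. f (u, v) \<partial>lborel \<partial>lborel) = (\<integral>\<^sup>+ v. \<integral>\<^sup>+ u. f (u, v) \<partial>lborel \<partial>lborel)"
proof -
  have "f \<in> borel_measurable (lborel \<Otimes>\<^sub>M lborel)" using f by (simp add: lborel_prod)
  then show ?thesis by (intro lborel_pair.Fubini'[symmetric]) simp
qed

lemma borel_measurable_nn_integral_lborel:
  fixes f :: "'a::euclidean_space \<times> 'b::euclidean_space \<Rightarrow> ennreal"
  assumes f: "f \<in> borel_measurable borel"
  shows "(\<lambda>u. \<integral>\<^sup>+ v. f (u, v) \<partial>lborel) \<in> borel_measurable borel"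
proof -
  have "f \<in> borel_measurable (lborel \<Otimes>\<^sub>M lborel)" using f by (simp add: lborel_prod)
  then have "(\<lambda>u. \<integral>\<^sup>+ v. f (u, v) \<partial>lborel) \<in> borel_measurable lborel"
    by (intro lborel.borel_measurable_nn_integral) simp
  then show ?thesis by simp
qed

lemma borel_measurable_indicator_comp:
  assumes "X \<in> sets borel" "f \<in> borel_measurable M"
  shows "(\<lambda>x. indicator X (f x) :: ennreal) \<in> borel_measurable M"
  by (rule measurable_compose[OF assms(2)]) (use assms(1) in simp)

lemma vol_as_integral:
  fixes A :: "'k::finite heis set"
  assumes "A \<in> hsets"
  shows "vol A = (\<integral>\<^sup>+ z. indicator (hc -` A) z \<partial>lborel)"
  using assms by (simp add: vol_hsets) (simp add: hsets_def)

lemma vol_translate_integral: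
  fixes B :: "'k::finite heis set"
  assumes "B \<in> hsets"
  shows "(\<integral>\<^sup>+ a. \<integral>\<^sup>+ \<tau>. indicator (hc -` B) (mulc z a \<tau>) \<partial>lborel \<partial>lborel) = vol B"
proof -
  let ?B = "{q. hc z + q \<in> B}"
  have B: "?B \<in> hsets" by (rule hsets_vimage_left[OF assms])
  have "vol B = emeasure lborel (hc -` ?B)" using vol_left[of "hc z" B] by (simp only: vol_hsets[OF B])
  also have "\<dots> = (\<integral>\<^sup>+ a. \<integral>\<^sup>+ \<tau>. indicator (hc -` ?B) (a, \<tau>) \<partial>lborel \<partial>lborel)"
    using B by (intro emeasure_prod_fst) (simp add: hsets_def)
  also have "\<dots> = (\<integral>\<^sup>+ a. \<integral>\<^sup>+ \<tau>. indicator (hc -` B) (mulc z a \<tau>) \<partial>lborel \<partial>lborel)"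
    by (intro nn_integral_cong) (simp add: indicator_def hc_mulc, simp add: hc_def)
  finally show ?thesis by simp
qed

text \<open>
  The constant of \<open>two_point_counting\<close>: the first summand stems from paths with exceptional start, the
  second from paths with exceptional end.
\<close>

definition count_const :: "'k::finite itself \<Rightarrow> real" where
  "count_const _ = unit_ball_vol (2 * real CARD('k)) * (4800 * 3 ^ (2 * CARD('k)) + 48 * 56 ^ (2 * CARD('k)))"

lemma count_const_pos: "count_const TYPE('k::finite) > 0"
  by (simp add: count_const_def add_pos_pos)

context aligned_pair
begin

lemma measurable_c: "f \<in> borel_measurable M \<Longrightarrow> (\<lambda>u. c (f u)) \<in> borel_measurable M"
  unfolding c_def by (intro borel_measurable_add borel_measurable_const borel_measurable_scaleR)

lemmas meas_intros = borel_measurable_Pair borel_measurable_add borel_measurable_diff borel_measurable_divide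
  borel_measurable_omega borel_measurable_fst' borel_measurable_snd' borel_measurable_const
  measurable_mulc measurable_c borel_measurable_times_ennreal borel_measurable_indicator_comp
  borel_measurable_uminus

text \<open>
  Parametrise \<open>p' = p + Heis a \<tau>\<close>. For fixed \<open>a\<close> the height \<open>\<tau> = heis_omega (c l) a / 2\<close> is an affine function
  of \<open>l\<close> with slope \<open>- (a \<bullet> \<nu>) / 2\<close>, at most \<open>3 t / 2\<close> in absolute value. Hence the paths that start at
  \<open>p\<close> and end in \<open>B\<close> are numerous.
\<close>

lemma slice_lower:
  assumes z: "hc z \<in> cball x (2 * \<rho>)" and BY: "B \<subseteq> cball y (2 * \<rho>)" and B: "B \<in> hsets"
  shows "vol B \<le> ennreal (3 * t / 2) *
     (\<integral>\<^sup>+ a. \<integral>\<^sup>+ l. indicator (hc -` B) (mulc z a (heis_omega (c l) a / 2)) \<partial>lborel \<partial>lborel)"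
proof -
  let ?i = "\<lambda>a \<tau>. indicator (hc -` B) (mulc z a \<tau>) :: ennreal"
  have Bm: "hc -` B \<in> sets borel" using B by (simp add: hsets_def)
  have "(\<integral>\<^sup>+ \<tau>. ?i a \<tau> \<partial>lborel) \<le> ennreal (3 * t / 2) * (\<integral>\<^sup>+ l. ?i a (heis_omega (c l) a / 2) \<partial>lborel)" for a
  proof (cases "a \<bullet> \<nu> = 0")
    case False
    define \<alpha> where "\<alpha> = a \<bullet> \<nu>"
    have \<alpha>: "\<alpha> \<noteq> 0" using False by (simp add: \<alpha>_def)
    have m: "(\<lambda>\<tau>. ?i a \<tau>) \<in> borel_measurable borel" by (intro meas_intros Bm) simp_all
    have "(\<integral>\<^sup>+ \<tau>. ?i a \<tau> \<partial>lborel) = ennreal \<bar>- (\<alpha> / 2)\<bar> * (\<integral>\<^sup>+ l. ?i a ((t / 4) * (\<mu> \<bullet> a) + - (\<alpha> / 2) * l) \<partial>lborel)"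
      by (rule nn_integral_real_affine[OF m]) (use \<alpha> in simp)
    also have "(\<lambda>l. (t / 4) * (\<mu> \<bullet> a) + - (\<alpha> / 2) * l) = (\<lambda>l. heis_omega (c l) a / 2)"
      by (rule ext) (simp add: omega_c \<alpha>_def inner_commute[of \<nu> a] field_simps)
    finally have eq: "(\<integral>\<^sup>+ \<tau>. ?i a \<tau> \<partial>lborel) = ennreal (\<bar>\<alpha>\<bar> / 2) * (\<integral>\<^sup>+ l. ?i a (heis_omega (c l) a / 2) \<partial>lborel)"
      by simp
    show ?thesis
    proof (cases "\<exists>l. hc (mulc z a (heis_omega (c l) a / 2)) \<in> B")
      case True
      then obtain l where "hc z + Heis a (heis_omega (c l) a / 2) \<in> cball y (2 * \<rho>)" using BY by (auto simp: hc_mulc)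
      from two_point_range(1,2)[OF z this] have "\<bar>\<alpha>\<bar> / 2 \<le> 3 * t / 2" using t_pos by (simp add: \<alpha>_def)
      then show ?thesis unfolding eq by (intro mult_right_mono ennreal_leI) auto
    next
      case False
      then have "?i a (heis_omega (c l) a / 2) = 0" for l by (simp add: indicator_def)
      then show ?thesis unfolding eq by simp
    qed
  next
    case True
    have "?i a \<tau> = 0" for \<tau>
    proof (rule ccontr)
      assume "?i a \<tau> \<noteq> 0"
      then have "hc z + Heis a \<tau> \<in> cball y (2 * \<rho>)" using BY by (auto simp: indicator_def hc_mulc split: if_splits)
      then have h: "norm (hor (hc z) + a - hor y) \<le> 2 * \<rho>" using ball_hor_ver(1)[of "hc z + Heis a \<tau>" y] by simp
      have h2: "norm (hor (hc z) - hor x) \<le> 2 * \<rho>" by (rule ball_hor_ver(1)[OF z])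
      have "hor y - hor x = s *\<^sub>R \<nu> + w" using hor_d by simp
      then have "a = (s *\<^sub>R \<nu> + w) + ((hor (hc z) + a - hor y) - (hor (hc z) - hor x))" by (simp add: algebra_simps)
      then have "a \<bullet> \<nu> = ((s *\<^sub>R \<nu> + w) + ((hor (hc z) + a - hor y) - (hor (hc z) - hor x))) \<bullet> \<nu>" by (rule arg_cong)
      also have "\<dots> = s + (hor (hc z) + a - hor y) \<bullet> \<nu> - (hor (hc z) - hor x) \<bullet> \<nu>"
        by (simp add: inner_add_left inner_diff_left inner_\<nu> w\<nu>)
      finally show False
        using True h h2 abs_inner_\<nu>_le(1)[of "hor (hc z) + a - hor y"] abs_inner_\<nu>_le(1)[of "hor (hc z) - hor x"]
          s t_ge \<rho> unfolding t_def[symmetric] by linarith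
    qed
    then show ?thesis by simp
  qed
  then have "(\<integral>\<^sup>+ a. \<integral>\<^sup>+ \<tau>. ?i a \<tau> \<partial>lborel \<partial>lborel) \<le>
      (\<integral>\<^sup>+ a. ennreal (3 * t / 2) * (\<integral>\<^sup>+ l. ?i a (heis_omega (c l) a / 2) \<partial>lborel) \<partial>lborel)"
    by (intro nn_integral_mono)
  also have "\<dots> = ennreal (3 * t / 2) * (\<integral>\<^sup>+ a. \<integral>\<^sup>+ l. ?i a (heis_omega (c l) a / 2) \<partial>lborel \<partial>lborel)"
  proof (rule nn_integral_cmult)
    have "(\<lambda>u. ?i (fst u) (heis_omega (c (snd u)) (fst u) / 2)) \<in> borel_measurable borel"
      by (intro meas_intros Bm) simp_all
    from borel_measurable_nn_integral_lborel[OF this]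
    show "(\<lambda>a. \<integral>\<^sup>+ l. ?i a (heis_omega (c l) a / 2) \<partial>lborel) \<in> borel_measurable lborel" by simp
  qed
  finally show ?thesis by (simp only: vol_translate_integral[OF B])
qed

text \<open>
  The triples \<open>(p, a, l)\<close> of paths from \<open>A\<close> to \<open>B\<close> have measure at least \<open>vol A * vol B / (3 t / 2)\<close> by
  \<open>slice_lower\<close>. Every path has an exceptional start, in \<open>F1 l\<close>, or an exceptional end, in \<open>F2 c'\<close>.
  Given start and \<open>l\<close>, the remaining parameter lies in a set of measure \<open>slab\<close>; given end and second
  segment, \<open>l\<close> lies in a short interval by \<open>lam_le\<close>. Both gain a factor of order \<open>\<rho> / t\<close>, so \<open>t\<close> cancels
  and the conclusion depends on the scale \<open>\<rho>\<close> alone.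
\<close>

lemma two_point_counting:
  fixes A B :: "'k heis set" and F1 :: "real \<Rightarrow> 'k heis set" and F2 :: "real ^ ('k + 'k) \<Rightarrow> 'k heis set"
  assumes A: "A \<in> hsets" "A \<subseteq> cball x (2 * \<rho>)" and B: "B \<in> hsets" "B \<subseteq> cball y (2 * \<rho>)"
    and F1m: "{u. hc (fst u) \<in> F1 (snd u)} \<in> sets borel" and F2m: "{u. hc (fst u) \<in> F2 (snd u)} \<in> sets borel"
    and F1: "\<And>l. F1 l \<subseteq> cball x (2 * \<rho>)" "\<And>l. \<bar>l\<bar> \<le> 50 * \<rho> \<Longrightarrow> vol (F1 l) \<le> ennreal K"
    and F2: "\<And>c'. norm (c' - (s - t / 2) *\<^sub>R \<nu>) \<le> 56 * \<rho> \<Longrightarrow> vol (F2 c') \<le> ennreal K"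
    and cov: "\<And>p l c'. p \<in> A \<Longrightarrow> p + hz (c l) + hz c' \<in> B \<Longrightarrow> p \<in> F1 l \<or> p + hz (c l) + hz c' \<in> F2 c'"
    and K: "K \<ge> 0"
  shows "vol A * vol B \<le> ennreal (count_const TYPE('k) * \<rho> ^ (2 * CARD('k) + 2) * K)"
proof -
  let ?D = "unit_ball_vol (2 * real CARD('k))"
  have D: "?D \<ge> 0" by simp
  define A' where "A' = hc -` A"
  define B' where "B' = hc -` B"
  define X' where "X' = hc -` cball x (2 * \<rho>)"
  define Y' where "Y' = hc -` cball y (2 * \<rho>)"
  define G1 where "G1 = {u. hc (fst u) \<in> F1 (snd u)}"
  define G2 where "G2 = {u. hc (fst u) \<in> F2 (snd u)}"
  define C' where "C' = cball ((s - t / 2) *\<^sub>R \<nu>) (56 * \<rho>)"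
  define I where "I = {- 50 * \<rho> .. 50 * \<rho>}"
  have ms: "A' \<in> sets borel" "B' \<in> sets borel" "X' \<in> sets borel" "Y' \<in> sets borel" "G1 \<in> sets borel" "G2 \<in> sets borel"
      "C' \<in> sets borel" "I \<in> sets borel"
    using A B F1m F2m hsets_closed[OF closed_cball, of x "2 * \<rho>"] hsets_closed[OF closed_cball, of y "2 * \<rho>"]
    by (simp_all add: A'_def B'_def X'_def Y'_def G1_def G2_def C'_def I_def hsets_def del: mem_cball)
  have ind_vol: "(\<integral>\<^sup>+ z. indicator G1 (z, l) \<partial>lborel) = vol (F1 l)" for l
  proof -
    have "(\<lambda>z. (z, l)) -` G1 \<inter> space borel \<in> sets borel"
      by (rule measurable_sets[OF _ ms(5)]) (intro borel_measurable_Pair borel_measurable_const, simp)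
    then have h: "F1 l \<in> hsets" by (simp add: hsets_def G1_def vimage_def)
    have "(\<integral>\<^sup>+ z. indicator G1 (z, l) \<partial>lborel) = (\<integral>\<^sup>+ z. indicator (hc -` F1 l) z \<partial>lborel)"
      by (intro nn_integral_cong) (simp add: G1_def indicator_def)
    then show ?thesis using vol_as_integral[OF h] by simp
  qed
  have ind_vol2: "(\<integral>\<^sup>+ z. indicator G2 (z, l) \<partial>lborel) = vol (F2 l)" for l
  proof -
    have "(\<lambda>z. (z, l)) -` G2 \<inter> space borel \<in> sets borel"
      by (rule measurable_sets[OF _ ms(6)]) (intro borel_measurable_Pair borel_measurable_const, simp)
    then have h: "F2 l \<in> hsets" by (simp add: hsets_def G2_def vimage_def)
    have "(\<integral>\<^sup>+ z. indicator G2 (z, l) \<partial>lborel) = (\<integral>\<^sup>+ z. indicator (hc -` F2 l) z \<partial>lborel)"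
      by (intro nn_integral_cong) (simp add: G2_def indicator_def)
    then show ?thesis using vol_as_integral[OF h] by simp
  qed
  let ?w = "\<lambda>z a l. mulc z a (heis_omega (c l) a / 2)"
  \<comment> \<open>The integrand \<open>f\<close> counts paths from \<open>A\<close> to \<open>B\<close>, and \<open>g1\<close> and \<open>g2\<close> those with exceptional start and end.\<close>
  define f where "f z a l = indicator A' z * (indicator B' (?w z a l) :: ennreal)" for z a l
  define g1 where "g1 z a l = indicator I l * indicator G1 (z, l) * (indicator Y' (?w z a l) :: ennreal)" for z a l
  define g2 where "g2 z a l = indicator C' (a - c l) * indicator G2 (?w z a l, a - c l) * (indicator X' z :: ennreal)" for z a l
  have fg: "f z a l \<le> g1 z a l + g2 z a l" for z a l
  proof (cases "z \<in> A' \<and> ?w z a l \<in> B'")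
    case True
    then have p: "hc z \<in> A" and p': "hc z + Heis a (heis_omega (c l) a / 2) \<in> B" by (simp_all add: A'_def B'_def hc_mulc)
    have pX: "hc z \<in> cball x (2 * \<rho>)" and pY: "hc z + Heis a (heis_omega (c l) a / 2) \<in> cball y (2 * \<rho>)"
      using p p' A B by blast+
    note r = two_point_range[OF pX pY]
    have "hc z \<in> F1 l \<or> hc z + hz (c l) + hz (a - c l) \<in> F2 (a - c l)"
      using cov[OF p, of l "a - c l"] p' by (simp only: add.assoc step_eq)
    then have "(z, l) \<in> G1 \<or> (?w z a l, a - c l) \<in> G2"
      by (simp only: G1_def G2_def mem_Collect_eq fst_conv snd_conv hc_mulc add.assoc step_eq)
    moreover have "l \<in> I" "a - c l \<in> C'" "z \<in> X'" "?w z a l \<in> Y'"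
      using r pX pY by (simp_all add: I_def C'_def X'_def Y'_def hc_mulc dist_norm norm_minus_commute abs_le_iff del: mem_cball)
        (simp_all add: dist_norm norm_minus_commute)
    ultimately show ?thesis using True by (auto simp: f_def g1_def g2_def)
  next
    case False
    then show ?thesis by (auto simp: f_def)
  qed
  have m1: "(\<lambda>u. g1 (fst u) (fst (snd u)) (snd (snd u))) \<in> borel_measurable borel"
    unfolding g1_def by (intro meas_intros ms) simp_all
  have m1': "(\<lambda>u. g1 z (fst u) (snd u)) \<in> borel_measurable borel" for z
    unfolding g1_def by (intro meas_intros ms) simp_all
  have m2: "(\<lambda>u. g2 (fst u) (fst (snd u)) (snd (snd u))) \<in> borel_measurable borel"
    unfolding g2_def by (intro meas_intros ms) simp_all
  have m2': "(\<lambda>u. g2 z (fst u) (snd u)) \<in> borel_measurable borel" for z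
    unfolding g2_def by (intro meas_intros ms) simp_all
  have int2: "(\<lambda>z. \<integral>\<^sup>+ a. \<integral>\<^sup>+ l. g z a l \<partial>lborel \<partial>lborel) \<in> borel_measurable lborel"
    if g: "(\<lambda>u. g (fst u) (fst (snd u)) (snd (snd u))) \<in> borel_measurable borel"
    for g :: "(real ^ ('k + 'k)) \<times> real \<Rightarrow> real ^ ('k + 'k) \<Rightarrow> real \<Rightarrow> ennreal"
  proof -
    have "(\<lambda>u. g (fst (fst u)) (snd (fst u)) (snd u)) \<in> borel_measurable borel"
      using measurable_compose[OF _ g, of "\<lambda>u. (fst (fst u), (snd (fst u), snd u))" borel]
      by (simp add: borel_measurable_Pair borel_measurable_fst' borel_measurable_snd')
    from borel_measurable_nn_integral_lborel[OF this]
    have "(\<lambda>u. \<integral>\<^sup>+ l. g (fst u) (snd u) l \<partial>lborel) \<in> borel_measurable borel" by simp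
    from borel_measurable_nn_integral_lborel[OF this] show ?thesis by simp
  qed
  have int1: "(\<lambda>a. \<integral>\<^sup>+ l. g z a l \<partial>lborel) \<in> borel_measurable lborel"
    if g: "(\<lambda>u. g z (fst u) (snd u)) \<in> borel_measurable borel"
    for z and g :: "(real ^ ('k + 'k)) \<times> real \<Rightarrow> real ^ ('k + 'k) \<Rightarrow> real \<Rightarrow> ennreal"
    using borel_measurable_nn_integral_lborel[OF g] by simp
  have int0: "(\<lambda>l. g z a l) \<in> borel_measurable lborel"
    if g: "(\<lambda>u. g z (fst u) (snd u)) \<in> borel_measurable borel"
    for z a and g :: "(real ^ ('k + 'k)) \<times> real \<Rightarrow> real ^ ('k + 'k) \<Rightarrow> real \<Rightarrow> ennreal"
    using measurable_compose[OF _ g, of "\<lambda>l. (a, l)" borel] by (simp add: borel_measurable_Pair)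
  have "vol A * vol B = (\<integral>\<^sup>+ z. indicator A' z * vol B \<partial>lborel)"
    using ms(1) by (simp add: nn_integral_multc vol_as_integral[OF A(1)] A'_def)
  also have "\<dots> \<le> (\<integral>\<^sup>+ z. ennreal (3 * t / 2) * (\<integral>\<^sup>+ a. \<integral>\<^sup>+ l. g1 z a l + g2 z a l \<partial>lborel \<partial>lborel) \<partial>lborel)"
  proof (rule nn_integral_mono)
    fix z
    show "indicator A' z * vol B \<le> ennreal (3 * t / 2) * (\<integral>\<^sup>+ a. \<integral>\<^sup>+ l. g1 z a l + g2 z a l \<partial>lborel \<partial>lborel)"
    proof (cases "z \<in> A'")
      case True
      then have "hc z \<in> cball x (2 * \<rho>)" using A by (auto simp: A'_def)
      from slice_lower[OF this B(2,1)]
      have "vol B \<le> ennreal (3 * t / 2) * (\<integral>\<^sup>+ a. \<integral>\<^sup>+ l. indicator B' (?w z a l) \<partial>lborel \<partial>lborel)" by (simp only: B'_def)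
      also have "\<dots> \<le> ennreal (3 * t / 2) * (\<integral>\<^sup>+ a. \<integral>\<^sup>+ l. g1 z a l + g2 z a l \<partial>lborel \<partial>lborel)"
      proof (intro mult_left_mono nn_integral_mono)
        fix a l show "indicator B' (?w z a l) \<le> g1 z a l + g2 z a l"
          using fg[of z a l] True by (simp add: f_def)
      qed simp
      finally show ?thesis using True by simp
    qed simp
  qed
  also have "\<dots> = ennreal (3 * t / 2) * ((\<integral>\<^sup>+ z. \<integral>\<^sup>+ a. \<integral>\<^sup>+ l. g1 z a l \<partial>lborel \<partial>lborel \<partial>lborel)
      + (\<integral>\<^sup>+ z. \<integral>\<^sup>+ a. \<integral>\<^sup>+ l. g2 z a l \<partial>lborel \<partial>lborel \<partial>lborel))"
    using int2[OF m1] int2[OF m2] int1[OF m1'] int1[OF m2'] int0[OF m1'] int0[OF m2']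
    by (simp add: nn_integral_add nn_integral_cmult)
  finally have main: "vol A * vol B \<le> ennreal (3 * t / 2) * ((\<integral>\<^sup>+ z. \<integral>\<^sup>+ a. \<integral>\<^sup>+ l. g1 z a l \<partial>lborel \<partial>lborel \<partial>lborel)
      + (\<integral>\<^sup>+ z. \<integral>\<^sup>+ a. \<integral>\<^sup>+ l. g2 z a l \<partial>lborel \<partial>lborel \<partial>lborel))" .
  \<comment> \<open>Paths with exceptional start: integrate over \<open>a\<close> first.\<close>
  have slab0: "slab \<ge> 0" using \<rho> by (simp add: slab_def)
  have "(\<integral>\<^sup>+ z. \<integral>\<^sup>+ a. \<integral>\<^sup>+ l. g1 z a l \<partial>lborel \<partial>lborel \<partial>lborel)
      \<le> (\<integral>\<^sup>+ z. \<integral>\<^sup>+ l. ennreal slab * (indicator I l * indicator G1 (z, l)) \<partial>lborel \<partial>lborel)"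
  proof (rule nn_integral_mono)
    fix z
    have "(\<integral>\<^sup>+ a. \<integral>\<^sup>+ l. g1 z a l \<partial>lborel \<partial>lborel) = (\<integral>\<^sup>+ l. \<integral>\<^sup>+ a. g1 z a l \<partial>lborel \<partial>lborel)"
      using nn_integral_lborel_swap[OF m1'] by simp
    also have "\<dots> \<le> (\<integral>\<^sup>+ l. ennreal slab * (indicator I l * indicator G1 (z, l)) \<partial>lborel)"
    proof (rule nn_integral_mono)
      fix l
      show "(\<integral>\<^sup>+ a. g1 z a l \<partial>lborel) \<le> ennreal slab * (indicator I l * indicator G1 (z, l))"
      proof (cases "(z, l) \<in> G1")
        case True
        then have zX: "hc z \<in> cball x (2 * \<rho>)" using F1(1)[of l] by (auto simp: G1_def simp del: mem_cball)
        let ?Z = "{a. hc z + Heis a (heis_omega (c l) a / 2) \<in> cball y (2 * \<rho>)}"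
        have "(\<lambda>a. ?w z a l) -` Y' \<inter> space borel \<in> sets borel"
          by (rule measurable_sets[OF _ ms(4)]) (intro meas_intros, simp_all)
        moreover have "(\<lambda>a. ?w z a l) -` Y' \<inter> space borel = ?Z"
          by (simp only: Y'_def vimage_def mem_Collect_eq hc_mulc space_borel Int_UNIV_right)
        ultimately have Z: "?Z \<in> sets borel" by simp
        have "(\<integral>\<^sup>+ a. g1 z a l \<partial>lborel) \<le> (\<integral>\<^sup>+ a. indicator I l * indicator ?Z a \<partial>lborel)"
          by (intro nn_integral_mono) (simp add: g1_def True Y'_def hc_mulc indicator_def)
        also have "\<dots> = indicator I l * emeasure lborel ?Z"
          using Z by (simp add: nn_integral_cmult del: mem_cball)
        also have "\<dots> \<le> indicator I l * ennreal slab" by (intro mult_left_mono slab_le[OF zX]) simp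
        finally show ?thesis using True by (simp add: mult.commute)
      qed (simp add: g1_def)
    qed
    finally show "(\<integral>\<^sup>+ a. \<integral>\<^sup>+ l. g1 z a l \<partial>lborel \<partial>lborel) \<le> (\<integral>\<^sup>+ l. ennreal slab * (indicator I l * indicator G1 (z, l)) \<partial>lborel)" .
  qed
  also have "\<dots> = (\<integral>\<^sup>+ l. \<integral>\<^sup>+ z. ennreal slab * (indicator I l * indicator G1 (z, l)) \<partial>lborel \<partial>lborel)"
  proof -
    have "(\<lambda>u. ennreal slab * (indicator I (snd u) * indicator G1 (fst u, snd u))) \<in> borel_measurable borel"
      by (intro meas_intros ms) simp_all
    from nn_integral_lborel_swap[OF this] show ?thesis by simp
  qed
  also have "\<dots> = (\<integral>\<^sup>+ l. ennreal slab * (indicator I l * vol (F1 l)) \<partial>lborel)"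
  proof (rule nn_integral_cong)
    fix l
    have "(\<lambda>z. indicator G1 (z, l) :: ennreal) \<in> borel_measurable lborel" by (simp, intro meas_intros ms) simp_all
    then show "(\<integral>\<^sup>+ z. ennreal slab * (indicator I l * indicator G1 (z, l)) \<partial>lborel) = ennreal slab * (indicator I l * vol (F1 l))"
      by (simp add: nn_integral_cmult ind_vol)
  qed
  also have "\<dots> \<le> (\<integral>\<^sup>+ l. ennreal slab * ennreal K * indicator I l \<partial>lborel)"
  proof (rule nn_integral_mono)
    fix l
    show "ennreal slab * (indicator I l * vol (F1 l)) \<le> ennreal slab * ennreal K * indicator I l"
    proof (cases "l \<in> I")
      case True
      then have "\<bar>l\<bar> \<le> 50 * \<rho>" by (auto simp: I_def)
      from F1(2)[OF this] True show ?thesis by (simp add: mult_left_mono)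
    qed simp
  qed
  also have "\<dots> = ennreal slab * ennreal K * emeasure lborel I" using ms(8) by (simp add: nn_integral_cmult)
  also have "\<dots> = ennreal (slab * K * (100 * \<rho>))"
    using \<rho> K slab0 by (simp add: I_def ennreal_mult)
  finally have T1: "(\<integral>\<^sup>+ z. \<integral>\<^sup>+ a. \<integral>\<^sup>+ l. g1 z a l \<partial>lborel \<partial>lborel \<partial>lborel) \<le> ennreal (slab * K * (100 * \<rho>))" .
  \<comment> \<open>Paths with exceptional end: pass to the end point and the second segment as variables, which
    preserves the measure, and integrate over \<open>l\<close> first.\<close>
  define h where "h z c' l = indicator C' c' * indicator G2 (z, c') * (indicator X' (mulc (mulc z (- c') 0) (- c l) 0) :: ennreal)" for z c' l
  have "(\<integral>\<^sup>+ z. \<integral>\<^sup>+ a. \<integral>\<^sup>+ l. g2 z a l \<partial>lborel \<partial>lborel \<partial>lborel) = (\<integral>\<^sup>+ z. \<integral>\<^sup>+ l. \<integral>\<^sup>+ a. g2 z a l \<partial>lborel \<partial>lborel \<partial>lborel)"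
    using nn_integral_lborel_swap[OF m2'] by simp
  also have "\<dots> = (\<integral>\<^sup>+ z. \<integral>\<^sup>+ l. \<integral>\<^sup>+ c'. g2 z (c l + c') l \<partial>lborel \<partial>lborel \<partial>lborel)"
  proof (rule nn_integral_cong, rule nn_integral_cong)
    fix z l
    have "(\<lambda>a. g2 z a l) \<in> borel_measurable borel" unfolding g2_def by (intro meas_intros ms) simp_all
    from nn_integral_translate[OF this, of "c l"]
    show "(\<integral>\<^sup>+ a. g2 z a l \<partial>lborel) = (\<integral>\<^sup>+ c'. g2 z (c l + c') l \<partial>lborel)" by simp
  qed
  also have "\<dots> = (\<integral>\<^sup>+ l. \<integral>\<^sup>+ z. \<integral>\<^sup>+ c'. g2 z (c l + c') l \<partial>lborel \<partial>lborel \<partial>lborel)"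
  proof -
    have "(\<lambda>u. g2 (fst (fst u)) (c (snd (fst u)) + snd u) (snd (fst u))) \<in> borel_measurable borel"
      unfolding g2_def by (intro meas_intros ms) simp_all
    from nn_integral_lborel_swap[OF borel_measurable_nn_integral_lborel[OF this]]
    show ?thesis by simp
  qed
  also have "\<dots> = (\<integral>\<^sup>+ l. \<integral>\<^sup>+ c'. \<integral>\<^sup>+ z. g2 z (c l + c') l \<partial>lborel \<partial>lborel \<partial>lborel)"
  proof (rule nn_integral_cong)
    fix l
    have "(\<lambda>u. g2 (fst u) (c l + snd u) l) \<in> borel_measurable borel"
      unfolding g2_def by (intro meas_intros ms) simp_all
    from nn_integral_lborel_swap[OF this]
    show "(\<integral>\<^sup>+ z. \<integral>\<^sup>+ c'. g2 z (c l + c') l \<partial>lborel \<partial>lborel) = (\<integral>\<^sup>+ c'. \<integral>\<^sup>+ z. g2 z (c l + c') l \<partial>lborel \<partial>lborel)"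
      by simp
  qed
  also have "\<dots> = (\<integral>\<^sup>+ l. \<integral>\<^sup>+ c'. \<integral>\<^sup>+ z. h z c' l \<partial>lborel \<partial>lborel \<partial>lborel)"
  proof (rule nn_integral_cong, rule nn_integral_cong)
    fix l c'
    have hm: "(\<lambda>z. h z c' l) \<in> borel_measurable borel" unfolding h_def by (intro meas_intros ms) simp_all
    have "g2 z (c l + c') l = h (?w z (c l + c') l) c' l" for z
    proof -
      have "hc (mulc (mulc (?w z (c l + c') l) (- c') 0) (- c l) 0) = hc z + (hz (c l) + hz (c l + c' - c l)) + hz (- c') + hz (- c l)"
        by (simp only: hc_mulc step_eq[symmetric]) (simp only: hz_def)
      also have "c l + c' - c l = c'" by simp
      also have "hc z + (hz (c l) + hz c') + hz (- c') + hz (- c l) = hc z"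
        by (simp only: uminus_hz[symmetric] add.assoc right_minus add_0_right add_minus_cancel)
      finally have "mulc (mulc (?w z (c l + c') l) (- c') 0) (- c l) 0 = z" by (rule injD[OF bij_is_inj[OF bij_hc]])
      then show ?thesis by (simp add: g2_def h_def)
    qed
    then have "(\<integral>\<^sup>+ z. g2 z (c l + c') l \<partial>lborel) = (\<integral>\<^sup>+ z. h (?w z (c l + c') l) c' l \<partial>lborel)" by simp
    also have "\<dots> = (\<integral>\<^sup>+ z. h z c' l \<partial>lborel)" by (rule nn_integral_right_translate[OF hm])
    finally show "(\<integral>\<^sup>+ z. g2 z (c l + c') l \<partial>lborel) = (\<integral>\<^sup>+ z. h z c' l \<partial>lborel)" .
  qed
  also have "\<dots> = (\<integral>\<^sup>+ c'. \<integral>\<^sup>+ l. \<integral>\<^sup>+ z. h z c' l \<partial>lborel \<partial>lborel \<partial>lborel)"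
  proof -
    have "(\<lambda>u. h (snd u) (snd (fst u)) (fst (fst u))) \<in> borel_measurable borel"
      unfolding h_def by (intro meas_intros ms) simp_all
    from nn_integral_lborel_swap[OF borel_measurable_nn_integral_lborel[OF this]]
    show ?thesis by simp
  qed
  also have "\<dots> = (\<integral>\<^sup>+ c'. \<integral>\<^sup>+ z. \<integral>\<^sup>+ l. h z c' l \<partial>lborel \<partial>lborel \<partial>lborel)"
  proof (rule nn_integral_cong)
    fix c'
    have "(\<lambda>u. h (snd u) c' (fst u)) \<in> borel_measurable borel"
      unfolding h_def by (intro meas_intros ms) simp_all
    from nn_integral_lborel_swap[OF this]
    show "(\<integral>\<^sup>+ l. \<integral>\<^sup>+ z. h z c' l \<partial>lborel \<partial>lborel) = (\<integral>\<^sup>+ z. \<integral>\<^sup>+ l. h z c' l \<partial>lborel \<partial>lborel)" by simp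
  qed
  also have "\<dots> \<le> (\<integral>\<^sup>+ c'. \<integral>\<^sup>+ z. ennreal (32 * \<rho> / 2 ^ i) * (indicator C' c' * indicator G2 (z, c')) \<partial>lborel \<partial>lborel)"
  proof (intro nn_integral_mono)
    fix c' z
    let ?L = "{l. hc z + hz (- c') + hz (- c l) \<in> cball x (2 * \<rho>)}"
    have "(\<lambda>l. mulc (mulc z (- c') 0) (- c l) 0) -` X' \<inter> space borel \<in> sets borel"
      by (rule measurable_sets[OF _ ms(3)]) (intro meas_intros, simp_all)
    moreover have "(\<lambda>l. mulc (mulc z (- c') 0) (- c l) 0) -` X' \<inter> space borel = ?L"
      by (simp only: X'_def vimage_def mem_Collect_eq hc_mulc hz_def space_borel Int_UNIV_right)
    ultimately have L: "?L \<in> sets borel" by simp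
    have "(\<integral>\<^sup>+ l. h z c' l \<partial>lborel) = (\<integral>\<^sup>+ l. indicator C' c' * indicator G2 (z, c') * indicator ?L l \<partial>lborel)"
      by (intro nn_integral_cong) (simp add: h_def X'_def hc_mulc hz_def indicator_def)
    also have "\<dots> = indicator C' c' * indicator G2 (z, c') * emeasure lborel ?L"
      using L by (simp add: nn_integral_cmult del: mem_cball)
    also have "\<dots> \<le> indicator C' c' * indicator G2 (z, c') * ennreal (32 * \<rho> / 2 ^ i)"
      by (intro mult_left_mono lam_le) simp
    finally show "(\<integral>\<^sup>+ l. h z c' l \<partial>lborel) \<le> ennreal (32 * \<rho> / 2 ^ i) * (indicator C' c' * indicator G2 (z, c'))"
      by (simp add: mult.commute)
  qed
  also have "\<dots> = (\<integral>\<^sup>+ c'. ennreal (32 * \<rho> / 2 ^ i) * (indicator C' c' * vol (F2 c')) \<partial>lborel)"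
  proof (rule nn_integral_cong)
    fix c'
    have "(\<lambda>z. indicator G2 (z, c') :: ennreal) \<in> borel_measurable lborel" by (simp, intro meas_intros ms) simp_all
    then show "(\<integral>\<^sup>+ z. ennreal (32 * \<rho> / 2 ^ i) * (indicator C' c' * indicator G2 (z, c')) \<partial>lborel) = ennreal (32 * \<rho> / 2 ^ i) * (indicator C' c' * vol (F2 c'))"
      by (simp add: nn_integral_cmult ind_vol2)
  qed
  also have "\<dots> \<le> (\<integral>\<^sup>+ c'. ennreal (32 * \<rho> / 2 ^ i) * ennreal K * indicator C' c' \<partial>lborel)"
  proof (rule nn_integral_mono)
    fix c'
    show "ennreal (32 * \<rho> / 2 ^ i) * (indicator C' c' * vol (F2 c')) \<le> ennreal (32 * \<rho> / 2 ^ i) * ennreal K * indicator C' c'"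
    proof (cases "c' \<in> C'")
      case True
      then have "norm (c' - (s - t / 2) *\<^sub>R \<nu>) \<le> 56 * \<rho>" by (simp add: C'_def dist_norm norm_minus_commute)
      from F2[OF this] True show ?thesis by (simp add: mult_left_mono)
    qed simp
  qed
  also have "\<dots> = ennreal (32 * \<rho> / 2 ^ i) * ennreal K * emeasure lborel C'" using ms(7) by (simp add: nn_integral_cmult)
  also have "emeasure lborel C' = ennreal (?D * (56 * \<rho>) ^ (2 * CARD('k)))"
    unfolding C'_def using \<rho> by (subst emeasure_cball) (simp_all only: DIM_hor, simp_all)
  also have "ennreal (32 * \<rho> / 2 ^ i) * ennreal K * ennreal (?D * (56 * \<rho>) ^ (2 * CARD('k))) =
      ennreal (32 * \<rho> / 2 ^ i * K * (?D * (56 * \<rho>) ^ (2 * CARD('k))))"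
  proof -
    have n1: "0 \<le> 32 * \<rho> / 2 ^ i" and n3: "0 \<le> ?D * (56 * \<rho>) ^ (2 * CARD('k))" using \<rho> by simp_all
    show ?thesis by (simp only: ennreal_mult[OF mult_nonneg_nonneg[OF n1 K] n3] ennreal_mult[OF n1 K])
  qed
  finally have T2: "(\<integral>\<^sup>+ z. \<integral>\<^sup>+ a. \<integral>\<^sup>+ l. g2 z a l \<partial>lborel \<partial>lborel \<partial>lborel)
    \<le> ennreal (32 * \<rho> / 2 ^ i * K * (?D * (56 * \<rho>) ^ (2 * CARD('k))))" .
  have nn: "0 \<le> slab * K * (100 * \<rho>)" "0 \<le> 32 * \<rho> / 2 ^ i * K * (?D * (56 * \<rho>) ^ (2 * CARD('k)))"
    using \<rho> K slab0 by auto
  have "vol A * vol B \<le> ennreal (3 * t / 2) * (ennreal (slab * K * (100 * \<rho>)) + ennreal (32 * \<rho> / 2 ^ i * K * (?D * (56 * \<rho>) ^ (2 * CARD('k)))))"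
    by (rule order_trans[OF main]) (intro mult_left_mono add_mono T1 T2, simp)
  also have "\<dots> = ennreal (3 * t / 2 * (slab * K * (100 * \<rho>) + 32 * \<rho> / 2 ^ i * K * (?D * (56 * \<rho>) ^ (2 * CARD('k)))))"
    using nn t_pos by (simp only: ennreal_plus[OF nn, symmetric]) (intro ennreal_mult[symmetric], auto)
  also have "3 * t / 2 * (slab * K * (100 * \<rho>) + 32 * \<rho> / 2 ^ i * K * (?D * (56 * \<rho>) ^ (2 * CARD('k)))) =
    count_const TYPE('k) * \<rho> ^ (2 * CARD('k) + 2) * K"
  proof -
    define P :: real where "P = 2 ^ (i - 5)"
    have P: "P > 0" by (simp add: P_def)
    have "(2::real) ^ i = 2 ^ (5 + (i - 5))" using i by simp
    then have i2: "(2::real) ^ i = 32 * P" by (simp only: power_add P_def) simp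
    show ?thesis
      unfolding count_const_def t_def slab_def i2 P_def[symmetric] power_mult_distrib
      using P by (simp add: field_simps power_add power2_eq_square)
  qed
  finally show ?thesis .
qed

end

section \<open>Two aligned crossing points force a non-monotone pattern\<close>

lemma sets_vimage_moving:
  assumes X: "X \<in> hsets" and g: "g \<in> borel_measurable borel"
  shows "{u. hc (fst u) + hz (g (snd u)) \<in> X} \<in> sets borel"
proof -
  have "(\<lambda>u. mulc (fst u) (g (snd u)) 0) -` (hc -` X) \<inter> space borel \<in> sets borel"
  proof (rule measurable_sets)
    show "(\<lambda>u. mulc (fst u) (g (snd u)) 0) \<in> borel \<rightarrow>\<^sub>M borel"
      by (intro measurable_mulc borel_measurable_fst' borel_measurable_const measurable_compose[OF _ g] borel_measurable_snd') simp_all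
  qed (use X in \<open>simp add: hsets_def\<close>)
  also have "(\<lambda>u. mulc (fst u) (g (snd u)) 0) -` (hc -` X) \<inter> space borel = {u. hc (fst u) + hz (g (snd u)) \<in> X}"
    by (simp only: vimage_def mem_Collect_eq hc_mulc hz_def space_borel Int_UNIV_right)
  finally show ?thesis .
qed

lemma sets_vimage_fixed:
  fixes X :: "'k::finite heis set"
  assumes X: "X \<in> hsets"
  shows "{u :: ((real ^ ('k + 'k)) \<times> real) \<times> 'b::euclidean_space. hc (fst u) \<in> X} \<in> sets borel"
proof -
  have "(\<lambda>u :: ((real ^ ('k + 'k)) \<times> real) \<times> 'b. fst u) -` (hc -` X) \<inter> space borel \<in> sets borel"
    by (rule measurable_sets[OF borel_measurable_fst']) (use X in \<open>simp_all add: hsets_def\<close>)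
  then show ?thesis by (simp add: vimage_def)
qed

lemma nonmonoI:
  assumes "m1 < m2" "m2 < m3" "m3 \<le> N"
    "(q + hz (real m1 *\<^sub>R v) \<in> A) \<noteq> (q + hz (real m2 *\<^sub>R v) \<in> A)"
    "(q + hz (real m2 *\<^sub>R v) \<in> A) \<noteq> (q + hz (real m3 *\<^sub>R v) \<in> A)"
  shows "q \<in> nonmono A N v"
  using assms unfolding nonmono_def by blast

context aligned_pair
begin

lemma dist_xy: "dist x y \<le> 3 * t"
proof -
  have "norm (hor (- x + y)) \<le> \<bar>s\<bar> + norm w" unfolding hor_d using norm_triangle_ineq[of "s *\<^sub>R \<nu>" w] \<nu> by simp
  then have 1: "norm (hor (- x + y)) \<le> 2 * t + 2 * \<rho>" using s w t_pos unfolding t_def[symmetric] by linarith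
  have "4 * \<rho> * t \<le> (t / 4)\<^sup>2"
  proof -
    have "4 * \<rho> * t \<le> t / 32 * t" using t_ge t_pos by (intro mult_right_mono) auto
    also have "\<dots> \<le> (t / 4)\<^sup>2" using t_pos by (simp add: power2_eq_square field_simps)
    finally show ?thesis .
  qed
  then have "\<bar>ver (- x + y)\<bar> \<le> (t / 4)\<^sup>2" using ver_d by (simp add: t_def)
  then have "sqrt \<bar>ver (- x + y)\<bar> \<le> t / 4" using t_pos by (intro real_le_lsqrt) auto
  moreover have "dist x y = koranyi (- x + y)" using dist_heis_def[of y x] by (simp add: dist_commute)
  ultimately show ?thesis using koranyi_le_length[of "- x + y"] 1 t_ge \<rho> by linarith
qed

end

context separation
begin

definition upset :: "'k heis \<Rightarrow> real \<Rightarrow> real ^ ('k + 'k) \<Rightarrow> 'k heis set" where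
  "upset z \<rho> \<nu> = {p \<in> cball z (2 * \<rho>). p \<in> \<Omega> \<and> p + hz (\<rho> *\<^sub>R \<nu>) \<notin> \<Omega>}"

lemma hsets_upset: "upset z \<rho> \<nu> \<in> hsets"
proof -
  have "upset z \<rho> \<nu> = cball z (2 * \<rho>) \<inter> (\<Omega> - {p. p + hz (\<rho> *\<^sub>R \<nu>) \<in> \<Omega>})" by (auto simp: upset_def)
  then show ?thesis by (simp add: hsets_Int hsets_Diff hsets_closed \<Omega>_sets hsets_vimage_right)
qed

definition err_const :: real where
  "err_const = 15 * 21 ^ (2 * CARD('k) + 1) * hit_const TYPE('k) * Cu"

lemma err_const_pos: "err_const > 0"
  using hit_const_pos[where 'k = 'k] Cu_pos by (simp add: err_const_def)

lemma vol_direction_change: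
  assumes \<nu>: "norm \<nu> = 1" and \<rho>: "\<rho> > 0" and \<delta>: "0 \<le> \<delta>" "\<delta> \<le> 1" and v: "norm (v - \<rho> *\<^sub>R \<nu>) \<le> \<delta> * \<rho>"
  shows "vol {q \<in> cball z (2 * \<rho>). (q + hz (\<rho> *\<^sub>R \<nu>) \<in> \<Omega>) \<noteq> (q + hz v \<in> \<Omega>)}
    \<le> ennreal (err_const * sqrt \<delta> * \<rho> ^ (2 * CARD('k) + 2))"
proof -
  let ?h = "hit_const TYPE('k)" and ?n = "2 * CARD('k) + 1"
  have h: "?h > 0" by (rule hit_const_pos)
  define g where "g = - hz (\<rho> *\<^sub>R \<nu>) + hz v"
  have kg: "koranyi g \<le> 3 * sqrt \<delta> * \<rho>"
    unfolding g_def using \<nu> \<rho> v by (intro koranyi_hz_diff_le \<delta>) auto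
  have sd: "sqrt \<delta> \<le> 1" using \<delta> by simp
  have kg3: "koranyi g \<le> 3 * \<rho>"
  proof -
    have "3 * sqrt \<delta> * \<rho> \<le> 3 * 1 * \<rho>" using sd \<rho> by (intro mult_right_mono mult_left_mono) auto
    with kg show ?thesis by simp
  qed
  have "{q \<in> cball z (2 * \<rho>). (q + hz (\<rho> *\<^sub>R \<nu>) \<in> \<Omega>) \<noteq> (q + hz v \<in> \<Omega>)}
    \<subseteq> {q. q + hz (\<rho> *\<^sub>R \<nu>) \<in> {q \<in> cball z (3 * \<rho>). (q \<in> \<Omega>) \<noteq> (q + g \<in> \<Omega>)}}"
  proof
    fix q assume q: "q \<in> {q \<in> cball z (2 * \<rho>). (q + hz (\<rho> *\<^sub>R \<nu>) \<in> \<Omega>) \<noteq> (q + hz v \<in> \<Omega>)}"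
    have "q + hz (\<rho> *\<^sub>R \<nu>) + g = q + hz v" by (simp add: g_def add.assoc)
    moreover have "dist q (q + hz (\<rho> *\<^sub>R \<nu>)) = \<rho>" using \<nu> \<rho> by simp
    then have "dist z (q + hz (\<rho> *\<^sub>R \<nu>)) \<le> 3 * \<rho>" using q dist_triangle[of z "q + hz (\<rho> *\<^sub>R \<nu>)" q] by simp
    ultimately show "q \<in> {q. q + hz (\<rho> *\<^sub>R \<nu>) \<in> {q \<in> cball z (3 * \<rho>). (q \<in> \<Omega>) \<noteq> (q + g \<in> \<Omega>)}}"
      using q by simp
  qed
  then have "vol {q \<in> cball z (2 * \<rho>). (q + hz (\<rho> *\<^sub>R \<nu>) \<in> \<Omega>) \<noteq> (q + hz v \<in> \<Omega>)}
    \<le> vol {q. q + hz (\<rho> *\<^sub>R \<nu>) \<in> {q \<in> cball z (3 * \<rho>). (q \<in> \<Omega>) \<noteq> (q + g \<in> \<Omega>)}}" by (rule vol_mono)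
  also have "\<dots> \<le> ennreal (5 * ?h * Cu * koranyi g * (3 * \<rho> + 6 * koranyi g) ^ ?n)"
    unfolding vol_right using \<rho> by (intro vol_change) simp
  also have "\<dots> \<le> ennreal (5 * ?h * Cu * (3 * sqrt \<delta> * \<rho>) * (21 * \<rho>) ^ ?n)"
    using h Cu_pos kg kg3 \<rho> \<delta> by (intro ennreal_leI mult_mono power_mono mult_left_mono) auto
  also have "5 * ?h * Cu * (3 * sqrt \<delta> * \<rho>) * (21 * \<rho>) ^ ?n = err_const * sqrt \<delta> * \<rho> ^ (2 * CARD('k) + 2)"
    by (simp add: err_const_def power_mult_distrib mult_ac)
  finally show ?thesis .
qed

text \<open>
  Consider a path from \<open>p\<close> near \<open>x\<close> via the corner \<open>P = p + hz (c l)\<close> to \<open>p' = P + hz c'\<close> near \<open>y\<close>, where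
  \<open>p\<close> and \<open>p'\<close> lie in the two upsets. Cut each segment into steps \<open>v\<close> of length about \<open>\<rho>\<close>. If \<open>P \<in> \<Omega>\<close>,
  then \<open>p, p + v, P\<close> lie inside, outside and inside \<open>\<Omega>\<close>; if \<open>P \<notin> \<Omega>\<close>, then \<open>P, p', p' + v\<close> lie outside,
  inside and outside. This supposes that \<open>p + v\<close> and \<open>p' + v\<close> lie on the same side as \<open>p + \<rho> \<nu>\<close> and
  \<open>p' + \<rho> \<nu>\<close>; the exceptions are few by \<open>vol_direction_change\<close>. If non-monotone points were rare for all directions \<open>v\<close>, both kinds of
  exceptional set would be small, and \<open>two_point_counting\<close> would bound the product of the upsets.
\<close>

lemma aligned_crossings_nonmono:
  assumes ap: "aligned_pair x y \<nu> w \<rho> s i"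
    and small: "count_const TYPE('k) * (err_const * sqrt (120 / 2 ^ i) + \<kappa>) < \<epsilon>\<^sup>2" and \<kappa>: "\<kappa> \<ge> 0" and \<epsilon>: "\<epsilon> \<ge> 0"
    and vx: "ennreal (\<epsilon> * \<rho> ^ (2 * CARD('k) + 2)) \<le> vol (upset x \<rho> \<nu>)"
    and vy: "ennreal (\<epsilon> * \<rho> ^ (2 * CARD('k) + 2)) \<le> vol (upset y \<rho> \<nu>)"
  shows "\<exists>v. norm (v - \<rho> *\<^sub>R \<nu>) \<le> 120 / 2 ^ i * \<rho> \<and>
     ennreal (\<kappa> * \<rho> ^ (2 * CARD('k) + 2)) < vol (nonmono \<Omega> (2 ^ (i + 1)) v \<inter> cball x (10 * (2 ^ i * \<rho>)))"
proof (rule ccontr)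
  assume no: "\<not> ?thesis"
  interpret aligned_pair x y \<nu> w \<rho> s i by (rule ap)
  let ?Q = "2 * CARD('k) + 2"
  define \<delta> :: real where "\<delta> = 120 / 2 ^ i"
  have "(2::real) ^ 7 \<le> 2 ^ i" using i by (intro power_increasing) auto
  then have \<delta>: "0 \<le> \<delta>" "\<delta> \<le> 1" by (simp_all add: \<delta>_def field_simps)
  let ?M = "(2::nat) ^ (i + 1)"
  have no': "vol (nonmono \<Omega> ?M v \<inter> cball x (10 * t)) \<le> ennreal (\<kappa> * \<rho> ^ ?Q)" if "norm (v - \<rho> *\<^sub>R \<nu>) \<le> \<delta> * \<rho>" for v
  proof (rule ccontr)
    assume "\<not> ?thesis"
    then have "ennreal (\<kappa> * \<rho> ^ ?Q) < vol (nonmono \<Omega> ?M v \<inter> cball x (10 * t))" by (simp only: not_le)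
    with that have "norm (v - \<rho> *\<^sub>R \<nu>) \<le> 120 / 2 ^ i * \<rho> \<and>
        ennreal (\<kappa> * \<rho> ^ ?Q) < vol (nonmono \<Omega> ?M v \<inter> cball x (10 * (2 ^ i * \<rho>)))"
      unfolding \<delta>_def t_def by (intro conjI)
    from notE[OF no exI, OF this] show False .
  qed
  define K where "K = (err_const * sqrt \<delta> + \<kappa>) * \<rho> ^ ?Q"
  have e0: "0 \<le> err_const * sqrt \<delta> * \<rho> ^ ?Q" "0 \<le> \<kappa> * \<rho> ^ ?Q" using err_const_pos \<delta> \<rho> \<kappa> by simp_all
  have K0: "K \<ge> 0" using e0 by (simp add: K_def distrib_right del: power_Suc)
  have Kb: "vol X \<le> ennreal K"
    if "X \<subseteq> {q \<in> cball z (2 * \<rho>). (q + hz (\<rho> *\<^sub>R \<nu>) \<in> \<Omega>) \<noteq> (q + hz v \<in> \<Omega>)} \<union> Y"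
      "norm (v - \<rho> *\<^sub>R \<nu>) \<le> \<delta> * \<rho>" "vol Y \<le> ennreal (\<kappa> * \<rho> ^ ?Q)" for X Y z v
  proof -
    have "vol X \<le> vol {q \<in> cball z (2 * \<rho>). (q + hz (\<rho> *\<^sub>R \<nu>) \<in> \<Omega>) \<noteq> (q + hz v \<in> \<Omega>)} + vol Y"
      by (rule order_trans[OF vol_mono[OF that(1)] vol_Un_le])
    also have "\<dots> \<le> ennreal (err_const * sqrt \<delta> * \<rho> ^ ?Q) + ennreal (\<kappa> * \<rho> ^ ?Q)"
      by (intro add_mono vol_direction_change[OF \<nu> \<rho> \<delta> that(2)] that(3))
    also have "\<dots> = ennreal K" unfolding K_def distrib_right by (rule ennreal_plus[OF e0, symmetric])
    finally show ?thesis .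
  qed
  \<comment> \<open>The first segment consists of \<open>N\<close> steps, as \<open>t / 2 = N \<rho>\<close>.\<close>
  define N where "N = (2::nat) ^ (i - 1)"
  have N2: "2 * real N = 2 ^ i" using i by (cases i) (simp_all add: N_def)
  have Nt: "real N * \<rho> = t / 2" using N2 by (simp add: t_def field_simps)
  have N1: "1 < N"
  proof -
    have "(2::nat) ^ 1 \<le> 2 ^ (i - 1)" using i by (intro power_increasing) auto
    then show ?thesis by (simp add: N_def)
  qed
  have NM: "N \<le> ?M" unfolding N_def by (intro power_increasing) auto
  \<comment> \<open>The second segment has length about \<open>s - t / 2\<close>. Rounding the number of its steps to an integer
    changes the step by a relative error of order \<open>1 / N\<close>. The pattern needs one further step beyond \<open>p'\<close>.\<close>
  define N' where "N' = nat \<lfloor>(s - t / 2) / \<rho>\<rfloor>"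
  have sr: "real N \<le> (s - t / 2) / \<rho>" "(s - t / 2) / \<rho> \<le> 3 * real N"
    using s Nt \<rho> unfolding t_def[symmetric] by (simp_all add: pos_le_divide_eq pos_divide_le_eq)
  have N'1: "N \<le> N'" unfolding N'_def using sr(1) by (simp add: le_nat_floor)
  have N'2: "real N' \<le> (s - t / 2) / \<rho>" "(s - t / 2) / \<rho> < real N' + 1"
    using sr(1) N1 unfolding N'_def by (auto simp: of_nat_floor)
  have N'M: "N' + 1 \<le> ?M"
  proof -
    have "real N' \<le> 3 * real N" using N'2 sr by linarith
    then have "N' \<le> 3 * N" by linarith
    moreover have "?M = 4 * N" using i by (cases i) (simp_all add: N_def)
    ultimately show ?thesis using N1 by simp
  qed
  have N'0: "real N' > 0" using N'1 N1 by simp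
  define F1 where "F1 l = {p \<in> cball x (2 * \<rho>). p \<in> \<Omega> \<and> p + hz (\<rho> *\<^sub>R \<nu>) \<notin> \<Omega> \<and>
     (p + hz (c l /\<^sub>R real N) \<in> \<Omega> \<or> p + hz (c l) \<in> \<Omega>)}" for l
  define F2 where "F2 c' = {p \<in> cball y (2 * \<rho>). p \<in> \<Omega> \<and> p + hz (\<rho> *\<^sub>R \<nu>) \<notin> \<Omega> \<and>
     (p + hz (c' /\<^sub>R real N') \<in> \<Omega> \<or> p + hz (- c') \<notin> \<Omega>)}" for c'
  have F1b: "vol (F1 l) \<le> ennreal K" if l: "\<bar>l\<bar> \<le> 50 * \<rho>" for l
  proof (rule Kb)
    let ?v = "c l /\<^sub>R real N"
    have Nv: "real N *\<^sub>R ?v = c l" using N1 by simp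
    show "F1 l \<subseteq> {q \<in> cball x (2 * \<rho>). (q + hz (\<rho> *\<^sub>R \<nu>) \<in> \<Omega>) \<noteq> (q + hz ?v \<in> \<Omega>)} \<union> (nonmono \<Omega> ?M ?v \<inter> cball x (10 * t))"
    proof
      fix p assume p: "p \<in> F1 l"
      show "p \<in> {q \<in> cball x (2 * \<rho>). (q + hz (\<rho> *\<^sub>R \<nu>) \<in> \<Omega>) \<noteq> (q + hz ?v \<in> \<Omega>)} \<union> (nonmono \<Omega> ?M ?v \<inter> cball x (10 * t))"
      proof (cases "p + hz ?v \<in> \<Omega>")
        case True
        with p show ?thesis by (auto simp: F1_def)
      next
        case False
        with p have "p + hz (c l) \<in> \<Omega>" "p \<in> \<Omega>" by (auto simp: F1_def)
        then have "p \<in> nonmono \<Omega> ?M ?v"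
          using False N1 NM by (intro nonmonoI[of 0 1 N]) (simp_all only: Nv, simp_all)
        moreover have "dist x p \<le> 10 * t" using p t_ge \<rho> by (auto simp: F1_def)
        ultimately show ?thesis by simp
      qed
    qed
    have "?v - \<rho> *\<^sub>R \<nu> = (l / real N) *\<^sub>R \<mu>"
    proof -
      have "real N *\<^sub>R (?v - \<rho> *\<^sub>R \<nu>) = real N *\<^sub>R ((l / real N) *\<^sub>R \<mu>)"
        using N1 Nt by (simp add: scaleR_diff_right c_def)
      then show ?thesis using N1 by (simp only: scaleR_cancel_left) simp
    qed
    then have "norm (?v - \<rho> *\<^sub>R \<nu>) = \<bar>l\<bar> / real N" using \<nu> N1 by simp
    also have "\<dots> \<le> 50 * \<rho> / real N" using l N1 by (intro divide_right_mono) auto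
    also have "\<dots> = 100 * \<rho> / 2 ^ i" using N2 N1 by (simp add: field_simps)
    also have "\<dots> \<le> \<delta> * \<rho>" using \<rho> by (simp add: \<delta>_def divide_right_mono)
    finally show nv: "norm (?v - \<rho> *\<^sub>R \<nu>) \<le> \<delta> * \<rho>" .
    show "vol (nonmono \<Omega> ?M ?v \<inter> cball x (10 * t)) \<le> ennreal (\<kappa> * \<rho> ^ ?Q)" by (rule no'[OF nv])
  qed
  note xy = dist_xy
  have F2b: "vol (F2 c') \<le> ennreal K" if c': "norm (c' - (s - t / 2) *\<^sub>R \<nu>) \<le> 56 * \<rho>" for c'
  proof (rule Kb)
    let ?v = "c' /\<^sub>R real N'"
    let ?Y = "{p. p + hz (- c') \<in> nonmono \<Omega> ?M ?v \<inter> cball x (10 * t)}"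
    have Nv: "real N' *\<^sub>R ?v = c'" using N'0 by simp
    have nc: "norm c' \<le> 2 * t"
    proof -
      have "norm c' \<le> norm (c' - (s - t / 2) *\<^sub>R \<nu>) + norm ((s - t / 2) *\<^sub>R \<nu>)"
        using norm_triangle_ineq[of "c' - (s - t / 2) *\<^sub>R \<nu>" "(s - t / 2) *\<^sub>R \<nu>"] by simp
      also have "norm ((s - t / 2) *\<^sub>R \<nu>) = \<bar>s - t / 2\<bar>" using \<nu> by simp
      finally show ?thesis using c' s t_ge \<rho> unfolding t_def[symmetric] by linarith
    qed
    show "F2 c' \<subseteq> {q \<in> cball y (2 * \<rho>). (q + hz (\<rho> *\<^sub>R \<nu>) \<in> \<Omega>) \<noteq> (q + hz ?v \<in> \<Omega>)} \<union> ?Y"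
    proof
      fix p assume p: "p \<in> F2 c'"
      show "p \<in> {q \<in> cball y (2 * \<rho>). (q + hz (\<rho> *\<^sub>R \<nu>) \<in> \<Omega>) \<noteq> (q + hz ?v \<in> \<Omega>)} \<union> ?Y"
      proof (cases "p + hz ?v \<in> \<Omega>")
        case True
        with p show ?thesis by (auto simp: F2_def)
      next
        case False
        with p have p2: "p + hz (- c') \<notin> \<Omega>" "p \<in> \<Omega>" by (auto simp: F2_def)
        have b: "p + hz (- c') + hz (real N' *\<^sub>R ?v) = p" unfolding Nv by (simp add: add.assoc flip: uminus_hz)
        have b1: "p + hz (- c') + hz (real (N' + 1) *\<^sub>R ?v) = p + hz ?v"
        proof -
          have "hz (real (N' + 1) *\<^sub>R ?v) = hz (real N' *\<^sub>R ?v) + hz ?v"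
            using hz_add_scaleR[of "real N'" ?v 1] by (simp only: scaleR_one of_nat_add of_nat_1)
          then show ?thesis using b by (simp only: add.assoc[symmetric])
        qed
        have "p + hz (- c') \<in> nonmono \<Omega> ?M ?v"
          using p2 False N'1 N1 N'M by (intro nonmonoI[of 0 N' "N' + 1"]) (simp_all only: b b1, simp_all)
        moreover have "dist x (p + hz (- c')) \<le> 10 * t"
        proof -
          have "dist y p \<le> 2 * \<rho>" using p by (auto simp: F2_def)
          moreover have "dist p (p + hz (- c')) \<le> 2 * t" using nc by simp
          ultimately show ?thesis
            using xy dist_triangle[of x "p + hz (- c')" p] dist_triangle[of x p y] t_ge \<rho> by linarith
        qed
        ultimately show ?thesis by simp
      qed
    qed
    have "?v - \<rho> *\<^sub>R \<nu> = (1 / real N') *\<^sub>R ((c' - (s - t / 2) *\<^sub>R \<nu>) + (s - t / 2 - real N' * \<rho>) *\<^sub>R \<nu>)"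
    proof -
      have "(c' - (s - t / 2) *\<^sub>R \<nu>) + (s - t / 2 - real N' * \<rho>) *\<^sub>R \<nu> = c' - (real N' * \<rho>) *\<^sub>R \<nu>"
        by (simp add: scaleR_diff_left)
      moreover have "(1 / real N') *\<^sub>R (c' - (real N' * \<rho>) *\<^sub>R \<nu>) = ?v - \<rho> *\<^sub>R \<nu>"
        using N'0 by (simp add: scaleR_diff_right inverse_eq_divide)
      ultimately show ?thesis by (simp only:)
    qed
    then have "norm (?v - \<rho> *\<^sub>R \<nu>) = norm ((c' - (s - t / 2) *\<^sub>R \<nu>) + (s - t / 2 - real N' * \<rho>) *\<^sub>R \<nu>) / real N'"
      using N'0 by simp
    also have "\<dots> \<le> 57 * \<rho> / real N'"
    proof (rule divide_right_mono)
      have "\<bar>s - t / 2 - real N' * \<rho>\<bar> \<le> \<rho>"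
        using N'2 \<rho> by (simp add: pos_le_divide_eq pos_divide_less_eq algebra_simps)
      then have "norm ((s - t / 2 - real N' * \<rho>) *\<^sub>R \<nu>) \<le> \<rho>" using \<nu> by simp
      with c' norm_triangle_ineq[of "c' - (s - t / 2) *\<^sub>R \<nu>" "(s - t / 2 - real N' * \<rho>) *\<^sub>R \<nu>"]
      show "norm ((c' - (s - t / 2) *\<^sub>R \<nu>) + (s - t / 2 - real N' * \<rho>) *\<^sub>R \<nu>) \<le> 57 * \<rho>" by linarith
    qed (use N'0 in simp)
    also have "\<dots> \<le> 57 * \<rho> / real N" using N'1 N1 \<rho> by (intro divide_left_mono mult_pos_pos) auto
    also have "\<dots> = 114 * \<rho> / 2 ^ i" using N2 N1 by (simp add: field_simps)
    also have "\<dots> \<le> \<delta> * \<rho>" using \<rho> by (simp add: \<delta>_def divide_right_mono)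
    finally show nv: "norm (?v - \<rho> *\<^sub>R \<nu>) \<le> \<delta> * \<rho>" .
    show "vol ?Y \<le> ennreal (\<kappa> * \<rho> ^ ?Q)" unfolding vol_right by (rule no'[OF nv])
  qed
  have cm: "(\<lambda>l. c l) \<in> borel_measurable borel" by (rule measurable_c) simp
  have F1m: "{u. hc (fst u) \<in> F1 (snd u)} \<in> sets borel"
  proof -
    have "{u. hc (fst u) \<in> F1 (snd u)} = {u. hc (fst u) \<in> cball x (2 * \<rho>)} \<inter> ({u. hc (fst u) \<in> \<Omega>} \<inter>
       (- {u. hc (fst u) + hz ((\<lambda>_. \<rho> *\<^sub>R \<nu>) (snd u)) \<in> \<Omega>} \<inter>
       ({u. hc (fst u) + hz ((\<lambda>l. c l /\<^sub>R real N) (snd u)) \<in> \<Omega>} \<union> {u. hc (fst u) + hz ((\<lambda>l. c l) (snd u)) \<in> \<Omega>})))"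
      by (auto simp: F1_def)
    also have "\<dots> \<in> sets borel"
      by (intro sets.Int sets.Un borel_comp sets_vimage_moving sets_vimage_fixed \<Omega>_sets hsets_closed closed_cball
        borel_measurable_const borel_measurable_scaleR cm)
    finally show ?thesis .
  qed
  have F2m: "{u. hc (fst u) \<in> F2 (snd u)} \<in> sets borel"
  proof -
    have "{u. hc (fst u) \<in> F2 (snd u)} = {u. hc (fst u) \<in> cball y (2 * \<rho>)} \<inter> ({u. hc (fst u) \<in> \<Omega>} \<inter>
       (- {u. hc (fst u) + hz ((\<lambda>_. \<rho> *\<^sub>R \<nu>) (snd u)) \<in> \<Omega>} \<inter>
       ({u. hc (fst u) + hz ((\<lambda>l. l /\<^sub>R real N') (snd u)) \<in> \<Omega>} \<union> - {u. hc (fst u) + hz ((\<lambda>l. - l) (snd u)) \<in> \<Omega>})))"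
      by (auto simp: F2_def)
    also have "\<dots> \<in> sets borel"
      by (intro sets.Int sets.Un borel_comp sets_vimage_moving sets_vimage_fixed \<Omega>_sets hsets_closed closed_cball
        borel_measurable_const borel_measurable_scaleR borel_measurable_uminus) simp_all
    finally show ?thesis .
  qed
  have "vol (upset x \<rho> \<nu>) * vol (upset y \<rho> \<nu>) \<le> ennreal (count_const TYPE('k) * \<rho> ^ ?Q * K)"
  proof (rule two_point_counting[OF hsets_upset _ hsets_upset _ F1m F2m _ F1b F2b _ K0])
    fix p l c' assume p: "p \<in> upset x \<rho> \<nu>" and p': "p + hz (c l) + hz c' \<in> upset y \<rho> \<nu>"
    show "p \<in> F1 l \<or> p + hz (c l) + hz c' \<in> F2 c'"
    proof (cases "p + hz (c l) \<in> \<Omega>")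
      case True
      with p show ?thesis by (simp add: F1_def upset_def)
    next
      case False
      have "p + hz (c l) + hz c' + hz (- c') = p + hz (c l)"
        by (simp only: uminus_hz[symmetric] add.assoc right_minus add_0_right)
      with False p' show ?thesis by (simp add: F2_def upset_def)
    qed
  qed (auto simp: upset_def F1_def)
  moreover have "ennreal (\<epsilon> * \<rho> ^ ?Q) * ennreal (\<epsilon> * \<rho> ^ ?Q) \<le> vol (upset x \<rho> \<nu>) * vol (upset y \<rho> \<nu>)"
    by (intro mult_mono vx vy) auto
  ultimately have "ennreal (\<epsilon> * \<rho> ^ ?Q) * ennreal (\<epsilon> * \<rho> ^ ?Q) \<le> ennreal (count_const TYPE('k) * \<rho> ^ ?Q * K)"
    by (rule order_trans[rotated])
  then have "ennreal (\<epsilon>\<^sup>2 * (\<rho> ^ ?Q)\<^sup>2) \<le> ennreal (count_const TYPE('k) * (err_const * sqrt \<delta> + \<kappa>) * (\<rho> ^ ?Q)\<^sup>2)"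
    using \<epsilon> \<rho> by (simp add: K_def ennreal_mult[symmetric] power2_eq_square mult_ac del: power_Suc)
  then have "\<epsilon>\<^sup>2 * (\<rho> ^ ?Q)\<^sup>2 \<le> count_const TYPE('k) * (err_const * sqrt \<delta> + \<kappa>) * (\<rho> ^ ?Q)\<^sup>2"
    using count_const_pos[where 'k = 'k] err_const_pos \<delta> \<kappa> by (subst (asm) ennreal_le_iff) auto
  then have "\<epsilon>\<^sup>2 \<le> count_const TYPE('k) * (err_const * sqrt \<delta> + \<kappa>)"
    using \<rho> by (simp del: power_Suc)
  with small show False by (simp add: \<delta>_def)
qed

end

section \<open>The cone order and extension of antichains to intrinsic Lipschitz graphs\<close>

text \<open>
  The upper half of a cone around the axis \<open>\<nu>\<close>. It is comparable to the upper half of \<open>heis_cone\<close>; the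
  bounds in coordinates make it a semigroup, see \<open>up_cone_add\<close>, so that it defines an order.
\<close>

definition up_cone :: "real \<Rightarrow> real ^ ('k::finite + 'k) \<Rightarrow> 'k heis set" where
  "up_cone \<gamma> \<nu> = {p. 0 \<le> hor p \<bullet> \<nu> \<and> norm (hor p - (hor p \<bullet> \<nu>) *\<^sub>R \<nu>) \<le> \<gamma> * (hor p \<bullet> \<nu>) \<and>
     \<bar>ver p\<bar> \<le> \<gamma> * (hor p \<bullet> \<nu>)\<^sup>2}"

lemma up_cone_zero [simp]: "0 \<in> up_cone \<gamma> \<nu>"
  by (simp add: up_cone_def)

lemma up_cone_eq_zero:
  assumes "p \<in> up_cone \<gamma> \<nu>" "hor p \<bullet> \<nu> = 0" shows "p = 0"
  using assms by (intro heis_eqI) (auto simp: up_cone_def)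

lemma up_cone_hz: "norm \<nu> = 1 \<Longrightarrow> 0 \<le> s \<Longrightarrow> 0 \<le> \<gamma> \<Longrightarrow> hz (s *\<^sub>R \<nu>) \<in> up_cone \<gamma> \<nu>"
  by (simp add: up_cone_def norm_eq_1)

text \<open>
  With heights \<open>s\<close> and \<open>s'\<close>, the symplectic term of the product is at most \<open>2 \<gamma> s s'\<close>, where \<open>\<gamma> \<le> 2\<close> serves
  to bound the contribution of the two sideways parts; this is the cross term of \<open>\<gamma> (s + s')\<^sup>2\<close>.
\<close>

lemma up_cone_add:
  assumes \<nu>: "norm \<nu> = 1" and \<gamma>: "0 \<le> \<gamma>" "\<gamma> \<le> 2"
    and p: "p \<in> up_cone \<gamma> \<nu>" and q: "q \<in> up_cone \<gamma> \<nu>"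
  shows "p + q \<in> up_cone \<gamma> \<nu>"
proof -
  define s where "s = hor p \<bullet> \<nu>"
  define s' where "s' = hor q \<bullet> \<nu>"
  define w where "w = hor p - s *\<^sub>R \<nu>"
  define w' where "w' = hor q - s' *\<^sub>R \<nu>"
  have s: "0 \<le> s" "0 \<le> s'" using p q by (auto simp: up_cone_def s_def s'_def)
  have w: "norm w \<le> \<gamma> * s" "norm w' \<le> \<gamma> * s'" using p q by (auto simp: up_cone_def s_def s'_def w_def w'_def)
  have v: "\<bar>ver p\<bar> \<le> \<gamma> * s\<^sup>2" "\<bar>ver q\<bar> \<le> \<gamma> * s'\<^sup>2" using p q by (auto simp: up_cone_def s_def s'_def)
  have hp: "hor p = s *\<^sub>R \<nu> + w" and hq: "hor q = s' *\<^sub>R \<nu> + w'" by (simp_all add: w_def w'_def)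
  have i: "hor (p + q) \<bullet> \<nu> = s + s'" by (simp add: inner_add_left s_def s'_def)
  have "hor (p + q) - (s + s') *\<^sub>R \<nu> = w + w'" by (simp add: hp hq algebra_simps)
  then have 1: "norm (hor (p + q) - (s + s') *\<^sub>R \<nu>) \<le> \<gamma> * (s + s')"
    using norm_triangle_ineq[of w w'] w by (simp add: algebra_simps)
  have o: "heis_omega (hor p) (hor q) = s * heis_omega \<nu> w' + s' * heis_omega w \<nu> + heis_omega w w'"
    by (simp add: hp hq omega_simps algebra_simps)
  have "\<bar>heis_omega \<nu> w'\<bar> \<le> \<gamma> * s'" "\<bar>heis_omega w \<nu>\<bar> \<le> \<gamma> * s"
    using abs_omega_le[of \<nu> w'] abs_omega_le[of w \<nu>] \<nu> w by auto
  then have o1: "\<bar>s * heis_omega \<nu> w'\<bar> \<le> s * (\<gamma> * s')" "\<bar>s' * heis_omega w \<nu>\<bar> \<le> s' * (\<gamma> * s)"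
    using s by (simp_all add: abs_mult mult_left_mono)
  have "\<bar>heis_omega w w'\<bar> \<le> (\<gamma> * s) * (\<gamma> * s')"
    using w s \<gamma> by (intro order_trans[OF abs_omega_le] mult_mono) auto
  also have "\<dots> = \<gamma> * (\<gamma> * (s * s'))" by (simp only: mult_ac)
  also have "\<dots> \<le> 2 * (\<gamma> * (s * s'))" using \<gamma> s by (intro mult_right_mono) auto
  finally have "\<bar>heis_omega (hor p) (hor q)\<bar> \<le> 4 * (\<gamma> * (s * s'))" unfolding o using o1 by (simp add: mult_ac)
  then have "\<bar>ver (p + q)\<bar> \<le> \<gamma> * s\<^sup>2 + \<gamma> * s'\<^sup>2 + 2 * (\<gamma> * (s * s'))" using v by simp
  also have "\<dots> = \<gamma> * (s + s')\<^sup>2" by (simp add: power2_eq_square algebra_simps)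
  finally show ?thesis using i 1 s by (simp add: up_cone_def)
qed

text \<open>
  Adding a long segment along the axis brings every element into the cone, since the bounds of the cone grow
  linearly and quadratically with the height while the vertical part grows only linearly.
\<close>

lemma up_cone_absorbs:
  assumes \<nu>: "norm \<nu> = 1" and \<gamma>: "0 < \<gamma>"
  obtains s0 where "\<And>s. s0 \<le> s \<Longrightarrow> g + hz (s *\<^sub>R \<nu>) \<in> up_cone \<gamma> \<nu>" "\<And>s. s0 \<le> s \<Longrightarrow> hz (s *\<^sub>R \<nu>) + g \<in> up_cone \<gamma> \<nu>"
proof -
  define P where "P = norm (hor g)"
  define T where "T = \<bar>ver g\<bar> + P\<^sup>2 + P"
  define s0 where "s0 = P + 1 + T / \<gamma>"
  have P: "P \<ge> 0" by (simp add: P_def)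
  have T: "T \<ge> 0" "P \<le> T" by (simp_all add: T_def P)
  have \<nu>1: "\<nu> \<bullet> \<nu> = 1" using \<nu> by (simp add: norm_eq_1)
  have key: "q \<in> up_cone \<gamma> \<nu>" if s: "s0 \<le> s" and h: "hor q = hor g + s *\<^sub>R \<nu>" and v: "\<bar>ver q\<bar> \<le> \<bar>ver g\<bar> + s * P / 2" for q s
  proof -
    define a where "a = hor q \<bullet> \<nu>"
    have cs: "\<bar>hor g \<bullet> \<nu>\<bar> \<le> P" using Cauchy_Schwarz_ineq2[of "hor g" \<nu>] \<nu> by (simp add: P_def)
    have a: "a = hor g \<bullet> \<nu> + s" by (simp add: a_def h inner_add_left \<nu>1)
    have T\<gamma>: "T / \<gamma> \<ge> 0" using T \<gamma> by simp
    have a1: "a \<ge> 1" "a \<ge> T / \<gamma>" "s \<le> a + P" using a cs s T\<gamma> unfolding s0_def by linarith+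
    have \<gamma>a: "T \<le> \<gamma> * a" using a1(2) \<gamma> by (simp add: pos_divide_le_eq mult.commute)
    have "hor q - a *\<^sub>R \<nu> = hor g - (hor g \<bullet> \<nu>) *\<^sub>R \<nu>" by (simp add: h a algebra_simps)
    moreover have "norm (hor g - (hor g \<bullet> \<nu>) *\<^sub>R \<nu>) \<le> P"
    proof -
      define b where "b = hor g \<bullet> \<nu>"
      have "(hor g - b *\<^sub>R \<nu>) \<bullet> (hor g - b *\<^sub>R \<nu>) = hor g \<bullet> hor g - b * b"
        by (simp only: inner_diff_left inner_diff_right inner_scaleR_left inner_scaleR_right \<nu>1
            inner_commute[of \<nu> "hor g"] b_def[symmetric]) simp
      then have "(norm (hor g - (hor g \<bullet> \<nu>) *\<^sub>R \<nu>))\<^sup>2 = (norm (hor g))\<^sup>2 - (hor g \<bullet> \<nu>)\<^sup>2"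
        by (simp only: power2_norm_eq_inner b_def power2_eq_square[of "hor g \<bullet> \<nu>"])
      then have "(norm (hor g - (hor g \<bullet> \<nu>) *\<^sub>R \<nu>))\<^sup>2 \<le> P\<^sup>2" unfolding P_def using zero_le_power2[of "hor g \<bullet> \<nu>"] by linarith
      then show ?thesis by (rule power2_le_imp_le) (rule P)
    qed
    ultimately have n: "norm (hor q - a *\<^sub>R \<nu>) \<le> \<gamma> * a" using \<gamma>a T by simp
    have "s * P \<le> (a + P) * P" using a1 P by (intro mult_right_mono) auto
    then have "s * P \<le> a * P + P\<^sup>2" by (simp add: distrib_right power2_eq_square)
    then have "s * P / 2 \<le> (a * P + P\<^sup>2) / 2" by (rule divide_right_mono) simp
    then have "\<bar>ver q\<bar> \<le> \<bar>ver g\<bar> + (a * P + P\<^sup>2) / 2" by (rule order_trans[OF v add_left_mono])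
    also have "\<dots> \<le> T * a"
    proof -
      have nn: "0 \<le> a * P + P\<^sup>2" using P a1 by simp
      have "\<bar>ver g\<bar> + (a * P + P\<^sup>2) / 2 \<le> \<bar>ver g\<bar> + (a * P + P\<^sup>2)"
      proof (rule add_left_mono)
        have "x / 2 \<le> x" if "0 \<le> x" for x :: real using that by simp
        then show "(a * P + P\<^sup>2) / 2 \<le> a * P + P\<^sup>2" using nn by blast
      qed
      also have "\<dots> \<le> \<bar>ver g\<bar> * a + (a * P + P\<^sup>2 * a)"
        using a1 by (intro add_mono) (simp_all add: mult_le_cancel_left1)
      also have "\<dots> = T * a" by (simp add: T_def algebra_simps)
      finally show ?thesis .
    qed
    also have "\<dots> \<le> (\<gamma> * a) * a" using \<gamma>a a1 by (intro mult_right_mono) auto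
    finally have "\<bar>ver q\<bar> \<le> \<gamma> * a\<^sup>2" by (simp add: power2_eq_square)
    with n a1 show ?thesis by (simp add: up_cone_def a_def)
  qed
  have s00: "s0 \<ge> 0" using P T \<gamma> by (simp add: s0_def)
  have o: "\<bar>heis_omega (hor g) \<nu>\<bar> \<le> P" "\<bar>heis_omega \<nu> (hor g)\<bar> \<le> P"
    using abs_omega_le[of "hor g" \<nu>] abs_omega_le[of \<nu> "hor g"] \<nu> by (simp_all add: P_def)
  show thesis
  proof (rule that[of s0])
    fix s assume s: "s0 \<le> s"
    have "\<bar>s * heis_omega (hor g) \<nu>\<bar> \<le> s * P" "\<bar>s * heis_omega \<nu> (hor g)\<bar> \<le> s * P"
      using o s s00 by (simp_all add: abs_mult mult_left_mono)
    then show "g + hz (s *\<^sub>R \<nu>) \<in> up_cone \<gamma> \<nu>" "hz (s *\<^sub>R \<nu>) + g \<in> up_cone \<gamma> \<nu>"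
      by (intro key[OF s]; simp add: omega_simps)+
  qed
qed

text \<open>
  A cone of half the aperture lies in \<open>up_cone \<gamma> \<nu>\<close>, up to sign, with room to spare.
\<close>

lemma heis_cone_strict:
  assumes \<nu>: "norm \<nu> = 1" and \<gamma>: "0 < \<gamma>" "\<gamma> \<le> 2" and c: "c \<in> heis_cone (\<gamma> / 2) \<nu>"
  shows "norm (hor c - (hor c \<bullet> \<nu>) *\<^sub>R \<nu>) \<le> \<gamma> / 2 * \<bar>hor c \<bullet> \<nu>\<bar>" "\<bar>ver c\<bar> \<le> \<gamma> / 2 * (hor c \<bullet> \<nu>)\<^sup>2"
    "hor c \<bullet> \<nu> = 0 \<Longrightarrow> c = 0"
proof -
  define a where "a = hor c \<bullet> \<nu>"
  define w where "w = hor c - a *\<^sub>R \<nu>"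
  define m where "m = \<gamma> / 2 * \<bar>a\<bar>"
  have hc: "hor c = a *\<^sub>R \<nu> + w" by (simp add: w_def)
  have W: "proj_W \<nu> c = c - hz (a *\<^sub>R \<nu>)" and L: "proj_L \<nu> c = hz (a *\<^sub>R \<nu>)"
    using \<nu> by (simp_all add: proj_W_eq proj_L_eq a_def hz_def)
  have k: "koranyi (proj_W \<nu> c) \<le> m" using c \<nu> by (simp add: heis_cone_def L m_def)
  have hw: "hor (proj_W \<nu> c) = w" by (simp add: W w_def)
  have vw: "ver (proj_W \<nu> c) = ver c - a * heis_omega w \<nu> / 2" unfolding W by (simp add: hc omega_simps)
  have nw: "norm w \<le> m" using koranyi_ge_norm_hor[of "proj_W \<nu> c"] k hw by simp
  then show "norm (hor c - (hor c \<bullet> \<nu>) *\<^sub>R \<nu>) \<le> \<gamma> / 2 * \<bar>hor c \<bullet> \<nu>\<bar>" by (simp add: w_def a_def m_def)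
  have "(koranyi (proj_W \<nu> c))\<^sup>2 \<le> m\<^sup>2" using k by (intro power_mono) auto
  then have v1: "\<bar>ver c - a * heis_omega w \<nu> / 2\<bar> \<le> m\<^sup>2 / 4" using abs_ver_le_koranyi[of "proj_W \<nu> c"] vw by simp
  have "\<bar>heis_omega w \<nu>\<bar> \<le> m" using abs_omega_le[of w \<nu>] \<nu> nw by simp
  then have "\<bar>a * heis_omega w \<nu>\<bar> \<le> \<bar>a\<bar> * m" by (simp add: abs_mult mult_left_mono)
  then have "\<bar>ver c\<bar> \<le> m\<^sup>2 / 4 + \<bar>a\<bar> * m / 2" using v1 by linarith
  also have "\<bar>a\<bar> * m = \<gamma> / 2 * a\<^sup>2" by (simp add: m_def power2_eq_square)
  also have "m\<^sup>2 = \<gamma>\<^sup>2 / 4 * a\<^sup>2" by (simp add: m_def power_mult_distrib power_divide)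
  also have "\<gamma>\<^sup>2 / 4 * a\<^sup>2 \<le> \<gamma> / 2 * a\<^sup>2"
    using \<gamma> by (intro mult_right_mono) (auto simp: power2_eq_square)
  finally show "\<bar>ver c\<bar> \<le> \<gamma> / 2 * (hor c \<bullet> \<nu>)\<^sup>2"
    using mult_nonneg_nonneg[of "\<gamma> / 2" "a\<^sup>2"] \<gamma> by (simp add: a_def)
  show "c = 0" if "hor c \<bullet> \<nu> = 0"
  proof -
    have "a = 0" using that by (simp add: a_def)
    then have "m = 0" by (simp add: m_def)
    then have "koranyi (proj_W \<nu> c) = 0" using k koranyi_nonneg[of "proj_W \<nu> c"] by linarith
    then have "proj_W \<nu> c = 0" by (simp only: koranyi_eq_0_iff)
    moreover have "proj_L \<nu> c = 0" using \<open>a = 0\<close> by (simp add: L)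
    ultimately show ?thesis using proj_W_plus_proj_L[OF \<nu>, of c] by simp
  qed
qed

text \<open>
  Let \<open>U\<close> be the upper closure of \<open>G\<close>. On every line \<open>w + hz (s *\<^sub>R \<nu>)\<close> it is an upward ray, and \<open>\<phi> w\<close> is the
  infimum of that ray; it is finite because the antichain condition keeps low points out of \<open>U\<close>.
  The graph of \<open>\<phi>\<close> contains \<open>G\<close>. If \<open>y\<close> were in the narrower cone above \<open>x\<close>, with both points on the
  graph, then a point slightly above \<open>x\<close>, which lies in \<open>U\<close>, would still be below a point slightly under
  \<open>y\<close> in the order, and this point would be in \<open>U\<close>, against the choice of \<open>\<phi>\<close>.
\<close>

lemma antichain_extends_to_graph:
  fixes G :: "'k::finite heis set"
  assumes \<nu>: "norm \<nu> = 1" and \<gamma>: "0 < \<gamma>" "\<gamma> \<le> 2" and G: "G \<noteq> {}"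
    and anti: "\<And>p q. p \<in> G \<Longrightarrow> q \<in> G \<Longrightarrow> - p + q \<in> up_cone \<gamma> \<nu> \<Longrightarrow> p = q"
  obtains \<Gamma> where "G \<subseteq> \<Gamma>" "intrinsic_lipschitz_graph (2 / \<gamma>) \<Gamma>"
proof -
  let ?C = "up_cone \<gamma> \<nu>"
  have \<gamma>0: "0 \<le> \<gamma>" using \<gamma> by simp
  note add = up_cone_add[OF \<nu> \<gamma>0 \<gamma>(2)]
  define U where "U = {q. \<exists>p\<in>G. - p + q \<in> ?C}"
  have UC: "q + d \<in> U" if q: "q \<in> U" and d: "d \<in> ?C" for q d
  proof -
    obtain p where p: "p \<in> G" "- p + q \<in> ?C" using q by (auto simp: U_def)
    from add[OF p(2) d] have "- p + (q + d) \<in> ?C" by (simp only: add.assoc)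
    with p(1) show ?thesis by (auto simp: U_def)
  qed
  define A where "A w = {s. w + hz (s *\<^sub>R \<nu>) \<in> U}" for w
  have A_up: "s' \<in> A w" if "s \<in> A w" "s \<le> s'" for s s' w
  proof -
    have "w + hz (s *\<^sub>R \<nu>) + hz ((s' - s) *\<^sub>R \<nu>) \<in> U"
      by (rule UC[OF _ up_cone_hz[OF \<nu> _ \<gamma>0]]) (use that in \<open>auto simp: A_def\<close>)
    then show ?thesis by (simp add: A_def add.assoc hz_add_scaleR)
  qed
  obtain p0 where p0: "p0 \<in> G" using G by blast
  have A_ne: "A w \<noteq> {}" for w
  proof -
    obtain s0 where "\<And>s. s0 \<le> s \<Longrightarrow> (- p0 + w) + hz (s *\<^sub>R \<nu>) \<in> ?C"
      using up_cone_absorbs[OF \<nu> \<gamma>(1), of "- p0 + w"] by metis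
    then have "- p0 + (w + hz (s0 *\<^sub>R \<nu>)) \<in> ?C" by (simp add: add.assoc)
    then have "s0 \<in> A w" using p0 by (auto simp: A_def U_def)
    then show ?thesis by blast
  qed
  have A_bdd: "bdd_below (A w)" for w
  proof -
    obtain s0 where s0: "\<And>s. s0 \<le> s \<Longrightarrow> hz (s *\<^sub>R \<nu>) + (- w + p0) \<in> ?C"
      using up_cone_absorbs[OF \<nu> \<gamma>(1), of "- w + p0"] by metis
    \<comment> \<open>A point so low that \<open>p0\<close> lies above it: if it were in \<open>U\<close>, above some \<open>p\<close>, then \<open>p\<close> would be below \<open>p0\<close>,
      hence equal to it, and the point would be higher than \<open>p0\<close>.\<close>
    define b where "b = min (- s0) ((hor p0 - hor w) \<bullet> \<nu>) - 1"
    have "b \<notin> A w"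
    proof
      assume "b \<in> A w"
      then obtain p where p: "p \<in> G" and d: "- p + (w + hz (b *\<^sub>R \<nu>)) \<in> ?C" by (auto simp: A_def U_def)
      have e: "- (w + hz (b *\<^sub>R \<nu>)) + p0 \<in> ?C"
      proof -
        have "hz (- b *\<^sub>R \<nu>) + (- w + p0) \<in> ?C" by (rule s0) (simp add: b_def)
        then show ?thesis by (simp add: minus_add uminus_hz add.assoc del: add_uminus_conv_diff)
      qed
      have "- p + (w + hz (b *\<^sub>R \<nu>)) + (- (w + hz (b *\<^sub>R \<nu>)) + p0) = - p + p0"
        by (simp only: add.assoc add_minus_cancel)
      with add[OF d e] have "- p + p0 \<in> ?C" by simp
      from anti[OF p p0 this] have "p = p0" .
      with d have "0 \<le> (- hor p0 + (hor w + b *\<^sub>R \<nu>)) \<bullet> \<nu>" by (simp add: up_cone_def)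
      then have "(hor p0 - hor w) \<bullet> \<nu> \<le> b" using \<nu> by (simp add: inner_add_left inner_diff_left norm_eq_1)
      then show False by (simp add: b_def)
    qed
    then have "\<And>s. s \<in> A w \<Longrightarrow> b \<le> s" using A_up by (meson linorder_not_le less_imp_le)
    then show ?thesis by (rule bdd_belowI)
  qed
  define \<phi> where "\<phi> w = Inf (A w)" for w
  define \<Gamma> where "\<Gamma> = {w + hz (\<phi> w *\<^sub>R \<nu>) | w. w \<in> heis_W \<nu>}"
  have \<nu>1: "\<nu> \<bullet> \<nu> = 1" using \<nu> by (simp add: norm_eq_1)
  have pW: "proj_W \<nu> (w + hz (s *\<^sub>R \<nu>)) = w" if "w \<in> heis_W \<nu>" for w s
  proof -
    have "hor w \<bullet> \<nu> = 0" using that by (auto simp: heis_W_def)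
    then have "hor (w + hz (s *\<^sub>R \<nu>)) \<bullet> \<nu> = s" by (simp add: inner_add_left \<nu>1)
    then have "proj_W \<nu> (w + hz (s *\<^sub>R \<nu>)) = w + hz (s *\<^sub>R \<nu>) - hz (s *\<^sub>R \<nu>)"
      unfolding proj_W_eq[OF \<nu>] by (simp only: hz_def)
    then show ?thesis by simp
  qed
  have proj: "proj_W \<nu> ` \<Gamma> = heis_W \<nu>"
  proof
    show "proj_W \<nu> ` \<Gamma> \<subseteq> heis_W \<nu>" using pW by (auto simp: \<Gamma>_def)
    show "heis_W \<nu> \<subseteq> proj_W \<nu> ` \<Gamma>"
    proof
      fix w assume w: "w \<in> heis_W \<nu>"
      then have "w + hz (\<phi> w *\<^sub>R \<nu>) \<in> \<Gamma>" by (auto simp: \<Gamma>_def)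
      then show "w \<in> proj_W \<nu> ` \<Gamma>" using pW[OF w, of "\<phi> w"] by (metis image_eqI)
    qed
  qed
  have sub: "G \<subseteq> \<Gamma>"
  proof
    fix q assume q: "q \<in> G"
    define s where "s = hor q \<bullet> \<nu>"
    define w where "w = q - hz (s *\<^sub>R \<nu>)"
    have w: "w \<in> heis_W \<nu>"
      using heis_decomp_iff[OF \<nu>, of w "hz (s *\<^sub>R \<nu>)" q] by (simp add: w_def s_def hz_def)
    have qw: "q = w + hz (s *\<^sub>R \<nu>)" by (simp add: w_def)
    have "s \<in> A w" using q by (auto simp: A_def U_def qw[symmetric] intro!: bexI[of _ q])
    moreover have "s \<le> s'" if s': "s' \<in> A w" for s'
    proof (rule ccontr)
      assume lt: "\<not> s \<le> s'"
      obtain p where p: "p \<in> G" "- p + (w + hz (s' *\<^sub>R \<nu>)) \<in> ?C" using s' by (auto simp: A_def U_def)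
      have "hz ((s - s') *\<^sub>R \<nu>) \<in> ?C" using lt \<nu> \<gamma>0 by (intro up_cone_hz) auto
      from add[OF p(2) this] have "- p + q \<in> ?C" by (simp add: add.assoc hz_add_scaleR qw)
      from anti[OF p(1) q this] have "p = q" .
      with p(2) have "0 \<le> (- hor q + (hor w + s' *\<^sub>R \<nu>)) \<bullet> \<nu>" by (simp add: up_cone_def)
      moreover have "hor q = hor w + s *\<^sub>R \<nu>" by (subst qw) simp
      ultimately show False using lt by (simp add: inner_add_left inner_diff_left \<nu>1)
    qed
    ultimately have "\<phi> w = s" unfolding \<phi>_def by (rule cInf_eq_minimum)
    then show "q \<in> \<Gamma>" using w qw by (auto simp: \<Gamma>_def)
  qed
  have above: "y = x + c \<Longrightarrow> False"
    if x: "x \<in> \<Gamma>" and y: "y \<in> \<Gamma>" and a: "0 < hor c \<bullet> \<nu>"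
      and cw: "norm (hor c - (hor c \<bullet> \<nu>) *\<^sub>R \<nu>) \<le> \<gamma> / 2 * (hor c \<bullet> \<nu>)" and cv: "\<bar>ver c\<bar> \<le> \<gamma> / 2 * (hor c \<bullet> \<nu>)\<^sup>2"
    for x y c
  proof -
    assume yx: "y = x + c"
    define a where "a = hor c \<bullet> \<nu>"
    \<comment> \<open>Shortening \<open>c\<close> by \<open>\<epsilon> \<nu>\<close> at both ends leaves its vertical part unchanged and keeps \<open>3 / 4\<close> of its height;
      as \<open>1 / 2 \<le> 9 / 16\<close>, it stays in \<open>up_cone \<gamma> \<nu>\<close>.\<close>
    define \<epsilon> where "\<epsilon> = a / 8"
    have \<epsilon>: "\<epsilon> > 0" using that(3) by (simp add: \<epsilon>_def a_def)
    obtain wx where wx: "x = wx + hz (\<phi> wx *\<^sub>R \<nu>)" using x by (auto simp: \<Gamma>_def)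
    obtain wy where wy: "y = wy + hz (\<phi> wy *\<^sub>R \<nu>)" using y by (auto simp: \<Gamma>_def)
    obtain s1 where "s1 \<in> A wx" "s1 < \<phi> wx + \<epsilon>"
      using cInf_lessD[OF A_ne, of wx "\<phi> wx + \<epsilon>"] \<epsilon> by (auto simp: \<phi>_def)
    then have "\<phi> wx + \<epsilon> \<in> A wx" using A_up by (meson less_imp_le)
    then have xU: "x + hz (\<epsilon> *\<^sub>R \<nu>) \<in> U" by (simp add: wx A_def add.assoc hz_add_scaleR)
    define d where "d = hz (- \<epsilon> *\<^sub>R \<nu>) + c + hz (- \<epsilon> *\<^sub>R \<nu>)"
    have hd: "hor d = hor c - (2 * \<epsilon>) *\<^sub>R \<nu>" by (simp add: d_def algebra_simps flip: scaleR_left_distrib)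
    have da: "hor d \<bullet> \<nu> = a - 2 * \<epsilon>" by (simp add: hd inner_diff_left \<nu>1 a_def)
    have vd: "ver d = ver c"
      using omega_commute[of \<nu> "hor c"] by (simp add: d_def omega_simps)
    have "d \<in> ?C"
    proof -
      have "hor d - (hor d \<bullet> \<nu>) *\<^sub>R \<nu> = hor c - a *\<^sub>R \<nu>"
        by (simp only: da) (simp add: hd algebra_simps)
      moreover have "norm (hor c - a *\<^sub>R \<nu>) \<le> \<gamma> * (a - 2 * \<epsilon>)"
      proof -
        have "\<gamma> / 2 * a \<le> \<gamma> * (3 / 4 * a)" using \<gamma> that(3) by (simp add: a_def)
        then show ?thesis using cw by (simp add: a_def \<epsilon>_def)
      qed
      moreover have "\<bar>ver d\<bar> \<le> \<gamma> * (a - 2 * \<epsilon>)\<^sup>2"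
      proof -
        have "a - 2 * \<epsilon> = 3 / 4 * a" by (simp add: \<epsilon>_def)
        then have "(a - 2 * \<epsilon>)\<^sup>2 = 9 / 16 * a\<^sup>2" by (simp add: power_mult_distrib power_divide)
        moreover have "\<gamma> / 2 * a\<^sup>2 \<le> \<gamma> * (9 / 16 * a\<^sup>2)" using \<gamma> by simp
        moreover have "\<bar>ver d\<bar> \<le> \<gamma> / 2 * a\<^sup>2" using cv by (simp only: vd a_def)
        ultimately show ?thesis by (metis order_trans)
      qed
      ultimately show ?thesis using that(3) by (simp add: up_cone_def da a_def \<epsilon>_def)
    qed
    from UC[OF xU this] have "x + hz (\<epsilon> *\<^sub>R \<nu>) + d \<in> U" .
    also have "x + hz (\<epsilon> *\<^sub>R \<nu>) + d = y + hz (- \<epsilon> *\<^sub>R \<nu>)"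
    proof -
      have "hz (\<epsilon> *\<^sub>R \<nu>) + (hz (- \<epsilon> *\<^sub>R \<nu>) + (c + hz (- \<epsilon> *\<^sub>R \<nu>))) = c + hz (- \<epsilon> *\<^sub>R \<nu>)"
        by (simp only: add.assoc[symmetric] hz_add_scaleR) simp
      then show ?thesis unfolding yx d_def by (simp only: add.assoc)
    qed
    also have "y + hz (- \<epsilon> *\<^sub>R \<nu>) = wy + hz ((\<phi> wy + - \<epsilon>) *\<^sub>R \<nu>)"
      by (simp only: wy add.assoc hz_add_scaleR)
    finally have "\<phi> wy - \<epsilon> \<in> A wy" by (simp add: A_def)
    then have "\<phi> wy \<le> \<phi> wy - \<epsilon>" unfolding \<phi>_def[of wy] using A_bdd by (intro cInf_lower)
    with \<epsilon> show False by simp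
  qed
  have cone: "(+) p ` heis_cone (\<gamma> / 2) \<nu> \<inter> \<Gamma> = {p}" if p: "p \<in> \<Gamma>" for p
  proof
    have "(0 :: 'k heis) \<in> heis_cone (\<gamma> / 2) \<nu>"
    proof -
      have "proj_W \<nu> 0 = (0 :: 'k heis)"
        using proj_W_eq[OF \<nu>, of 0] by (simp add: zero_heis_def[symmetric] flip: hz_def)
      then show ?thesis using \<gamma> by (simp add: heis_cone_def)
    qed
    then show "{p} \<subseteq> (+) p ` heis_cone (\<gamma> / 2) \<nu> \<inter> \<Gamma>" using p by (auto intro!: image_eqI[of _ _ 0])
    show "(+) p ` heis_cone (\<gamma> / 2) \<nu> \<inter> \<Gamma> \<subseteq> {p}"
    proof
      fix q assume "q \<in> (+) p ` heis_cone (\<gamma> / 2) \<nu> \<inter> \<Gamma>"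
      then obtain c where c: "c \<in> heis_cone (\<gamma> / 2) \<nu>" "q = p + c" and q: "q \<in> \<Gamma>" by blast
      note st = heis_cone_strict[OF \<nu> \<gamma> c(1)]
      consider "hor c \<bullet> \<nu> = 0" | "hor c \<bullet> \<nu> > 0" | "hor c \<bullet> \<nu> < 0" by linarith
      then show "q \<in> {p}"
      proof cases
        case 1
        with st(3) c show ?thesis by simp
      next
        case 2
        then show ?thesis using above[OF p q 2] st c(2) by simp
      next
        case 3
        have "p = q + - c" by (simp add: c(2) add.assoc)
        moreover have "norm (hor (- c) - (hor (- c) \<bullet> \<nu>) *\<^sub>R \<nu>) = norm (hor c - (hor c \<bullet> \<nu>) *\<^sub>R \<nu>)"
          using norm_minus_cancel[of "hor c - (hor c \<bullet> \<nu>) *\<^sub>R \<nu>"] by simp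
        ultimately show ?thesis using above[OF q p, of "- c"] st 3 by simp
      qed
    qed
  qed
  have "intrinsic_lipschitz_graph (2 / \<gamma>) \<Gamma>"
    unfolding intrinsic_lipschitz_graph_def using \<nu> proj cone by (intro exI[of _ \<nu>]) simp
  with sub that show thesis by blast
qed


section \<open>Chains seeing few scales, and decomposition into antichains\<close>

definition scale_of :: "real \<Rightarrow> int" where "scale_of d = \<lfloor>log 2 d\<rfloor>"

lemma scale_of_eq_iff: "d > 0 \<Longrightarrow> scale_of d = j \<longleftrightarrow> 2 powr j \<le> d \<and> d < 2 powr (j + 1)"
  by (auto simp: scale_of_def floor_eq_iff le_log_iff log_less_iff)

text \<open>
  Cut the range of \<open>H\<close>, of length between \<open>2\<^sup>j\<close> and \<open>2\<^sup>j\<^sup>+\<^sup>1\<close>, into four pieces of length \<open>2\<^sup>j / 2\<close>. Every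
  point is at distance at least \<open>2\<^sup>j / 2\<close> from the minimum or the maximum, whereas within its
  piece all distances are smaller. So within the pieces every point sees one scale less.
\<close>

lemma card_le_of_few_scales:
  fixes H :: "real set"
  assumes "finite H" and "\<And>u. u \<in> H \<Longrightarrow> card ((\<lambda>v. scale_of \<bar>u - v\<bar>) ` (H - {u})) \<le> J"
  shows "card H \<le> 4 ^ J"
  using assms
proof (induction J arbitrary: H)
  case 0
  have "u = v" if "u \<in> H" "v \<in> H" for u v
  proof -
    have "H - {u} = {}" using 0(2)[OF that(1)] 0(1) by simp
    with that show ?thesis by blast
  qed
  then have "card H \<le> 1" using card_le_Suc0_iff_eq[OF 0(1)] by simp
  then show ?case by simp
next
  case (Suc J)
  show ?case
  proof (cases "card H \<le> 1")
    case True
    then show ?thesis by (rule order_trans) simp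
  next
    case False
    then have ne: "H \<noteq> {}" by auto
    define m where "m = Min H"
    define M where "M = Max H"
    have mM: "m \<in> H" "M \<in> H" and mb: "\<And>u. u \<in> H \<Longrightarrow> m \<le> u \<and> u \<le> M"
      using Suc(2) ne by (auto simp: m_def M_def)
    have mltM: "m < M"
    proof (rule ccontr)
      assume "\<not> m < M"
      with mb have "u = m" if "u \<in> H" for u using that mb[OF mM(1)] by (meson antisym linorder_not_le order_trans)
      then have "H \<subseteq> {m}" by blast
      then have "card H \<le> 1" using card_mono[of "{m}" H] by simp
      with False show False by simp
    qed
    define D where "D = M - m"
    define j where "j = scale_of D"
    have D: "D > 0" using mltM by (simp add: D_def)
    have j: "2 powr j \<le> D" "D < 2 powr (j + 1)" using scale_of_eq_iff[OF D, of j] by (simp_all add: j_def)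
    define L where "L = (2::real) powr j"
    have L: "L > 0" "L \<le> D" "D < 2 * L" using j by (simp_all add: L_def powr_add)
    define P where "P a = {u \<in> H. m + real a * (L / 2) \<le> u \<and> u < m + (real a + 1) * (L / 2)}" for a :: nat
    have fin: "finite (P a)" for a using Suc(2) by (simp add: P_def)
    have bd: "card (P a) \<le> 4 ^ J" for a
    proof (rule Suc.IH[OF fin])
      fix u assume u: "u \<in> P a"
      then have uH: "u \<in> H" by (simp add: P_def)
      let ?s = "\<lambda>v. scale_of \<bar>u - v\<bar>"
      have small: "?s v < j - 1" if v: "v \<in> P a - {u}" for v
      proof -
        have d0: "\<bar>u - v\<bar> > 0" using v by auto
        have "m + real a * (L / 2) \<le> u" "u < m + real a * (L / 2) + L / 2"
          "m + real a * (L / 2) \<le> v" "v < m + real a * (L / 2) + L / 2"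
          using u v by (simp_all add: P_def distrib_right add_divide_distrib)
        then have "\<bar>u - v\<bar> < L / 2" unfolding abs_less_iff by linarith
        also have "L / 2 = 2 powr (j - 1)" by (simp add: L_def powr_diff)
        finally have "log 2 \<bar>u - v\<bar> < j - 1" using d0 by (simp add: log_less_iff)
        then show ?thesis unfolding scale_of_def by linarith
      qed
      obtain v where v: "v \<in> H - {u}" "D / 2 \<le> \<bar>u - v\<bar>"
      proof (cases "u - m \<ge> D / 2")
        case True then show thesis using that[of m] mM D by auto
      next
        case False then show thesis using that[of M] mM D by (auto simp: D_def)
      qed
      have big: "?s v \<ge> j - 1"
      proof -
        have "2 powr (j - 1) \<le> \<bar>u - v\<bar>" using v L by (simp add: L_def powr_diff)
        then have "real_of_int (j - 1) \<le> log 2 \<bar>u - v\<bar>" using v(1) by (simp add: le_log_iff)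
        then show ?thesis unfolding scale_of_def by linarith
      qed
      have "?s ` (P a - {u}) \<subseteq> ?s ` (H - {u}) - {?s v}"
        using small big by (fastforce simp: P_def)
      then have "card (?s ` (P a - {u})) \<le> card (?s ` (H - {u}) - {?s v})"
        using Suc(2) by (intro card_mono) auto
      also have "\<dots> = card (?s ` (H - {u})) - 1" using v Suc(2) by (subst card_Diff_singleton) auto
      also have "\<dots> \<le> J" using Suc(3)[OF uH] by simp
      finally show "card (?s ` (P a - {u})) \<le> J" .
    qed
    have "H \<subseteq> (\<Union>a\<in>{..<4}. P a)"
    proof
      fix u assume u: "u \<in> H"
      define a where "a = nat \<lfloor>(u - m) / (L / 2)\<rfloor>"
      have x0: "0 \<le> (u - m) / (L / 2)" using mb[OF u] L by simp
      have x4: "(u - m) / (L / 2) < 4" using mb[OF u] L by (simp add: D_def pos_divide_less_eq)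
      have "real a \<le> (u - m) / (L / 2)" "(u - m) / (L / 2) < real a + 1" using x0 unfolding a_def by (auto simp: of_nat_floor)
      moreover from this x4 have "a < 4" by linarith
      ultimately have "u \<in> P a" using u L by (simp add: P_def pos_le_divide_eq pos_divide_less_eq algebra_simps add_divide_distrib)
      with \<open>a < 4\<close> show "u \<in> (\<Union>a\<in>{..<4}. P a)" by blast
    qed
    then have "card H \<le> card (\<Union>a\<in>{..<4}. P a)" using fin by (intro card_mono) auto
    also have "\<dots> \<le> (\<Sum>a<4. card (P a))" by (rule card_UN_le) simp
    also have "\<dots> \<le> (\<Sum>a<4::nat. 4 ^ J)" by (intro sum_mono bd)
    finally show ?thesis by simp
  qed
qed

text \<open>
  The easy half of Mirsky's theorem: \<open>f x\<close> is the length of the longest chain with top \<open>x\<close>. The level sets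
  of \<open>f\<close> are antichains.
\<close>

lemma antichain_decomposition:
  fixes lt :: "'a \<Rightarrow> 'a \<Rightarrow> bool"
  assumes irrefl: "\<And>x. \<not> lt x x" and trans: "\<And>x y z. lt x y \<Longrightarrow> lt y z \<Longrightarrow> lt x z"
    and chains: "\<And>C. finite C \<Longrightarrow> C \<subseteq> G \<Longrightarrow> (\<And>x y. x \<in> C \<Longrightarrow> y \<in> C \<Longrightarrow> x \<noteq> y \<Longrightarrow> lt x y \<or> lt y x) \<Longrightarrow> card C \<le> M"
  obtains f :: "'a \<Rightarrow> nat" where "\<And>x. x \<in> G \<Longrightarrow> f x \<le> M" "\<And>x y. x \<in> G \<Longrightarrow> y \<in> G \<Longrightarrow> lt x y \<Longrightarrow> f x < f y"
proof -
  define Ch where "Ch x = {C. finite C \<and> C \<subseteq> G \<and> (\<forall>u\<in>C. \<forall>v\<in>C. u \<noteq> v \<longrightarrow> lt u v \<or> lt v u) \<and> x \<in> C \<and> (\<forall>u\<in>C. u = x \<or> lt u x)}" for x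
  define f where "f x = Max (card ` Ch x)" for x
  have sub: "card ` Ch x \<subseteq> {..M}" for x using chains by (auto simp: Ch_def)
  then have fin: "finite (card ` Ch x)" for x using finite_subset by blast
  have ne: "{x} \<in> Ch x" if "x \<in> G" for x using that by (auto simp: Ch_def)
  have 1: "f x \<le> M" if "x \<in> G" for x
    unfolding f_def using fin ne[OF that] sub by (subst Max_le_iff) auto
  have 2: "f x < f y" if x: "x \<in> G" and y: "y \<in> G" and xy: "lt x y" for x y
  proof -
    have "f x \<in> card ` Ch x" unfolding f_def using fin ne[OF x] by (intro Max_in) auto
    then obtain C where C: "C \<in> Ch x" "f x = card C" by blast
    have yC: "y \<notin> C"
    proof
      assume "y \<in> C"
      then have "y = x \<or> lt y x" using C by (auto simp: Ch_def)
      with xy show False using irrefl trans by blast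
    qed
    have below: "lt u y" if "u \<in> C" for u using C that xy trans by (auto simp: Ch_def)
    have "insert y C \<in> Ch y" using C y below by (auto simp: Ch_def)
    then have "card (insert y C) \<le> f y" unfolding f_def using fin by (intro Max_ge) auto
    moreover have "card (insert y C) = Suc (card C)" using C yC by (simp add: Ch_def)
    ultimately show ?thesis using C by simp
  qed
  show thesis by (rule that[of f]) (use 1 2 in auto)
qed

section \<open>Selecting crossing points by bisection\<close>

locale crossing_family = separation S \<Omega> Cu for S \<Omega> :: "'k::finite heis set" and Cu :: real +
  fixes \<nu> :: "real ^ ('k + 'k)" and l :: real
  assumes \<nu>: "norm \<nu> = 1" and l: "l > 0" and closed_S: "closed S"
begin

definition starts :: "'k heis \<Rightarrow> real \<Rightarrow> 'k heis set" where
  "starts p R = {q \<in> cball p R. q \<in> \<Omega> \<and> q + hz (l *\<^sub>R \<nu>) \<notin> \<Omega>}"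

text \<open>
  The bisection keeps a dyadic interval of length \<open>l / 2\<^sup>j\<close> whose lower end lies in \<open>\<Omega>\<close> and whose upper end
  does not, see \<open>bis_invariant\<close>. It is preferred to the first exit time because the position of the
  interval is a multiple of \<open>l / 2\<^sup>j\<close> and thus takes \<open>2\<^sup>j\<close> values only, see \<open>bis_grid\<close>.
\<close>

primrec bis :: "nat \<Rightarrow> 'k heis \<Rightarrow> real" where
  "bis 0 q = 0"
| "bis (Suc j) q = bis j q + (if q + hz ((bis j q + l / 2 ^ Suc j) *\<^sub>R \<nu>) \<in> \<Omega> then l / 2 ^ Suc j else 0)"

definition stop_time :: "'k heis \<Rightarrow> real" where "stop_time q = lim (\<lambda>j. bis j q)"

definition hit :: "'k heis \<Rightarrow> 'k heis" where "hit q = q + hz (stop_time q *\<^sub>R \<nu>)"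

lemma hsets_starts: "starts p R \<in> hsets"
proof -
  have "starts p R = cball p R \<inter> (\<Omega> - {q. q + hz (l *\<^sub>R \<nu>) \<in> \<Omega>})" by (auto simp: starts_def)
  then show ?thesis by (simp add: hsets_Int hsets_Diff hsets_closed \<Omega>_sets hsets_vimage_right)
qed

lemma bis_invariant:
  assumes "q \<in> starts p R"
  shows "q + hz (bis j q *\<^sub>R \<nu>) \<in> \<Omega>" "q + hz ((bis j q + l / 2 ^ j) *\<^sub>R \<nu>) \<notin> \<Omega>"
proof -
  have "q + hz (bis j q *\<^sub>R \<nu>) \<in> \<Omega> \<and> q + hz ((bis j q + l / 2 ^ j) *\<^sub>R \<nu>) \<notin> \<Omega>"
  proof (induction j)
    case 0
    then show ?case using assms by (simp add: starts_def)
  next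
    case (Suc j)
    have e: "bis j q + l / 2 ^ Suc j + l / 2 ^ Suc j = bis j q + l / 2 ^ j" by (simp add: field_simps)
    show ?case
    proof (cases "q + hz ((bis j q + l / 2 ^ Suc j) *\<^sub>R \<nu>) \<in> \<Omega>")
      case True
      then have b: "bis (Suc j) q = bis j q + l / 2 ^ Suc j" by (simp only: bis.simps if_True)
      show ?thesis unfolding b e using True Suc by blast
    next
      case False
      then have b: "bis (Suc j) q = bis j q" by (simp only: bis.simps if_False add_0_right)
      show ?thesis unfolding b using False Suc by blast
    qed
  qed
  then show "q + hz (bis j q *\<^sub>R \<nu>) \<in> \<Omega>" "q + hz ((bis j q + l / 2 ^ j) *\<^sub>R \<nu>) \<notin> \<Omega>" by auto
qed

lemma bis_grid: "\<exists>m<2 ^ j. bis j q = real m * (l / 2 ^ j)"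
proof (induction j)
  case (Suc j)
  then obtain m where m: "m < 2 ^ j" "bis j q = real m * (l / 2 ^ j)" by blast
  have e: "real m * (l / 2 ^ j) = real (2 * m) * (l / 2 ^ Suc j)" by (simp add: field_simps)
  show ?case
  proof (cases "q + hz ((bis j q + l / 2 ^ Suc j) *\<^sub>R \<nu>) \<in> \<Omega>")
    case True
    then have "bis (Suc j) q = real (2 * m + 1) * (l / 2 ^ Suc j)"
      by (simp only: bis.simps if_True m e) (simp add: algebra_simps add_divide_distrib)
    then show ?thesis using m by (intro exI[of _ "2 * m + 1"]) auto
  next
    case False
    then have "bis (Suc j) q = real (2 * m) * (l / 2 ^ Suc j)"
      by (simp only: bis.simps if_False m e add_0_right)
    then show ?thesis using m by (intro exI[of _ "2 * m"]) auto
  qed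
qed simp

lemma bis_mono: "bis j q \<le> bis (Suc j) q" and bis_upper: "bis (Suc j) q + l / 2 ^ Suc j \<le> bis j q + l / 2 ^ j"
  using l by (auto simp: field_simps)

lemma bis_le: "i \<le> j \<Longrightarrow> bis j q + l / 2 ^ j \<le> bis i q + l / 2 ^ i"
proof (induction j rule: dec_induct)
  case (step n)
  then show ?case using bis_upper[of n q] by linarith
qed simp

lemma bis_LIMSEQ: "(\<lambda>j. bis j q) \<longlonglongrightarrow> stop_time q"
  and bis_le_stop: "bis j q \<le> stop_time q" and stop_le_bis: "stop_time q \<le> bis j q + l / 2 ^ j"
proof -
  have inc: "incseq (\<lambda>j. bis j q)" by (rule incseq_SucI) (rule bis_mono)
  have bd: "bis j q \<le> l" for j
  proof -
    have "l / 2 ^ j > 0" using l by simp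
    then show ?thesis using bis_le[of 0 j q] by simp
  qed
  then obtain L where L: "(\<lambda>j. bis j q) \<longlonglongrightarrow> L" using incseq_convergent[OF inc, of l] by blast
  then have eq: "L = stop_time q" by (simp add: stop_time_def limI)
  show lim: "(\<lambda>j. bis j q) \<longlonglongrightarrow> stop_time q" using L eq by simp
  show "bis j q \<le> stop_time q" by (rule incseq_le[OF inc lim])
  have "bis i q \<le> bis j q + l / 2 ^ j" if "i \<ge> j" for i
  proof -
    have "l / 2 ^ i > 0" using l by simp
    then show ?thesis using bis_le[OF that, of q] by linarith
  qed
  then show "stop_time q \<le> bis j q + l / 2 ^ j" by (intro LIMSEQ_le_const2[OF lim]) auto
qed

lemma stop_time_range: "0 \<le> stop_time q" "stop_time q \<le> l"
  using bis_le_stop[of 0 q] stop_le_bis[of q 0] by simp_all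

lemma dist_hit: "dist (q + hz (bis j q *\<^sub>R \<nu>)) (hit q) \<le> l / 2 ^ j"
proof -
  have "hit q = q + hz (bis j q *\<^sub>R \<nu>) + hz ((stop_time q - bis j q) *\<^sub>R \<nu>)"
    by (simp add: hit_def add.assoc hz_add_scaleR)
  then have "dist (q + hz (bis j q *\<^sub>R \<nu>)) (hit q) = \<bar>stop_time q - bis j q\<bar>" using \<nu> by simp
  then show ?thesis using bis_le_stop[of j q] stop_le_bis[of q j] by simp
qed

lemma dist_start_hit: "dist q (hit q) \<le> l"
  using dist_hit[of q 0] by simp

text \<open>
  Near \<open>hit q\<close> there are points of \<open>\<Omega>\<close> and of its complement on one line, hence points of \<open>S\<close>; and \<open>S\<close> is
  closed.
\<close>

lemma hit_in_S:
  assumes q: "q \<in> starts p R" shows "hit q \<in> S"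
proof -
  have "\<exists>y\<in>S. dist y (hit q) < e" if e: "e > 0" for e
  proof -
    have "(\<lambda>j. 2 * l / 2 ^ j) \<longlonglongrightarrow> 0" by (rule LIMSEQ_divide_realpow_zero) simp
    then obtain j where j: "2 * l / 2 ^ j < e"
      using e by (metis (no_types, lifting) order_tendsto_iff eventually_happens' sequentially_bot)
    let ?q = "q + hz (bis j q *\<^sub>R \<nu>)"
    have step: "?q + hz ((l / 2 ^ j) *\<^sub>R \<nu>) = q + hz ((bis j q + l / 2 ^ j) *\<^sub>R \<nu>)"
      by (simp add: add.assoc hz_add_scaleR)
    have "(?q \<in> \<Omega>) \<noteq> (?q + hz ((l / 2 ^ j) *\<^sub>R \<nu>) \<in> \<Omega>)" unfolding step using bis_invariant[OF q, of j] by blast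
    then obtain s where s: "0 \<le> s" "s \<le> 1" and y: "?q + hz (s *\<^sub>R ((l / 2 ^ j) *\<^sub>R \<nu>)) \<in> S" using cross by (metis atLeastAtMost_iff)
    have "dist ?q (?q + hz (s *\<^sub>R ((l / 2 ^ j) *\<^sub>R \<nu>))) \<le> 1 * (l / 2 ^ j)"
      using s l \<nu> by (simp add: divide_right_mono mult_left_le_one_le)
    then have "dist (?q + hz (s *\<^sub>R ((l / 2 ^ j) *\<^sub>R \<nu>))) (hit q) \<le> 2 * l / 2 ^ j"
      using dist_hit[of q j] dist_triangle3[of "?q + hz (s *\<^sub>R ((l / 2 ^ j) *\<^sub>R \<nu>))" "hit q" ?q] by simp
    with y j show ?thesis by force
  qed
  then show ?thesis using closed_approachable[OF closed_S, of "hit q"] by blast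
qed

lemma hit_subset_Hit: "{q \<in> starts p R. hit q \<in> G} \<subseteq> Hit (l *\<^sub>R \<nu>) G"
proof clarify
  fix q assume "q \<in> starts p R" "hit q \<in> G"
  then show "q \<in> Hit (l *\<^sub>R \<nu>) G"
    unfolding Hit_def using stop_time_range[of q] l
    by (auto simp: hit_def intro!: bexI[of _ "stop_time q / l"])
qed

text \<open>
  The distribution of the selected points: the image of volume on \<open>starts p R\<close> under \<open>hit\<close>.
\<close>

definition mass :: "'k heis \<Rightarrow> real \<Rightarrow> 'k heis set \<Rightarrow> ennreal" where
  "mass p R E = vol {q \<in> starts p R. hit q \<in> E}"

lemma mass_cball_le:
  assumes "\<rho> > 0"
  shows "mass p R (cball x \<rho>) \<le> ennreal (hit_const TYPE('k) * l * (Cu * \<rho> ^ (2 * CARD('k) + 1)))"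
proof -
  have "mass p R (cball x \<rho>) \<le> vol (Hit (l *\<^sub>R \<nu>) (S \<inter> cball x \<rho>))"
    unfolding mass_def
  proof (rule vol_mono)
    show "{q \<in> starts p R. hit q \<in> cball x \<rho>} \<subseteq> Hit (l *\<^sub>R \<nu>) (S \<inter> cball x \<rho>)"
      using hit_subset_Hit[of p R "S \<inter> cball x \<rho>"] hit_in_S by blast
  qed
  also have "\<dots> \<le> ennreal (hit_const TYPE('k) * norm (l *\<^sub>R \<nu>) * (Cu * \<rho> ^ (2 * CARD('k) + 1)))"
    using l \<nu> assms by (intro vol_Hit_S_le) auto
  finally show ?thesis using l \<nu> by simp
qed

text \<open>
  If \<open>hit q\<close> is close to \<open>x\<close>, the lower end of the \<open>j\<close>-th bisection interval lies in the upset of \<open>x\<close>, and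
  it arises from \<open>q\<close> by one of \<open>2\<^sup>j\<close> translations.
\<close>

lemma mass_cball_le_upset:
  "mass p R (cball x (l / 2 ^ j)) \<le> ennreal (2 ^ j) * vol (upset x (l / 2 ^ j) \<nu>)"
proof -
  let ?U = "upset x (l / 2 ^ j) \<nu>"
  have "{q \<in> starts p R. hit q \<in> cball x (l / 2 ^ j)} \<subseteq> (\<Union>m\<in>{..<2 ^ j}. {q. q + hz ((real m * (l / 2 ^ j)) *\<^sub>R \<nu>) \<in> ?U})"
  proof
    fix q assume q: "q \<in> {q \<in> starts p R. hit q \<in> cball x (l / 2 ^ j)}"
    obtain m where m: "m < 2 ^ j" "bis j q = real m * (l / 2 ^ j)" using bis_grid by blast
    let ?q = "q + hz (bis j q *\<^sub>R \<nu>)"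
    have "dist x ?q \<le> 2 * (l / 2 ^ j)"
      using q dist_hit[of q j] dist_triangle2[of x ?q "hit q"] by simp
    moreover have "?q + hz ((l / 2 ^ j) *\<^sub>R \<nu>) = q + hz ((bis j q + l / 2 ^ j) *\<^sub>R \<nu>)"
      by (simp add: add.assoc hz_add_scaleR)
    ultimately have "?q \<in> ?U" using bis_invariant[of q p R j] q by (simp add: upset_def)
    with m show "q \<in> (\<Union>m\<in>{..<2 ^ j}. {q. q + hz ((real m * (l / 2 ^ j)) *\<^sub>R \<nu>) \<in> ?U})" by auto
  qed
  then have "mass p R (cball x (l / 2 ^ j)) \<le> (\<Sum>m\<in>{..<2 ^ j :: nat}. vol {q. q + hz ((real m * (l / 2 ^ j)) *\<^sub>R \<nu>) \<in> ?U})"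
    unfolding mass_def by (intro order_trans[OF vol_mono vol_UN_finite_le]) auto
  also have "\<dots> = of_nat (2 ^ j) * vol ?U" by (simp only: vol_right sum_constant card_lessThan)
  also have "(of_nat (2 ^ j) :: ennreal) = ennreal (2 ^ j)" by (simp flip: ennreal_of_nat_eq_real_of_nat ennreal_power)
  finally show ?thesis .
qed


section \<open>Most crossing points have large density at every scale\<close>

text \<open>
  Cover the selected points of low density by balls of low mass whose shrunken balls are disjoint. By lower
  regularity the sum of the \<open>n\<close>-th powers of the radii is bounded by the Hausdorff measure of \<open>S\<close> in a
  large ball, so the total mass of the cover is at most a multiple of \<open>\<epsilon>\<close>.
\<close>

lemma low_density_small:
  assumes cl: "cl > 0" and lower: "\<And>z \<rho>. z \<in> S \<Longrightarrow> 0 < \<rho> \<Longrightarrow> \<rho> \<le> l \<Longrightarrow> ennreal (cl * \<rho> ^ (2 * CARD('k) + 1)) \<le> hmeas (S \<inter> cball z \<rho>)"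
    and \<epsilon>: "\<epsilon> \<ge> 0" and R: "R \<ge> 0"
  shows "vol {q \<in> starts p R. \<exists>j. mass p R (cball (hit q) (l / 2 ^ j)) < ennreal (\<epsilon> * l * (l / 2 ^ j) ^ (2 * CARD('k) + 1))}
    \<le> ennreal (\<epsilon> * l * 6 ^ (2 * CARD('k) + 1) / cl * (Cu * (R + 2 * l) ^ (2 * CARD('k) + 1)))"
proof -
  let ?n = "2 * CARD('k) + 1"
  define Z where "Z = {q \<in> starts p R. \<exists>j. mass p R (cball (hit q) (l / 2 ^ j)) < ennreal (\<epsilon> * l * (l / 2 ^ j) ^ ?n)}"
  define C where "C = hit ` Z"
  define T where "T = Cu * (R + 2 * l) ^ ?n"
  have T0: "T > 0" using Cu_pos R l by (simp add: T_def)
  have "\<exists>j. mass p R (cball x (l / 2 ^ j)) < ennreal (\<epsilon> * l * (l / 2 ^ j) ^ ?n)" if "x \<in> C" for x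
    using that by (auto simp: C_def Z_def)
  then obtain J where J: "\<And>x. x \<in> C \<Longrightarrow> mass p R (cball x (l / 2 ^ J x)) < ennreal (\<epsilon> * l * (l / 2 ^ J x) ^ ?n)" by metis
  define \<rho> where "\<rho> x = l / 2 ^ J x" for x
  have \<rho>: "0 < \<rho> x" "\<rho> x \<le> l" for x
  proof -
    show "0 < \<rho> x" using l by (simp add: \<rho>_def)
    show "\<rho> x \<le> l" using l by (simp add: \<rho>_def divide_le_eq mult_le_cancel_left1)
  qed
  have radb: "0 < \<rho> x / 3 \<and> \<rho> x / 3 \<le> l" for x using \<rho>[of x] by simp
  obtain D where D: "D \<subseteq> C" and disj: "\<And>x y. x \<in> D \<Longrightarrow> y \<in> D \<Longrightarrow> x \<noteq> y \<Longrightarrow> cball x (\<rho> x / 3) \<inter> cball y (\<rho> y / 3) = {}"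
    and cov: "\<And>x. x \<in> C \<Longrightarrow> \<exists>y\<in>D. dist x y \<le> 3 * (\<rho> y / 3)"
    using Vitali_metric[of C "\<lambda>x. \<rho> x / 3" l, OF radb] by metis
  have CS: "x \<in> S" "dist p x \<le> R + l" if xC: "x \<in> C" for x
  proof -
    obtain q where q: "q \<in> starts p R" "x = hit q" using xC by (auto simp: C_def Z_def)
    show "x \<in> S" using hit_in_S[OF q(1)] q(2) by simp
    show "dist p x \<le> R + l" using q dist_start_hit[of q] dist_triangle[of p x q] by (simp add: starts_def)
  qed
  have fin_sum: "(\<Sum>y\<in>F. \<rho> y ^ ?n) \<le> 6 ^ ?n / cl * T" if F: "finite F" "F \<subseteq> D" for F
  proof -
    have "ennreal (\<Sum>y\<in>F. cl * (\<rho> y / 6) ^ ?n) = (\<Sum>y\<in>F. ennreal (cl * (\<rho> y / 6) ^ ?n))"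
      using cl \<rho>(1) by (intro sum_ennreal[symmetric]) (simp add: less_imp_le)
    also have "\<dots> \<le> (\<Sum>y\<in>F. hmeas (S \<inter> cball y (\<rho> y / 3 / 2)))"
    proof (rule sum_mono)
      fix y assume "y \<in> F"
      then have "y \<in> S" using F D CS by blast
      from lower[OF this, of "\<rho> y / 6"] \<rho>[of y]
      show "ennreal (cl * (\<rho> y / 6) ^ ?n) \<le> hmeas (S \<inter> cball y (\<rho> y / 3 / 2))" by simp
    qed
    also have "\<dots> \<le> hmeas (S \<inter> (\<Union>y\<in>F. cball y (\<rho> y / 3)))"
      using F \<rho>(1) by (intro hausdorff_disjoint_balls disj) auto
    also have "\<dots> \<le> hmeas (S \<inter> cball p (R + 2 * l))"
    proof (rule hausdorff_mono)
      have "cball y (\<rho> y / 3) \<subseteq> cball p (R + 2 * l)" if "y \<in> F" for y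
      proof
        fix u assume u: "u \<in> cball y (\<rho> y / 3)"
        have "dist p y \<le> R + l" using that F D CS by blast
        then show "u \<in> cball p (R + 2 * l)" using u \<rho>[of y] dist_triangle[of p u y] by simp
      qed
      then show "S \<inter> (\<Union>y\<in>F. cball y (\<rho> y / 3)) \<subseteq> S \<inter> cball p (R + 2 * l)" by blast
    qed
    also have "\<dots> \<le> ennreal T" unfolding T_def using R l by (intro upper) simp
    finally have "(\<Sum>y\<in>F. cl * (\<rho> y / 6) ^ ?n) \<le> T" using T0 by (subst (asm) ennreal_le_iff) auto
    moreover have "(\<Sum>y\<in>F. cl * (\<rho> y / 6) ^ ?n) = cl / 6 ^ ?n * (\<Sum>y\<in>F. \<rho> y ^ ?n)"
      by (simp add: power_divide sum_distrib_left)
    ultimately have "cl / 6 ^ ?n * (\<Sum>y\<in>F. \<rho> y ^ ?n) \<le> T" by (simp only:)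
    then have "6 ^ ?n / cl * (cl / 6 ^ ?n * (\<Sum>y\<in>F. \<rho> y ^ ?n)) \<le> 6 ^ ?n / cl * T"
      using cl by (intro mult_left_mono) auto
    moreover have "6 ^ ?n / cl * (cl / 6 ^ ?n * X) = X" for X using cl by simp
    ultimately show ?thesis by (simp only:)
  qed
  \<comment> \<open>There are finitely many disjoint balls of each dyadic size, so the cover is countable.\<close>
  define Dj where "Dj j = {y \<in> D. J y = j}" for j
  have fin: "finite (Dj j)" for j
  proof (rule ccontr)
    assume inf: "infinite (Dj j)"
    define b where "b = (l / 2 ^ j) ^ ?n"
    have b: "b > 0" using l by (simp add: b_def)
    obtain N :: nat where N: "6 ^ ?n / cl * T < real N * b" using reals_Archimedean3[OF b] by blast
    obtain F where F: "F \<subseteq> Dj j" "finite F" "card F = N" using infinite_arbitrarily_large[OF inf] by metis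
    have "(\<Sum>y\<in>F. \<rho> y ^ ?n) = (\<Sum>y\<in>F. b)" using F by (intro sum.cong) (auto simp: Dj_def \<rho>_def b_def)
    then have "real N * b \<le> 6 ^ ?n / cl * T" using fin_sum[of F] F by (auto simp: Dj_def)
    with N show False by simp
  qed
  define E where "E j = (\<Union>y\<in>Dj j. {q \<in> starts p R. hit q \<in> cball y (\<rho> y)})" for j
  have "Z \<subseteq> (\<Union>j. E j)"
  proof
    fix q assume q: "q \<in> Z"
    then have "hit q \<in> C" by (simp add: C_def)
    from cov[OF this] obtain y where "y \<in> D" "dist (hit q) y \<le> \<rho> y" by auto
    then have "q \<in> E (J y)" using q by (auto simp: E_def Dj_def Z_def dist_commute)
    then show "q \<in> (\<Union>j. E j)" by blast
  qed
  then have "vol Z \<le> (\<Sum>j. vol (E j))" by (intro order_trans[OF vol_mono vol_UN_le])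
  also have "\<dots> \<le> (\<Sum>j. \<Sum>y\<in>Dj j. ennreal (\<epsilon> * l * \<rho> y ^ ?n))"
  proof (intro suminf_le summableI)
    fix j
    have "vol (E j) \<le> (\<Sum>y\<in>Dj j. mass p R (cball y (\<rho> y)))"
      unfolding E_def mass_def by (rule vol_UN_finite_le[OF fin])
    also have "\<dots> \<le> (\<Sum>y\<in>Dj j. ennreal (\<epsilon> * l * \<rho> y ^ ?n))"
      using J D by (intro sum_mono less_imp_le) (auto simp: Dj_def \<rho>_def)
    finally show "vol (E j) \<le> (\<Sum>y\<in>Dj j. ennreal (\<epsilon> * l * \<rho> y ^ ?n))" .
  qed
  also have "\<dots> \<le> ennreal (\<epsilon> * l * 6 ^ ?n / cl * T)"
    unfolding suminf_eq_SUP
  proof (rule SUP_least)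
    fix N
    have "(\<Sum>j<N. \<Sum>y\<in>Dj j. ennreal (\<epsilon> * l * \<rho> y ^ ?n)) = (\<Sum>y\<in>(\<Union>j<N. Dj j). ennreal (\<epsilon> * l * \<rho> y ^ ?n))"
      using fin by (intro sum.UNION_disjoint[symmetric]) (auto simp: Dj_def)
    also have "\<dots> = ennreal (\<Sum>y\<in>(\<Union>j<N. Dj j). \<epsilon> * l * \<rho> y ^ ?n)"
      using \<epsilon> l \<rho>(1) by (intro sum_ennreal) (simp add: less_imp_le)
    also have "\<dots> \<le> ennreal (\<epsilon> * l * 6 ^ ?n / cl * T)"
    proof (rule ennreal_leI)
      have "(\<Sum>y\<in>(\<Union>j<N. Dj j). \<epsilon> * l * \<rho> y ^ ?n) = \<epsilon> * l * (\<Sum>y\<in>(\<Union>j<N. Dj j). \<rho> y ^ ?n)"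
        by (simp only: sum_distrib_left)
      also have "\<dots> \<le> \<epsilon> * l * (6 ^ ?n / cl * T)"
        using fin \<epsilon> l by (intro mult_left_mono fin_sum) (auto simp: Dj_def)
      finally show "(\<Sum>y\<in>(\<Union>j<N. Dj j). \<epsilon> * l * \<rho> y ^ ?n) \<le> \<epsilon> * l * 6 ^ ?n / cl * T" by simp
    qed
    finally show "(\<Sum>j<N. \<Sum>y\<in>Dj j. ennreal (\<epsilon> * l * \<rho> y ^ ?n)) \<le> ennreal (\<epsilon> * l * 6 ^ ?n / cl * T)" .
  qed
  finally show ?thesis by (simp only: Z_def T_def)
qed


section \<open>Most crossing points see few non-monotone scales\<close>

definition bad_scale :: "(real ^ ('k + 'k)) set \<Rightarrow> real \<Rightarrow> nat \<Rightarrow> 'k heis \<Rightarrow> nat \<Rightarrow> bool" where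
  "bad_scale W \<kappa> i x j \<longleftrightarrow> (\<exists>w\<in>W. ennreal (\<kappa> * (l / 2 ^ j) ^ (2 * CARD('k) + 2)) \<le>
     vol (nonmono \<Omega> (2 ^ (i + 1)) ((l / 2 ^ j) *\<^sub>R w) \<inter> cball x (20 * (2 ^ i * (l / 2 ^ j)))))"

lemma measurable_bis: "(\<lambda>z. bis j (hc z)) \<in> borel_measurable borel"
proof (induction j)
  case (Suc j)
  have "(\<lambda>z. mulc z ((bis j (hc z) + l / 2 ^ Suc j) *\<^sub>R \<nu>) 0) \<in> borel_measurable borel"
    by (intro measurable_mulc borel_measurable_scaleR borel_measurable_add borel_measurable_const Suc) simp
  then have "(\<lambda>z. mulc z ((bis j (hc z) + l / 2 ^ Suc j) *\<^sub>R \<nu>) 0) -` (hc -` \<Omega>) \<inter> space borel \<in> sets borel"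
    by (rule measurable_sets) (use \<Omega>_sets in \<open>simp add: hsets_def\<close>)
  also have "(\<lambda>z. mulc z ((bis j (hc z) + l / 2 ^ Suc j) *\<^sub>R \<nu>) 0) -` (hc -` \<Omega>) \<inter> space borel =
      {z \<in> space borel. hc z + hz ((bis j (hc z) + l / 2 ^ Suc j) *\<^sub>R \<nu>) \<in> \<Omega>}"
    by (simp only: vimage_def mem_Collect_eq hc_mulc hz_def space_borel Int_UNIV_right) simp
  finally have P: "{z \<in> space borel. hc z + hz ((bis j (hc z) + l / 2 ^ Suc j) *\<^sub>R \<nu>) \<in> \<Omega>} \<in> sets borel" .
  show ?case
    unfolding bis.simps by (intro borel_measurable_add Suc measurable_If P borel_measurable_const)
qed simp

lemma measurable_stop_time: "(\<lambda>z. stop_time (hc z)) \<in> borel_measurable borel"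
  by (rule borel_measurable_LIMSEQ_real[OF bis_LIMSEQ measurable_bis])

lemma sets_hit_near:
  "{u. dist (hit (hc (fst u))) (hc (snd u)) \<le> r} \<in> sets borel"
proof -
  let ?T = "\<lambda>u. (mulc (fst u) (stop_time (hc (fst u)) *\<^sub>R \<nu>) 0, snd u)"
  have cl: "closed {v. dist (hc (fst v)) (hc (snd v)) \<le> r}"
    by (intro closed_Collect_le continuous_intros continuous_on_compose2[OF continuous_on_hc[of UNIV]]) auto
  have "?T -` {v. dist (hc (fst v)) (hc (snd v)) \<le> r} \<inter> space borel \<in> sets borel"
    by (rule measurable_sets[OF _ borel_closed[OF cl]])
      (intro borel_measurable_Pair measurable_mulc borel_measurable_scaleR borel_measurable_const
        measurable_compose[OF _ measurable_stop_time] borel_measurable_fst' borel_measurable_snd'; simp)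
  also have "?T -` {v. dist (hc (fst v)) (hc (snd v)) \<le> r} \<inter> space borel = {u. dist (hit (hc (fst u))) (hc (snd u)) \<le> r}"
    by (auto simp: hc_mulc hit_def hz_def)
  finally show ?thesis .
qed

lemma nonmono_localized:
  assumes q: "q \<in> nonmono \<Omega> N v" and d: "dist p q + real N * norm v \<le> R"
  shows "q \<in> nonmono (\<Omega> \<inter> cball p R) N v"
proof -
  have "q + hz (real m *\<^sub>R v) \<in> cball p R" if "m \<le> N" for m
  proof -
    have "dist q (q + hz (real m *\<^sub>R v)) = real m * norm v" by simp
    also have "\<dots> \<le> real N * norm v" using that by (intro mult_right_mono) auto
    finally show ?thesis using d dist_triangle[of p "q + hz (real m *\<^sub>R v)" q] by simp
  qed
  then have e: "(q + hz (real m *\<^sub>R v) \<in> \<Omega> \<inter> cball p R) = (q + hz (real m *\<^sub>R v) \<in> \<Omega>)" if "m \<le> N" for m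
    using that by blast
  obtain m1 m2 m3 where m: "m1 < m2" "m2 < m3" "m3 \<le> N"
    "(q + hz (real m1 *\<^sub>R v) \<in> \<Omega>) \<noteq> (q + hz (real m2 *\<^sub>R v) \<in> \<Omega>)"
    "(q + hz (real m2 *\<^sub>R v) \<in> \<Omega>) \<noteq> (q + hz (real m3 *\<^sub>R v) \<in> \<Omega>)"
    using q unfolding nonmono_def by blast
  then have "m1 \<le> N" "m2 \<le> N" "m3 \<le> N" by auto
  then show ?thesis using m(4,5) by (intro nonmonoI[OF m(1,2,3)]) (simp_all only: e not_False_eq_True)
qed

text \<open>
  Integrate over \<open>q\<close> the number of bad scales of \<open>hit q\<close>, bounded by the volumes that occur in
  \<open>bad_scale\<close> divided by their threshold. Interchanging the integrals, a non-monotone point \<open>y\<close> of scale \<open>j\<close> is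
  counted with the mass of a ball of radius comparable to \<open>l / 2\<^sup>j\<close>, which gives
  \<open>2\<^sup>j\<close> times the volume of the non-monotone set, and \<open>nonmono_packing\<close> bounds the sum over \<open>j\<close>. Markov's
  inequality finishes the proof.
\<close>

lemma many_bad_scales_small:
  assumes W: "finite W" "\<And>w. w \<in> W \<Longrightarrow> norm w \<le> 3" and \<kappa>: "\<kappa> > 0" and R: "R \<ge> 0"
    and R2: "R + l + 26 * 2 ^ i * l \<le> R2" and J: "J > 0"
  shows "vol {q \<in> starts p R. \<not> (finite {j. bad_scale W \<kappa> i (hit q) j} \<and> card {j. bad_scale W \<kappa> i (hit q) j} < J)}
    \<le> ennreal (1 / real J * (real (card W) * (1 / \<kappa> * hit_const TYPE('k) * Cu * (20 * 2 ^ i) ^ (2 * CARD('k) + 1) *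
        (2 ^ (i + 1) * real (i + 1) * pack_const * (3 * l) * R2 ^ (2 * CARD('k) + 1)))))"
proof -
  let ?n = "2 * CARD('k) + 1" and ?h = "hit_const TYPE('k)" and ?M = "(2::nat) ^ (i + 1)"
  let ?A = "starts p R" and ?O = "\<Omega> \<inter> cball p R2"
  have h: "?h > 0" by (rule hit_const_pos)
  have R20: "R2 > 0"
  proof -
    have "0 < R + l + 26 * 2 ^ i * l" using R l by (simp add: add_nonneg_pos add_pos_pos)
    with R2 show ?thesis by linarith
  qed
  define \<rho> where "\<rho> j = l / 2 ^ j" for j
  have \<rho>: "\<rho> j > 0" "\<rho> j \<le> l" for j
  proof -
    show "\<rho> j > 0" using l by (simp add: \<rho>_def)
    show "\<rho> j \<le> l" using l by (simp add: \<rho>_def divide_le_eq mult_le_cancel_left1)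
  qed
  define NM where "NM w j = nonmono ?O ?M (\<rho> j *\<^sub>R w)" for w j
  have NMh: "NM w j \<in> hsets" for w j
    unfolding NM_def by (intro hsets_nonmono hsets_Int \<Omega>_sets hsets_closed closed_cball)
  define Rj where "Rj j = 20 * (2 ^ i * \<rho> j)" for j
  have Rj: "Rj j > 0" for j using \<rho> by (simp add: Rj_def)
  define K where "K w j = {u. hc (fst u) \<in> ?A} \<inter> ({u. hc (snd u) \<in> NM w j} \<inter> {u. dist (hit (hc (fst u))) (hc (snd u)) \<le> Rj j})" for w j
  have Km: "K w j \<in> sets borel" for w j
  proof -
    have "{u :: ((real ^ ('k + 'k)) \<times> real) \<times> ((real ^ ('k + 'k)) \<times> real). hc (snd u) \<in> NM w j} \<in> sets borel"
    proof -
      have "(\<lambda>u :: ((real ^ ('k + 'k)) \<times> real) \<times> ((real ^ ('k + 'k)) \<times> real). snd u) -` (hc -` NM w j) \<inter> space borel \<in> sets borel"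
        by (rule measurable_sets[OF borel_measurable_snd']) (use NMh in \<open>simp_all add: hsets_def\<close>)
      then show ?thesis by (simp add: vimage_def)
    qed
    then show ?thesis unfolding K_def by (intro sets.Int sets_vimage_fixed hsets_starts sets_hit_near)
  qed
  define cf where "cf j = 1 / (\<kappa> * \<rho> j ^ (?n + 1))" for j
  have cf: "cf j > 0" for j using \<kappa> \<rho> by (simp add: cf_def)
  define \<psi> where "\<psi> z w j = ennreal (cf j) * (\<integral>\<^sup>+ y. indicator (K w j) (z, y) \<partial>lborel)" for z w j
  define \<Psi> where "\<Psi> z = (\<Sum>j. \<Sum>w\<in>W. \<psi> z w j)" for z
  have im: "(\<lambda>u. indicator (K w j) u :: ennreal) \<in> borel_measurable borel" for w j using Km by simp
  have m0: "(\<lambda>z. \<integral>\<^sup>+ y. indicator (K w j) (z, y) \<partial>lborel :: ennreal) \<in> borel_measurable borel" for w j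
    by (rule borel_measurable_nn_integral_lborel[OF im])
  have m1: "(\<lambda>z. \<psi> z w j) \<in> borel_measurable borel" for w j unfolding \<psi>_def using m0 by simp
  have m2: "(\<lambda>z. \<Sum>w\<in>W. \<psi> z w j) \<in> borel_measurable borel" for j using m1 by simp
  have m3: "\<Psi> \<in> borel_measurable borel" unfolding \<Psi>_def using m2 by simp
  \<comment> \<open>The weight \<open>cf j\<close> is chosen so that every bad scale contributes at least one to \<open>\<Psi>\<close>.\<close>
  have one: "1 \<le> (\<Sum>w\<in>W. \<psi> z w j)" if z: "hc z \<in> ?A" and b: "bad_scale W \<kappa> i (hit (hc z)) j" for z j
  proof -
    obtain w where w: "w \<in> W" and v: "ennreal (\<kappa> * \<rho> j ^ (?n + 1)) \<le> vol (nonmono \<Omega> ?M (\<rho> j *\<^sub>R w) \<inter> cball (hit (hc z)) (Rj j))"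
      using b by (auto simp: bad_scale_def \<rho>_def Rj_def)
    have sub: "nonmono \<Omega> ?M (\<rho> j *\<^sub>R w) \<inter> cball (hit (hc z)) (Rj j) \<subseteq> NM w j \<inter> cball (hit (hc z)) (Rj j)"
    proof
      fix y assume y: "y \<in> nonmono \<Omega> ?M (\<rho> j *\<^sub>R w) \<inter> cball (hit (hc z)) (Rj j)"
      have "dist p y \<le> R + l + Rj j"
        using y z dist_start_hit[of "hc z"] dist_triangle[of p y "hit (hc z)"] dist_triangle[of p "hit (hc z)" "hc z"]
        by (simp add: starts_def)
      moreover have "Rj j \<le> 20 * (2 ^ i * l)" unfolding Rj_def using \<rho> by (intro mult_left_mono) auto
      moreover have "real ?M * norm (\<rho> j *\<^sub>R w) \<le> 6 * (2 ^ i * l)"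
      proof -
        have "norm (\<rho> j *\<^sub>R w) \<le> l * 3" using \<rho>[of j] W(2)[OF w] l by (simp only: norm_scaleR, intro mult_mono) auto
        then have "real ?M * norm (\<rho> j *\<^sub>R w) \<le> real ?M * (l * 3)" by (intro mult_left_mono) auto
        then show ?thesis by simp
      qed
      ultimately have "dist p y + real ?M * norm (\<rho> j *\<^sub>R w) \<le> R2" using R2 by linarith
      then show "y \<in> NM w j \<inter> cball (hit (hc z)) (Rj j)" using y nonmono_localized[of y ?M "\<rho> j *\<^sub>R w" p R2] by (simp add: NM_def)
    qed
    have hs: "NM w j \<inter> cball (hit (hc z)) (Rj j) \<in> hsets" by (intro hsets_Int NMh hsets_closed closed_cball)
    have "ennreal (\<kappa> * \<rho> j ^ (?n + 1)) \<le> vol (NM w j \<inter> cball (hit (hc z)) (Rj j))"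
      using v vol_mono[OF sub] by (rule order_trans)
    also have "\<dots> = (\<integral>\<^sup>+ y. indicator (K w j) (z, y) \<partial>lborel)"
      unfolding vol_as_integral[OF hs] using z by (intro nn_integral_cong) (simp add: K_def indicator_def)
    finally have "ennreal (cf j) * ennreal (\<kappa> * \<rho> j ^ (?n + 1)) \<le> \<psi> z w j" unfolding \<psi>_def by (rule mult_left_mono) simp
    moreover have "ennreal (cf j) * ennreal (\<kappa> * \<rho> j ^ (?n + 1)) = 1"
    proof -
      have "\<kappa> * \<rho> j ^ (?n + 1) > 0" using \<kappa> \<rho> by (intro mult_pos_pos zero_less_power)
      have "cf j * (\<kappa> * \<rho> j ^ (?n + 1)) = 1" using \<kappa> \<rho>(1)[of j] by (simp add: cf_def)
      then show ?thesis using cf[of j] \<open>\<kappa> * \<rho> j ^ (?n + 1) > 0\<close> by (simp flip: ennreal_mult del: power_Suc add_Suc_right)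
    qed
    ultimately have "1 \<le> \<psi> z w j" by simp
    also have "\<dots> \<le> (\<Sum>w\<in>W. \<psi> z w j)" using W(1) w by (intro member_le_sum) auto
    finally show ?thesis .
  qed
  have sub: "hc -` {q \<in> ?A. \<not> (finite {j. bad_scale W \<kappa> i (hit q) j} \<and> card {j. bad_scale W \<kappa> i (hit q) j} < J)}
    \<subseteq> {z \<in> hc -` ?A. 1 \<le> ennreal (1 / real J) * \<Psi> z}"
  proof
    fix z assume "z \<in> hc -` {q \<in> ?A. \<not> (finite {j. bad_scale W \<kappa> i (hit q) j} \<and> card {j. bad_scale W \<kappa> i (hit q) j} < J)}"
    then have z: "hc z \<in> ?A" and nf: "\<not> (finite {j. bad_scale W \<kappa> i (hit (hc z)) j} \<and> card {j. bad_scale W \<kappa> i (hit (hc z)) j} < J)" by auto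
    obtain F where F: "finite F" "F \<subseteq> {j. bad_scale W \<kappa> i (hit (hc z)) j}" "card F = J"
    proof (cases "finite {j. bad_scale W \<kappa> i (hit (hc z)) j}")
      case True
      with nf have "J \<le> card {j. bad_scale W \<kappa> i (hit (hc z)) j}" by simp
      then obtain F where "F \<subseteq> {j. bad_scale W \<kappa> i (hit (hc z)) j}" "card F = J" by (meson obtain_subset_with_card_n)
      with that[of F] True finite_subset show ?thesis by blast
    next
      case False
      from infinite_arbitrarily_large[OF this, of J] that show ?thesis by blast
    qed
    have "ennreal (real J) = (\<Sum>j\<in>F. 1)" using F by (simp add: ennreal_of_nat_eq_real_of_nat)
    also have "\<dots> \<le> (\<Sum>j\<in>F. \<Sum>w\<in>W. \<psi> z w j)" using F one[OF z] by (intro sum_mono) auto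
    also have "\<dots> \<le> \<Psi> z" unfolding \<Psi>_def by (rule sum_le_suminf[OF summableI F(1)]) simp
    finally have "ennreal (1 / real J) * ennreal (real J) \<le> ennreal (1 / real J) * \<Psi> z" by (rule mult_left_mono) simp
    moreover have "ennreal (1 / real J) * ennreal (real J) = 1" using J by (simp flip: ennreal_mult)
    ultimately show "z \<in> {z \<in> hc -` ?A. 1 \<le> ennreal (1 / real J) * \<Psi> z}" using z by simp
  qed
  have Am: "hc -` ?A \<in> sets lborel" using hsets_starts[of p R] by (simp add: hsets_def)
  have tm: "{z \<in> hc -` ?A. 1 \<le> ennreal (1 / real J) * \<Psi> z} \<in> sets lborel"
  proof -
    have "{z \<in> space lborel. 1 \<le> ennreal (1 / real J) * \<Psi> z} \<in> sets lborel" using m3 by measurable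
    from sets.Int[OF Am this] show ?thesis by (simp add: Int_def)
  qed
  have "vol {q \<in> ?A. \<not> (finite {j. bad_scale W \<kappa> i (hit q) j} \<and> card {j. bad_scale W \<kappa> i (hit q) j} < J)}
    \<le> emeasure lborel {z \<in> hc -` ?A. 1 \<le> ennreal (1 / real J) * \<Psi> z}"
    unfolding vol_def outer_measure_of_eq[OF tm, symmetric] by (rule outer_measure_of_mono[OF sub])
  also have "\<dots> \<le> ennreal (1 / real J) * (\<integral>\<^sup>+ z. \<Psi> z * indicator (hc -` ?A) z \<partial>lborel)"
    using m3 Am by (intro nn_integral_Markov_inequality) (auto intro!: borel_measurable_times_ennreal)
  also have "\<dots> \<le> ennreal (1 / real J) * (\<integral>\<^sup>+ z. \<Psi> z \<partial>lborel)"
    by (intro mult_left_mono nn_integral_mono) (auto simp: indicator_def)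
  also have "(\<integral>\<^sup>+ z. \<Psi> z \<partial>lborel) = (\<Sum>j. \<integral>\<^sup>+ z. (\<Sum>w\<in>W. \<psi> z w j) \<partial>lborel)"
    unfolding \<Psi>_def using m2 by (intro nn_integral_suminf) simp
  also have "\<dots> = (\<Sum>j. \<Sum>w\<in>W. \<integral>\<^sup>+ z. \<psi> z w j \<partial>lborel)"
    using m1 by (intro suminf_cong nn_integral_sum) simp
  also have "\<dots> = (\<Sum>w\<in>W. \<Sum>j. \<integral>\<^sup>+ z. \<psi> z w j \<partial>lborel)"
    by (rule suminf_sum) (rule summableI)
  also have "\<dots> \<le> (\<Sum>w\<in>W. ennreal (1 / \<kappa> * ?h * Cu * (20 * 2 ^ i) ^ ?n * (2 ^ (i + 1) * real (i + 1) * pack_const * (3 * l) * R2 ^ ?n)))"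
  proof (rule sum_mono)
    fix w assume w: "w \<in> W"
    have scale_term: "(\<integral>\<^sup>+ z. \<psi> z w j \<partial>lborel) \<le> ennreal (1 / \<kappa> * ?h * Cu * (20 * 2 ^ i) ^ ?n) * (ennreal (2 ^ j) * vol (NM w j))" for j
    proof -
      have "(\<integral>\<^sup>+ z. \<psi> z w j \<partial>lborel) = ennreal (cf j) * (\<integral>\<^sup>+ z. \<integral>\<^sup>+ y. indicator (K w j) (z, y) \<partial>lborel \<partial>lborel)"
        unfolding \<psi>_def using m0 by (intro nn_integral_cmult) simp
      also have "(\<integral>\<^sup>+ z. \<integral>\<^sup>+ y. indicator (K w j) (z, y) \<partial>lborel \<partial>lborel) = (\<integral>\<^sup>+ y. \<integral>\<^sup>+ z. indicator (K w j) (z, y) \<partial>lborel \<partial>lborel)"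
        by (rule nn_integral_lborel_swap[OF im])
      also have "\<dots> \<le> (\<integral>\<^sup>+ y. ennreal (?h * l * (Cu * Rj j ^ ?n)) * indicator (hc -` NM w j) y \<partial>lborel)"
      proof (rule nn_integral_mono)
        fix y
        show "(\<integral>\<^sup>+ z. indicator (K w j) (z, y) \<partial>lborel) \<le> ennreal (?h * l * (Cu * Rj j ^ ?n)) * indicator (hc -` NM w j) y"
        proof (cases "hc y \<in> NM w j")
          case True
          let ?Y = "{q \<in> ?A. hit q \<in> cball (hc y) (Rj j)}"
          have ind: "(\<lambda>z. indicator (K w j) (z, y) :: ennreal) = indicator (hc -` ?Y)"
            using True by (auto simp: K_def indicator_def dist_commute)
          have "(\<lambda>z. (z, y)) -` K w j \<inter> space borel \<in> sets borel"
            by (rule measurable_sets[OF _ Km]) (intro borel_measurable_Pair borel_measurable_const, simp)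
          moreover have "(\<lambda>z. (z, y)) -` K w j \<inter> space borel = hc -` ?Y"
            using True by (auto simp: K_def dist_commute)
          ultimately have Yh: "?Y \<in> hsets" by (simp add: hsets_def)
          have "(\<integral>\<^sup>+ z. indicator (K w j) (z, y) \<partial>lborel) = mass p R (cball (hc y) (Rj j))"
            unfolding mass_def vol_as_integral[OF Yh] by (simp only: ind)
          also have "\<dots> \<le> ennreal (?h * l * (Cu * Rj j ^ ?n))" by (rule mass_cball_le[OF Rj])
          finally show ?thesis using True by simp
        next
          case False
          then show ?thesis by (simp add: K_def)
        qed
      qed
      also have "\<dots> = ennreal (?h * l * (Cu * Rj j ^ ?n)) * vol (NM w j)"
        unfolding vol_as_integral[OF NMh] using NMh[of w j] by (intro nn_integral_cmult) (simp add: hsets_def)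
      finally have "(\<integral>\<^sup>+ z. \<psi> z w j \<partial>lborel) \<le> ennreal (cf j) * (ennreal (?h * l * (Cu * Rj j ^ ?n)) * vol (NM w j))"
        by (simp add: mult_left_mono)
      also have "\<dots> = ennreal (cf j * (?h * l * (Cu * Rj j ^ ?n))) * vol (NM w j)"
        using cf[of j] h l Cu_pos Rj[of j] by (subst ennreal_mult) (simp_all add: mult.assoc)
      also have "cf j * (?h * l * (Cu * Rj j ^ ?n)) = (1 / \<kappa> * ?h * Cu * (20 * 2 ^ i) ^ ?n) * 2 ^ j"
      proof -
        have "Rj j ^ ?n = (20 * 2 ^ i) ^ ?n * \<rho> j ^ ?n" unfolding Rj_def by (simp only: power_mult_distrib[symmetric] mult.assoc)
        moreover have "l = \<rho> j * 2 ^ j" by (simp add: \<rho>_def)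
        ultimately show ?thesis using \<kappa> \<rho>(1)[of j] by (simp add: cf_def field_simps)
      qed
      also have "ennreal ((1 / \<kappa> * ?h * Cu * (20 * 2 ^ i) ^ ?n) * 2 ^ j) = ennreal (1 / \<kappa> * ?h * Cu * (20 * 2 ^ i) ^ ?n) * ennreal (2 ^ j)"
        using \<kappa> h Cu_pos by (intro ennreal_mult) auto
      finally show ?thesis by (simp only: mult.assoc)
    qed
    have "(\<Sum>j. \<integral>\<^sup>+ z. \<psi> z w j \<partial>lborel) \<le> (\<Sum>j. ennreal (1 / \<kappa> * ?h * Cu * (20 * 2 ^ i) ^ ?n) * (ennreal (2 ^ j) * vol (NM w j)))"
      by (intro suminf_le scale_term summableI)
    also have "\<dots> = ennreal (1 / \<kappa> * ?h * Cu * (20 * 2 ^ i) ^ ?n) * (\<Sum>j. ennreal (2 ^ j) * vol (NM w j))"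
      by (simp only: ennreal_suminf_cmult)
    also have "(\<Sum>j. ennreal (2 ^ j) * vol (NM w j)) \<le> ennreal (2 ^ (i + 1) * real (i + 1) * pack_const * norm (l *\<^sub>R w) * R2 ^ ?n)"
    proof -
      have "NM w j = nonmono ?O (2 ^ (i + 1)) ((l *\<^sub>R w) /\<^sub>R 2 ^ j)" for j
        by (simp add: NM_def \<rho>_def divide_inverse mult.commute)
      then show ?thesis using nonmono_packing[OF R20, of p "i + 1" "l *\<^sub>R w"] by (simp only:)
    qed
    also have "\<dots> \<le> ennreal (2 ^ (i + 1) * real (i + 1) * pack_const * (3 * l) * R2 ^ ?n)"
    proof (intro ennreal_leI mult_right_mono mult_left_mono)
      show "norm (l *\<^sub>R w) \<le> 3 * l" using W(2)[OF w] l by (simp add: mult.commute)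
    qed (use pack_const_pos R20 in auto)
    finally have "(\<Sum>j. \<integral>\<^sup>+ z. \<psi> z w j \<partial>lborel) \<le> ennreal (1 / \<kappa> * ?h * Cu * (20 * 2 ^ i) ^ ?n) * ennreal (2 ^ (i + 1) * real (i + 1) * pack_const * (3 * l) * R2 ^ ?n)"
      by (simp add: mult_left_mono)
    also have "\<dots> = ennreal (1 / \<kappa> * ?h * Cu * (20 * 2 ^ i) ^ ?n * (2 ^ (i + 1) * real (i + 1) * pack_const * (3 * l) * R2 ^ ?n))"
      using \<kappa> h Cu_pos by (intro ennreal_mult'[symmetric]) auto
    finally show "(\<Sum>j. \<integral>\<^sup>+ z. \<psi> z w j \<partial>lborel) \<le> ennreal (1 / \<kappa> * ?h * Cu * (20 * 2 ^ i) ^ ?n * (2 ^ (i + 1) * real (i + 1) * pack_const * (3 * l) * R2 ^ ?n))" .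
  qed
  also have "\<dots> = ennreal (real (card W) * (1 / \<kappa> * ?h * Cu * (20 * 2 ^ i) ^ ?n * (2 ^ (i + 1) * real (i + 1) * pack_const * (3 * l) * R2 ^ ?n)))"
    using \<kappa> h Cu_pos pack_const_pos l R20
    by (subst ennreal_mult) (simp_all add: ennreal_of_nat_eq_real_of_nat)
  finally have "vol {q \<in> ?A. \<not> (finite {j. bad_scale W \<kappa> i (hit q) j} \<and> card {j. bad_scale W \<kappa> i (hit q) j} < J)}
    \<le> ennreal (1 / real J) * ennreal (real (card W) * (1 / \<kappa> * ?h * Cu * (20 * 2 ^ i) ^ ?n * (2 ^ (i + 1) * real (i + 1) * pack_const * (3 * l) * R2 ^ ?n)))"
    by (simp add: mult_left_mono)
  also have "\<dots> = ennreal (1 / real J * (real (card W) * (1 / \<kappa> * ?h * Cu * (20 * 2 ^ i) ^ ?n * (2 ^ (i + 1) * real (i + 1) * pack_const * (3 * l) * R2 ^ ?n))))"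
    by (intro ennreal_mult'[symmetric]) simp
  finally show ?thesis .
qed

end

section \<open>Comparable crossing points share a non-monotone scale\<close>

lemma finite_net:
  fixes \<delta> :: real
  assumes \<delta>: "0 < \<delta>" "\<delta> \<le> 1"
  obtains W :: "'a::euclidean_space set" where "finite W" "\<And>w. w \<in> W \<Longrightarrow> norm w \<le> 3"
    "\<And>u. norm u \<le> 2 \<Longrightarrow> \<exists>w\<in>W. norm (u - w) \<le> \<delta>"
proof -
  have "compact (cball (0 :: 'a) 2)" by simp
  then obtain K :: "'a set" where K: "finite K" "cball 0 2 \<subseteq> (\<Union>x\<in>K. ball x \<delta>)"
    using \<delta> unfolding compact_eq_totally_bounded by blast
  show thesis
  proof (rule that[of "{w \<in> K. norm w \<le> 3}"])
    fix u :: 'a assume u: "norm u \<le> 2"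
    then obtain w where w: "w \<in> K" "dist w u < \<delta>" using K(2) by (auto simp: subset_iff)
    then have "norm w \<le> 3" using u \<delta> norm_triangle_ineq2[of w u] by (simp add: dist_norm)
    with w show "\<exists>w\<in>{w \<in> K. norm w \<le> 3}. norm (u - w) \<le> \<delta>" by (intro bexI[of _ w]) (auto simp: dist_norm norm_minus_commute)
  qed (use K in auto)
qed

context separation
begin

text \<open>
  A direction close to \<open>v\<close> moves each of the points \<open>q + m v\<close> only a little, so outside a small set they all
  remain on the same sides. This reduces the directions to a finite net.
\<close>

lemma nonmono_perturb:
  assumes \<rho>: "\<rho> > 0" and \<delta>: "0 < \<delta>" "\<delta> \<le> 1" and v: "norm v \<le> 2 * \<rho>" and vw: "norm (v - v') \<le> \<delta> * \<rho>" and r: "r \<ge> 0"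
  shows "vol (nonmono \<Omega> M v \<inter> cball x r) \<le> vol (nonmono \<Omega> M v' \<inter> cball x r) +
    ennreal (real (M + 1) * (5 * hit_const TYPE('k) * Cu * (3 * real M * sqrt \<delta> * \<rho>) * (r + 20 * real M * \<rho>) ^ (2 * CARD('k) + 1)))"
proof -
  let ?n = "2 * CARD('k) + 1" and ?h = "hit_const TYPE('k)"
  have h: "?h > 0" by (rule hit_const_pos)
  define X where "X m = {q \<in> cball x r. (q + hz (real m *\<^sub>R v) \<in> \<Omega>) \<noteq> (q + hz (real m *\<^sub>R v') \<in> \<Omega>)}" for m :: nat
  have "nonmono \<Omega> M v \<inter> cball x r \<subseteq> (nonmono \<Omega> M v' \<inter> cball x r) \<union> (\<Union>m\<in>{..M}. X m)"
  proof
    fix q assume q: "q \<in> nonmono \<Omega> M v \<inter> cball x r"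
    show "q \<in> (nonmono \<Omega> M v' \<inter> cball x r) \<union> (\<Union>m\<in>{..M}. X m)"
    proof (cases "\<exists>m\<le>M. q \<in> X m")
      case False
      then have e: "(q + hz (real m *\<^sub>R v') \<in> \<Omega>) = (q + hz (real m *\<^sub>R v) \<in> \<Omega>)" if "m \<le> M" for m
        using that q by (auto simp: X_def)
      from q obtain m1 m2 m3 where m: "m1 < m2" "m2 < m3" "m3 \<le> M"
        "(q + hz (real m1 *\<^sub>R v) \<in> \<Omega>) \<noteq> (q + hz (real m2 *\<^sub>R v) \<in> \<Omega>)"
        "(q + hz (real m2 *\<^sub>R v) \<in> \<Omega>) \<noteq> (q + hz (real m3 *\<^sub>R v) \<in> \<Omega>)"
        unfolding nonmono_def by blast
      then have "m1 \<le> M" "m2 \<le> M" "m3 \<le> M" by auto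
      then have "q \<in> nonmono \<Omega> M v'" using m(4,5) by (intro nonmonoI[OF m(1,2,3)]) (simp_all only: e not_False_eq_True)
      with q show ?thesis by blast
    qed auto
  qed
  then have "vol (nonmono \<Omega> M v \<inter> cball x r) \<le> vol (nonmono \<Omega> M v' \<inter> cball x r) + vol (\<Union>m\<in>{..M}. X m)"
    by (intro order_trans[OF vol_mono vol_Un_le])
  also have "vol (\<Union>m\<in>{..M}. X m) \<le> (\<Sum>m\<in>{..M}. vol (X m))" by (rule vol_UN_finite_le) simp
  also have "\<dots> \<le> (\<Sum>m\<in>{..M}. ennreal (5 * ?h * Cu * (3 * real M * sqrt \<delta> * \<rho>) * (r + 20 * real M * \<rho>) ^ ?n))"
  proof (rule sum_mono)
    fix m assume "m \<in> {..M}"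
    then have m: "real m \<le> real M" by simp
    define g where "g = - hz (real m *\<^sub>R v) + hz (real m *\<^sub>R v')"
    have kg: "koranyi g \<le> 3 * real M * sqrt \<delta> * \<rho>"
    proof -
      have "norm (real m *\<^sub>R v) \<le> 2 * (real M * \<rho>)"
        using mult_mono[OF m v] by simp
      moreover have "norm (real m *\<^sub>R v' - real m *\<^sub>R v) \<le> \<delta> * (real M * \<rho>)"
        using mult_mono[OF m vw] by (simp add: norm_minus_commute mult_ac flip: scaleR_diff_right)
      ultimately have "koranyi g \<le> 3 * sqrt \<delta> * (real M * \<rho>)"
        unfolding g_def using \<delta> by (intro koranyi_hz_diff_le) auto
      then show ?thesis by (simp add: mult_ac)
    qed
    have kg3: "koranyi g \<le> 3 * real M * \<rho>"
    proof -
      have "3 * real M * sqrt \<delta> * \<rho> \<le> 3 * real M * 1 * \<rho>" using \<delta> \<rho> by (intro mult_right_mono mult_left_mono) auto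
      with kg show ?thesis by simp
    qed
    have "X m \<subseteq> {q. q + hz (real m *\<^sub>R v) \<in> {q \<in> cball x (r + 2 * real M * \<rho>). (q \<in> \<Omega>) \<noteq> (q + g \<in> \<Omega>)}}"
    proof
      fix q assume q: "q \<in> X m"
      have e: "q + hz (real m *\<^sub>R v) + g = q + hz (real m *\<^sub>R v')" by (simp add: g_def add.assoc)
      have "norm (real m *\<^sub>R v) \<le> real M * (2 * \<rho>)" using m v by (simp only: norm_scaleR, intro mult_mono) auto
      then have "dist q (q + hz (real m *\<^sub>R v)) \<le> 2 * real M * \<rho>" by simp
      then have "dist x (q + hz (real m *\<^sub>R v)) \<le> r + 2 * real M * \<rho>"
        using q dist_triangle[of x "q + hz (real m *\<^sub>R v)" q] by (simp add: X_def)
      then show "q \<in> {q. q + hz (real m *\<^sub>R v) \<in> {q \<in> cball x (r + 2 * real M * \<rho>). (q \<in> \<Omega>) \<noteq> (q + g \<in> \<Omega>)}}"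
        using q unfolding mem_Collect_eq e by (simp add: X_def)
    qed
    from vol_mono[OF this] have "vol (X m) \<le> vol {q \<in> cball x (r + 2 * real M * \<rho>). (q \<in> \<Omega>) \<noteq> (q + g \<in> \<Omega>)}"
      unfolding vol_right .
    also have "\<dots> \<le> ennreal (5 * ?h * Cu * koranyi g * ((r + 2 * real M * \<rho>) + 6 * koranyi g) ^ ?n)"
      using r \<rho> by (intro vol_change) simp
    also have "\<dots> \<le> ennreal (5 * ?h * Cu * (3 * real M * sqrt \<delta> * \<rho>) * (r + 20 * real M * \<rho>) ^ ?n)"
    proof -
      have "(r + 2 * real M * \<rho>) + 6 * koranyi g \<le> r + 20 * real M * \<rho>" using kg3 by (simp add: mult_ac)
      then show ?thesis
        using h Cu_pos kg \<rho> \<delta> r by (intro ennreal_leI mult_mono power_mono mult_left_mono) auto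
    qed
    finally show "vol (X m) \<le> ennreal (5 * ?h * Cu * (3 * real M * sqrt \<delta> * \<rho>) * (r + 20 * real M * \<rho>) ^ ?n)" .
  qed
  also have "\<dots> = ennreal (real (M + 1) * (5 * ?h * Cu * (3 * real M * sqrt \<delta> * \<rho>) * (r + 20 * real M * \<rho>) ^ ?n))"
    using h Cu_pos \<rho> \<delta> r by (subst ennreal_mult) (simp_all add: ennreal_of_nat_eq_real_of_nat)
  finally show ?thesis by (simp add: add_left_mono)
qed

end

text \<open>
  The error term of \<open>nonmono_perturb\<close> for \<open>r = 5 M \<rho>\<close>, in units of \<open>sqrt \<delta> \<rho>\<^sup>Q\<close>.
\<close>

definition net_const :: "'k::finite itself \<Rightarrow> real \<Rightarrow> real \<Rightarrow> real" where
  "net_const _ Cu M = (M + 1) * (15 * hit_const TYPE('k) * Cu * M * (25 * M) ^ (2 * CARD('k) + 1))"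

context crossing_family
begin

text \<open>
  For the scale \<open>\<rho>\<close> with height difference between \<open>2\<^sup>i \<rho>\<close> and \<open>2 \<cdot> 2\<^sup>i \<rho>\<close>, the cone of aperture
  \<open>1 / 2\<^sup>i\<close> makes \<open>x\<close> and \<open>y\<close> an aligned pair. The non-monotone points obtained near \<open>x\<close> lie in the
  larger ball around \<open>y\<close> as well.
\<close>

lemma comparable_bad_scale:
  assumes i: "i \<ge> 7" and small: "count_const TYPE('k) * (err_const * sqrt (120 / 2 ^ i) + \<kappa>) < \<epsilon>\<^sup>2"
    and \<kappa>: "\<kappa> > 0" and \<epsilon>: "\<epsilon> \<ge> 0" and \<delta>: "0 < \<delta>" "\<delta> \<le> 1"
    and net: "\<And>u. norm u \<le> 2 \<Longrightarrow> \<exists>w\<in>W. norm (u - w) \<le> \<delta>"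
    and \<delta>\<kappa>: "net_const TYPE('k) Cu (2 ^ (i + 1)) * sqrt \<delta> \<le> \<kappa> / 2"
    and dx: "ennreal (\<epsilon> * (l / 2 ^ j) ^ (2 * CARD('k) + 2)) \<le> vol (upset x (l / 2 ^ j) \<nu>)"
    and dy: "ennreal (\<epsilon> * (l / 2 ^ j) ^ (2 * CARD('k) + 2)) \<le> vol (upset y (l / 2 ^ j) \<nu>)"
    and cone: "- x + y \<in> up_cone (1 / 2 ^ i) \<nu>"
    and s: "2 ^ i * (l / 2 ^ j) \<le> hor (- x + y) \<bullet> \<nu>" "hor (- x + y) \<bullet> \<nu> \<le> 2 * (2 ^ i * (l / 2 ^ j))"
  shows "bad_scale W (\<kappa> / 2) i x j \<and> bad_scale W (\<kappa> / 2) i y j"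
proof -
  let ?Q = "2 * CARD('k) + 2" and ?n = "2 * CARD('k) + 1" and ?h = "hit_const TYPE('k)"
  define \<rho> where "\<rho> = l / 2 ^ j"
  have \<rho>: "\<rho> > 0" using l by (simp add: \<rho>_def)
  define t where "t = 2 ^ i * \<rho>"
  have t: "t > 0" using \<rho> by (simp add: t_def)
  define s' where "s' = hor (- x + y) \<bullet> \<nu>"
  define w where "w = hor (- x + y) - s' *\<^sub>R \<nu>"
  have s': "t \<le> s'" "s' \<le> 2 * t" using s by (simp_all add: s'_def t_def \<rho>_def)
  have ap: "aligned_pair x y \<nu> w \<rho> s' i"
  proof
    show "w \<bullet> \<nu> = 0" using \<nu> by (simp add: w_def inner_diff_left s'_def norm_eq_1)
    show "hor (- x + y) = s' *\<^sub>R \<nu> + w" by (simp add: w_def)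
    have "norm w \<le> 1 / 2 ^ i * s'" using cone by (simp add: up_cone_def w_def s'_def)
    also have "\<dots> \<le> 1 / 2 ^ i * (2 * t)" using s' by (intro mult_left_mono) auto
    also have "\<dots> = 2 * \<rho>" by (simp add: t_def)
    finally show "norm w \<le> 2 * \<rho>" .
    have "\<bar>ver (- x + y)\<bar> \<le> 1 / 2 ^ i * s'\<^sup>2" using cone by (simp add: up_cone_def s'_def)
    also have "\<dots> \<le> 1 / 2 ^ i * (2 * t)\<^sup>2" using s' t by (intro mult_left_mono power_mono) auto
    also have "\<dots> = 4 * \<rho> * (2 ^ i * \<rho>)" by (simp add: t_def power2_eq_square)
    finally show "\<bar>ver (- x + y)\<bar> \<le> 4 * \<rho> * (2 ^ i * \<rho>)" .
  qed (use \<nu> \<rho> i s' in \<open>simp_all add: t_def\<close>)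
  have dxy: "dist x y \<le> 3 * t" using aligned_pair.dist_xy[OF ap] aligned_pair.t_def[OF ap] by (simp add: t_def)
  obtain v where v: "norm (v - \<rho> *\<^sub>R \<nu>) \<le> 120 / 2 ^ i * \<rho>"
    and V: "ennreal (\<kappa> * \<rho> ^ ?Q) < vol (nonmono \<Omega> (2 ^ (i + 1)) v \<inter> cball x (10 * (2 ^ i * \<rho>)))"
    using aligned_crossings_nonmono[OF ap small less_imp_le[OF \<kappa>] \<epsilon> dx[folded \<rho>_def] dy[folded \<rho>_def]] by blast
  have "(2::real) ^ 7 \<le> 2 ^ i" using i by (intro power_increasing) auto
  then have "120 / 2 ^ i * \<rho> \<le> 1 * \<rho>" using \<rho> by (intro mult_right_mono) (auto simp: field_simps)
  then have nv: "norm v \<le> 2 * \<rho>" using v norm_triangle_ineq2[of v "\<rho> *\<^sub>R \<nu>"] \<nu> \<rho> by simp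
  have "norm (v /\<^sub>R \<rho>) \<le> 2" using nv \<rho> by (simp add: divide_inverse[symmetric] pos_divide_le_eq mult.commute[of "inverse \<rho>"])
  from net[OF this] obtain u where u: "u \<in> W" "norm (v /\<^sub>R \<rho> - u) \<le> \<delta>" by blast
  have "v - \<rho> *\<^sub>R u = \<rho> *\<^sub>R (v /\<^sub>R \<rho> - u)" using \<rho> by (simp add: scaleR_diff_right)
  then have vu: "norm (v - \<rho> *\<^sub>R u) \<le> \<delta> * \<rho>" using u \<rho> by (simp add: mult.commute)
  let ?M = "(2::nat) ^ (i + 1)"
  let ?B = "cball x (10 * (2 ^ i * \<rho>))"
  have "vol (nonmono \<Omega> ?M v \<inter> ?B) \<le> vol (nonmono \<Omega> ?M (\<rho> *\<^sub>R u) \<inter> ?B) +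
    ennreal (real (?M + 1) * (5 * ?h * Cu * (3 * real ?M * sqrt \<delta> * \<rho>) * (10 * (2 ^ i * \<rho>) + 20 * real ?M * \<rho>) ^ ?n))"
    using \<rho> by (intro nonmono_perturb[OF \<rho> \<delta> nv vu]) simp
  also have "real (?M + 1) * (5 * ?h * Cu * (3 * real ?M * sqrt \<delta> * \<rho>) * (10 * (2 ^ i * \<rho>) + 20 * real ?M * \<rho>) ^ ?n)
     = (net_const TYPE('k) Cu (2 ^ (i + 1)) * sqrt \<delta>) * \<rho> ^ ?Q"
  proof -
    have "10 * (2 ^ i * \<rho>) + 20 * real ?M * \<rho> = 25 * 2 ^ (i + 1) * \<rho>" by simp
    then show ?thesis by (simp add: net_const_def power_mult_distrib mult_ac)
  qed
  finally have le: "vol (nonmono \<Omega> ?M v \<inter> ?B) \<le> vol (nonmono \<Omega> ?M (\<rho> *\<^sub>R u) \<inter> ?B) + ennreal ((net_const TYPE('k) Cu (2 ^ (i + 1)) * sqrt \<delta>) * \<rho> ^ ?Q)" .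
  have big: "ennreal (\<kappa> / 2 * \<rho> ^ ?Q) \<le> vol (nonmono \<Omega> ?M (\<rho> *\<^sub>R u) \<inter> ?B)"
  proof (rule ccontr)
    assume "\<not> ?thesis"
    then have "vol (nonmono \<Omega> ?M (\<rho> *\<^sub>R u) \<inter> ?B) \<le> ennreal (\<kappa> / 2 * \<rho> ^ ?Q)" by simp
    then have "vol (nonmono \<Omega> ?M v \<inter> ?B) \<le> ennreal (\<kappa> / 2 * \<rho> ^ ?Q) + ennreal (\<kappa> / 2 * \<rho> ^ ?Q)"
      using \<delta>\<kappa> \<rho> by (intro order_trans[OF le] add_mono ennreal_leI mult_right_mono) auto
    also have "\<dots> = ennreal (\<kappa> * \<rho> ^ ?Q)" using \<kappa> \<rho> by (subst ennreal_plus[symmetric]) (auto simp: field_simps)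
    finally show False using V by (simp add: leD)
  qed
  have incl: "?B \<subseteq> cball z (20 * (2 ^ i * \<rho>))" if "z = x \<or> z = y" for z
  proof
    fix q assume "q \<in> ?B"
    then have q: "dist x q \<le> 10 * t" by (simp add: t_def)
    have "dist z x \<le> 3 * t" using that dxy t by (auto simp: dist_commute)
    then have "dist z q \<le> 20 * t" using q dist_triangle[of z q x] t by linarith
    then show "q \<in> cball z (20 * (2 ^ i * \<rho>))" by (simp add: t_def)
  qed
  have "ennreal (\<kappa> / 2 * \<rho> ^ ?Q) \<le> vol (nonmono \<Omega> ?M (\<rho> *\<^sub>R u) \<inter> cball z (20 * (2 ^ i * \<rho>)))" if "z = x \<or> z = y" for z
    by (rule order_trans[OF big vol_mono]) (use incl[OF that] in blast)
  with u(1) show ?thesis unfolding bad_scale_def \<rho>_def[symmetric] by blast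
qed

definition good_starts :: "(real ^ ('k + 'k)) set \<Rightarrow> real \<Rightarrow> real \<Rightarrow> nat \<Rightarrow> nat \<Rightarrow> 'k heis \<Rightarrow> real \<Rightarrow> 'k heis set" where
  "good_starts W \<kappa> \<epsilon> i J p R = {q \<in> starts p R.
     (\<forall>j. ennreal (\<epsilon> * (l / 2 ^ j) ^ (2 * CARD('k) + 2)) \<le> vol (upset (hit q) (l / 2 ^ j) \<nu>)) \<and>
     finite {j. bad_scale W \<kappa> i (hit q) j} \<and> card {j. bad_scale W \<kappa> i (hit q) j} < J}"

text \<open>
  Two comparable points have a common bad scale, which is determined by their height difference. Since a good
  point has fewer than \<open>J\<close> bad scales, chains have at most \<open>4\<^sup>J\<close> elements. The level sets of the antichain
  decomposition cover all good points, and \<open>G\<close> is the one that is hit most often.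
\<close>

lemma large_antichain:
  assumes i: "i \<ge> 7" and small: "count_const TYPE('k) * (err_const * sqrt (120 / 2 ^ i) + \<kappa>) < \<epsilon>\<^sup>2"
    and \<kappa>: "\<kappa> > 0" and \<epsilon>: "\<epsilon> \<ge> 0" and \<delta>: "0 < \<delta>" "\<delta> \<le> 1"
    and net: "\<And>u. norm u \<le> 2 \<Longrightarrow> \<exists>w\<in>W. norm (u - w) \<le> \<delta>"
    and \<delta>\<kappa>: "net_const TYPE('k) Cu (2 ^ (i + 1)) * sqrt \<delta> \<le> \<kappa> / 2"
    and Rl: "R + l < 2 ^ i * l"
  obtains G where "G \<subseteq> S \<inter> cball p (R + l)"
    "\<And>x y. x \<in> G \<Longrightarrow> y \<in> G \<Longrightarrow> - x + y \<in> up_cone (1 / 2 ^ i) \<nu> \<Longrightarrow> x = y"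
    "vol (good_starts W (\<kappa> / 2) \<epsilon> i J p R) \<le> of_nat (4 ^ J + 1) * vol (Hit (l *\<^sub>R \<nu>) G)"
proof -
  define \<gamma> :: real where "\<gamma> = 1 / 2 ^ i"
  have \<gamma>: "0 \<le> \<gamma>" "\<gamma> \<le> 2"
  proof -
    have "(1::real) \<le> 2 ^ i" by simp
    then have "1 \<le> 2 * (2::real) ^ i" by linarith
    then show "0 \<le> \<gamma>" "\<gamma> \<le> 2" by (simp_all add: \<gamma>_def divide_le_eq)
  qed
  define A where "A = good_starts W (\<kappa> / 2) \<epsilon> i J p R"
  define G where "G = hit ` A"
  have AS: "A \<subseteq> starts p R" by (auto simp: A_def good_starts_def)
  have GS: "x \<in> S \<and> dist p x \<le> R + l" if xG: "x \<in> G" for x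
  proof -
    obtain q where q: "q \<in> starts p R" "x = hit q" using xG AS unfolding G_def by blast
    then show ?thesis using hit_in_S[OF q(1)] dist_start_hit[of q] dist_triangle[of p x q] by (simp add: starts_def)
  qed
  define lt where "lt x y \<longleftrightarrow> x \<noteq> y \<and> - x + y \<in> up_cone \<gamma> \<nu>" for x y
  have lt_height: "(hor y - hor x) \<bullet> \<nu> > 0" if "lt x y" for x y
  proof -
    have c: "- x + y \<in> up_cone \<gamma> \<nu>" and ne: "x \<noteq> y" using that by (auto simp: lt_def)
    have "hor (- x + y) \<bullet> \<nu> \<noteq> 0"
    proof
      assume "hor (- x + y) \<bullet> \<nu> = 0"
      from up_cone_eq_zero[OF c this] have "y = x" by (metis add_minus_cancel add_0_right)
      with ne show False by simp
    qed
    then show ?thesis using c by (simp add: up_cone_def)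
  qed
  have irrefl: "\<not> lt x x" for x by (simp add: lt_def)
  have trans: "lt x z" if xy: "lt x y" and yz: "lt y z" for x y z
  proof -
    have "(- x + y) + (- y + z) \<in> up_cone \<gamma> \<nu>"
      by (rule up_cone_add[OF \<nu> \<gamma>]) (use xy yz in \<open>simp_all add: lt_def\<close>)
    moreover have "(- x + y) + (- y + z) = - x + z" by (simp only: add.assoc add_minus_cancel)
    moreover have "x \<noteq> z" using lt_height[OF xy] lt_height[OF yz] by (auto simp: inner_diff_left)
    ultimately show ?thesis by (simp add: lt_def)
  qed
  define ht where "ht x = (hor x \<bullet> \<nu>) / (2 ^ i * l)" for x :: "'k heis"
  have il: "2 ^ i * l > 0" using l by simp
  have pair: "bad_scale W (\<kappa> / 2) i x (nat (- scale_of \<bar>ht x - ht y\<bar>)) \<and> bad_scale W (\<kappa> / 2) i y (nat (- scale_of \<bar>ht x - ht y\<bar>))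
      \<and> scale_of \<bar>ht x - ht y\<bar> \<le> 0 \<and> ht x \<noteq> ht y"
    if x: "x \<in> G" and y: "y \<in> G" and xy: "lt x y" for x y
  proof -
    define s where "s = (hor y - hor x) \<bullet> \<nu>"
    have s0: "s > 0" using lt_height[OF xy] by (simp add: s_def)
    have d: "\<bar>ht x - ht y\<bar> = s / (2 ^ i * l)"
    proof -
      have "ht x - ht y = - (s / (2 ^ i * l))"
        by (simp add: ht_def s_def inner_diff_left diff_divide_distrib)
      then show ?thesis using s0 il by simp
    qed
    have "s \<le> dist x y"
    proof -
      have "s \<le> norm (hor (- x + y))" using Cauchy_Schwarz_ineq2[of "hor y - hor x" \<nu>] \<nu> by (simp add: s_def)
      also have "\<dots> \<le> koranyi (- x + y)" by (rule koranyi_ge_norm_hor)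
      also have "\<dots> = dist x y" using dist_heis_def[of y x] by (simp add: dist_commute)
      finally show ?thesis .
    qed
    also have "\<dots> \<le> 2 * (R + l)" 
      using order_trans[OF dist_triangle3[of x y p] add_mono[OF conjunct2[OF GS[OF x]] conjunct2[OF GS[OF y]]]] by simp
    also have "\<dots> < 2 * (2 ^ i * l)" using Rl by simp
    finally have d2: "s / (2 ^ i * l) < 2" using il by (simp add: pos_divide_less_eq)
    have d0: "s / (2 ^ i * l) > 0" using s0 il by simp
    define m where "m = scale_of (s / (2 ^ i * l))"
    have m: "2 powr m \<le> s / (2 ^ i * l)" "s / (2 ^ i * l) < 2 powr (m + 1)"
      using scale_of_eq_iff[OF d0, of m] by (simp_all add: m_def)
    \<comment> \<open>The bound on \<open>R + l\<close> ensures that height differences correspond to scales \<open>l / 2\<^sup>j\<close> with \<open>j \<ge> 0\<close>.\<close>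
    have "2 powr m < 2 powr 1" using m d2 by simp
    then have "real_of_int m < 1" by (subst (asm) powr_less_cancel_iff) simp_all
    then have m0: "m \<le> 0" by simp
    define j where "j = nat (- m)"
    have "real_of_int m = - real j" using m0 by (simp add: j_def)
    then have pm: "2 powr m = 1 / 2 ^ j" by (simp add: powr_minus powr_realpow divide_inverse)
    have mj: "l / 2 ^ j = l * 2 powr m" by (simp add: pm)
    have s1: "2 ^ i * (l / 2 ^ j) \<le> s" using m(1) il by (simp add: mj pos_le_divide_eq mult_ac)
    have s2: "s \<le> 2 * (2 ^ i * (l / 2 ^ j))" using m(2) il by (simp add: mj pos_divide_less_eq powr_add mult_ac)
    have hs: "hor (- x + y) \<bullet> \<nu> = s" by (simp add: s_def)
    obtain q q' where q: "q \<in> A" "x = hit q" "q' \<in> A" "y = hit q'" using x y by (auto simp: G_def)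
    have "bad_scale W (\<kappa> / 2) i x j \<and> bad_scale W (\<kappa> / 2) i y j"
    proof (rule comparable_bad_scale[OF i small \<kappa> \<epsilon> \<delta> net \<delta>\<kappa>])
      show "- x + y \<in> up_cone (1 / 2 ^ i) \<nu>" using xy by (simp add: lt_def \<gamma>_def)
    qed (use q s1 s2 hs in \<open>auto simp: A_def good_starts_def\<close>)
    then show ?thesis using d m0 s0 il d0 by (auto simp: m_def j_def)
  qed
  have chains: "card C \<le> 4 ^ J"
    if C: "finite C" "C \<subseteq> G" and tot: "\<And>x y. x \<in> C \<Longrightarrow> y \<in> C \<Longrightarrow> x \<noteq> y \<Longrightarrow> lt x y \<or> lt y x" for C
  proof -
    have pr: "bad_scale W (\<kappa> / 2) i x (nat (- scale_of \<bar>ht x - ht y\<bar>)) \<and> scale_of \<bar>ht x - ht y\<bar> \<le> 0 \<and> ht x \<noteq> ht y"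
      if "x \<in> C" "y \<in> C" "x \<noteq> y" for x y
      using tot[OF that]
    proof
      assume "lt x y"
      with pair[of x y] that C(2) show ?thesis by blast
    next
      assume "lt y x"
      with pair[of y x] that C(2) have "bad_scale W (\<kappa> / 2) i x (nat (- scale_of \<bar>ht y - ht x\<bar>)) \<and> scale_of \<bar>ht y - ht x\<bar> \<le> 0 \<and> ht y \<noteq> ht x"
        by blast
      then show ?thesis unfolding abs_minus_commute[of "ht x"] by metis
    qed
    have inj: "inj_on ht C" using pr by (auto simp: inj_on_def)
    have "card (ht ` C) \<le> 4 ^ J"
    proof (rule card_le_of_few_scales)
      show "finite (ht ` C)" using C by simp
      fix u assume "u \<in> ht ` C"
      then obtain x where x: "x \<in> C" "u = ht x" by blast
      let ?B = "{j. bad_scale W (\<kappa> / 2) i x j}"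
      obtain q where q: "q \<in> A" "x = hit q" using x C by (auto simp: G_def)
      then have B: "finite ?B" "card ?B < J" by (auto simp: A_def good_starts_def)
      have "(\<lambda>v. scale_of \<bar>u - v\<bar>) ` (ht ` C - {u}) \<subseteq> (\<lambda>j. - int j) ` ?B"
      proof
        fix k assume "k \<in> (\<lambda>v. scale_of \<bar>u - v\<bar>) ` (ht ` C - {u})"
        then obtain y where y: "y \<in> C" "ht y \<noteq> ht x" "k = scale_of \<bar>ht x - ht y\<bar>" using x by auto
        then have "x \<noteq> y" by auto
        from pr[OF x(1) y(1) this] have "nat (- k) \<in> ?B" "k \<le> 0" using y by auto
        then show "k \<in> (\<lambda>j. - int j) ` ?B" by (intro image_eqI[of _ _ "nat (- k)"]) auto
      qed
      then have "card ((\<lambda>v. scale_of \<bar>u - v\<bar>) ` (ht ` C - {u})) \<le> card ((\<lambda>j. - int j) ` ?B)"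
        using B by (intro card_mono) auto
      also have "\<dots> \<le> card ?B" using B by (intro card_image_le)
      finally show "card ((\<lambda>v. scale_of \<bar>u - v\<bar>) ` (ht ` C - {u})) \<le> J" using B by simp
    qed
    then show ?thesis using card_image[OF inj] by simp
  qed
  obtain f :: "'k heis \<Rightarrow> nat" where f: "\<And>x. x \<in> G \<Longrightarrow> f x \<le> 4 ^ J" "\<And>x y. x \<in> G \<Longrightarrow> y \<in> G \<Longrightarrow> lt x y \<Longrightarrow> f x < f y"
  proof (rule antichain_decomposition[of lt G "4 ^ J"])
    show "\<not> lt x x" for x by (rule irrefl)
    show "lt x z" if "lt x y" "lt y z" for x y z using that by (rule trans)
    show "card C \<le> 4 ^ J" if "finite C" "C \<subseteq> G" "\<And>x y. x \<in> C \<Longrightarrow> y \<in> C \<Longrightarrow> x \<noteq> y \<Longrightarrow> lt x y \<or> lt y x" for C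
      using that by (rule chains)
  qed (rule that)
  define Gm where "Gm m = {x \<in> G. f x = m}" for m
  have "A \<subseteq> (\<Union>m\<in>{..4 ^ J}. Hit (l *\<^sub>R \<nu>) (Gm m))"
  proof
    fix q assume q: "q \<in> A"
    then have hG: "hit q \<in> G" by (simp add: G_def)
    then have "q \<in> Hit (l *\<^sub>R \<nu>) (Gm (f (hit q)))" using hit_subset_Hit[of p R "Gm (f (hit q))"] q AS by (auto simp: Gm_def)
    with f(1)[OF hG] show "q \<in> (\<Union>m\<in>{..4 ^ J}. Hit (l *\<^sub>R \<nu>) (Gm m))" by blast
  qed
  then have vA: "vol A \<le> (\<Sum>m\<in>{..4 ^ J}. vol (Hit (l *\<^sub>R \<nu>) (Gm m)))"
    by (intro order_trans[OF vol_mono vol_UN_finite_le]) auto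
  have "\<exists>m\<in>{..4 ^ J}. \<forall>m'\<in>{..4 ^ J}. vol (Hit (l *\<^sub>R \<nu>) (Gm m')) \<le> vol (Hit (l *\<^sub>R \<nu>) (Gm m))"
  proof -
    have "Max ((\<lambda>m. vol (Hit (l *\<^sub>R \<nu>) (Gm m))) ` {..4 ^ J}) \<in> (\<lambda>m. vol (Hit (l *\<^sub>R \<nu>) (Gm m))) ` {..4 ^ J :: nat}"
      by (intro Max_in) auto
    then obtain m where "m \<in> {..4 ^ J}" "Max ((\<lambda>m. vol (Hit (l *\<^sub>R \<nu>) (Gm m))) ` {..4 ^ J}) = vol (Hit (l *\<^sub>R \<nu>) (Gm m))" by blast
    then show ?thesis by (metis (mono_tags, lifting) Max_ge finite_atMost finite_imageI imageI)
  qed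
  then obtain m where m: "\<And>m'. m' \<in> {..4 ^ J} \<Longrightarrow> vol (Hit (l *\<^sub>R \<nu>) (Gm m')) \<le> vol (Hit (l *\<^sub>R \<nu>) (Gm m))" by blast
  show thesis
  proof (rule that[of "Gm m"])
    show "Gm m \<subseteq> S \<inter> cball p (R + l)" using GS by (auto simp: Gm_def)
    show "x = y" if "x \<in> Gm m" "y \<in> Gm m" "- x + y \<in> up_cone (1 / 2 ^ i) \<nu>" for x y
    proof (rule ccontr)
      assume "x \<noteq> y"
      then have "lt x y" using that(3) by (simp add: lt_def \<gamma>_def)
      with f(2)[of x y] that(1,2) show False by (auto simp: Gm_def)
    qed
    have "vol A \<le> (\<Sum>m'\<in>{..4 ^ J :: nat}. vol (Hit (l *\<^sub>R \<nu>) (Gm m)))"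
      by (rule order_trans[OF vA sum_mono[OF m]])
    also have "\<dots> = of_nat (4 ^ J + 1) * vol (Hit (l *\<^sub>R \<nu>) (Gm m))" by simp
    finally show "vol (good_starts W (\<kappa> / 2) \<epsilon> i J p R) \<le> of_nat (4 ^ J + 1) * vol (Hit (l *\<^sub>R \<nu>) (Gm m))" by (simp only: A_def)
  qed
qed

end

section \<open>Big pieces\<close>

context crossing_family
begin

text \<open>
  Short segments hit \<open>S\<close> from a small volume only, so the segments of \<open>condition_B_crossing\<close> cannot be much
  shorter than \<open>r\<close>.
\<close>

lemma cross_length_bound:
  assumes l12: "l \<le> 12 * r" and r: "r > 0"
    and big: "ennreal (cA * r ^ (2 * CARD('k) + 2)) \<le> vol (starts p (12 * r))"
  shows "cA * r \<le> hit_const TYPE('k) * Cu * 24 ^ (2 * CARD('k) + 1) * l"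
proof -
  let ?n = "2 * CARD('k) + 1" and ?h = "hit_const TYPE('k)"
  have h: "?h > 0" by (rule hit_const_pos)
  have "hit q \<in> S \<inter> cball p (24 * r)" if "q \<in> starts p (12 * r)" for q
    using hit_in_S[OF that] dist_start_hit[of q] dist_triangle[of p "hit q" q] that l12
    by (simp add: starts_def)
  then have "starts p (12 * r) \<subseteq> Hit (l *\<^sub>R \<nu>) (S \<inter> cball p (24 * r))"
    using hit_subset_Hit[of p "12 * r" "S \<inter> cball p (24 * r)"] by blast
  then have "vol (starts p (12 * r)) \<le> vol (Hit (l *\<^sub>R \<nu>) (S \<inter> cball p (24 * r)))" by (rule vol_mono)
  also have "\<dots> \<le> ennreal (?h * norm (l *\<^sub>R \<nu>) * (Cu * (24 * r) ^ ?n))"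
    using l \<nu> r by (intro vol_Hit_S_le) auto
  finally have "ennreal (cA * r ^ (2 * CARD('k) + 2)) \<le> ennreal (?h * l * (Cu * (24 * r) ^ ?n))"
    using big l \<nu> by simp
  then have "cA * r ^ (2 * CARD('k) + 2) \<le> ?h * l * (Cu * (24 * r) ^ ?n)"
    using h l Cu_pos r by (subst (asm) ennreal_le_iff) auto
  then have "(cA * r) * r ^ ?n \<le> (?h * Cu * 24 ^ ?n * l) * r ^ ?n"
    by (simp add: power_mult_distrib mult_ac)
  then show ?thesis using r by (simp add: mult_le_cancel_right)
qed

text \<open>
  The two exceptional sets have at most a quarter of the volume of the starting points each.
\<close>

lemma good_starts_large:
  assumes l12: "l \<le> 12 * r" and r: "r > 0" and cA: "cA > 0"
    and big: "ennreal (cA * r ^ (2 * CARD('k) + 2)) \<le> vol (starts p (12 * r))"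
    and cl: "cl > 0" and lower: "\<And>z \<rho>. z \<in> S \<Longrightarrow> 0 < \<rho> \<Longrightarrow> \<rho> \<le> l \<Longrightarrow> ennreal (cl * \<rho> ^ (2 * CARD('k) + 1)) \<le> hmeas (S \<inter> cball z \<rho>)"
    and W: "finite W" "\<And>w. w \<in> W \<Longrightarrow> norm w \<le> 3" and \<kappa>: "\<kappa> > 0" and J: "J > 0"
    and \<epsilon>: "\<epsilon> > 0" "\<epsilon> * 12 * 6 ^ (2 * CARD('k) + 1) / cl * (Cu * 36 ^ (2 * CARD('k) + 1)) \<le> cA / 4"
    and JB: "1 / real J * (real (card W) * (1 / \<kappa> * hit_const TYPE('k) * Cu * (20 * 2 ^ i) ^ (2 * CARD('k) + 1) *
        (2 ^ (i + 1) * real (i + 1) * pack_const * 36 * (24 + 312 * 2 ^ i) ^ (2 * CARD('k) + 1)))) \<le> cA / 4"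
  shows "ennreal (cA / 2 * r ^ (2 * CARD('k) + 2)) \<le> vol (good_starts W \<kappa> \<epsilon> i J p (12 * r))"
proof -
  let ?n = "2 * CARD('k) + 1" and ?Q = "2 * CARD('k) + 2" and ?h = "hit_const TYPE('k)"
  have h: "?h > 0" by (rule hit_const_pos)
  let ?R = "12 * r"
  define Z where "Z = {q \<in> starts p ?R. \<exists>j. mass p ?R (cball (hit q) (l / 2 ^ j)) < ennreal (\<epsilon> * l * (l / 2 ^ j) ^ ?n)}"
  define Y where "Y = {q \<in> starts p ?R. \<not> (finite {j. bad_scale W \<kappa> i (hit q) j} \<and> card {j. bad_scale W \<kappa> i (hit q) j} < J)}"
  have "vol Z \<le> ennreal (\<epsilon> * l * 6 ^ ?n / cl * (Cu * (?R + 2 * l) ^ ?n))"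
    unfolding Z_def using cl lower \<epsilon>(1) r by (intro low_density_small) auto
  also have "\<dots> \<le> ennreal (cA / 4 * r ^ ?Q)"
  proof (rule ennreal_leI)
    have "\<epsilon> * l * 6 ^ ?n / cl * (Cu * (?R + 2 * l) ^ ?n) \<le> \<epsilon> * (12 * r) * 6 ^ ?n / cl * (Cu * (36 * r) ^ ?n)"
      using l l12 r \<epsilon>(1) cl Cu_pos by (intro mult_mono divide_right_mono power_mono) auto
    also have "\<dots> = (\<epsilon> * 12 * 6 ^ ?n / cl * (Cu * 36 ^ ?n)) * r ^ ?Q"
      by (simp add: power_mult_distrib mult_ac)
    also have "\<dots> \<le> cA / 4 * r ^ ?Q" using \<epsilon>(2) r by (intro mult_right_mono) auto
    finally show "\<epsilon> * l * 6 ^ ?n / cl * (Cu * (?R + 2 * l) ^ ?n) \<le> cA / 4 * r ^ ?Q" .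
  qed
  finally have vZ: "vol Z \<le> ennreal (cA / 4 * r ^ ?Q)" .
  let ?D = "24 + 312 * 2 ^ i :: real"
  have "vol Y \<le> ennreal (1 / real J * (real (card W) * (1 / \<kappa> * ?h * Cu * (20 * 2 ^ i) ^ ?n *
        (2 ^ (i + 1) * real (i + 1) * pack_const * (3 * l) * (?D * r) ^ ?n))))"
    unfolding Y_def
  proof (rule many_bad_scales_small[OF W \<kappa> _ _ J])
    have "?R + l + 26 * 2 ^ i * l \<le> ?R + 12 * r + 26 * 2 ^ i * (12 * r)"
      using l12 by (intro add_mono mult_left_mono) auto
    also have "\<dots> = ?D * r" by (simp add: algebra_simps)
    finally show "?R + l + 26 * 2 ^ i * l \<le> ?D * r" .
  qed (use r in auto)
  also have "\<dots> \<le> ennreal (cA / 4 * r ^ ?Q)"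
  proof (rule ennreal_leI)
    have "1 / real J * (real (card W) * (1 / \<kappa> * ?h * Cu * (20 * 2 ^ i) ^ ?n *
        (2 ^ (i + 1) * real (i + 1) * pack_const * (3 * l) * (?D * r) ^ ?n)))
      \<le> 1 / real J * (real (card W) * (1 / \<kappa> * ?h * Cu * (20 * 2 ^ i) ^ ?n *
        (2 ^ (i + 1) * real (i + 1) * pack_const * (36 * r) * (?D * r) ^ ?n)))"
      using l12 r \<kappa> h Cu_pos pack_const_pos by (intro mult_left_mono mult_right_mono) auto
    also have "\<dots> = (1 / real J * (real (card W) * (1 / \<kappa> * ?h * Cu * (20 * 2 ^ i) ^ ?n *
        (2 ^ (i + 1) * real (i + 1) * pack_const * 36 * ?D ^ ?n)))) * r ^ ?Q"
      by (simp add: power_mult_distrib[of "24 + 312 * 2 ^ i" r])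
    also have "\<dots> \<le> cA / 4 * r ^ ?Q" using JB r by (intro mult_right_mono) auto
    finally show "1 / real J * (real (card W) * (1 / \<kappa> * ?h * Cu * (20 * 2 ^ i) ^ ?n *
        (2 ^ (i + 1) * real (i + 1) * pack_const * (3 * l) * (?D * r) ^ ?n))) \<le> cA / 4 * r ^ ?Q" .
  qed
  finally have vY: "vol Y \<le> ennreal (cA / 4 * r ^ ?Q)" .
  let ?A = "good_starts W \<kappa> \<epsilon> i J p ?R"
  have "starts p ?R \<subseteq> ?A \<union> (Z \<union> Y)"
  proof
    fix q assume q: "q \<in> starts p ?R"
    show "q \<in> ?A \<union> (Z \<union> Y)"
    proof (cases "q \<in> Z \<or> q \<in> Y")
      case False
      have "ennreal (\<epsilon> * (l / 2 ^ j) ^ ?Q) \<le> vol (upset (hit q) (l / 2 ^ j) \<nu>)" for j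
      proof -
        have "\<not> mass p ?R (cball (hit q) (l / 2 ^ j)) < ennreal (\<epsilon> * l * (l / 2 ^ j) ^ ?n)"
          using False q by (auto simp: Z_def)
        then have "ennreal (\<epsilon> * l * (l / 2 ^ j) ^ ?n) \<le> mass p ?R (cball (hit q) (l / 2 ^ j))" by simp
        also have "\<dots> \<le> ennreal (2 ^ j) * vol (upset (hit q) (l / 2 ^ j) \<nu>)" by (rule mass_cball_le_upset)
        finally have le: "ennreal (\<epsilon> * l * (l / 2 ^ j) ^ ?n) \<le> ennreal (2 ^ j) * vol (upset (hit q) (l / 2 ^ j) \<nu>)" .
        have "ennreal (\<epsilon> * (l / 2 ^ j) ^ ?Q) = ennreal (1 / 2 ^ j) * ennreal (\<epsilon> * l * (l / 2 ^ j) ^ ?n)"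
          by (subst ennreal_mult[symmetric]) (use \<epsilon>(1) l in \<open>auto simp: mult_ac\<close>)
        also have "\<dots> \<le> ennreal (1 / 2 ^ j) * (ennreal (2 ^ j) * vol (upset (hit q) (l / 2 ^ j) \<nu>))"
          by (intro mult_left_mono le) simp
        also have "\<dots> = vol (upset (hit q) (l / 2 ^ j) \<nu>)"
          unfolding mult.assoc[symmetric] by (subst ennreal_mult[symmetric]) auto
        finally show ?thesis .
      qed
      moreover have "finite {j. bad_scale W \<kappa> i (hit q) j} \<and> card {j. bad_scale W \<kappa> i (hit q) j} < J"
        using False q unfolding Y_def by blast
      ultimately show ?thesis using q by (simp add: good_starts_def)
    qed blast
  qed
  then have "vol (starts p ?R) \<le> vol ?A + (vol Z + vol Y)"
    using vol_Un_le[of ?A "Z \<union> Y"] vol_Un_le[of Z Y] by (meson add_left_mono order_trans vol_mono)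
  also have "\<dots> \<le> vol ?A + (ennreal (cA / 4 * r ^ ?Q) + ennreal (cA / 4 * r ^ ?Q))"
    by (intro add_mono vZ vY order_refl)
  also have "\<dots> = vol ?A + ennreal (cA / 2 * r ^ ?Q)"
    using cA r by (subst ennreal_plus[symmetric]) (auto simp: field_simps)
  finally have "ennreal (cA * r ^ ?Q) \<le> vol ?A + ennreal (cA / 2 * r ^ ?Q)" using big by (rule order_trans[rotated])
  moreover have "ennreal (cA * r ^ ?Q) = ennreal (cA / 2 * r ^ ?Q) + ennreal (cA / 2 * r ^ ?Q)"
    using cA r by (subst ennreal_plus[symmetric]) (auto simp: field_simps)
  ultimately show ?thesis by (simp add: add.commute[of "vol ?A"])
qed

end

lemma small_constants:
  fixes A B D :: real
  assumes "A > 0" "B > 0" "D > 0"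
  obtains i :: nat where "i \<ge> 7" "B * sqrt (120 / 2 ^ i) < D" "A < 2 ^ i"
proof -
  have "(\<lambda>i. B * sqrt (120 * (1 / 2) ^ i)) \<longlonglongrightarrow> B * sqrt (120 * 0)"
    by (intro tendsto_intros LIMSEQ_power_zero) simp
  then have "eventually (\<lambda>i. B * sqrt (120 * (1 / 2) ^ i) < D) sequentially"
    using assms by (intro order_tendstoD(2)[where y = "B * sqrt (120 * 0)"]) auto
  moreover have "eventually (\<lambda>i. A < 2 ^ i) sequentially"
  proof -
    obtain N where N: "A < 2 ^ N" using real_arch_pow[of 2 A] by auto
    have "A < 2 ^ i" if "i \<ge> N" for i
      by (rule order.strict_trans2[OF N power_increasing[OF that]]) simp
    then show ?thesis by (auto simp: eventually_sequentially)
  qed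
  ultimately have "eventually (\<lambda>i. i \<ge> 7 \<and> B * sqrt (120 * (1 / 2) ^ i) < D \<and> A < 2 ^ i) sequentially"
    using eventually_ge_at_top[of 7] by eventually_elim auto
  from eventually_happens'[OF sequentially_bot this]
  obtain i where i: "i \<ge> 7" "B * sqrt (120 * (1 / 2) ^ i) < D" "A < 2 ^ i" by (elim exE conjE)
  have "120 * (1 / 2) ^ i = 120 / (2::real) ^ i" by (simp add: power_one_over)
  with i(2) have "B * sqrt (120 / 2 ^ i) < D" by (simp only:)
  with i(1,3) show thesis by (intro that[of i])
qed

text \<open>
  The constants are chosen in the order \<open>\<epsilon>\<close>, \<open>\<kappa>\<close>, \<open>i\<close>, \<open>\<delta>\<close>, \<open>W\<close>, \<open>J\<close>. First \<open>\<epsilon>\<close> makes the set of low density small;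
  then \<open>\<kappa>\<close> and the narrow aperture \<open>1 / 2\<^sup>i\<close> satisfy the hypothesis of \<open>aligned_crossings_nonmono\<close>, where \<open>2\<^sup>i\<close> also has
  to exceed the ratio of \<open>r\<close> and the length of the segments; the net \<open>W\<close> of fineness \<open>\<delta>\<close> costs half of \<open>\<kappa>\<close>;
  and \<open>J\<close> makes the set of points with many bad scales small.
\<close>

lemma semmes_big_pieces:
  fixes S :: "'k::finite heis set"
  assumes closed: "closed S" and Cu: "Cu > 0"
    and upper: "\<And>p r. r > 0 \<Longrightarrow> hmeas (S \<inter> cball p r) \<le> ennreal (Cu * r ^ (2 * CARD('k) + 1))"
    and B: "condition_B S"
  obtains L c where "L > 0" "c > 0"
    "\<And>p r. p \<in> S \<Longrightarrow> r > 0 \<Longrightarrow> ennreal r < ediam S \<Longrightarrow>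
      \<exists>\<Gamma>. intrinsic_lipschitz_graph L \<Gamma> \<and> ennreal (c * r ^ (2 * CARD('k) + 1)) \<le> hmeas (cball p r \<inter> S \<inter> \<Gamma>)"
proof -
  let ?n = "2 * CARD('k) + 1" and ?Q = "2 * CARD('k) + 2" and ?h = "hit_const TYPE('k)" and ?cnt = "count_const TYPE('k)"
  have h: "?h > 0" by (rule hit_const_pos)
  have cnt: "?cnt > 0" by (rule count_const_pos)
  obtain cA where cA: "cA > 0" and crossing: "\<And>p r. p \<in> S \<Longrightarrow> r > 0 \<Longrightarrow> ennreal r < ediam S \<Longrightarrow>
      \<exists>K\<in>components (- S). \<exists>a. a \<noteq> 0 \<and> norm a \<le> 12 * r \<and>
        ennreal (cA * r ^ (2 * CARD('k) + 2)) \<le> vol {q \<in> cball p (12 * r). q \<in> K \<and> q + hz a \<notin> K}"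
    by (rule condition_B_crossing[OF B]) (rule that)
  obtain cl where cl: "cl > 0" and lower: "\<And>p r. p \<in> S \<Longrightarrow> r > 0 \<Longrightarrow> ennreal r < ediam S \<Longrightarrow>
      ennreal (cl * r ^ (2 * CARD('k) + 1)) \<le> hmeas (S \<inter> cball p r)"
    by (rule condition_B_lower_regular[OF B]) (rule that)
  define pk where "pk = ?h * Cu * 2 ^ ?n + 2 * unit_vol TYPE('k) * real (2 * CARD('k) + 2)"
  define err where "err = 15 * 21 ^ ?n * ?h * Cu"
  have err: "err > 0" using h Cu by (simp add: err_def)
  define lam where "lam = cA / (?h * Cu * 24 ^ ?n)"
  have lam: "lam > 0" using cA h Cu by (simp add: lam_def)
  define \<epsilon> where "\<epsilon> = cA * cl / (4 * 12 * 6 ^ ?n * Cu * 36 ^ ?n)"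
  have \<epsilon>: "\<epsilon> > 0" using cA cl Cu by (simp add: \<epsilon>_def)
  have \<epsilon>2: "\<epsilon> * 12 * 6 ^ ?n / cl * (Cu * 36 ^ ?n) \<le> cA / 4"
  proof -
    have "\<epsilon> * 12 * 6 ^ ?n / cl * (Cu * 36 ^ ?n) = \<epsilon> * (4 * 12 * 6 ^ ?n * Cu * 36 ^ ?n) / cl / 4" by simp
    also have "\<dots> = cA / 4" using cl Cu by (simp add: \<epsilon>_def)
    finally show ?thesis by simp
  qed
  define \<kappa> where "\<kappa> = \<epsilon>\<^sup>2 / (2 * ?cnt)"
  have \<kappa>: "\<kappa> > 0" using \<epsilon> cnt by (simp add: \<kappa>_def)
  obtain i where i: "i \<ge> 7" and i1: "?cnt * err * sqrt (120 / 2 ^ i) < \<epsilon>\<^sup>2 / 2" and i2: "12 / lam + 1 < 2 ^ i"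
    by (rule small_constants[of "12 / lam + 1" "?cnt * err" "\<epsilon>\<^sup>2 / 2"])
      (use lam cnt err \<epsilon> in \<open>auto intro: add_pos_pos\<close>)
  have small: "?cnt * (err * sqrt (120 / 2 ^ i) + \<kappa>) < \<epsilon>\<^sup>2"
  proof -
    have "?cnt * \<kappa> = \<epsilon>\<^sup>2 / 2" using cnt by (simp add: \<kappa>_def)
    then show ?thesis using i1 by (simp add: distrib_left mult.assoc)
  qed
  define N where "N = net_const TYPE('k) Cu (2 ^ (i + 1))"
  have N: "N > 0" using h Cu by (simp add: N_def net_const_def add_pos_pos)
  define \<delta> where "\<delta> = min 1 ((\<kappa> / (2 * N))\<^sup>2)"
  have \<delta>: "0 < \<delta>" "\<delta> \<le> 1" using \<kappa> N by (auto simp: \<delta>_def)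
  have \<delta>\<kappa>: "N * sqrt \<delta> \<le> \<kappa> / 2"
  proof -
    have "sqrt \<delta> \<le> sqrt ((\<kappa> / (2 * N))\<^sup>2)" by (intro real_sqrt_le_mono) (simp add: \<delta>_def)
    also have "\<dots> = \<kappa> / (2 * N)" using \<kappa> N by simp
    finally have "N * sqrt \<delta> \<le> N * (\<kappa> / (2 * N))" using N by (intro mult_left_mono) auto
    also have "\<dots> = \<kappa> / 2" using N by simp
    finally show ?thesis .
  qed
  obtain W :: "(real ^ ('k + 'k)) set" where W: "finite W" "\<And>w. w \<in> W \<Longrightarrow> norm w \<le> 3"
    and net: "\<And>u. norm u \<le> 2 \<Longrightarrow> \<exists>w\<in>W. norm (u - w) \<le> \<delta>"
    using finite_net[OF \<delta>] by blast
  define Bd where "Bd = real (card W) * (1 / (\<kappa> / 2) * ?h * Cu * (20 * 2 ^ i) ^ ?n *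
        (2 ^ (i + 1) * real (i + 1) * pk * 36 * (24 + 312 * 2 ^ i) ^ ?n))"
  obtain J :: nat where J: "J > 0" and JB: "1 / real J * Bd \<le> cA / 4"
  proof -
    obtain J :: nat where J: "4 * Bd / cA < real J" using reals_Archimedean2 by blast
    have "1 / real (Suc J) * Bd \<le> cA / 4"
      using J cA by (simp add: field_simps)
    then show thesis by (intro that[of "Suc J"]) simp
  qed
  define c0 where "c0 = cA / (24 * real (4 ^ J + 1) * ?h)"
  have c0: "c0 > 0" using cA h by (simp add: c0_def add_pos_pos)
  show thesis
  proof (rule that[of "2 * 2 ^ i" "c0 / 100 ^ ?n"])
    fix p :: "'k heis" and r :: real
    assume p: "p \<in> S" and r: "r > 0" and rd: "ennreal r < ediam S"
    \<comment> \<open>The antichain will lie within \<open>24 r1\<close> of \<open>p\<close>.\<close>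
    define r1 where "r1 = r / 100"
    have r1: "r1 > 0" using r by (simp add: r1_def)
    have "ennreal r1 \<le> ennreal r" using r by (intro ennreal_leI) (simp add: r1_def)
    then have "ennreal r1 < ediam S" using rd by (rule order.strict_trans1)
    with crossing[OF p r1] obtain K a where K: "K \<in> components (- S)" and a: "a \<noteq> 0" "norm a \<le> 12 * r1"
      and big: "ennreal (cA * r1 ^ ?Q) \<le> vol {q \<in> cball p (12 * r1). q \<in> K \<and> q + hz a \<notin> K}" by blast
    define l where "l = norm a"
    define \<nu> where "\<nu> = a /\<^sub>R l"
    have lr: "l > 0" "l \<le> 12 * r1" using a by (auto simp: l_def)
    have dir: "norm \<nu> = 1" "l *\<^sub>R \<nu> = a" using a by (auto simp: \<nu>_def l_def)
    interpret side S K by (rule side_component[OF K])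
    interpret crossing_family S K Cu \<nu> l
      by unfold_locales (use hsets_open[OF open_component_heis[OF closed K]] Cu upper dir lr closed in auto)
    have big': "ennreal (cA * r1 ^ ?Q) \<le> vol (starts p (12 * r1))" using big by (simp only: starts_def dir(2))
    have "cA * r1 \<le> ?h * Cu * 24 ^ ?n * l" by (rule cross_length_bound[OF lr(2) r1 big'])
    then have ll: "lam * r1 \<le> l" using h Cu by (simp add: lam_def divide_le_eq mult_ac)
    have Rl: "12 * r1 + l < 2 ^ i * l"
    proof -
      have "12 * r1 \<le> 12 / lam * l" using ll lam by (simp add: pos_le_divide_eq mult_ac)
      then have "12 * r1 + l \<le> (12 / lam + 1) * l" by (simp add: distrib_right)
      also have "\<dots> < 2 ^ i * l" using i2 lr by (intro mult_strict_right_mono) auto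
      finally show ?thesis .
    qed
    have lower': "ennreal (cl * \<rho> ^ ?n) \<le> hmeas (S \<inter> cball z \<rho>)" if "z \<in> S" "0 < \<rho>" "\<rho> \<le> l" for z \<rho>
    proof (rule lower[OF that(1,2)])
      have "\<rho> \<le> r" using that lr r by (simp add: r1_def)
      then have "ennreal \<rho> \<le> ennreal r" by (rule ennreal_leI)
      then show "ennreal \<rho> < ediam S" using rd by (rule order.strict_trans1)
    qed
    have \<kappa>2: "\<kappa> / 2 > 0" using \<kappa> by simp
    have good: "ennreal (cA / 2 * r1 ^ ?Q) \<le> vol (good_starts W (\<kappa> / 2) \<epsilon> i J p (12 * r1))"
      by (rule good_starts_large[OF lr(2) r1 cA big' cl lower' W \<kappa>2 J \<epsilon> \<epsilon>2])
        (use JB in \<open>simp_all only: Bd_def pk_def pack_const_def\<close>)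
    obtain G where G: "G \<subseteq> S \<inter> cball p (12 * r1 + l)"
      and anti: "\<And>x y. x \<in> G \<Longrightarrow> y \<in> G \<Longrightarrow> - x + y \<in> up_cone (1 / 2 ^ i) \<nu> \<Longrightarrow> x = y"
      and vG: "vol (good_starts W (\<kappa> / 2) \<epsilon> i J p (12 * r1)) \<le> of_nat (4 ^ J + 1) * vol (Hit (l *\<^sub>R \<nu>) G)"
      by (rule large_antichain[OF i small[unfolded err_def, folded err_const_def] \<kappa> less_imp_le[OF \<epsilon>] \<delta> net \<delta>\<kappa>[unfolded N_def] Rl])
        (assumption, rule that)
    have "vol (Hit (l *\<^sub>R \<nu>) G) \<le> ennreal (?h * l) * hmeas G"
      using vol_Hit_le[OF a(1), of G] unfolding dir(2) l_def[symmetric] .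
    then have "ennreal (cA / 2 * r1 ^ ?Q) \<le> of_nat (4 ^ J + 1) * (ennreal (?h * l) * hmeas G)"
      by (rule order_trans[OF order_trans[OF good vG] mult_left_mono]) simp
    also have "\<dots> \<le> of_nat (4 ^ J + 1) * (ennreal (?h * (12 * r1)) * hmeas G)"
      using lr h by (intro mult_left_mono mult_right_mono ennreal_leI) auto
    also have "\<dots> = ennreal (real (4 ^ J + 1) * (?h * (12 * r1))) * hmeas G"
      using h r1 by (subst ennreal_mult) (auto simp: ennreal_of_nat_eq_real_of_nat mult.assoc)
    finally have e: "ennreal (cA / 2 * r1 ^ ?Q) \<le> ennreal (real (4 ^ J + 1) * (?h * (12 * r1))) * hmeas G" .
    define D where "D = real (4 ^ J + 1) * (?h * (12 * r1))"
    have D: "D > 0" using h r1 by (simp add: D_def add_pos_pos)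
    have mG: "ennreal (c0 * r1 ^ ?n) \<le> hmeas G"
    proof -
      have "c0 * r1 ^ ?n = 1 / D * (cA / 2 * r1 ^ ?Q)" using r1 by (simp add: c0_def D_def)
      then have "ennreal (c0 * r1 ^ ?n) = ennreal (1 / D) * ennreal (cA / 2 * r1 ^ ?Q)"
        using D cA r1 by (simp only:, subst ennreal_mult) auto
      also have "\<dots> \<le> ennreal (1 / D) * (ennreal D * hmeas G)"
        by (intro mult_left_mono e[folded D_def]) simp
      also have "\<dots> = hmeas G"
        unfolding mult.assoc[symmetric] using D by (subst ennreal_mult[symmetric]) auto
      finally show ?thesis .
    qed
    have Gne: "G \<noteq> {}"
    proof
      assume "G = {}"
      then have "Hit (l *\<^sub>R \<nu>) G = {}" by (simp add: Hit_def)
      then have "vol (Hit (l *\<^sub>R \<nu>) G) = 0" by (simp add: vol_def)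
      then have "vol (good_starts W (\<kappa> / 2) \<epsilon> i J p (12 * r1)) = 0" using vG by simp
      then show False using good cA r1 by simp
    qed
    have \<gamma>: "0 < 1 / (2::real) ^ i" "1 / (2::real) ^ i \<le> 2"
      using order_trans[OF one_le_power[of "2::real" i], of "2 * 2 ^ i"] by (simp_all add: divide_le_eq)
    obtain \<Gamma> where \<Gamma>: "G \<subseteq> \<Gamma>" "intrinsic_lipschitz_graph (2 / (1 / 2 ^ i)) \<Gamma>"
      by (rule antichain_extends_to_graph[OF dir(1) \<gamma> Gne anti]) (auto intro: that)
    have "12 * r1 + l \<le> r" using lr r by (simp add: r1_def)
    then have "G \<subseteq> cball p r \<inter> S \<inter> \<Gamma>" using G \<Gamma>(1) by auto
    then have "hmeas G \<le> hmeas (cball p r \<inter> S \<inter> \<Gamma>)" by (rule hausdorff_mono)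
    then have "ennreal (c0 * r1 ^ ?n) \<le> hmeas (cball p r \<inter> S \<inter> \<Gamma>)" using mG by (rule order_trans[rotated])
    moreover have "c0 * r1 ^ ?n = c0 / 100 ^ ?n * r ^ ?n" by (simp add: r1_def power_divide)
    ultimately show "\<exists>\<Gamma>. intrinsic_lipschitz_graph (2 * 2 ^ i) \<Gamma> \<and> ennreal (c0 / 100 ^ ?n * r ^ ?n) \<le> hmeas (cball p r \<inter> S \<inter> \<Gamma>)"
      using \<Gamma>(2) by (intro exI[of _ \<Gamma>]) simp
  qed (use c0 in simp_all)
qed

theorem theorem1p8:
  fixes S :: "('k::finite) heis set"
  assumes "semmes_surface S"
  shows "lower_ahlfors_regular (2 * real CARD('k) + 1) S \<and>
         big_pieces_intrinsic_lipschitz_graphs S"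
proof -
  let ?n = "2 * CARD('k) + 1"
  have S: "closed S" and B: "condition_B S" using assms by (auto simp: semmes_surface_def)
  have pw: "r powr (2 * real CARD('k) + 1) = r ^ ?n" if "r > 0" for r :: real
    using powr_realpow[OF that, of ?n] by (simp only: of_nat_add of_nat_mult of_nat_numeral of_nat_1)
  obtain C where C: "C > 0" and up: "\<And>p r. r > 0 \<Longrightarrow>
      hausdorff (2 * real CARD('k) + 1) (cball p r \<inter> S) \<le> ennreal (C * r powr (2 * real CARD('k) + 1))"
    using assms unfolding semmes_surface_def upper_ahlfors_regular_def by metis
  have upC: "hmeas (S \<inter> cball p r) \<le> ennreal (C * r ^ ?n)" if "r > 0" for p r
    using up[OF that, of p] by (simp only: pw[OF that] Int_commute)
  obtain L c where L: "L > 0" and c: "c > 0" and bp: "\<And>p r. p \<in> S \<Longrightarrow> r > 0 \<Longrightarrow> ennreal r < ediam S \<Longrightarrow>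
      \<exists>\<Gamma>. intrinsic_lipschitz_graph L \<Gamma> \<and> ennreal (c * r ^ ?n) \<le> hmeas (cball p r \<inter> S \<inter> \<Gamma>)"
    by (rule semmes_big_pieces[OF S C _ B]) (erule upC, rule that)
  obtain cl where cl: "cl > 0" and lower: "\<And>p r. p \<in> S \<Longrightarrow> r > 0 \<Longrightarrow> ennreal r < ediam S \<Longrightarrow>
      ennreal (cl * r ^ ?n) \<le> hmeas (S \<inter> cball p r)"
    by (rule condition_B_lower_regular[OF B]) (rule that)
  have "lower_ahlfors_regular (2 * real CARD('k) + 1) S"
    unfolding lower_ahlfors_regular_def
    using S cl lower by (intro conjI exI[of _ cl] ballI allI impI) (simp_all add: pw Int_commute)
  moreover have "big_pieces_intrinsic_lipschitz_graphs S"
    unfolding big_pieces_intrinsic_lipschitz_graphs_def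
    using S L c bp by (intro conjI exI[of _ L] exI[of _ c] ballI allI impI) (simp_all add: pw)
  ultimately show ?thesis ..
qed

end
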